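(* Let $\beta>1/2$, $\kappa=4/\beta\in(0,8)$, $f_\beta={}_2F_1(1-\beta,\beta;2\beta;\cdot)$, and let $F,G$ be the neighbor functions on $[0,1)^3$ defined in the context. Then: (a) on $(0,1)^3$, for all $\{j,k,\ell\}=\{1,2,3\}$, $$\big(r_\ell(1-r_\ell)\partial_{r_\ell}^2+(2\beta-2r_\ell)\partial_{r_\ell}-\beta(1-\beta)\big)F=(1-r_j)(1-r_k)G,$$ $$\big(2r_jr_k\partial_{r_j}\partial_{r_k}+\beta r_j\partial_{r_j}+\beta r_k\partial_{r_k}+\beta r_\ell\partial_{r_\ell}+\beta^2\big)F=\big(r_\ell(r_j+r_k)-(1+r_jr_k)\big)G;$$ (b) $F$ extends continuously to $[0,1]^3$ and $F(r,1,1)=F(1,r,1)=F(1,1,r)=c_F\,f_\beta(r)$ for $r\in(0,1)$, with $c_F=\frac{\Gamma(2\beta)\Gamma(3\beta-1)}{\Gamma(\beta)\Gamma(4\beta-1)}f_\beta(1)$; (c) the extension of $F$ is positive on $\partial[0,1]^3$. Consequently, let $\alpha=\{\{a_1,b_1\},\{a_2,b_2\},\{a_3,b_3\}\}\in\mathrm{LP}_3$ be a neighbor pattern, put $H(r_1,r_2,r_3)=(r_1r_2r_3)^{2/\kappa}F(r_1,r_2,r_3)$ and, for $x\in\mathfrak X_6$, $$\mathcal Z_\alpha(x)=c_\alpha\prod_{j=1}^3|x_{a_j}-x_{b_j}|^{-2h}\,H\Big(C_{\{x_{a_1},x_{b_1}\},\{x_{a_2},x_{b_2}\}},C_{\{x_{a_2},x_{b_2}\},\{x_{a_3},x_{b_3}\}},C_{\{x_{a_3},x_{b_3}\},\{x_{a_1},x_{b_1}\}}\Big)$$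 with $$c_\alpha=c_F^{-1}f_\beta(1)^{-1}=\frac{\Gamma(\beta)\Gamma(4\beta-1)}{\Gamma(2\beta)\Gamma(3\beta-1)}\cdot\Big(\frac{\Gamma(\beta)\Gamma(3\beta-1)}{\Gamma(2\beta)\Gamma(2\beta-1)}\Big)^2.$$ Then $\mathcal Z_\alpha$ is positive on $\mathfrak X_6$ and satisfies (PDE), (COV) and (ASY) with $N=3$. In particular, $\mathcal Z_\alpha$ is the pure partition function associated with $\alpha$ for $\kappa=4/\beta$.
   Context: Notation. $[n]=\{1,\dots,n\}$, $\mathbb N_0=\{0,1,2,\dots\}$, $r^n=r_1^{n_1}r_2^{n_2}r_3^{n_3}$, $e_j$ is the $j$-th unit vector of $\mathbb Z^3$, $h=\frac{6-\kappa}{2\kappa}$. $\mathfrak X_{2N}=\{(x_1,\dots,x_{2N})\in\mathbb R^{2N}:x_j<x_k\text{ if }j<k\}$. $\mathbb H$ is the open upper half-plane. The neighbor functions: $A,B:\mathbb N_0^3\to\mathbb R$, extended by $0$ to $\mathbb Z^3$, are the unique pair with $A_{(0,0,0)}=1$ such that for all $n\in\mathbb Z^3$ and all $\{j,k,\ell\}=\{1,2,3\}$, $$(n_\ell+1)(n_\ell+2\beta)A_{n+e_\ell}-(n_\ell+\beta)(n_\ell+1-\beta)A_n=B_n-B_{n-e_j}-B_{n-e_k}+B_{n-e_j-e_k},$$ $$(2n_jn_k+\beta n_j+\beta n_k+\beta n_\ell+\beta^2)A_n=B_{n-e_\ell-e_j}+B_{n-e_\ell-e_k}-B_n-B_{n-e_j-e_k}.$$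 The series $\sum A_nr^n$ and $\sum B_nr^n$ converge absolutely for $r\in\mathbb C^3$ with all $|r_i|<1/10$, and their sums extend analytically to a domain in $\mathbb C^3$ containing $[0,1)^3$; $F$ and $G$ denote these extensions restricted to $[0,1)^3$. (PDE): for every $i\in[2N]$, $\Big[\tfrac\kappa2\partial_i^2+\sum_{j\in[2N]\setminus\{i\}}\big(\frac{2}{x_j-x_i}\partial_j-\frac{2h}{(x_j-x_i)^2}\big)\Big]\mathcal Z=0$ on $\mathfrak X_{2N}$ ($\mathcal Z$ smooth). (COV): for all Möbius maps $\varphi$ of $\mathbb H$ with $\varphi(x_1)<\cdots<\varphi(x_{2N})$, $\mathcal Z(x_1,\dots,x_{2N})=\prod_{i=1}^{2N}\varphi'(x_i)^h\cdot\mathcal Z(\varphi(x_1),\dots,\varphi(x_{2N}))$. Link patterns: $\mathrm{LP}_N$ is the set of partitions $\{\{a_1,b_1\},\dots,\{a_N,b_N\}\}$ of $[2N]$ into pairs with $(a_j-a_k)(a_j-b_k)(b_j-a_k)(b_j-b_k)>0$ for $j\ne k$. The neighbor patterns in $\mathrm{LP}_3$ are $\{\{1,2\},\{3,4\},\{5,6\}\}$ and $\{\{1,6\},\{2,3\},\{4,5\}\}$. Unoriented cross-ratio: $C_{\{p_1,q_1\},\{p_2,q_2\}}:=\min\Big\{\frac{|p_1-p_2||q_1-q_2|}{|p_1-q_2||q_1-p_2|},\frac{|p_1-q_2||q_1-p_2|}{|p_1-p_2||q_1-q_2|}\Big\}$. $N=2$ pure partition functions: for $\alpha'=\{\{a_1,b_1\},\{a_2,b_2\}\}\in\mathrm{LP}_2$,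 $x\in\mathfrak X_4$, $C=C_{\{x_{a_1},x_{b_1}\},\{x_{a_2},x_{b_2}\}}$: $\mathcal Z_{\alpha'}(x)=\prod_{j=1}^2|x_{a_j}-x_{b_j}|^{-2h}\cdot\frac{C^{2/\kappa}f_\beta(C)}{f_\beta(1)}$. (ASY) for $N=3$: for all $j\in[5]$, $\xi\in\mathbb R$, with $x_1<\cdots<x_{j-1}<\xi<x_{j+2}<\cdots<x_6$ fixed and $x\in\mathfrak X_6$, $\lim_{x_j,x_{j+1}\to\xi}\mathcal Z_\alpha(x)/(x_{j+1}-x_j)^{-2h}$ equals $0$ if $\{j,j+1\}\notin\alpha$, and equals $\mathcal Z_{\alpha/\{j,j+1\}}(x/\{j,j+1\})$ if $\{j,j+1\}\in\alpha$, where $\alpha/\{j,j+1\}\in\mathrm{LP}_2$ is obtained by removing $\{j,j+1\}$ and relabeling in increasing order, and $x/\{j,j+1\}$ by removing $x_j,x_{j+1}$. The pure partition function of $\alpha$ is characterized by: positivity, (PDE), (COV) and (ASY). *)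

theory Defs
  imports "HOL-Analysis.Analysis" "HOL-Library.Disjoint_Sets"
begin

section \<open>The neighbor functions\<close>

text \<open>
  The index set \<open>{1,2,3}\<close> is the numeral type \<open>3\<close> (whose elements are \<open>1, 2\<close> and \<open>3 = 0\<close>).
\<close>

definition zero_extend :: "(nat^3 \<Rightarrow> real) \<Rightarrow> int^3 \<Rightarrow> real" where
  "zero_extend A n = (if \<forall>i. 0 \<le> n$i then A (\<chi> i. nat (n$i)) else 0)"

definition neighbor_coefficients ::
  "real \<Rightarrow> (nat^3 \<Rightarrow> real) \<Rightarrow> (nat^3 \<Rightarrow> real) \<Rightarrow> bool" where
  "neighbor_coefficients \<beta> A0 B0 \<longleftrightarrow>
    A0 (\<chi> i. 0) = 1 \<and>
    (let A = zero_extend A0; B = zero_extend B0; e = (\<lambda>j. axis j 1 :: int^3) in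
      \<forall>(n :: int^3) (j::3) k l. {j, k, l} = {1, 2, 3} \<longrightarrow>
        (let nj = real_of_int (n$j); nk = real_of_int (n$k); nl = real_of_int (n$l) in
          (nl + 1) * (nl + 2*\<beta>) * A (n + e l) - (nl + \<beta>) * (nl + 1 - \<beta>) * A n
            = B n - B (n - e j) - B (n - e k) + B (n - e j - e k) \<and>
          (2 * nj * nk + \<beta> * nj + \<beta> * nk + \<beta> * nl + \<beta>\<^sup>2) * A n
            = B (n - e l - e j) + B (n - e l - e k) - B n - B (n - e j - e k)))"

text \<open>
  Analyticity in several complex variables: near every point of the open set \<open>D\<close>, the function
  is the sum of a convergent power series on a polydisc.  (In \<open>\<complex>\<close>, \<open>has_sum\<close> is absolute convergence.)
\<close>

definition multi_analytic_on :: "(complex^'n \<Rightarrow> complex) \<Rightarrow> (complex^'n) set \<Rightarrow> bool" where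
  "multi_analytic_on f D \<longleftrightarrow> open D \<and>
    (\<forall>w\<in>D. \<exists>\<rho>>0. \<exists>c :: nat^'n \<Rightarrow> complex. \<forall>z. (\<forall>i. cmod (z$i - w$i) < \<rho>) \<longrightarrow>
      ((\<lambda>n. c n * (\<Prod>i\<in>UNIV. (z$i - w$i) ^ (n$i))) has_sum f z) UNIV)"

definition half_open_cube :: "(real^3) set" where
  "half_open_cube = {r. \<forall>i. 0 \<le> r$i \<and> r$i < 1}"

definition open_cube :: "(real^3) set" where
  "open_cube = {r. \<forall>i. 0 < r$i \<and> r$i < 1}"

definition closed_cube :: "(real^3) set" where
  "closed_cube = {r. \<forall>i. 0 \<le> r$i \<and> r$i \<le> 1}"

text \<open>
  \<open>F\<close> restricted to \<open>[0,1)\<^sup>3\<close> is the restriction of an analytic continuation, along a domain (open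
  and connected) containing \<open>[0,1)\<^sup>3\<close>, of the sum of the power series with coefficients \<open>A\<close>.
  By the identity theorem this determines \<open>F\<close> on \<open>[0,1)\<^sup>3\<close>; its values elsewhere are arbitrary.
\<close>

definition continues_power_series :: "(nat^3 \<Rightarrow> real) \<Rightarrow> (real^3 \<Rightarrow> real) \<Rightarrow> bool" where
  "continues_power_series A F \<longleftrightarrow> (\<exists>D f.
    open D \<and> connected D \<and> multi_analytic_on f D \<and>
    {z. \<forall>i. cmod (z$i) < 1/10} \<subseteq> D \<and>
    (\<forall>z. (\<forall>i. cmod (z$i) < 1/10) \<longrightarrow>
      ((\<lambda>n. complex_of_real (A n) * (\<Prod>i\<in>UNIV. (z$i) ^ (n$i))) has_sum f z) UNIV) \<and>
    (\<forall>r\<in>half_open_cube.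
      (\<chi> i. complex_of_real (r$i)) \<in> D \<and> f (\<chi> i. complex_of_real (r$i)) = complex_of_real (F r)))"

definition neighbor_functions :: "real \<Rightarrow> (real^3 \<Rightarrow> real) \<Rightarrow> (real^3 \<Rightarrow> real) \<Rightarrow> bool" where
  "neighbor_functions \<beta> F G \<longleftrightarrow> (\<exists>A B. neighbor_coefficients \<beta> A B \<and>
    continues_power_series A F \<and> continues_power_series B G)"

definition partial3 :: "3 \<Rightarrow> (real^3 \<Rightarrow> real) \<Rightarrow> real^3 \<Rightarrow> real" where
  "partial3 i f r = deriv (\<lambda>t. f (\<chi> k. if k = i then t else r$k)) (r$i)"


section \<open>Constants\<close>

text \<open>The series also converges at \<open>r = 1\<close>, because \<open>2\<beta> - (1-\<beta>) - \<beta> = 2\<beta> - 1 > 0\<close>.\<close>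

definition f_hyp :: "real \<Rightarrow> real \<Rightarrow> real" where
  "f_hyp \<beta> r = eval_fps (fps_hypergeo [1 - \<beta>, \<beta>] [2*\<beta>] 1) r"

definition c_F :: "real \<Rightarrow> real" where
  "c_F \<beta> = Gamma (2*\<beta>) * Gamma (3*\<beta> - 1) / (Gamma \<beta> * Gamma (4*\<beta> - 1)) * f_hyp \<beta> 1"

definition c_alpha :: "real \<Rightarrow> real" where
  "c_alpha \<beta> = inverse (c_F \<beta>) * inverse (f_hyp \<beta> 1)"

definition h_exp :: "real \<Rightarrow> real" where
  "h_exp \<kappa> = (6 - \<kappa>) / (2*\<kappa>)"


section \<open>Boundary points, PDE and covariance\<close>

text \<open>
  \<open>\<real>\<^bsup>2N\<^esup>\<close> is represented by the functions \<open>nat \<Rightarrow> real\<close> that are \<open>undefined\<close> outside \<open>{1..2N}\<close>;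
  the product topology of \<open>nat \<Rightarrow> real\<close> induces the usual topology on this set.
\<close>

definition chamber :: "nat \<Rightarrow> (nat \<Rightarrow> real) set" where
  "chamber N = {x \<in> {1..2*N} \<rightarrow>\<^sub>E UNIV. \<forall>j\<in>{1..2*N}. \<forall>k\<in>{1..2*N}. j < k \<longrightarrow> x j < x k}"

definition partial :: "nat \<Rightarrow> ((nat \<Rightarrow> real) \<Rightarrow> real) \<Rightarrow> (nat \<Rightarrow> real) \<Rightarrow> real" where
  "partial i Z x = deriv (\<lambda>t. Z (x(i := t))) (x i)"

text \<open>Smoothness: all iterated partial derivatives exist and are continuous.\<close>

definition smooth_on_chamber :: "nat \<Rightarrow> ((nat \<Rightarrow> real) \<Rightarrow> real) \<Rightarrow> bool" where
  "smooth_on_chamber N Z \<longleftrightarrow> (\<forall>js. set js \<subseteq> {1..2*N} \<longrightarrow>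
    continuous_on (chamber N) (foldr partial js Z) \<and>
    (\<forall>x\<in>chamber N. \<forall>i\<in>{1..2*N}.
      (\<lambda>t. foldr partial js Z (x(i := t))) differentiable (at (x i))))"

definition PDE :: "nat \<Rightarrow> real \<Rightarrow> ((nat \<Rightarrow> real) \<Rightarrow> real) \<Rightarrow> bool" where
  "PDE N \<kappa> Z \<longleftrightarrow> smooth_on_chamber N Z \<and>
    (\<forall>i\<in>{1..2*N}. \<forall>x\<in>chamber N.
      \<kappa>/2 * partial i (partial i Z) x +
      (\<Sum>j\<in>{1..2*N} - {i}. 2 / (x j - x i) * partial j Z x
                          - 2 * h_exp \<kappa> / (x j - x i)\<^sup>2 * Z x) = 0)"

definition moebius :: "real \<Rightarrow> real \<Rightarrow> real \<Rightarrow> real \<Rightarrow> real \<Rightarrow> real" where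
  "moebius a b c d t = (a*t + b) / (c*t + d)"

text \<open>
  The Moebius maps of the upper half-plane are those with real coefficients and \<open>ad - bc > 0\<close>.
  Since division by zero is zero in HOL, it must be required separately that
  no \<open>x\<^sub>i\<close> is mapped to infinity.
\<close>

definition COV :: "nat \<Rightarrow> real \<Rightarrow> ((nat \<Rightarrow> real) \<Rightarrow> real) \<Rightarrow> bool" where
  "COV N \<kappa> Z \<longleftrightarrow> (\<forall>x\<in>chamber N. \<forall>a b c d.
    let \<phi> = moebius a b c d; \<phi>x = restrict (\<lambda>i. \<phi> (x i)) {1..2*N} in
      a*d - b*c > 0 \<and> (\<forall>i\<in>{1..2*N}. c * x i + d \<noteq> 0) \<and> \<phi>x \<in> chamber N \<longrightarrow>
      Z x = (\<Prod>i\<in>{1..2*N}. deriv \<phi> (x i) powr h_exp \<kappa>) * Z \<phi>x)"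


section \<open>Link patterns and asymptotics\<close>

definition LP :: "nat \<Rightarrow> nat set set set" where
  "LP N = {\<alpha>. partition_on {1..2*N} \<alpha> \<and> (\<forall>p\<in>\<alpha>. card p = 2) \<and>
    (\<forall>a b c d. {a, b} \<in> \<alpha> \<and> {c, d} \<in> \<alpha> \<and> {a, b} \<noteq> {c, d} \<longrightarrow>
      (int a - int c) * (int a - int d) * (int b - int c) * (int b - int d) > 0)}"

definition neighbor_patterns :: "nat set set set" where
  "neighbor_patterns = {{{1, 2}, {3, 4}, {5, 6}}, {{1, 6}, {2, 3}, {4, 5}}}"

definition cross_ratio :: "real \<Rightarrow> real \<Rightarrow> real \<Rightarrow> real \<Rightarrow> real" where
  "cross_ratio p1 q1 p2 q2 =
    min (\<bar>p1 - p2\<bar> * \<bar>q1 - q2\<bar> / (\<bar>p1 - q2\<bar> * \<bar>q1 - p2\<bar>))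
        (\<bar>p1 - q2\<bar> * \<bar>q1 - p2\<bar> / (\<bar>p1 - p2\<bar> * \<bar>q1 - q2\<bar>))"

text \<open>
  The pure partition function for \<open>N = 2\<close> and the link pattern \<open>{{a 1, b 1}, {a 2, b 2}}\<close>;
  it depends on the pattern only, not on the labeling by \<open>a\<close> and \<open>b\<close>.
\<close>

definition ppf2 :: "real \<Rightarrow> (nat \<Rightarrow> nat) \<Rightarrow> (nat \<Rightarrow> nat) \<Rightarrow> (nat \<Rightarrow> real) \<Rightarrow> real" where
  "ppf2 \<kappa> a b x =
    (let \<beta> = 4 / \<kappa>; C = cross_ratio (x (a 1)) (x (b 1)) (x (a 2)) (x (b 2)) in
      (\<Prod>j\<in>{1..2}. \<bar>x (a j) - x (b j)\<bar> powr (- 2 * h_exp \<kappa>)) *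
      (C powr (2/\<kappa>) * f_hyp \<beta> C / f_hyp \<beta> 1))"

definition remove_link :: "nat \<Rightarrow> nat set set \<Rightarrow> nat set set" where
  "remove_link j \<alpha> = (\<lambda>p. (\<lambda>i. if i < j then i else i - 2) ` p) ` (\<alpha> - {{j, j+1}})"

definition remove_points :: "nat \<Rightarrow> (nat \<Rightarrow> real) \<Rightarrow> nat \<Rightarrow> real" where
  "remove_points j x = restrict (\<lambda>i. if i < j then x i else x (i + 2)) {1..4}"

text \<open>
  The coordinates of \<open>y\<close> other than \<open>j\<close> and \<open>j+1\<close> are the fixed ones; \<open>s\<close> and \<open>t\<close> are the
  variables \<open>x\<^sub>j\<close> and \<open>x\<^bsub>j+1\<^esub>\<close>.
\<close>

definition ASY3 :: "real \<Rightarrow> nat set set \<Rightarrow> ((nat \<Rightarrow> real) \<Rightarrow> real) \<Rightarrow> bool" where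
  "ASY3 \<kappa> \<alpha> Z \<longleftrightarrow> (\<forall>j\<in>{1..5}. \<forall>\<xi>. \<forall>y\<in>{1..6} \<rightarrow>\<^sub>E UNIV.
    strict_mono_on ({1..6} - {j, j+1}) y \<and>
    (\<forall>i\<in>{1..<j}. y i < \<xi>) \<and> (\<forall>i\<in>{j+2..6}. \<xi> < y i) \<longrightarrow>
    (let xx = (\<lambda>(s, t). y(j := s, j+1 := t));
         ratio = (\<lambda>(s, t). Z (xx (s, t)) / (t - s) powr (- 2 * h_exp \<kappa>));
         lim_is = (\<lambda>L. (ratio \<longlongrightarrow> L) (at (\<xi>, \<xi>) within {st. xx st \<in> chamber 3}))
     in ({j, j+1} \<notin> \<alpha> \<longrightarrow> lim_is 0) \<and>
        ({j, j+1} \<in> \<alpha> \<longrightarrow>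
          (\<forall>a b. remove_link j \<alpha> = {{a 1, b 1}, {a 2, b 2}} \<longrightarrow>
            lim_is (ppf2 \<kappa> a b (remove_points j y))))))"

definition pure_partition_function3 ::
  "real \<Rightarrow> nat set set \<Rightarrow> ((nat \<Rightarrow> real) \<Rightarrow> real) \<Rightarrow> bool" where
  "pure_partition_function3 \<kappa> \<alpha> Z \<longleftrightarrow>
    (\<forall>x\<in>chamber 3. 0 < Z x) \<and> PDE 3 \<kappa> Z \<and> COV 3 \<kappa> Z \<and> ASY3 \<kappa> \<alpha> Z"


section \<open>The candidate for neighbor patterns\<close>

definition H_fun :: "real \<Rightarrow> (real^3 \<Rightarrow> real) \<Rightarrow> real^3 \<Rightarrow> real" where
  "H_fun \<kappa> F r = (r$1 * r$2 * r$3) powr (2/\<kappa>) * F r"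

definition Z_neighbor ::
  "real \<Rightarrow> real \<Rightarrow> (real^3 \<Rightarrow> real) \<Rightarrow> (nat \<Rightarrow> nat) \<Rightarrow> (nat \<Rightarrow> nat) \<Rightarrow> (nat \<Rightarrow> real) \<Rightarrow> real" where
  "Z_neighbor \<beta> \<kappa> F a b x =
    (let C = (\<lambda>i j. cross_ratio (x (a i)) (x (b i)) (x (a j)) (x (b j))) in
      c_alpha \<beta> * (\<Prod>j\<in>{1..3}. \<bar>x (a j) - x (b j)\<bar> powr (- 2 * h_exp \<kappa>)) *
      H_fun \<kappa> F (vector [C 1 2, C 2 3, C 3 1]))"

end

theory Submission
  imports Defs "HOL-Probability.Probability" "HOL-Complex_Analysis.Complex_Analysis" "HOL-Real_Asymp.Real_Asymp"
begin

text \<open>Write b for \<beta> and (a)_n for rising factorials. The recurrences can be solved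
  explicitly. Let K(x,y,w) be the coefficients of the sum over m of (4b-1)_{2m} / ((b)_m m!) (XYZ)^m
  (1-X-Y-Z)^(-(4b-1)-2m). Substitute -\<rho>/(1-\<rho>) for each variable, multiply by the factors
  (1-\<rho>)^(-2b), and multiply the coefficient of each power \<rho>^n by (b)_n / (2b)_n. The
  result is A; a companion with the extra weight 1/(b+m) leads to B. The first recurrence is a
  contiguity relation of hypergeometric sums, the second comes from telescoping in m
  (\<open>A_cf_rec1\<close>, \<open>A_cf_rec2\<close>), and induction on the total degree shows that
  no other pair solves both (\<open>neighbor_coefficients_unique\<close>).

  The numbers (b)_n / (2b)_n and (1/2)_m / (b)_m are moments of beta distributions. Hence F is the
  expectation, over three Beta(b,b) variables t_i and one Beta(1/2,b-1/2) variable u, of a power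
  times the kernel Re (P + i sqrt Y)^(-(4b-1)), where P and Y are polynomials in the r_i t_i and u
  (\<open>Fbar\<close>). For small r this is a comparison of power series; on the half-open cube it
  follows by analytic continuation along rays from 0 (\<open>neighbor_function_eq_Fbar\<close>). One
  integrable majorant serves all r in the closed cube, so \<open>Fbar\<close> is continuous there.
  On a face r_i = 0 the kernel is positive because Y = 0. On a face r_i = 1 the integrals over t_i
  and u can be evaluated, and \<open>Fbar\<close> becomes a constant times f(r_j) f(r_k)
  (\<open>Fbar_face\<close>). This gives (b) and (c). Part (a) is the recurrences read as identities
  of power series near 0 and continued along the same rays (\<open>neighbor_pde\<close>).

  Inside the cube the kernel takes both signs, so positivity of F comes from a maximum principle
  (\<open>neighbor_function_pos\<close>). Eliminating G from three of the equations leaves L F = 0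
  for an operator L (\<open>lop\<close>) whose second-order part is elliptic in r_1, r_2. There are
  positive functions \<psi> with L \<psi> \<ge> 0 and \<phi> with L \<phi> < 0. If F <
  \<delta>\<psi> somewhere, for a \<delta> so small that F > \<delta>\<psi> on the boundary, then
  subtracting from F - \<delta>\<psi> its most negative multiple of \<phi> gives a function with an
  interior minimum 0, where L of it is at once nonnegative and negative.

  On the chamber, Z is a product of powers of the |x_a - x_c| times F of the three cross-ratios.
  After 1/(x_j - x_i) is taken as coordinate, the equation at x_i is a linear combination of three
  of the equations in (a), and the terms with G cancel (\<open>pde_core\<close>,
  \<open>Zf_pde\<close>). Covariance only depends on the sums of the exponents at each point
  (\<open>Zf_cov\<close>). When two points fuse, the ratio in (ASY) is a convergent factor times
  (x_{j+1} - x_j)^E times \<open>Fbar\<close>. For unlinked points E = 2b-1 > 0 and the limit is 0;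
  for linked points E = 0, two cross-ratios tend to 1, and the edge values of F produce the N = 2
  function (\<open>ASY3_neighbor\<close>).\<close>

abbreviation "cor \<equiv> complex_of_real"

section \<open>Hypergeometric sums and their recurrences\<close>

definition rfact :: "nat => nat => real" where
 "rfact n m = (if m <= n then 1 / fact (n - m) else 0)"

lemma rfact_Suc_right: "rfact n (Suc m) = rfact n m * (real n - m)"
proof (cases "m < n")
 case True
 then obtain k where "n = Suc m + k" by (metis less_eq_Suc_le le_Suc_ex)
 then show ?thesis by (simp add: rfact_def Suc_diff_le)
qed (auto simp: rfact_def)

lemma rfact_Suc_Suc: "rfact (Suc n) (Suc m) = rfact n m"
 by (simp add: rfact_def)

lemma rfact_Suc_left: "rfact (Suc n) m * (real n + 1 - m) = rfact n m"
 using rfact_Suc_right[of "Suc n" m] rfact_Suc_Suc[of n m] by (simp add: add_ac)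

lemma rfact_eq_0: "n < m ==> rfact n m = 0"
 by (simp add: rfact_def)

text \<open>The m-th contribution to the coefficient of X^x Y^y Z^w in the sum over m of (4b-1)_{2m}
  / ((b)_m m!) (XYZ)^m (1-X-Y-Z)^(-(4b-1)-2m), obtained by expanding the last factor
  (\<open>tau3_has_sum\<close>).\<close>

definition tau :: "real => nat => nat => nat => nat => real" where
 "tau b m x y w = pochhammer (4*b-1) (x+y+w-m) / (pochhammer b m * fact m) * rfact x m * rfact y m * rfact w m"

definition K_cf :: "real => nat => nat => nat => real" where
 "K_cf b x y w = (\<Sum>m\<le>x+y+w. tau b m x y w)"

text \<open>The companion that leads to the coefficients B. Its weight 1/(b+m) is what a
  simultaneous shift of m and w produces in \<open>tau_Suc_m_w\<close>.\<close>

definition Z_cf :: "real => nat => nat => nat => real" where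
 "Z_cf b x y w = (\<Sum>m\<le>x+y+w. tau b m x y w / (b + m))"

lemma tau_perm: "tau b m x y w = tau b m y x w" "tau b m x y w = tau b m x w y"
 by (auto simp: tau_def add_ac mult_ac)

lemma tau_eq_0: "x < m ==> tau b m x y w = 0" "y < m ==> tau b m x y w = 0" "w < m ==> tau b m x y w = 0"
 by (auto simp: tau_def rfact_eq_0)

lemma K_cf_eq: "x <= M ==> K_cf b x y w = (\<Sum>m\<le>M. tau b m x y w)"
 unfolding K_cf_def
 by (rule sum.mono_neutral_cong) (auto simp: tau_eq_0)

lemma Z_cf_eq: "x <= M ==> Z_cf b x y w = (\<Sum>m\<le>M. tau b m x y w / (b + m))"
 unfolding Z_cf_def
 by (rule sum.mono_neutral_cong) (auto simp: tau_eq_0)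

lemma K_cf_perm: "K_cf b x y w = K_cf b y x w" "K_cf b x y w = K_cf b x w y"
proof -
 show "K_cf b x y w = K_cf b y x w"
  unfolding K_cf_def tau_perm(1)[of b _ x y w] by (simp add: add_ac)
 show "K_cf b x y w = K_cf b x w y"
  unfolding K_cf_def tau_perm(2)[of b _ x y w] by (simp add: add_ac)
qed

lemma Z_cf_perm: "Z_cf b x y w = Z_cf b y x w" "Z_cf b x y w = Z_cf b x w y"
proof -
 show "Z_cf b x y w = Z_cf b y x w"
  unfolding Z_cf_def tau_perm(1)[of b _ x y w] by (simp add: add_ac)
 show "Z_cf b x y w = Z_cf b x w y"
  unfolding Z_cf_def tau_perm(2)[of b _ x y w] by (simp add: add_ac)
qed

lemma pochhammer_fact_Suc:
 assumes "b > 0"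
 shows "inverse (pochhammer b (Suc m) * fact (Suc m)) * ((b+real m)*(real m+1)) = inverse (pochhammer b m * fact m)"
proof -
 have "b + real m > 0" "real m + 1 > 0" using assms by auto
 then have nz: "(b + real m) * (real m + 1) ~= 0" by auto
 have "pochhammer b (Suc m) * fact (Suc m) = (pochhammer b m * fact m) * ((b + real m) * (real m + 1))"
  unfolding pochhammer_Suc fact_Suc of_nat_Suc by (simp only: mult_ac add_ac)
 then show ?thesis using nz by (metis inverse_mult_distrib left_inverse mult.assoc mult.right_neutral)
qed

text \<open>With the next two lemmas this gives the ratios of neighboring values of the
  hypergeometric term \<open>tau\<close>, in m, in w and in both. They are written as products, so
  that they survive where \<open>tau\<close> vanishes; in the cases spoilt by truncated subtraction
  both sides are 0.\<close>

lemma tau_Suc_m: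
 assumes "b > 1/2"
 shows "tau b (Suc m) x y w * ((b + m) * (m+1) * (4*b - 1 + x + y + w - m - 1))
  = tau b m x y w * ((real x - m) * (real y - m) * (real w - m))"
proof -
 define c where "c = (%m. inverse (pochhammer b m * fact m))"
 have c: "c (Suc m) * ((b+real m)*(real m+1)) = c m"
  unfolding c_def by (rule pochhammer_fact_Suc) (use assms in auto)
 show ?thesis
 proof (cases "Suc m <= x+y+w")
  case True
  then have "x+y+w-m = Suc (x+y+w-Suc m)" by auto
  then have p: "pochhammer (4*b-1) (x+y+w-m) = pochhammer (4*b-1) (x+y+w-Suc m) * (4*b - 1 + x + y + w - m - 1)"
   using True by (simp add: pochhammer_Suc of_nat_diff algebra_simps)
  define Q where "Q = pochhammer (4*b-1) (x+y+w-Suc m)"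
  define R where "R = 4*b - 1 + x + y + w - m - 1"
  show ?thesis
   unfolding tau_def divide_inverse p[folded Q_def R_def] rfact_Suc_right c[unfolded c_def, symmetric]
    Q_def[symmetric] R_def[symmetric] of_nat_add of_nat_1 by (simp only: mult_ac)
 next
  case False
  then have "m = x \<or> x < m" by auto
  then show ?thesis by (auto simp: tau_eq_0)
 qed
qed

lemma tau_Suc_w:
 "tau b m x y (Suc w) * (real w + 1 - m) = tau b m x y w * (4*b - 1 + x + y + w - m)"
proof (cases "m <= x+y+w")
 case True
 then have "x+y+Suc w-m = Suc (x+y+w- m)" by auto
 then have p: "pochhammer (4*b-1) (x+y+Suc w-m) = pochhammer (4*b-1) (x+y+w-m) * (4*b - 1 + x + y + w - m)"
  using True by (simp add: pochhammer_Suc of_nat_diff algebra_simps)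
 show ?thesis
  unfolding tau_def divide_inverse p rfact_Suc_left[of w m, symmetric] by (simp only: mult_ac)
next
 case False
 then have "m = Suc w \<or> Suc w < m" by auto
 then show ?thesis by (auto simp: tau_eq_0)
qed

lemma tau_Suc_m_w:
 assumes "b > 1/2"
 shows "(real m + 1) * tau b (Suc m) x y (Suc w) = tau b m x y w * ((real x-m)*(real y-m)/(b+m))"
proof -
 define c where "c = (%m. inverse (pochhammer b m * fact m))"
 have c: "c (Suc m) * ((b+real m)*(real m+1)) = c m"
  unfolding c_def by (rule pochhammer_fact_Suc) (use assms in auto)
 have p: "x+y+Suc w-Suc m = x+y+w-m" by auto
 have bm: "b + real m ~= 0" using assms by auto
 have "(b+m) * ((real m + 1) * tau b (Suc m) x y (Suc w)) = tau b m x y w * ((real x-m)*(real y-m))"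
  unfolding tau_def divide_inverse p rfact_Suc_right[of x] rfact_Suc_right[of y] rfact_Suc_Suc c[unfolded c_def, symmetric]
  by (simp only: mult_ac)
 then show ?thesis using bm by (simp add: field_simps)
qed

text \<open>Write w+1 = (w+1-m) + m in each term. The first part is a ratio in w, the second is
  summed after m is shifted by one. What remains is (4b-1+x+y+w-m) + (x-m)(y-m)/(b+m) = (w+3b-1) +
  (x+b)(y+b)/(b+m).\<close>

lemma K_cf_rec1:
 assumes "b > 1/2"
 shows "(real w+1) * K_cf b x y (Suc w) = (w + 3*b - 1) * K_cf b x y w + (x+b)*(y+b) * Z_cf b x y w"
proof -
 define M where "M = Suc x"
 have t: "(real w+1) * tau b m x y (Suc w) = tau b m x y w * (4*b - 1 + x + y + w - m) + m * tau b m x y (Suc w)" for m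
  using tau_Suc_w[of b m x y w] by (simp add: algebra_simps)
 have m: "(\<Sum>m\<le>M. m * tau b m x y (Suc w)) = (\<Sum>m\<le>x. (real m+1) * tau b (Suc m) x y (Suc w))"
  unfolding M_def by (subst sum.atMost_Suc_shift) (simp add: add_ac)
 have "(real w+1) * K_cf b x y (Suc w) = (\<Sum>m\<le>M. (real w+1) * tau b m x y (Suc w))"
  by (subst K_cf_eq[of x M]) (auto simp: M_def sum_distrib_left simp del: sum.atMost_Suc)
 also have "\<dots> = (\<Sum>m\<le>M. tau b m x y w * (4*b - 1 + x + y + w - m)) + (\<Sum>m\<le>M. m * tau b m x y (Suc w))"
  unfolding t sum.distrib ..
 also have "(\<Sum>m\<le>M. tau b m x y w * (4*b - 1 + x + y + w - m)) = (\<Sum>m\<le>x. tau b m x y w * (4*b - 1 + x + y + w - m))"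
  unfolding M_def by (simp add: tau_eq_0)
 also have "\<dots> + (\<Sum>m\<le>M. m * tau b m x y (Suc w)) =
   (\<Sum>m\<le>x. tau b m x y w * (4*b - 1 + x + y + w - m) + tau b m x y w * ((real x-m)*(real y-m)/(b+m)))"
  unfolding m tau_Suc_m_w[OF assms] sum.distrib ..
 also have "\<dots> = (\<Sum>m\<le>x. (w + 3*b - 1) * tau b m x y w + (x+b)*(y+b) * (tau b m x y w/(b+m)))"
 proof (intro sum.cong refl)
  fix m :: nat
  have bm: "b + m ~= 0" using assms by auto
  show "tau b m x y w * (4*b - 1 + x + y + w - m) + tau b m x y w * ((real x-m)*(real y-m)/(b+m)) = (w + 3*b - 1) * tau b m x y w + (x+b)*(y+b) * (tau b m x y w/(b+m))"
   using bm by (simp add: field_simps)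
 qed
 also have "\<dots> = (w + 3*b - 1) * K_cf b x y w + (x+b)*(y+b) * Z_cf b x y w"
  by (simp add: K_cf_eq[of x x] Z_cf_eq[of x x] sum.distrib sum_distrib_left)
 finally show ?thesis .
qed

text \<open>The rational certificate for \<open>K_cf_rec2\<close>. The left side is the summand of
  that relation divided by \<open>tau\<close>; the right side is V(m+1) - V(m) divided by
  \<open>tau\<close>, where V(m) is \<open>tau\<close> times m h(m)/(q-1) with a polynomial
  h.\<close>

lemma certificate_identity:
 fixes b x y w m :: real
 assumes "q = 4*b - 1 + x + y + w - m" "b + m ~= 0" "q - 1 ~= 0" "q - 2 ~= 0"
 shows "((2*b+x-1)*(y+b)*(w+b)*((x-m)/(q-1)) + (2*b+y-1)*(x+b)*(w+b)*((y-m)/(q-1)) + (2*b+w-1)*(x+b)*(y+b)*((w-m)/(q-1))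
   - (x+b)*(y+b)*(w+b) - 2*(2*b+x-1)*(2*b+y-1)*(w+b)*((x-m)*(y-m)/((q-1)*(q-2)))) / (b+m)
  + 2*(2*b+x-1)*(2*b+y-1)*((x-m)*(y-m)/((q-1)*(q-2))) - 2*(2*b+x-1)*(y+b)*((x-m)/(q-1))
  - 2*(2*b+y-1)*(x+b)*((y-m)/(q-1)) + 2*(x+b)*(y+b)
  + b*(2*b+x-1)*((x-m)/(q-1)) - b*(x+b) + b*(2*b+y-1)*((y-m)/(q-1)) - b*(y+b)
  - b*(2*b+w-1)*((w-m)/(q-1)) + b*(w+b)
  = (x-m)*(y-m)*(w-m)*(-2*x*y+(1-3*b)*(x+y)+(b-1)*w-4*b^2+b+1+(1-b)*m) / ((b+m)*(q-1)*(q-2))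
   - m*(-2*x*y+(1-3*b)*(x+y)+(b-1)*w-4*b^2+b+1+(1-b)*(m-1)) / (q-1)"
proof -
 \<comment> \<open>The shifted variables x+b, y+b, w+b, b+m and b-1 shorten all polynomials.\<close>
 define d h P Q R p e where "d = b + m" and "h = b - 1" and "P = x + b" and "Q = y + b" and "R = w + b" and "p = q - 1" and "e = q - 2"
 define a0 a1 a2 where "a0 = P*Q*R" and "a1 = (P+h)*Q*R*(P-d) + (Q+h)*P*R*(Q-d) + (R+h)*P*Q*(R-d)"
  and "a2 = 2*(P+h)*(Q+h)*R*((P-d)*(Q-d))"
 define c0 c1 c2 where "c0 = 2*P*Q - b*P - b*Q + b*R"
  and "c1 = b*(P+h)*(P-d) + b*(Q+h)*(Q-d) - 2*(P+h)*Q*(P-d) - 2*(Q+h)*P*(Q-d) - b*(R+h)*(R-d)"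
  and "c2 = 2*(P+h)*(Q+h)*((P-d)*(Q-d))"
 define r1 r2 where "r1 = m*(h*(R-d) - h*(P+Q) - 2*P*Q)" and "r2 = (P-d)*(Q-d)*(R-d)*(h*(R-d) - h*(P+Q) - 2*P*Q - h)"
 have nz: "d ~= 0" "p ~= 0" "e ~= 0" using assms by (simp_all add: d_def p_def e_def)
 have v: "p = P + Q + R - d + 2*h" "e = P + Q + R - d + 2*h - 1" "m = d - h - 1" "b = h + 1"
  using assms(1) by (simp_all add: d_def h_def P_def Q_def R_def p_def e_def)
 \<comment> \<open>A full expansion is avoided by two smaller identities: the parts with denominator
   p alone collect to K, and K e cancels the parts with denominator p e.\<close>
 define K where "K = (P-d)*(Q-d)*(R-d)*h"
 have id1: "a1 - a0*p + d*(c1 + c0*p) + r1*d = K"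
  unfolding a0_def a1_def c0_def c1_def r1_def K_def v by (simp add: algebra_simps)
 have he: "h*e = 2*(P+h)*(Q+h) + (h*(R-d) - h*(P+Q) - 2*P*Q - h)" unfolding v by (simp add: algebra_simps)
 have "U*(R-d)*(T+Y) = T*R*U - d*(T*U) + U*(R-d)*Y" for U T Y by (simp add: algebra_simps)
 then have Ke: "K*e = a2 - d*c2 + r2" unfolding K_def mult.assoc[of _ h e] he a2_def c2_def r2_def .
 have "a1*e - a0*(p*e) - a2 + d*(c2 + c1*e + c0*(p*e)) - (r2 - r1*(d*e))
   = (a1 - a0*p + d*(c1 + c0*p) + r1*d)*e - (a2 - d*c2 + r2)"
  by (simp add: algebra_simps)
 also have "\<dots> = 0" unfolding id1 Ke[symmetric] by simp
 finally have id: "a1*e - a0*(p*e) - a2 + d*(c2 + c1*e + c0*(p*e)) = r2 - r1*(d*e)" by simp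
 have gg: "2*b+x-1 = P+h" "2*b+y-1 = Q+h" "2*b+w-1 = R+h" "x-m = P-d" "y-m = Q-d" "w-m = R-d" "b+m = d" "q-1 = p" "q-2 = e"
   "x+b = P" "y+b = Q" "w+b = R"
  by (simp_all add: d_def h_def P_def Q_def R_def p_def e_def)
 have f: "-2*x*y+(1-3*b)*(x+y)+(b-1)*w-4*b^2+b+1+(1-b)*m = h*(R-d) - h*(P+Q) - 2*P*Q - h"
  "-2*x*y+(1-3*b)*(x+y)+(b-1)*w-4*b^2+b+1+(1-b)*(m-1) = h*(R-d) - h*(P+Q) - 2*P*Q"
  unfolding d_def h_def P_def Q_def R_def by (simp_all add: algebra_simps power2_eq_square)
 have "(a1/p - a0 - a2/(p*e))/d + (c2/(p*e) + c1/p + c0) = (a1*e - a0*(p*e) - a2 + d*(c2 + c1*e + c0*(p*e)))/(d*(p*e))"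
  using nz by (simp add: add_divide_distrib diff_divide_distrib mult_ac)
 also have "\<dots> = r2/(d*p*e) - r1/p" unfolding id using nz by (simp add: diff_divide_distrib mult_ac)
 finally have F: "(a1/p - a0 - a2/(p*e))/d + (c2/(p*e) + c1/p + c0) = r2/(d*p*e) - r1/p" .
 have gen: "(A1*Q*R*(X/p) + A2*P*R*(Y/p) + A3*P*Q*(V/p) - P*Q*R - 2*A1*A2*R*(X*Y/(p*e))) / d
  + 2*A1*A2*(X*Y/(p*e)) - 2*A1*Q*(X/p) - 2*A2*P*(Y/p) + 2*P*Q + b*A1*(X/p) - b*P + b*A2*(Y/p) - b*Q - b*A3*(V/p) + b*R
  = ((A1*Q*R*X + A2*P*R*Y + A3*P*Q*V)/p - P*Q*R - 2*A1*A2*R*(X*Y)/(p*e))/d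
  + (2*A1*A2*(X*Y)/(p*e) + (b*A1*X + b*A2*Y - 2*A1*Q*X - 2*A2*P*Y - b*A3*V)/p + (2*P*Q - b*P - b*Q + b*R))" for A1 A2 A3 X Y V
  by (simp add: algebra_simps add_divide_distrib diff_divide_distrib)
 show ?thesis unfolding f gg
  by (rule trans[OF gen F[unfolded a0_def a1_def a2_def c0_def c1_def c2_def r1_def r2_def]])
qed

text \<open>Backward shift with value 0 at index 0, in accordance with the extension of the
  coefficients by 0 to negative indices.\<close>

definition prev :: "(nat => real) => nat => real" where
 "prev f n = (if n = 0 then 0 else f (n - 1))"

lemma prev_simps [simp]: "prev f 0 = 0" "prev f (Suc n) = f n"
 by (auto simp: prev_def)

lemma tau_prev:
 assumes "b > 1/2"
 shows "prev (%x. tau b m x y w) x = tau b m x y w * ((real x-m) / (4*b - 1 + x + y + w - m - 1))"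
  and "prev (%y. tau b m x y w) y = tau b m x y w * ((real y-m) / (4*b - 1 + x + y + w - m - 1))"
  and "prev (%w. tau b m x y w) w = tau b m x y w * ((real w-m) / (4*b - 1 + x + y + w - m - 1))"
proof -
 have *: "prev (%w. tau b m x y w) w = tau b m x y w * ((real w-m) / (4*b - 1 + x + y + w - m - 1))" for x y w
 proof (cases w)
  case 0
  then show ?thesis by (cases "m = 0") (auto simp: tau_eq_0)
 next
  case (Suc w')
  show ?thesis
  proof (cases "m <= w'")
   case True
   then have "4*b - 1 + x + y + w' - m > 0" using assms by (simp add: algebra_simps)
   then show ?thesis using tau_Suc_w[of b m x y w'] by (simp add: Suc field_simps)
  next
   case False
   then have "m = w \<or> w < m" using Suc by auto
   then show ?thesis using False by (auto simp: Suc tau_eq_0)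
  qed
 qed
 show "prev (%w. tau b m x y w) w = tau b m x y w * ((real w-m) / (4*b - 1 + x + y + w - m - 1))" by (rule *)
 have e1: "(%y. tau b m x y w) = (%y. tau b m x w y)" by (rule ext, rule tau_perm(2))
 have e2: "(%x. tau b m x y w) = (%x. tau b m y w x)" by (rule ext) (metis tau_perm)
 have d: "4*b - 1 + x + w + y - m - 1 = 4*b - 1 + x + y + w - m - 1" "4*b - 1 + y + w + x - m - 1 = 4*b - 1 + x + y + w - m - 1"
  by simp_all
 have p: "tau b m x w y = tau b m x y w" "tau b m y w x = tau b m x y w"
  by (metis tau_perm)+
 show "prev (%y. tau b m x y w) y = tau b m x y w * ((real y-m) / (4*b - 1 + x + y + w - m - 1))"
  unfolding e1 using *[of x w y] unfolding d p .
 show "prev (%x. tau b m x y w) x = tau b m x y w * ((real x-m) / (4*b - 1 + x + y + w - m - 1))"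
  unfolding e2 using *[of y w x] unfolding d p .
qed

lemma tau_prev2:
 assumes "b > 1/2"
 shows "prev (%x. prev (%y. tau b m x y w) y) x = tau b m x y w * ((real x-m) * (real y - m) / ((4*b - 1 + x + y + w - m - 1) * (4*b - 1 + x + y + w - m - 2)))"
proof (cases x)
 case 0
 then show ?thesis by (cases "m = 0") (auto simp: tau_eq_0)
next
 case (Suc x')
 have "prev (%x. prev (%y. tau b m x y w) y) x = prev (%y. tau b m x' y w) y"
  by (simp add: Suc)
 also have "\<dots> = tau b m x' y w * ((real y-m) / (4*b - 1 + x' + y + w - m - 1))"
  by (rule tau_prev(2)[OF assms])
 also have "tau b m x' y w = prev (%x. tau b m x y w) x" by (simp add: Suc)
 also have "\<dots> = tau b m x y w * ((real x-m) / (4*b - 1 + x + y + w - m - 1))"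
  by (rule tau_prev(1)[OF assms])
 also have "4*b - 1 + x' + y + w - m - 1 = 4*b - 1 + x + y + w - m - 2" by (simp add: Suc)
 finally show ?thesis by simp
qed

lemma prev_sum: "prev (%x. \<Sum>m\<in>M. f m x) x = (\<Sum>m\<in>M. prev (f m) x)"
 by (simp add: prev_def)

lemma prev_cong: "(!!y. Suc y <= x ==> f y = g y) ==> prev f x = prev g x"
 by (cases x) auto

lemma prev_cmult: "prev (%x. c * f x) x = c * prev f x" "prev (%x. f x / c) x = prev f x / c"
 by (auto simp: prev_def)

lemma certificate_sum_term:
 fixes t d X Y V U :: real
 shows "c1*(t*X/d) + c2*(t*Y/d) + c3*(t*V/d) - c4*(t/d) - c5*(t*U/d) + c6*(t*U) - c7*(t*X) - c8*(t*Y) + c9*t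
   + c10*(t*X) - c11*t + c12*(t*Y) - c13*t - c14*(t*V) + c15*t
  = t*((c1*X + c2*Y + c3*V - c4 - c5*U)/d + c6*U - c7*X - c8*Y + c9 + c10*X - c11 + c12*Y - c13 - c14*V + c15)"
 by (simp add: algebra_simps add_divide_distrib diff_divide_distrib)

text \<open>Telescoping in m: by \<open>certificate_identity\<close> the summand is V(m+1) - V(m),
  and V vanishes at 0 and beyond the range of summation.\<close>

lemma K_cf_rec2:
 assumes "b > 1/2"
 defines "K \<equiv> K_cf b" and "Z \<equiv> Z_cf b"
 shows "(2*b+real x-1)*(y+b)*(w+b) * prev (%x. Z x y w) x
   + (2*b+real y-1)*(x+b)*(w+b)* prev (%y. Z x y w) y
   + (2*b+real w-1)*(x+b)*(y+b)* prev (%w. Z x y w) w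
   - (x+b)*(y+b)*(w+b) * Z x y w - 2*(2*b+real x-1)*(2*b+real y-1)*(w+b)* prev (%x. prev (%y. Z x y w) y) x
  + 2*(2*b+real x-1)*(2*b+real y-1) * prev (%x. prev (%y. K x y w) y) x
  - 2*(2*b+real x-1)*(y+b)*prev (%x. K x y w) x
  - 2*(2*b+real y-1)*(x+b)*prev (%y. K x y w) y + 2*(x+b)*(y+b)*K x y w
  + b*(2*b+real x-1)*prev (%x. K x y w) x - b*(x+b)*K x y w + b*(2*b+real y-1)*prev (%y. K x y w) y - b*(y+b)*K x y w
  - b*(2*b+real w-1)*prev (%w. K x y w) w + b*(w+b)*K x y w = 0" (is "?L = 0")
\<comment> \<open>At x = y = w = 0 the denominator q - 2 = 4b - 3 can vanish, so this case is
  computed directly. Otherwise q > 2 wherever \<open>tau\<close> is nonzero.\<close>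
proof (cases "x+y+w = 0")
 case True
 then show ?thesis using assms
  by (simp add: K_cf_def Z_cf_def tau_def rfact_def divide_simps)
    (simp add: algebra_simps power2_eq_square)?
next
 case False
 define q where "q m = 4*b - 1 + x + y + w - real m" for m
 define t where "t m = tau b m x y w" for m
 define M where "M = x+y+w"
 define h where "h m = -2*real x*y+(1-3*b)*(real x+y)+(b-1)*w-4*b^2+b+1+(1-b)*(m-1)" for m :: real
 define V where "V m = t m * m * h m / (q m - 1)" for m
 define U where "U m = ((2*b+real x-1)*(y+b)*(w+b)*((real x-m)/(q m-1)) + (2*b+real y-1)*(x+b)*(w+b)*((real y-m)/(q m-1)) + (2*b+real w-1)*(x+b)*(y+b)*((real w-m)/(q m-1))
   - (x+b)*(y+b)*(w+b) - 2*(2*b+real x-1)*(2*b+real y-1)*(w+b)*((real x-m)*(real y-m)/((q m-1)*(q m-2)))) / (b+m)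
  + 2*(2*b+real x-1)*(2*b+real y-1)*((real x-m)*(real y-m)/((q m-1)*(q m-2))) - 2*(2*b+real x-1)*(y+b)*((real x-m)/(q m-1))
  - 2*(2*b+real y-1)*(x+b)*((real y-m)/(q m-1)) + 2*(x+b)*(y+b)
  + b*(2*b+real x-1)*((real x-m)/(q m-1)) - b*(x+b) + b*(2*b+real y-1)*((real y-m)/(q m-1)) - b*(y+b)
  - b*(2*b+real w-1)*((real w-m)/(q m-1)) + b*(w+b)" for m :: nat
 have K: "K x y w = (\<Sum>m\<le>M. t m)" "Z x y w = (\<Sum>m\<le>M. t m / (b+m))"
  by (auto simp: K_def Z_def K_cf_def Z_cf_def M_def t_def)
 have KM: "K x' y' w' = (\<Sum>m\<le>M. tau b m x' y' w')" "Z x' y' w' = (\<Sum>m\<le>M. tau b m x' y' w' / (b+m))" if "x' <= x" for x' y' w'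
  using that by (auto simp: K_def Z_def M_def intro!: K_cf_eq Z_cf_eq)
 have K1: "prev (%x. K x y w) x = (\<Sum>m\<le>M. t m * ((real x-m) / (q m - 1)))"
  "prev (%x. Z x y w) x = (\<Sum>m\<le>M. t m * ((real x-m) / (q m - 1)) / (b+m))"
  unfolding t_def q_def tau_prev[OF assms(1), symmetric] prev_sum[symmetric] prev_cmult[symmetric]
  by (intro prev_cong KM; simp)+
 have K1': "prev (%y. K x y w) y = (\<Sum>m\<le>M. t m * ((real y-m) / (q m - 1)))"
  "prev (%y. Z x y w) y = (\<Sum>m\<le>M. t m * ((real y-m) / (q m - 1)) / (b+m))"
  unfolding t_def q_def tau_prev[OF assms(1), symmetric] prev_sum[symmetric] prev_cmult[symmetric]
  by (intro prev_cong KM; simp)+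
 have K1'': "prev (%w. K x y w) w = (\<Sum>m\<le>M. t m * ((real w-m) / (q m - 1)))"
  "prev (%w. Z x y w) w = (\<Sum>m\<le>M. t m * ((real w-m) / (q m - 1)) / (b+m))"
  unfolding t_def q_def tau_prev[OF assms(1), symmetric] prev_sum[symmetric] prev_cmult[symmetric]
  by (intro prev_cong KM; simp)+
 have K2: "prev (%x. prev (%y. K x y w) y) x = (\<Sum>m\<le>M. t m * ((real x-m)*(real y-m) / ((q m - 1)*(q m - 2))))"
  "prev (%x. prev (%y. Z x y w) y) x = (\<Sum>m\<le>M. t m * ((real x-m)*(real y-m) / ((q m - 1)*(q m - 2))) / (b+m))"
  unfolding t_def q_def tau_prev2[OF assms(1), symmetric] prev_sum[symmetric] prev_cmult[symmetric]
  by (intro prev_cong KM; simp)+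
 have "?L = (\<Sum>m\<le>M. t m * U m)"
  unfolding K K1 K1' K1'' K2 U_def sum_distrib_left sum.distrib[symmetric] sum_subtractf[symmetric]
  by (intro sum.cong refl, rule certificate_sum_term)
 also have "\<dots> = (\<Sum>m\<le>M. V (Suc m) - V m)"
 proof (intro sum.cong refl)
  fix m :: nat
  show "t m * U m = V (Suc m) - V m"
  proof (cases "m <= x & m <= y & m <= w")
   case True
   have "Suc m <= x + y + w" using True False by linarith
   then have "real (x + y + w) >= real m + 1" by linarith
   then have q: "q m > 2" using assms by (auto simp: q_def)
   have bm: "b + m > 0" using assms by auto
   have V: "V (Suc m) = t m * ((real x-m)*(real y-m)*(real w-m)*h (real m+1) / ((b+m)*(q m-1)*(q m-2)))"
   proof -
    have "t (Suc m) * ((b + m) * (m+1) * (q m - 1)) = t m * ((real x-m)*(real y-m)*(real w-m))"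
     using tau_Suc_m[OF assms(1), of m x y w] by (simp add: t_def q_def)
    moreover have "q (Suc m) - 1 = q m - 2" by (simp add: q_def)
    moreover have "(b+m)*(q m-1) ~= 0" using q bm by simp
    ultimately have "t (Suc m) * (real m+1) = t m * ((real x-m)*(real y-m)*(real w-m)) / ((b+m)*(q m-1))"
     by (subst nonzero_eq_divide_eq) (simp_all add: mult_ac add_ac)
    then show ?thesis unfolding V_def using \<open>q (Suc m) - 1 = q m - 2\<close> by (simp add: mult_ac add_ac)
   qed
   have "U m = (real x-m)*(real y-m)*(real w-m)*h (real m+1) / ((b+m)*(q m-1)*(q m-2)) - m * h m / (q m - 1)"
    unfolding U_def h_def
    using certificate_identity[of "q m" b "real x" "real y" "real w" "real m"] q bm
    by (simp add: q_def)
   then show ?thesis unfolding V by (simp add: V_def right_diff_distrib mult.assoc)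
  next
   case False
   then have "t m = 0" "t (Suc m) = 0" by (auto simp: t_def tau_eq_0)
   then show ?thesis by (simp add: V_def)
  qed
 qed
 also have "\<dots> = V (Suc M) - V 0"
  unfolding lessThan_Suc_atMost[symmetric] by (rule sum_lessThan_telescope)
 also have "\<dots> = 0" by (simp add: V_def t_def tau_eq_0 M_def)
 finally show ?thesis .
qed

section \<open>Transform of the sums and explicit coefficients A, B\<close>

text \<open>The coefficient of \<rho>^N in \<rho>^n (1-\<rho>)^(-2b-n)
  (\<open>Tker_has_sum\<close>). Hence \<open>Tr\<close> is the effect on coefficients of
  substituting \<rho>/(1-\<rho>) and multiplying by (1-\<rho>)^(-2b).\<close>

definition Tker :: "real => nat => nat => real" where
 "Tker b N n = pochhammer (2*b+n) (N-n) * rfact N n"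

lemma Tker_eq_0: "N < n ==> Tker b N n = 0"
 by (simp add: Tker_def rfact_eq_0)

lemma Tker_Suc_right: "Tker b N n * (real N - n) = Tker b N (Suc n) * (2*b+n)"
proof (cases "n < N")
 case True
 then obtain k where N: "N = Suc n + k" by (metis less_eq_Suc_le le_Suc_ex)
 have p: "pochhammer (2*b+n) (Suc k) = (2*b+n) * pochhammer (2*b+Suc n) k"
  by (simp add: pochhammer_rec add_ac)
 have d: "N - n = Suc k" "N - Suc n = k" using N by auto
 show ?thesis unfolding Tker_def d p rfact_Suc_right by (simp only: mult_ac)
qed (auto simp: Tker_eq_0 not_less le_less)

lemma Tker_Suc_Suc: "Tker b (Suc N) (Suc n) * (2*b+n) = Tker b N n * (2*b+N)"
proof (cases "n <= N")
 case True
 then obtain k where N: "N = n + k" by (metis le_Suc_ex)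
 have "(2*b+n) * pochhammer (2*b+Suc n) k = pochhammer (2*b+n) k * (2*b+N)"
  using pochhammer_rec[of "2*b+n" k] pochhammer_Suc[of "2*b+n" k] by (simp add: N add_ac)
 then show ?thesis unfolding Tker_def rfact_Suc_Suc using N by (simp add: mult_ac)
qed (auto simp: Tker_eq_0)

definition Tr :: "real => (nat => real) => nat => real" where
 "Tr b f N = (\<Sum>n\<le>N. Tker b N n * f n)"

lemma Tr_eq: "N <= M ==> Tr b f N = (\<Sum>n\<le>M. Tker b N n * f n)"
 unfolding Tr_def by (rule sum.mono_neutral_left) (auto simp: Tker_eq_0)

lemma Tr_add: "Tr b (%n. f n + g n) N = Tr b f N + Tr b g N"
 and Tr_diff: "Tr b (%n. f n - g n) N = Tr b f N - Tr b g N"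
 and Tr_cmult: "Tr b (%n. c * f n) N = c * Tr b f N"
 by (simp_all add: Tr_def sum.distrib sum_subtractf sum_distrib_left algebra_simps)

text \<open>The transform commutes with the weighted lowering of the index. By
  \<open>Tker_Suc_Suc\<close>, lowering both indices of the kernel exchanges the weights 2b+n and
  2b+N.\<close>

lemma Tr_prev:
 assumes "b > 1/2"
 shows "(2*b+real N-1) * prev (Tr b f) N = Tr b (%n. (2*b+real n-1) * prev f n) N"
proof (cases N)
 case (Suc M)
 have "Tr b (%n. (2*b+real n-1) * prev f n) N = (\<Sum>n\<le>M. Tker b (Suc M) (Suc n) * (2*b+n) * f n)"
  unfolding Tr_def Suc by (subst sum.atMost_Suc_shift) (simp add: mult_ac)
 also have "\<dots> = (2*b+M) * Tr b f M"
  unfolding Tker_Suc_Suc Tr_def by (simp add: sum_distrib_left mult_ac)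
 finally show ?thesis by (simp add: Suc)
qed (simp add: Tr_def)

text \<open>In N = n + (N-n), the factor N-n moves the kernel from n to n+1 by
  \<open>Tker_Suc_right\<close>, so that part becomes the transform of the lowered sequence.\<close>

lemma Tr_index:
 fixes b :: real
 shows   "(b + real N) * Tr b f N = Tr b (%n. (real n+b) * f n) N + Tr b (%n. (2*b+real n-1) * prev f n) N"
proof -
 have "Tr b (%n. (2*b+real n-1) * prev f n) N = (\<Sum>n\<le>Suc N. Tker b N n * ((2*b+real n-1) * prev f n))"
  by (rule Tr_eq) simp
 also have "\<dots> = (\<Sum>n\<le>N. Tker b N (Suc n) * (2*b+n) * f n)"
  by (subst sum.atMost_Suc_shift) (simp add: mult_ac)
 also have "\<dots> = Tr b (%n. (real N - n) * f n) N"
  unfolding Tker_Suc_right[symmetric] Tr_def by (simp add: mult_ac)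
 finally have e: "Tr b (%n. (2*b+real n-1) * prev f n) N = Tr b (%n. (real N - n) * f n) N" .
 show ?thesis unfolding e unfolding Tr_def sum_distrib_left sum.distrib[symmetric] by (intro sum.cong) (auto simp: algebra_simps)
qed

lemma Tker_diff:
 assumes "b > 1/2"
 shows "Tker b (Suc N) (Suc n) - Tker b N n = Tker b N (Suc n)"
proof -
 have "(Tker b (Suc N) (Suc n) - Tker b N n) * (2*b+n) = Tker b N (Suc n) * (2*b+n)"
  unfolding left_diff_distrib Tker_Suc_Suc Tker_Suc_right[of b N n, symmetric] by (simp add: algebra_simps)
 moreover have "2*b + n > 0" using assms by auto
 ultimately show ?thesis by auto
qed

text \<open>Split N+1 = n + (N+1-n). The second part reduces the kernel from N+1 to N; on the first,
  the Pascal rule \<open>Tker_diff\<close> does so.\<close>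

lemma Tr_Suc:
 fixes b :: real
 assumes "b > 1/2"
 shows "(real N+1) * Tr b f (Suc N) - (real N+1-b) * Tr b f N = Tr b (%n. (real n+1) * f (Suc n) + (real n+3*b-1) * f n) N"
proof -
 have t: "(real N+1) * Tker b (Suc N) n = n * Tker b (Suc N) n + (2*b+N) * Tker b N n" for n
 proof -
  have "Tker b (Suc N) n * (real (Suc N) - n) = Tker b N n * (2*b+N)"
   using Tker_Suc_Suc[of b N n] Tker_Suc_right[of b "Suc N" n] by simp
  then show ?thesis by (simp add: algebra_simps)
 qed
 have n: "real (Suc n) * Tker b (Suc N) (Suc n) = real (Suc n) * Tker b N n + real (Suc n) * Tker b N (Suc n)" for n
  using Tker_diff[OF assms, of N n] by (simp add: algebra_simps)
 have "(\<Sum>n\<le>Suc N. n * Tker b (Suc N) n * f n) = (\<Sum>n\<le>N. real (Suc n) * Tker b (Suc N) (Suc n) * f (Suc n))"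
  by (subst sum.atMost_Suc_shift) simp
 also have "\<dots> = (\<Sum>n\<le>N. real (Suc n) * Tker b N n * f (Suc n)) + (\<Sum>n\<le>N. real (Suc n) * Tker b N (Suc n) * f (Suc n))"
  unfolding n by (simp add: sum.distrib distrib_right)
 also have "(\<Sum>n\<le>N. real (Suc n) * Tker b N (Suc n) * f (Suc n)) = (\<Sum>n\<le>Suc N. n * Tker b N n * f n)"
  by (subst sum.atMost_Suc_shift) simp
 also have "\<dots> = (\<Sum>n\<le>N. n * Tker b N n * f n)" by (simp add: Tker_eq_0)
 finally have s: "(\<Sum>n\<le>Suc N. n * Tker b (Suc N) n * f n) =
  (\<Sum>n\<le>N. real (Suc n) * Tker b N n * f (Suc n)) + (\<Sum>n\<le>N. n * Tker b N n * f n)" .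
 have "(real N+1) * Tr b f (Suc N) = (\<Sum>n\<le>Suc N. (real N+1) * Tker b (Suc N) n * f n)"
  by (simp only: Tr_def sum_distrib_left mult_ac)
 also have "\<dots> = (\<Sum>n\<le>Suc N. n * Tker b (Suc N) n * f n) + (\<Sum>n\<le>Suc N. (2*b+N) * Tker b N n * f n)"
  unfolding sum.distrib[symmetric] by (intro sum.cong refl, subst t, rule distrib_right)
 also have "(\<Sum>n\<le>Suc N. (2*b+N) * Tker b N n * f n) = (2*b+N) * Tr b f N"
  by (simp add: Tr_def Tker_eq_0 sum_distrib_left mult_ac)
 finally have f: "(real N+1) * Tr b f (Suc N) = (\<Sum>n\<le>N. real (Suc n) * Tker b N n * f (Suc n)) + (\<Sum>n\<le>N. n * Tker b N n * f n) + (2*b+N) * Tr b f N"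
  unfolding s .
 have "(2*b+N) * Tr b f N - (real N+1-b) * Tr b f N = (3*b-1) * Tr b f N" by (simp add: algebra_simps)
 with f have "(real N+1) * Tr b f (Suc N) - (real N+1-b) * Tr b f N =
   (\<Sum>n\<le>N. real (Suc n) * Tker b N n * f (Suc n)) + (\<Sum>n\<le>N. n * Tker b N n * f n) + (3*b-1) * Tr b f N"
  by linarith
 also have "\<dots> = Tr b (%n. (real n+1) * f (Suc n) + (real n+3*b-1) * f n) N"
  unfolding Tr_def sum_distrib_left sum.distrib[symmetric] by (intro sum.cong) (auto simp: algebra_simps)
 finally show ?thesis .
qed

text \<open>The n-th moment of the Beta(b,b) distribution; here the variables t_i of the integral
  \<open>Fint\<close> originate.\<close>

definition mu :: "real => nat => real" where
 "mu b n = pochhammer b n / pochhammer (2*b) n"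

lemma mu_Suc: "b > 1/2 ==> mu b (Suc n) * (2*b+n) = mu b n * (b+n)"
proof -
 assume "b > 1/2"
 then have "2*b + n > 0" by auto
 then show ?thesis by (simp add: mu_def pochhammer_Suc)
qed

lemma prev_mu:
 assumes "b > 1/2"
 shows "prev (%w. (b + real w) * mu b w * g w) w = mu b w * ((2*b+real w-1) * prev g w)"
proof (cases w)
 case (Suc k)
 have "(b + k) * mu b k * g k = (mu b (Suc k) * (2*b+k)) * g k"
  unfolding mu_Suc[OF assms] by (simp only: mult_ac)
 then show ?thesis by (simp add: Suc mult_ac)
qed simp

abbreviation Tr3 :: "real => (nat => nat => nat => real) => nat => nat => nat => real" where
 "Tr3 b f x y w \<equiv> Tr b (%i. Tr b (%j. Tr b (%k. f i j k) w) y) x"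

text \<open>The signs come from substituting -\<rho>/(1-\<rho>) instead of \<rho>/(1-\<rho>). The
  additional minus in \<open>sgZ\<close> is dictated by the first recurrence.\<close>

definition sgK :: "real => nat => nat => nat => real" where
 "sgK b i j k = (-1)^(i+j+k) * K_cf b i j k"

definition sgZ :: "real => nat => nat => nat => real" where
 "sgZ b i j k = - ((-1)^(i+j+k) * Z_cf b i j k)"

definition P3 :: "real => (nat => nat => nat => real) => nat => nat => nat => real" where
 "P3 b f x y w = mu b x * mu b y * mu b w * Tr3 b f x y w"

definition A_cf :: "real => nat => nat => nat => real" where
 "A_cf b x y w = P3 b (sgK b) x y w"

text \<open>With these three prefactors every difference B(n) - B(n-e_j) becomes \<open>P3\<close>
  of a sequence multiplied by its own index plus b: subtract \<open>P3_cx\<close> from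
  \<open>P3_dx\<close>.\<close>

definition B_cf :: "real => nat => nat => nat => real" where
 "B_cf b x y w = (b + real x) * ((b + real y) * ((b + real w) * P3 b (sgZ b) x y w))"

text \<open>The two kinds of operators, c (weighted lowering) and d (multiplication by index plus
  b), suffice for both recurrences. Multiplying a transform by b+x applies d + c to the sequence; a
  backward shift afterwards leaves c.\<close>

definition cx :: "real => (nat => nat => nat => real) => nat => nat => nat => real" where
 "cx b f i j k = (2*b+real i-1) * prev (%i. f i j k) i"
definition cy :: "real => (nat => nat => nat => real) => nat => nat => nat => real" where
 "cy b f i j k = (2*b+real j-1) * prev (%j. f i j k) j"
definition cw :: "real => (nat => nat => nat => real) => nat => nat => nat => real" where
 "cw b f i j k = (2*b+real k-1) * prev (%k. f i j k) k"
definition dx :: "real => (nat => nat => nat => real) => nat => nat => nat => real" where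
 "dx b f i j k = (real i + b) * f i j k"
definition dy :: "real => (nat => nat => nat => real) => nat => nat => nat => real" where
 "dy b f i j k = (real j + b) * f i j k"
definition dw :: "real => (nat => nat => nat => real) => nat => nat => nat => real" where
 "dw b f i j k = (real k + b) * f i j k"

lemma prev_Tr: "prev (%k. Tr b (%i. f i k) x) w = Tr b (%i. prev (%k. f i k) w) x"
 by (cases w) (simp_all add: Tr_def)

lemma Tr3_cx: assumes "b > 1/2"
 shows "(2*b+real x-1) * prev (%x. Tr3 b f x y w) x = Tr3 b (cx b f) x y w"
 using Tr_prev[OF assms, of x "%i. Tr b (%j. Tr b (%k. f i j k) w) y"]
 by (simp add: cx_def Tr_cmult prev_Tr)

lemma Tr3_cy: assumes "b > 1/2"
 shows "(2*b+real y-1) * prev (%y. Tr3 b f x y w) y = Tr3 b (cy b f) x y w"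
 unfolding prev_Tr Tr_cmult[symmetric] using Tr_prev[OF assms]
 by (simp add: cy_def Tr_cmult prev_Tr)

lemma Tr3_cw: assumes "b > 1/2"
 shows "(2*b+real w-1) * prev (%w. Tr3 b f x y w) w = Tr3 b (cw b f) x y w"
 unfolding prev_Tr Tr_cmult[symmetric] using Tr_prev[OF assms]
 by (simp add: cw_def Tr_cmult prev_Tr)

lemma Tr3_dx: "(b + real x) * Tr3 b f x y w = Tr3 b (dx b f) x y w + Tr3 b (cx b f) x y w"
 unfolding Tr_index[of b x] by (simp add: dx_def cx_def Tr_cmult prev_Tr)

lemma Tr3_dy: "(b + real y) * Tr3 b f x y w = Tr3 b (dy b f) x y w + Tr3 b (cy b f) x y w"
proof -
 have "(b + real y) * Tr3 b f x y w = Tr b (%i. (b + real y) * Tr b (%j. Tr b (%k. f i j k) w) y) x"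
  by (simp only: Tr_cmult)
 also have "\<dots> = Tr3 b (dy b f) x y w + Tr3 b (cy b f) x y w"
  unfolding Tr_index[of b y] Tr_add by (simp add: dy_def cy_def Tr_cmult prev_Tr)
 finally show ?thesis .
qed

lemma Tr3_dw: "(b + real w) * Tr3 b f x y w = Tr3 b (dw b f) x y w + Tr3 b (cw b f) x y w"
proof -
 have "(b + real w) * Tr3 b f x y w = Tr b (%i. Tr b (%j. (b + real w) * Tr b (%k. f i j k) w) y) x"
  by (simp only: Tr_cmult)
 also have "\<dots> = Tr3 b (dw b f) x y w + Tr3 b (cw b f) x y w"
  unfolding Tr_index[of b w] Tr_add by (simp add: dw_def cw_def Tr_cmult prev_Tr)
 finally show ?thesis .
qed

lemma P3_dx: "(b + real x) * P3 b f x y w = P3 b (dx b f) x y w + P3 b (cx b f) x y w"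
 unfolding P3_def distrib_left[symmetric] Tr3_dx[symmetric] by (simp only: mult_ac)

lemma P3_dy: "(b + real y) * P3 b f x y w = P3 b (dy b f) x y w + P3 b (cy b f) x y w"
 unfolding P3_def distrib_left[symmetric] Tr3_dy[symmetric] by (simp only: mult_ac)

lemma P3_dw: "(b + real w) * P3 b f x y w = P3 b (dw b f) x y w + P3 b (cw b f) x y w"
 unfolding P3_def distrib_left[symmetric] Tr3_dw[symmetric] by (simp only: mult_ac)

lemma P3_cx:
 assumes "b > 1/2" shows "prev (%x. (b + real x) * P3 b f x y w) x = P3 b (cx b f) x y w"
proof -
 have "prev (%x. (b + real x) * P3 b f x y w) x = mu b y * mu b w * prev (%x. (b + real x) * mu b x * Tr3 b f x y w) x"
  unfolding P3_def prev_cmult[symmetric] by (intro prev_cong) (simp only: mult_ac)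
 then show ?thesis unfolding prev_mu[OF assms] Tr3_cx[OF assms] P3_def by (simp only: mult_ac)
qed

lemma P3_cy:
 assumes "b > 1/2" shows "prev (%y. (b + real y) * P3 b f x y w) y = P3 b (cy b f) x y w"
proof -
 have "prev (%y. (b + real y) * P3 b f x y w) y = mu b x * mu b w * prev (%y. (b + real y) * mu b y * Tr3 b f x y w) y"
  unfolding P3_def prev_cmult[symmetric] by (intro prev_cong) (simp only: mult_ac)
 then show ?thesis unfolding prev_mu[OF assms] Tr3_cy[OF assms] P3_def by (simp only: mult_ac)
qed

lemma P3_cw:
 assumes "b > 1/2" shows "prev (%w. (b + real w) * P3 b f x y w) w = P3 b (cw b f) x y w"
proof -
 have "prev (%w. (b + real w) * P3 b f x y w) w = mu b x * mu b y * prev (%w. (b + real w) * mu b w * Tr3 b f x y w) w"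
  unfolding P3_def prev_cmult[symmetric] by (intro prev_cong) (simp only: mult_ac)
 then show ?thesis unfolding prev_mu[OF assms] Tr3_cw[OF assms] P3_def by (simp only: mult_ac)
qed

lemma prev_B_cf:
 assumes b: "b > 1/2"
 shows "prev (%x. B_cf b x y w) x = (b + real y) * ((b + real w) * P3 b (cx b (sgZ b)) x y w)"
  and "prev (%y. B_cf b x y w) y = (b + real x) * ((b + real w) * P3 b (cy b (sgZ b)) x y w)"
  and "prev (%x. prev (%y. B_cf b x y w) y) x = (b + real w) * P3 b (cx b (cy b (sgZ b))) x y w"
  and "prev (%w. prev (%x. B_cf b x y w) x) w = (b + real y) * P3 b (cw b (cx b (sgZ b))) x y w"
  and "prev (%w. prev (%y. B_cf b x y w) y) w = (b + real x) * P3 b (cw b (cy b (sgZ b))) x y w"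
proof -
 show 1: "prev (%x. B_cf b x y w) x = (b + real y) * ((b + real w) * P3 b (cx b (sgZ b)) x y w)" for w
  unfolding P3_cx[OF b, symmetric] prev_cmult[symmetric] by (intro prev_cong) (simp only: B_cf_def mult_ac)
 show 2: "prev (%y. B_cf b x y w) y = (b + real x) * ((b + real w) * P3 b (cy b (sgZ b)) x y w)" for x w
  unfolding P3_cy[OF b, symmetric] prev_cmult[symmetric] by (intro prev_cong) (simp only: B_cf_def mult_ac)
 show "prev (%x. prev (%y. B_cf b x y w) y) x = (b + real w) * P3 b (cx b (cy b (sgZ b))) x y w"
  unfolding 2 P3_cx[OF b, symmetric] prev_cmult[symmetric] by (intro prev_cong) (simp only: mult_ac)
 show "prev (%w. prev (%x. B_cf b x y w) x) w = (b + real y) * P3 b (cw b (cx b (sgZ b))) x y w"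
  unfolding 1 P3_cw[OF b, symmetric] prev_cmult[symmetric] by (intro prev_cong) (simp only: mult_ac)
 show "prev (%w. prev (%y. B_cf b x y w) y) w = (b + real x) * P3 b (cw b (cy b (sgZ b))) x y w"
  unfolding 2 P3_cw[OF b, symmetric] prev_cmult[symmetric] by (intro prev_cong) (simp only: mult_ac)
qed

text \<open>Both sides are (b+w) times \<open>P3\<close> of one and the same sequence: on the left
  by \<open>Tr_Suc\<close> and \<open>K_cf_rec1\<close>, on the right because two differences in x
  and y leave only the d operators.\<close>

lemma A_cf_rec1:
 assumes b: "b > 1/2"
 shows "(real w+1)*(real w+2*b)*A_cf b x y (Suc w) - (real w+b)*(real w+1-b) * A_cf b x y w =
  B_cf b x y w - prev (%x. B_cf b x y w) x - prev (%y. B_cf b x y w) y + prev (%x. prev (%y. B_cf b x y w) y) x"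
proof -
 define M where "M = mu b x * mu b y * mu b w"
 have L1: "(real w+1)*(real w+2*b)*A_cf b x y (Suc w) = M * (b + w) * ((real w+1) * Tr3 b (sgK b) x y (Suc w))"
 proof -
  have "(real w+1)*(real w+2*b)*A_cf b x y (Suc w) = mu b x * mu b y * (mu b (Suc w) * (2*b+w)) * ((real w+1) * Tr3 b (sgK b) x y (Suc w))"
   unfolding A_cf_def P3_def by (simp only: mult_ac add_ac)
  then show ?thesis unfolding mu_Suc[OF b] M_def by (simp only: mult_ac)
 qed
 have L: "(real w+1)*(real w+2*b)*A_cf b x y (Suc w) - (real w+b)*(real w+1-b) * A_cf b x y w
  = (b + w) * (M * ((real w+1) * Tr3 b (sgK b) x y (Suc w) - (real w+1-b) * Tr3 b (sgK b) x y w))"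
  unfolding L1 unfolding A_cf_def P3_def M_def[symmetric] by (subst eq_iff_diff_eq_0) (simp add: algebra_simps)
 have "(real w+1) * Tr3 b (sgK b) x y (Suc w) - (real w+1-b) * Tr3 b (sgK b) x y w
  = Tr b (%i. Tr b (%j. (real w+1) * Tr b (%k. sgK b i j k) (Suc w) - (real w+1-b) * Tr b (%k. sgK b i j k) w) y) x"
  by (simp only: Tr_diff Tr_cmult)
 also have "\<dots> = Tr3 b (%i j k. (real k+1) * sgK b i j (Suc k) + (real k+3*b-1) * sgK b i j k) x y w"
  unfolding Tr_Suc[OF b] ..
 also have "(%i j k. (real k+1) * sgK b i j (Suc k) + (real k+3*b-1) * sgK b i j k) = dx b (dy b (sgZ b))"
 proof (intro ext)
  fix i j k
  show "(real k+1) * sgK b i j (Suc k) + (real k+3*b-1) * sgK b i j k = dx b (dy b (sgZ b)) i j k"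
   using arg_cong[OF K_cf_rec1[OF b, of k i j], of "%t. (-1)^(i+j+k) * t"]
   by (simp add: sgK_def sgZ_def dx_def dy_def algebra_simps)
 qed
 finally have K: "M * ((real w+1) * Tr3 b (sgK b) x y (Suc w) - (real w+1-b) * Tr3 b (sgK b) x y w) = P3 b (dx b (dy b (sgZ b))) x y w"
  by (simp add: P3_def M_def)
 have "B_cf b x y w = (b + real w) * ((b + real x) * ((b + real y) * P3 b (sgZ b) x y w))"
  by (simp only: B_cf_def mult_ac)
 also have "\<dots> = (b + real w) * (P3 b (dx b (dy b (sgZ b))) x y w + P3 b (cx b (dy b (sgZ b))) x y w + (b + real x) * P3 b (cy b (sgZ b)) x y w)"
  unfolding P3_dy distrib_left P3_dx by simp
 finally have B: "B_cf b x y w = \<dots>" .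
 have "cx b (dy b (sgZ b)) = dy b (cx b (sgZ b))"
  by (auto simp: fun_eq_iff cx_def dy_def prev_def)
 then have C: "P3 b (cx b (dy b (sgZ b))) x y w = (b + real y) * P3 b (cx b (sgZ b)) x y w - P3 b (cy b (cx b (sgZ b))) x y w"
  by (simp add: P3_dy)
 have D: "cy b (cx b (sgZ b)) = cx b (cy b (sgZ b))"
  by (auto simp: fun_eq_iff cx_def cy_def prev_def)
 show ?thesis unfolding L K prev_B_cf(3-5)[OF b] unfolding prev_B_cf(1,2)[OF b] unfolding B C D by (simp add: algebra_simps)
qed

lemma P3_add: "P3 b (%i j k. f i j k + g i j k) x y w = P3 b f x y w + P3 b g x y w"
 and P3_diff: "P3 b (%i j k. f i j k - g i j k) x y w = P3 b f x y w - P3 b g x y w"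
 and P3_cmult: "P3 b (%i j k. c * f i j k) x y w = c * P3 b f x y w"
 by (simp_all only: P3_def Tr_add Tr_diff Tr_cmult distrib_left right_diff_distrib mult_ac)

text \<open>The polynomial on the left is 2(b+x)(b+y) - b(b+x) - b(b+y) + b(b+w). Moving every
  factor under \<open>P3\<close> turns the claim into an equality of sequences, which is
  \<open>K_cf_rec2\<close> up to sign.\<close>

lemma A_cf_rec2:
 assumes b: "b > 1/2"
 shows "(2*real x*real y + b*real x + b*real y + b*real w + b^2) * A_cf b x y w =
  prev (%w. prev (%x. B_cf b x y w) x) w + prev (%w. prev (%y. B_cf b x y w) y) w
   - B_cf b x y w - prev (%x. prev (%y. B_cf b x y w) y) x"
proof -
 define p where "p f = P3 b f x y w" for f
 define k where "k = sgK b"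
 define z where "z = sgZ b"
 have l: "(2*real x*real y + b*real x + b*real y + b*real w + b^2) * A_cf b x y w =
   2 * ((b+real x) * ((b+real y) * p k)) - b * ((b+real x)*p k) - b * ((b+real y) * p k) + b * ((b+real w) * p k)"
  unfolding A_cf_def p_def k_def by (simp add: algebra_simps power2_eq_square)
 have dx: "(b+real x) * p f = p (dx b f) + p (cx b f)" for f unfolding p_def by (rule P3_dx)
 have dy: "(b+real y) * p f = p (dy b f) + p (cy b f)" for f unfolding p_def by (rule P3_dy)
 have dw: "(b+real w) * p f = p (dw b f) + p (cw b f)" for f unfolding p_def by (rule P3_dw)
 have B: "B_cf b x y w = (b+real x) * ((b + real y) * ((b + real w) * p z))"
  unfolding B_cf_def p_def z_def ..
 have pp: "p f + p g = p (%i j k. f i j k + g i j k)" "p f - p g = p (%i j k. f i j k - g i j k)"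
  "c * p f = p (%i j k. c * f i j k)" for f g c
  unfolding p_def by (simp_all only: P3_add P3_diff P3_cmult)
 show ?thesis
  unfolding l prev_B_cf(3-5)[OF b] unfolding B z_def[symmetric] p_def[symmetric]
  unfolding dx dy dw distrib_left unfolding pp
 proof (rule arg_cong[of _ _ p], intro ext, goal_cases)
  case (1 i j l)
  define e where "e = (-1::real)^(i+j+l)"
  have pointwise: "(dx b (dy b (k))) i j l = (real i+b) * (real j+b) * (e * (K_cf b i j l))"
   "(cx b (dy b (k))) i j l = (2*b+real i-1) * (real j+b) * (- e * (prev (%i. K_cf b i j l) i))"
   "(dx b (cy b (k))) i j l = (real i+b) * (2*b+real j-1) * (- e * (prev (%j. K_cf b i j l) j))"
   "(cx b (cy b (k))) i j l = (2*b+real i-1) * (2*b+real j-1) * (e * (prev (%i. prev (%j. K_cf b i j l) j) i))"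
   "(dx b (k)) i j l = (real i+b) * (e * (K_cf b i j l))"
   "(cx b (k)) i j l = (2*b+real i-1) * (- e * (prev (%i. K_cf b i j l) i))"
   "(dy b (k)) i j l = (real j+b) * (e * (K_cf b i j l))"
   "(cy b (k)) i j l = (2*b+real j-1) * (- e * (prev (%j. K_cf b i j l) j))"
   "(dw b (k)) i j l = (real l+b) * (e * (K_cf b i j l))"
   "(cw b (k)) i j l = (2*b+real l-1) * (- e * (prev (%l. K_cf b i j l) l))"
   "(dy b (cw b (cx b (z)))) i j l = (real j+b) * (2*b+real l-1) * (2*b+real i-1) * (- e * (prev (%i. prev (%l. Z_cf b i j l) l) i))"
   "(cy b (cw b (cx b (z)))) i j l = (2*b+real j-1) * (2*b+real l-1) * (2*b+real i-1) * (e * (prev (%i. prev (%j. prev (%l. Z_cf b i j l) l) j) i))"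
   "(dx b (cw b (cy b (z)))) i j l = (real i+b) * (2*b+real l-1) * (2*b+real j-1) * (- e * (prev (%j. prev (%l. Z_cf b i j l) l) j))"
   "(cx b (cw b (cy b (z)))) i j l = (2*b+real i-1) * (2*b+real l-1) * (2*b+real j-1) * (e * (prev (%i. prev (%j. prev (%l. Z_cf b i j l) l) j) i))"
   "(dw b (cx b (cy b (z)))) i j l = (real l+b) * (2*b+real i-1) * (2*b+real j-1) * (- e * (prev (%i. prev (%j. Z_cf b i j l) j) i))"
   "(cw b (cx b (cy b (z)))) i j l = (2*b+real l-1) * (2*b+real i-1) * (2*b+real j-1) * (e * (prev (%i. prev (%j. prev (%l. Z_cf b i j l) l) j) i))"
   "(dx b (dy b (dw b (z)))) i j l = (real i+b) * (real j+b) * (real l+b) * (- e * (Z_cf b i j l))"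
   "(dx b (dy b (cw b (z)))) i j l = (real i+b) * (real j+b) * (2*b+real l-1) * (e * (prev (%l. Z_cf b i j l) l))"
   "(dx b (cy b (dw b (z)))) i j l = (real i+b) * (2*b+real j-1) * (real l+b) * (e * (prev (%j. Z_cf b i j l) j))"
   "(dx b (cy b (cw b (z)))) i j l = (real i+b) * (2*b+real j-1) * (2*b+real l-1) * (- e * (prev (%j. prev (%l. Z_cf b i j l) l) j))"
   "(cx b (dy b (dw b (z)))) i j l = (2*b+real i-1) * (real j+b) * (real l+b) * (e * (prev (%i. Z_cf b i j l) i))"
   "(cx b (dy b (cw b (z)))) i j l = (2*b+real i-1) * (real j+b) * (2*b+real l-1) * (- e * (prev (%i. prev (%l. Z_cf b i j l) l) i))"
   "(cx b (cy b (dw b (z)))) i j l = (2*b+real i-1) * (2*b+real j-1) * (real l+b) * (- e * (prev (%i. prev (%j. Z_cf b i j l) j) i))"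
   "(cx b (cy b (cw b (z)))) i j l = (2*b+real i-1) * (2*b+real j-1) * (2*b+real l-1) * (e * (prev (%i. prev (%j. prev (%l. Z_cf b i j l) l) j) i))"
   unfolding e_def k_def z_def cx_def cy_def cw_def dx_def dy_def dw_def
   by (cases i; cases j; cases l; simp add: sgK_def sgZ_def)+
  define zijla where "zijla = prev (%i. prev (%j. prev (%l. Z_cf b i j l) l) j) i"
  define zjla where "zjla = prev (%j. prev (%l. Z_cf b i j l) l) j"
  define zila where "zila = prev (%i. prev (%l. Z_cf b i j l) l) i"
  define zija where "zija = prev (%i. prev (%j. Z_cf b i j l) j) i"
  define zla where "zla = prev (%l. Z_cf b i j l) l"
  define zja where "zja = prev (%j. Z_cf b i j l) j"
  define zia where "zia = prev (%i. Z_cf b i j l) i"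
  define z0a where "z0a = Z_cf b i j l"
  define kija where "kija = prev (%i. prev (%j. K_cf b i j l) j) i"
  define kla where "kla = prev (%l. K_cf b i j l) l"
  define kja where "kja = prev (%j. K_cf b i j l) j"
  define kia where "kia = prev (%i. K_cf b i j l) i"
  define k0a where "k0a = K_cf b i j l"
  define p1 p2 p3 q1 q2 q3 where "p1 = real i + b" "p2 = real j + b" "p3 = real l + b"
   "q1 = 2*b+real i-1" "q2 = 2*b+real j-1" "q3 = 2*b+real l-1"
  note pq = this[symmetric]
  have rec: "e * ((2*b+real i-1)*(real j+b)*(real l+b) * zia + (2*b+real j-1)*(real i+b)*(real l+b)* zja
   + (2*b+real l-1)*(real i+b)*(real j+b)* zla
   - (real i+b)*(real j+b)*(real l+b) * z0a - 2*(2*b+real i-1)*(2*b+real j-1)*(real l+b)* zija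
  + 2*(2*b+real i-1)*(2*b+real j-1) * kija
  - 2*(2*b+real i-1)*(real j+b)*kia
  - 2*(2*b+real j-1)*(real i+b)*kja + 2*(real i+b)*(real j+b)*k0a
  + b*(2*b+real i-1)*kia - b*(real i+b)*k0a + b*(2*b+real j-1)*kja - b*(real j+b)*k0a
  - b*(2*b+real l-1)*kla + b*(real l+b)*k0a) = 0"
   using K_cf_rec2[OF b, of i j l] unfolding zijla_def zjla_def zila_def zija_def zla_def zja_def zia_def z0a_def kija_def kla_def kja_def kia_def k0a_def by simp
  show ?case unfolding pointwise zijla_def[symmetric] zjla_def[symmetric] zila_def[symmetric] zija_def[symmetric] zla_def[symmetric] zja_def[symmetric] zia_def[symmetric] z0a_def[symmetric] kija_def[symmetric] kla_def[symmetric] kja_def[symmetric] kia_def[symmetric] k0a_def[symmetric]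
    pq
   by (subst eq_iff_diff_eq_0, rule trans[OF _ rec[unfolded pq]]) (simp add: algebra_simps)
 qed
qed

section \<open>Symmetry and uniqueness of the coefficients\<close>

lemma Tr_swap: "Tr b (%i. Tr b (%j. f i j) y) x = Tr b (%j. Tr b (%i. f i j) x) y"
 unfolding Tr_def sum_distrib_left by (subst sum.swap) (simp only: mult_ac)

lemma P3_swap:
 shows "P3 b f x y w = P3 b (%i j k. f j i k) y x w"
  and "P3 b f x y w = P3 b (%i j k. f i k j) x w y"
proof -
 have "Tr3 b f x y w = Tr3 b (%i j k. f j i k) y x w" by (rule Tr_swap)
 then show "P3 b f x y w = P3 b (%i j k. f j i k) y x w" unfolding P3_def by (simp only: mult_ac)
 have "(%i. Tr b (%j. Tr b (%k. f i j k) w) y) = (%i. Tr b (%k. Tr b (%j. f i j k) y) w)"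
  by (intro ext Tr_swap)
 then have "Tr3 b f x y w = Tr3 b (%i j k. f i k j) x w y" by (rule arg_cong)
 then show "P3 b f x y w = P3 b (%i j k. f i k j) x w y" unfolding P3_def by (simp only: mult_ac)
qed

lemma A_cf_swap: "A_cf b x y w = A_cf b y x w" "A_cf b x y w = A_cf b x w y"
proof -
 have s: "(%i j k. sgK b j i k) = sgK b" "(%i j k. sgK b i k j) = sgK b"
 proof -
  have "sgK b j i k = sgK b i j k" "sgK b i k j = sgK b i j k" for i j k
   unfolding sgK_def K_cf_perm(1)[of b j i k] K_cf_perm(2)[of b i k j] by (simp_all add: add_ac)
  then show "(%i j k. sgK b j i k) = sgK b" "(%i j k. sgK b i k j) = sgK b"
   by (intro ext, assumption?, blast)+
 qed
 show "A_cf b x y w = A_cf b y x w"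
  unfolding A_cf_def using P3_swap(1)[of b "sgK b" x y w] arg_cong[OF s(1), of "%f. P3 b f y x w"] by (rule trans)
 show "A_cf b x y w = A_cf b x w y"
  unfolding A_cf_def using P3_swap(2)[of b "sgK b" x y w] arg_cong[OF s(2), of "%f. P3 b f x w y"] by (rule trans)
qed

lemma B_cf_swap: "B_cf b x y w = B_cf b y x w" "B_cf b x y w = B_cf b x w y"
proof -
 have s: "(%i j k. sgZ b j i k) = sgZ b" "(%i j k. sgZ b i k j) = sgZ b"
 proof -
  have "sgZ b j i k = sgZ b i j k" "sgZ b i k j = sgZ b i j k" for i j k
   unfolding sgZ_def Z_cf_perm(1)[of b j i k] Z_cf_perm(2)[of b i k j] by (simp_all add: add_ac)
  then show "(%i j k. sgZ b j i k) = sgZ b" "(%i j k. sgZ b i k j) = sgZ b"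
   by (intro ext, assumption?, blast)+
 qed
 have "P3 b (sgZ b) x y w = P3 b (sgZ b) y x w" using P3_swap(1)[of b "sgZ b" x y w] arg_cong[OF s(1), of "%f. P3 b f y x w"] by (rule trans)
 then show "B_cf b x y w = B_cf b y x w"
  unfolding B_cf_def by (simp only: mult_ac)
 have "P3 b (sgZ b) x y w = P3 b (sgZ b) x w y" using P3_swap(2)[of b "sgZ b" x y w] arg_cong[OF s(2), of "%f. P3 b f x w y"] by (rule trans)
 then show "B_cf b x y w = B_cf b x w y"
  unfolding B_cf_def by (simp only: mult_ac)
qed

lemma zero_extend_vector:
 "zero_extend A (vector [i,j,k]) = (if 0 <= i & 0 <= j & 0 <= k then A (vector [nat i, nat j, nat k]) else 0)"
proof -
 have "(\<chi> l. nat ((vector [i,j,k] :: int^3) $ l)) = vector [nat i, nat j, nat k]"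
  by (simp add: vec_eq_iff forall_3)
 then show ?thesis by (simp add: zero_extend_def forall_3)
qed

lemma vector_plus_axis:
 fixes i j k :: int
 shows "vector [i,j,k] + axis (1::3) 1 = (vector [i+1,j,k] :: int^3)"
  "vector [i,j,k] + axis (2::3) 1 = (vector [i,j+1,k] :: int^3)"
  "vector [i,j,k] + axis (3::3) 1 = (vector [i,j,k+1] :: int^3)"
  "vector [i,j,k] - axis (1::3) 1 = (vector [i-1,j,k] :: int^3)"
  "vector [i,j,k] - axis (2::3) 1 = (vector [i,j-1,k] :: int^3)"
  "vector [i,j,k] - axis (3::3) 1 = (vector [i,j,k-1] :: int^3)"
 by (simp_all add: vec_eq_iff forall_3 axis_def)

lemma zero_extend_prev:
 "zero_extend B (vector [int x - 1, int y, int w]) = prev (%x. B (vector [x,y,w])) x"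
 "zero_extend B (vector [int x, int y - 1, int w]) = prev (%y. B (vector [x,y,w])) y"
 "zero_extend B (vector [int x, int y, int w - 1]) = prev (%w. B (vector [x,y,w])) w"
 "zero_extend B (vector [int x - 1, int y - 1, int w]) = prev (%x. prev (%y. B (vector [x,y,w])) y) x"
 "zero_extend B (vector [int x - 1, int y, int w - 1]) = prev (%x. prev (%w. B (vector [x,y,w])) w) x"
 "zero_extend B (vector [int x, int y - 1, int w - 1]) = prev (%y. prev (%w. B (vector [x,y,w])) w) y"
proof -
 have n: "nat (int x - 1) = x - 1" "0 <= int x - 1 \<longleftrightarrow> x ~= 0" for x by auto
 show "zero_extend B (vector [int x - 1, int y, int w]) = prev (%x. B (vector [x,y,w])) x"
 "zero_extend B (vector [int x, int y - 1, int w]) = prev (%y. B (vector [x,y,w])) y"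
 "zero_extend B (vector [int x, int y, int w - 1]) = prev (%w. B (vector [x,y,w])) w"
 "zero_extend B (vector [int x - 1, int y - 1, int w]) = prev (%x. prev (%y. B (vector [x,y,w])) y) x"
 "zero_extend B (vector [int x - 1, int y, int w - 1]) = prev (%x. prev (%w. B (vector [x,y,w])) w) x"
 "zero_extend B (vector [int x, int y - 1, int w - 1]) = prev (%y. prev (%w. B (vector [x,y,w])) w) y"
  by (simp_all add: zero_extend_vector prev_def n)
qed

context
 fixes b :: real and A0 B0 :: "nat^3 => real"
 assumes b: "b > 1/2" and nc: "neighbor_coefficients b A0 B0"
begin

lemma nc_eqs:
 fixes x y w :: nat
 defines "a \<equiv> %x y w. A0 (vector [x,y,w])" and "c \<equiv> %x y w. B0 (vector [x,y,w])"
 shows "(real w+1)*(real w+2*b)*a x y (Suc w) - (real w+b)*(real w+1-b) * a x y w =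
   c x y w - prev (%x. c x y w) x - prev (%y. c x y w) y + prev (%x. prev (%y. c x y w) y) x"
  and "(real x+1)*(real x+2*b)*a (Suc x) y w - (real x+b)*(real x+1-b) * a x y w =
   c x y w - prev (%y. c x y w) y - prev (%w. c x y w) w + prev (%y. prev (%w. c x y w) w) y"
  and "(real y+1)*(real y+2*b)*a x (Suc y) w - (real y+b)*(real y+1-b) * a x y w =
   c x y w - prev (%x. c x y w) x - prev (%w. c x y w) w + prev (%x. prev (%w. c x y w) w) x"
  and "(2*real x*real y + b*real x + b*real y + b*real w + b^2) * a x y w =
  prev (%x. prev (%w. c x y w) w) x + prev (%y. prev (%w. c x y w) w) y
   - c x y w - prev (%x. prev (%y. c x y w) y) x"
proof -
 define n where "n = (vector [int x, int y, int w] :: int^3)"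
 have nn: "n $ 1 = int x" "n $ 2 = int y" "n $ 3 = int w" by (simp_all add: n_def)
 have n1: "nat (int x + 1) = Suc x" "0 <= int x + 1" for x by auto
 have z: "zero_extend A0 n = a x y w" "zero_extend B0 n = c x y w"
  "zero_extend A0 (n + axis 1 1) = a (Suc x) y w"
  "zero_extend A0 (n + axis 2 1) = a x (Suc y) w"
  "zero_extend A0 (n + axis 3 1) = a x y (Suc w)"
  unfolding n_def vector_plus_axis zero_extend_vector a_def c_def by (simp_all only: n1 nat_int of_nat_0_le_iff simp_thms if_True)
 have zp: "zero_extend B0 (n - axis 1 1) = prev (%x. c x y w) x"
  "zero_extend B0 (n - axis 2 1) = prev (%y. c x y w) y"
  "zero_extend B0 (n - axis 3 1) = prev (%w. c x y w) w"
  "zero_extend B0 (n - axis 1 1 - axis 2 1) = prev (%x. prev (%y. c x y w) y) x"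
  "zero_extend B0 (n - axis 1 1 - axis 3 1) = prev (%x. prev (%w. c x y w) w) x"
  "zero_extend B0 (n - axis 2 1 - axis 3 1) = prev (%y. prev (%w. c x y w) w) y"
  "zero_extend B0 (n - axis 3 1 - axis 1 1) = prev (%x. prev (%w. c x y w) w) x"
  "zero_extend B0 (n - axis 3 1 - axis 2 1) = prev (%y. prev (%w. c x y w) w) y"
  unfolding n_def vector_plus_axis c_def zero_extend_prev by (rule refl)+
 have main: "(real_of_int (n$l) + 1) * (real_of_int (n$l) + 2*b) * zero_extend A0 (n + axis l 1) - (real_of_int (n$l) + b) * (real_of_int (n$l) + 1 - b) * zero_extend A0 n
      = zero_extend B0 n - zero_extend B0 (n - axis j 1) - zero_extend B0 (n - axis k 1) + zero_extend B0 (n - axis j 1 - axis k 1) &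
     (2 * real_of_int (n$j) * real_of_int (n$k) + b * real_of_int (n$j) + b * real_of_int (n$k) + b * real_of_int (n$l) + b\<^sup>2) * zero_extend A0 n
      = zero_extend B0 (n - axis l 1 - axis j 1) + zero_extend B0 (n - axis l 1 - axis k 1) - zero_extend B0 n - zero_extend B0 (n - axis j 1 - axis k 1)"
  if "{j,k,l} = {1,2,3::3}" for j k l
  using nc that unfolding neighbor_coefficients_def Let_def by blast
 have s: "{1,2,3::3} = {1,2,3}" "{2,3,1::3} = {1,2,3}" "{1,3,2::3} = {1,2,3}" by auto
 show "(real w+1)*(real w+2*b)*a x y (Suc w) - (real w+b)*(real w+1-b) * a x y w =
   c x y w - prev (%x. c x y w) x - prev (%y. c x y w) y + prev (%x. prev (%y. c x y w) y) x"
  "(2*real x*real y + b*real x + b*real y + b*real w + b^2) * a x y w =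
  prev (%x. prev (%w. c x y w) w) x + prev (%y. prev (%w. c x y w) w) y
   - c x y w - prev (%x. prev (%y. c x y w) y) x"
  using main[OF s(1)] unfolding nn z zp of_int_of_nat_eq by blast+
 show "(real x+1)*(real x+2*b)*a (Suc x) y w - (real x+b)*(real x+1-b) * a x y w =
   c x y w - prev (%y. c x y w) y - prev (%w. c x y w) w + prev (%y. prev (%w. c x y w) w) y"
  using main[OF s(2)] unfolding nn z zp of_int_of_nat_eq by blast
 show "(real y+1)*(real y+2*b)*a x (Suc y) w - (real y+b)*(real y+1-b) * a x y w =
   c x y w - prev (%x. c x y w) x - prev (%w. c x y w) w + prev (%x. prev (%w. c x y w) w) x"
  using main[OF s(3)] unfolding nn z zp of_int_of_nat_eq by blast
qed

text \<open>Induction on the total degree. The first recurrence gives A in the next degree because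
  (w+1)(w+2b) is nonzero; the second then gives B of that degree from A and from B of lower
  degree.\<close>

lemma neighbor_coefficients_unique_aux:
 "x + y + w = n ==> A0 (vector [x,y,w]) = A_cf b x y w & B0 (vector [x,y,w]) = B_cf b x y w"
proof (induction n arbitrary: x y w rule: less_induct)
 case (less n)
 have IH: "A0 (vector [x',y',w']) = A_cf b x' y' w'" "B0 (vector [x',y',w']) = B_cf b x' y' w'"
  if "x'+y'+w' < x+y+w" for x' y' w'
  using less.IH[of "x'+y'+w'"] that less.prems by auto
 have pos: "(real w + 1) * (real w + 2*b) ~= 0" for w
  using b by (auto simp: add_eq_0_iff_both_eq_0)
 have A: "A0 (vector [x,y,w]) = A_cf b x y w"
 proof -
  consider "x = 0" "y = 0" "w = 0" | w' where "w = Suc w'" | x' where "x = Suc x'" | y' where "y = Suc y'"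
   by (metis not0_implies_Suc)
  then show ?thesis
  proof cases
   case 1
   have "(vector [0,0,0] :: nat^3) = (\<chi> i. 0)" by (simp add: vec_eq_iff forall_3)
   then have "A0 (vector [0,0,0]) = 1" using nc by (simp add: neighbor_coefficients_def)
   moreover have "A_cf b 0 0 0 = 1"
    by (simp add: A_cf_def P3_def Tr_def Tker_def sgK_def K_cf_def tau_def rfact_def mu_def)
   ultimately show ?thesis using 1 by simp
  next
   case 2
   have IH': "x'' <= x ==> y'' <= y ==> w'' <= w' ==> A0 (vector [x'',y'',w'']) = A_cf b x'' y'' w''"
    "x'' <= x ==> y'' <= y ==> w'' <= w' ==> B0 (vector [x'',y'',w'']) = B_cf b x'' y'' w''" for x'' y'' w''
    using IH[of x'' y'' w''] 2 by auto
   have pB: "prev (%x. B0 (vector [x,y,w'])) x = prev (%x. B_cf b x y w') x" "prev (%y. B0 (vector [x,y,w'])) y = prev (%y. B_cf b x y w') y" "prev (%x. prev (%y. B0 (vector [x,y,w'])) y) x = prev (%x. prev (%y. B_cf b x y w') y) x"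
    by (auto simp: prev_def intro!: IH')
   have pC: "A0 (vector [x,y,w']) = A_cf b x y w'" "B0 (vector [x,y,w']) = B_cf b x y w'" by (rule IH'; simp)+
   have "(real w'+1)*(real w'+2*b)*A0 (vector [x,y,Suc w']) = (real w'+1)*(real w'+2*b)*A_cf b x y (Suc w')"
    using nc_eqs(1)[of w' x y] A_cf_rec1[OF b, of w' x y]
    unfolding pB pC by linarith
   then show ?thesis using pos[of w'] 2 by simp
  next
   case 3
   have IH': "x'' <= x' ==> y'' <= y ==> w'' <= w ==> A0 (vector [x'',y'',w'']) = A_cf b x'' y'' w''"
    "x'' <= x' ==> y'' <= y ==> w'' <= w ==> B0 (vector [x'',y'',w'']) = B_cf b x'' y'' w''" for x'' y'' w''
    using IH[of x'' y'' w''] 3 by auto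
   \<comment> \<open>By symmetry of the explicit coefficients, the recurrence proved in the last
     index holds in the first one too.\<close>
   define gA gB where "gA = (%y w x. A_cf b x y w)" and "gB = (%y w x. B_cf b x y w)"
   have g: "A_cf b = gA" "B_cf b = gB" "!!y w x. gA y w x = A_cf b x y w" "!!y w x. gB y w x = B_cf b x y w"
    unfolding gA_def gB_def fun_eq_iff by (metis A_cf_swap) (metis B_cf_swap, rule refl, rule refl)
   have pB: "prev (%y. B0 (vector [x',y,w])) y = prev (%y. B_cf b x' y w) y" "prev (%w. B0 (vector [x',y,w])) w = prev (%w. B_cf b x' y w) w" "prev (%y. prev (%w. B0 (vector [x',y,w])) w) y = prev (%y. prev (%w. B_cf b x' y w) w) y"
    by (auto simp: prev_def intro!: IH')
   have pC: "A0 (vector [x',y,w]) = A_cf b x' y w" "B0 (vector [x',y,w]) = B_cf b x' y w" by (rule IH'; simp)+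
   have "(real x'+1)*(real x'+2*b)*A0 (vector [Suc x',y,w]) = (real x'+1)*(real x'+2*b)*A_cf b (Suc x') y w"
    using nc_eqs(2)[of x' y w] A_cf_rec1[OF b, of x' y w, unfolded g(1,2), unfolded g(3,4)]
    unfolding pB pC by linarith
   then show ?thesis using pos[of x'] 3 by simp
  next
   case 4
   have IH': "x'' <= x ==> y'' <= y' ==> w'' <= w ==> A0 (vector [x'',y'',w'']) = A_cf b x'' y'' w''"
    "x'' <= x ==> y'' <= y' ==> w'' <= w ==> B0 (vector [x'',y'',w'']) = B_cf b x'' y'' w''" for x'' y'' w''
    using IH[of x'' y'' w''] 4 by auto
   define gA gB where "gA = (%x w y. A_cf b x y w)" and "gB = (%x w y. B_cf b x y w)"
   have h: "A_cf b = gA" "B_cf b = gB" "!!x w y. gA x w y = A_cf b x y w" "!!x w y. gB x w y = B_cf b x y w"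
    unfolding gA_def gB_def fun_eq_iff by (metis A_cf_swap(2)) (metis B_cf_swap(2), rule refl, rule refl)
   have pB: "prev (%x. B0 (vector [x,y',w])) x = prev (%x. B_cf b x y' w) x" "prev (%w. B0 (vector [x,y',w])) w = prev (%w. B_cf b x y' w) w" "prev (%x. prev (%w. B0 (vector [x,y',w])) w) x = prev (%x. prev (%w. B_cf b x y' w) w) x"
    by (auto simp: prev_def intro!: IH')
   have pC: "A0 (vector [x,y',w]) = A_cf b x y' w" "B0 (vector [x,y',w]) = B_cf b x y' w" by (rule IH'; simp)+
   have "(real y'+1)*(real y'+2*b)*A0 (vector [x,Suc y',w]) = (real y'+1)*(real y'+2*b)*A_cf b x (Suc y') w"
    using nc_eqs(3)[of y' x w] A_cf_rec1[OF b, of y' x w, unfolded h(1,2), unfolded h(3,4)]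
    unfolding pB pC by linarith
   then show ?thesis using pos[of y'] 4 by simp
  qed
 qed
 moreover have "B0 (vector [x,y,w]) = B_cf b x y w"
 proof -
  have z: "prev (%w. prev (%x. B_cf b x y w) x) w = prev (%x. prev (%w. B_cf b x y w) w) x"
   "prev (%w. prev (%y. B_cf b x y w) y) w = prev (%y. prev (%w. B_cf b x y w) w) y"
   by (auto simp: prev_def)
  have "prev (%x. prev (%w. B0 (vector [x,y,w])) w) x = prev (%x. prev (%w. B_cf b x y w) w) x"
   "prev (%y. prev (%w. B0 (vector [x,y,w])) w) y = prev (%y. prev (%w. B_cf b x y w) w) y"
   "prev (%x. prev (%y. B0 (vector [x,y,w])) y) x = prev (%x. prev (%y. B_cf b x y w) y) x"
   by (auto simp: prev_def intro!: IH)
  then show ?thesis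
   using nc_eqs(4)[of x y w] A_cf_rec2[OF b, of x y w] unfolding A z by linarith
 qed
 ultimately show ?case by simp
qed

lemma neighbor_coefficients_unique:
 "A0 (vector [x,y,w]) = A_cf b x y w" "B0 (vector [x,y,w]) = B_cf b x y w"
 using neighbor_coefficients_unique_aux by blast+

end

section \<open>Power series in several complex variables\<close>

unbundle no Formal_Power_Series.fps_syntax

definition upd :: "'a^'n => 'n => 'a => 'a^'n" where
 "upd z i t = (\<chi> k. if k = i then t else z$k)"

lemma upd_nth [simp]: "upd z i t $ k = (if k = i then t else z$k)"
 by (simp add: upd_def)

lemma upd_same [simp]: "upd z i (z$i) = z"
 by (simp add: vec_eq_iff)

definition cpd :: "'n => (complex^'n => complex) => complex^'n => complex" where
 "cpd i f z = deriv (%t. f (upd z i t)) (z$i)"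

definition zmono :: "complex^'n => nat^'n => complex" where
 "zmono z n = (\<Prod>i\<in>UNIV. (z$i) ^ (n$i))"

lemma norm_zmono_le:
 assumes "!!i. norm (z$i) <= r i"
 shows "norm (zmono z n) <= (\<Prod>i\<in>UNIV. r i ^ (n$i))"
 unfolding zmono_def prod_norm[symmetric] norm_power
 by (intro prod_mono conjI power_mono assms) auto

definition pderiv_coeff :: "'n => (nat^'n => complex) => nat^'n => complex" where
 "pderiv_coeff i c n = of_nat (n$i + 1) * c (n + axis i 1)"

text \<open>In one variable, with the others fixed, the series converges uniformly on a closed disc
  of radius r: its terms are dominated by their values at the corner w + R, where the series
  converges absolutely. Locally uniform limits of holomorphic functions may be differentiated
  termwise.\<close>

lemma powser_cpd:
 fixes f :: "complex^'n => complex"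
 assumes sums: "!!z. (!!i. cmod (z$i - w$i) < \<rho>) ==> ((%n. c n * zmono (z - w) n) has_sum f z) UNIV"
  and z: "!!i. cmod (z$i - w$i) < \<rho>"
 shows "((%t. f (upd z i t)) has_field_derivative cpd i f z) (at (z$i))"
  and "((%n. pderiv_coeff i c n * zmono (z - w) n) has_sum cpd i f z) UNIV"
proof -
 define m where "m = Max (range (%k. cmod (z$k - w$k)))"
 have m: "cmod (z$k - w$k) <= m" for k unfolding m_def by (rule Max_ge) auto
 have "m \<in> range (%k. cmod (z$k - w$k))" unfolding m_def by (rule Max_in) auto
 then have m\<rho>: "m < \<rho>" using z by auto
 then obtain r where r: "m < r" "r < \<rho>" using dense by blast
 have rpos: "0 < r" using m[of i] r norm_ge_zero[of "z$i - w$i"] by linarith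
 define R where "R = ((\<chi> k. cor r) :: complex^'n)"
 define M where "M n = norm (c n * zmono R n)" for n
 have "((%n. c n * zmono ((w + R) - w) n) has_sum f (w + R)) UNIV"
  by (rule sums) (use r rpos in \<open>auto simp: R_def\<close>)
 then have Msum: "M summable_on UNIV"
  unfolding M_def by (auto simp: summable_on_iff_abs_summable_on_complex[symmetric] has_sum_imp_summable)
 define g where "g n t = c n * zmono (upd z i t - w) n" for n t
 define Q where "Q n = (\<Prod>k\<in>UNIV - {i}. (z$k - w$k) ^ (n$k))" for n :: "nat^'n"
 have zm: "zmono (upd z i t - w) n = (t - w$i) ^ (n$i) * Q n" for t n
  unfolding zmono_def Q_def
  by (subst prod.remove[of _ i]) (auto intro!: prod.cong)
 define g' where "g' n t = c n * (of_nat (n$i) * (t - w$i) ^ (n$i - 1) * Q n)" for n t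
 have gder: "(g n has_field_derivative g' n t) (at t)" for n t
  unfolding g_def g'_def zm by (auto intro!: derivative_eq_intros)
 have bound: "norm (g n t) <= M n" if "t \<in> cball (w$i) r" for n t
 proof -
  have "norm (zmono (upd z i t - w) n) <= (\<Prod>i\<in>UNIV. r ^ (n$i))"
   by (rule norm_zmono_le) (use that m r in \<open>auto simp: dist_norm norm_minus_commute intro: less_imp_le order_trans\<close>)
  also have "\<dots> = norm (zmono R n)"
   unfolding zmono_def prod_norm[symmetric] using rpos by (simp add: R_def norm_power)
  finally show ?thesis unfolding g_def M_def norm_mult by (intro mult_left_mono) auto
 qed
 have ul: "uniform_limit (cball (w$i) r) (%X t. \<Sum>n\<in>X. g n t) (%t. f (upd z i t)) (finite_subsets_at_top UNIV)"
 proof (rule Weierstrass_m_test_general'[OF bound _ Msum])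
  fix t assume "t \<in> cball (w$i) r"
  then show "((%n. g n t) has_sum f (upd z i t)) UNIV"
   unfolding g_def by (intro sums) (use z r in \<open>auto simp: dist_norm norm_minus_commute\<close>)
 qed
 have zi: "z$i \<in> ball (w$i) r" using m[of i] r by (simp add: dist_norm norm_minus_commute)
 obtain h where h: "!!t. t \<in> ball (w$i) r ==> ((%t. f (upd z i t)) has_field_derivative h t) (at t) &
   ((%X. \<Sum>n\<in>X. g' n t) \<longlongrightarrow> h t) (finite_subsets_at_top UNIV)"
 proof (rule has_complex_derivative_uniform_limit[OF _ ul _ rpos, of "%X t. \<Sum>n\<in>X. g' n t"])
  show "\<forall>\<^sub>F X in finite_subsets_at_top UNIV. continuous_on (cball (w$i) r) (%t. \<Sum>n\<in>X. g n t) &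
   (\<forall>t\<in>ball (w$i) r. ((%t. \<Sum>n\<in>X. g n t) has_field_derivative (\<Sum>n\<in>X. g' n t)) (at t))"
  proof (rule always_eventually, intro allI conjI ballI)
   fix X :: "(nat^'n) set"
   show "((%t. \<Sum>n\<in>X. g n t) has_field_derivative (\<Sum>n\<in>X. g' n t)) (at t)" for t
    by (rule DERIV_sum) (rule gder)
   then show "continuous_on (cball (w$i) r) (%t. \<Sum>n\<in>X. g n t)"
    by (meson DERIV_continuous continuous_at_imp_continuous_on)
  qed
 qed auto
 have hz: "cpd i f z = h (z$i)" unfolding cpd_def using h[OF zi] by (auto intro: DERIV_imp_deriv)
 then show "((%t. f (upd z i t)) has_field_derivative cpd i f z) (at (z$i))" using h[OF zi] by simp
 have "((%n. g' n (z$i)) has_sum cpd i f z) UNIV"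
  unfolding has_sum_def hz using h[OF zi] by blast
 \<comment> \<open>Terms free of the i-th variable have derivative 0; the others are indexed by n +
   e_i.\<close>
 then have *: "((%n. g' n (z$i)) has_sum cpd i f z) (range (%n. n + axis i 1))"
 proof (rule has_sum_cong_neutral[THEN iffD1, rotated -1])
  fix n :: "nat^'n" assume "n \<in> UNIV - range (%n. n + axis i 1)"
  then have "n$i = 0"
  proof (rule contrapos_pp)
   assume "n$i ~= 0"
   then have "n = (n - axis i 1) + axis i 1" by (auto simp: vec_eq_iff axis_def)
   then show "n \<notin> UNIV - range (%n. n + axis i 1)" by auto
  qed
  then show "g' n (z$i) = 0" by (simp add: g'_def)
 qed auto
 have inj: "inj (%n :: nat^'n. n + axis i 1)" by (auto simp: inj_def)
 have "((%n. g' (n + axis i 1) (z$i)) has_sum cpd i f z) UNIV"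
  using * has_sum_reindex[OF inj, of "%n. g' n (z$i)"] by (simp add: o_def)
 moreover have "g' (n + axis i 1) (z$i) = pderiv_coeff i c n * zmono (z - w) n" for n
 proof -
  have "Q (n + axis i 1) = Q n" unfolding Q_def by (intro prod.cong) (auto simp: axis_def)
  moreover have "zmono (z - w) n = (z$i - w$i) ^ (n$i) * Q n" using zm[of "z$i" n] by simp
  ultimately show ?thesis by (simp add: g'_def pderiv_coeff_def)
 qed
 ultimately show "((%n. pderiv_coeff i c n * zmono (z - w) n) has_sum cpd i f z) UNIV" by simp
qed

lemma multi_analytic_powser:
 assumes "multi_analytic_on f D" "w \<in> D"
 obtains \<rho> c where "\<rho> > 0" "!!z. (!!i. cmod (z$i - w$i) < \<rho>) ==> ((%n. c n * zmono (z - w) n) has_sum f z) UNIV"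
proof -
 obtain \<rho> c where "\<rho> > 0" "\<forall>z. (\<forall>i. cmod (z$i - w$i) < \<rho>) \<longrightarrow>
   ((%n. c n * (\<Prod>i\<in>UNIV. (z$i - w$i) ^ (n$i))) has_sum f z) UNIV"
  using assms unfolding multi_analytic_on_def by blast
 then show ?thesis by (intro that[of \<rho> c]) (auto simp: zmono_def)
qed

lemma multi_analytic_open: "multi_analytic_on f D ==> open D"
 by (simp add: multi_analytic_on_def)

lemma multi_analytic_cpd:
 assumes "multi_analytic_on f D"
 shows "multi_analytic_on (cpd i f) D"
 unfolding multi_analytic_on_def
proof (intro conjI ballI)
 show "open D" using assms by (rule multi_analytic_open)
 fix w assume "w \<in> D"
 obtain \<rho> c where \<rho>: "\<rho> > 0" and c: "!!z. (!!i. cmod (z$i - w$i) < \<rho>) ==> ((%n. c n * zmono (z - w) n) has_sum f z) UNIV"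
  using multi_analytic_powser[OF assms \<open>w \<in> D\<close>] by blast
 show "\<exists>\<rho>>0. \<exists>c. \<forall>z. (\<forall>i. cmod (z$i - w$i) < \<rho>) \<longrightarrow>
   ((%n. c n * (\<Prod>i\<in>UNIV. (z$i - w$i) ^ (n$i))) has_sum cpd i f z) UNIV"
  using powser_cpd(2)[OF c] \<rho> unfolding zmono_def vector_minus_component by blast
qed

lemma multi_analytic_slice:
 assumes "multi_analytic_on f D" "z \<in> D"
 shows "((%t. f (upd z i t)) has_field_derivative cpd i f z) (at (z$i))"
proof -
 obtain \<rho> c where "\<rho> > 0" and c: "!!z'. (!!i. cmod (z'$i - z$i) < \<rho>) ==> ((%n. c n * zmono (z' - z) n) has_sum f z') UNIV"
  using multi_analytic_powser[OF assms] by blast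
 show ?thesis by (rule powser_cpd(1)[OF c]) (use \<open>\<rho> > 0\<close> in auto)
qed

lemma zmono_0: "zmono 0 n = (if n = 0 then 1 else 0)"
 by (auto simp: zmono_def vec_eq_iff prod_zero_iff power_0_left)

lemma zmono_zero_exponent: "zmono z 0 = 1"
 by (simp add: zmono_def)

lemma zmono_axis: "zmono z (axis i 1) = z $ i"
 unfolding zmono_def by (subst prod.remove[of _ i]) (auto simp: axis_def intro!: prod.neutral)

text \<open>The constant and linear terms of the expansion at w are the value and the partial
  derivatives; the terms of degree at least two are O(|h|^2).\<close>

lemma multi_analytic_has_derivative:
 fixes f :: "complex^'n => complex"
 assumes "multi_analytic_on f D" "w \<in> D"
 shows "(f has_derivative (%h. \<Sum>i\<in>UNIV. cpd i f w * h$i)) (at w)"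
proof -
 obtain \<rho> c where \<rho>: "\<rho> > 0" and c: "!!z. (!!i. cmod (z$i - w$i) < \<rho>) ==> ((%n. c n * zmono (z - w) n) has_sum f z) UNIV"
  using multi_analytic_powser[OF assms] by blast
 have c0: "c 0 = f w"
 proof -
  have "((%n. c n * zmono (w - w) n) has_sum f w) UNIV" by (rule c) (use \<rho> in auto)
  moreover have "((%n. c n * zmono (w - w) n) has_sum (c 0)) UNIV"
   by (rule has_sum_finite_neutralI[of "{0}"]) (auto simp: zmono_0)
  ultimately show ?thesis by (rule has_sum_unique[symmetric])
 qed
 have c1: "c (axis i 1) = cpd i f w" for i
 proof -
  have "((%n. pderiv_coeff i c n * zmono (w - w) n) has_sum cpd i f w) UNIV" by (rule powser_cpd(2)[OF c]) (use \<rho> in auto)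
  moreover have "((%n. pderiv_coeff i c n * zmono (w - w) n) has_sum (c (axis i 1))) UNIV"
   by (rule has_sum_finite_neutralI[of "{0}"]) (auto simp: zmono_0 pderiv_coeff_def)
  ultimately show ?thesis by (rule has_sum_unique[symmetric])
 qed
 define r where "r = \<rho> / 2"
 have r: "0 < r" "r < \<rho>" using \<rho> by (auto simp: r_def)
 define R where "R = ((\<chi> k. cor r) :: complex^'n)"
 define M where "M n = norm (c n * zmono R n)" for n
 have "((%n. c n * zmono ((w + R) - w) n) has_sum f (w + R)) UNIV"
  by (rule c) (use r in \<open>auto simp: R_def\<close>)
 then have Msum: "M summable_on UNIV"
  unfolding M_def by (auto simp: summable_on_iff_abs_summable_on_complex[symmetric] has_sum_imp_summable)
 define S where "S = infsum M UNIV"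
 define T where "T = insert 0 (range (%i. axis i 1) :: (nat^'n) set)"
 have finT: "finite T" by (simp add: T_def)
 have Mpos: "M n >= 0" for n by (simp add: M_def)
 have deg: "2 <= sum (($) n) UNIV" if "n \<notin> T" for n :: "nat^'n"
 proof (rule ccontr)
  assume "\<not> ?thesis"
  then consider "sum (($) n) UNIV = 0" | "sum (($) n) UNIV = 1" by linarith
  then show False
  proof cases
   case 1
   then have "n = 0" by (simp add: vec_eq_iff)
   then show False using that by (simp add: T_def)
  next
   case 2
   then obtain i where i: "n$i = 1" "!!k. k ~= i ==> n$k = 0"
    by (subst (asm) sum_eq_1_iff) auto
   then have "n = axis i 1" by (auto simp: vec_eq_iff axis_def)
   then show False using that by (auto simp: T_def)
  qed
 qed
 have main: "norm (f (w+h) - f w - (\<Sum>i\<in>UNIV. cpd i f w * h$i)) <= (norm h / r)^2 * S" if h: "norm h < r" for h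
 proof -
  define \<delta> where "\<delta> = norm h"
  have hk: "norm (h$k) <= \<delta>" for k unfolding \<delta>_def by (rule Finite_Cartesian_Product.norm_nth_le)
  have "((%n. c n * zmono (w + h - w) n) has_sum f (w+h)) UNIV"
  proof (rule c)
   show "cmod ((w + h)$i - w$i) < \<rho>" for i using hk[of i] h r by (simp add: \<delta>_def)
  qed
  then have hs: "((%n. c n * zmono h n) has_sum f (w+h)) UNIV" by simp
  have "((%n. c n * zmono h n) has_sum (f (w+h) - (\<Sum>n\<in>T. c n * zmono h n))) (UNIV - T)"
   by (rule has_sum_Diff[OF hs]) (use finT in \<open>auto intro: has_sum_finite\<close>)
  moreover have "(\<Sum>n\<in>T. c n * zmono h n) = f w + (\<Sum>i\<in>UNIV. cpd i f w * h$i)"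
  proof -
   have "0 \<notin> range (%i::'n. axis i (1::nat))" by (auto simp: vec_eq_iff axis_def split: if_splits)
   moreover have "inj (%i::'n. axis i (1::nat))"
    by (auto simp: inj_def axis_eq_axis)
   ultimately show ?thesis unfolding T_def
    by (simp add: zmono_zero_exponent c0 sum.reindex zmono_axis[unfolded One_nat_def] c1[unfolded One_nat_def] o_def)
  qed
  ultimately have hs2: "((%n. c n * zmono h n) has_sum (f (w+h) - f w - (\<Sum>i\<in>UNIV. cpd i f w * h$i))) (UNIV - T)"
   by (simp add: algebra_simps)
  \<comment> \<open>In degree k \<ge> 2 the bound \<delta>^k \<le> (\<delta>/r)^2 r^k holds because
    \<delta> < r; the right-hand sides are summable by convergence at the corner.\<close>
  have bd: "norm (c n * zmono h n) <= (\<delta>/r)^2 * M n" if "n \<in> UNIV - T" for n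
  proof -
   have "norm (zmono h n) <= (\<Prod>i\<in>UNIV. \<delta> ^ (n$i))" by (rule norm_zmono_le[OF hk])
   also have "\<dots> = \<delta> ^ (sum (($) n) UNIV)" by (simp add: power_sum)
   also have "\<dots> = (\<delta>/r) ^ (sum (($) n) UNIV) * r ^ (sum (($) n) UNIV)"
    using r by (simp add: power_divide)
   also have "\<dots> <= (\<delta>/r)^2 * r ^ (sum (($) n) UNIV)"
    by (intro mult_right_mono power_decreasing deg) (use that h r in \<open>auto simp: \<delta>_def\<close>)
   also have "r ^ (sum (($) n) UNIV) = norm (zmono R n)"
    unfolding zmono_def prod_norm[symmetric] using r by (simp add: R_def norm_power power_sum)
   finally show ?thesis unfolding M_def norm_mult by (metis mult.left_commute mult_left_mono norm_ge_zero)
  qed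
  have MT: "(%n. (\<delta>/r)^2 * M n) summable_on (UNIV - T)"
   by (intro summable_on_cmult_right summable_on_subset_banach[OF Msum]) auto
  have "norm (f (w+h) - f w - (\<Sum>i\<in>UNIV. cpd i f w * h$i)) <= infsum (%n. (\<delta>/r)^2 * M n) (UNIV - T)"
   by (rule norm_infsum_le[OF hs2 has_sum_infsum[OF MT] bd])
  also have "\<dots> = (\<delta>/r)^2 * infsum M (UNIV - T)"
   by (rule infsum_cmult_right')
  also have "\<dots> <= (\<delta>/r)^2 * S"
   unfolding S_def by (intro mult_left_mono infsum_mono_neutral summable_on_subset_banach[OF Msum] Msum) (auto simp: Mpos)
  finally show ?thesis unfolding \<delta>_def .
 qed
 have bl: "bounded_linear (%h. \<Sum>i\<in>UNIV. cpd i f w * h$i)"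
  by (intro bounded_linear_sum bounded_linear_const_mult bounded_linear_vec_nth)
 have S0: "S >= 0" unfolding S_def by (rule infsum_nonneg) (rule Mpos)
 show ?thesis unfolding has_derivative_at
 proof (rule conjI, rule bl, rule tendsto_norm_zero_cancel)
  have lim: "((%h. norm h * (S / r^2)) \<longlongrightarrow> 0) (at (0::complex^'n))"
   using r by (auto intro!: tendsto_eq_intros)
  show "((%h. norm (norm (f (w + h) - f w - (\<Sum>i\<in>UNIV. cpd i f w * h$i)) / norm h)) \<longlongrightarrow> 0) (at 0)"
  proof (rule tendsto_sandwich[OF _ _ tendsto_const lim])
   show "\<forall>\<^sub>F h in at 0. norm (norm (f (w + h) - f w - (\<Sum>i\<in>UNIV. cpd i f w * h$i)) / norm h) <= norm h * (S / r^2)"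
    unfolding eventually_at
   proof (intro exI[of _ r] conjI ballI impI)
    fix h :: "complex^'n" assume "h ~= 0 & dist h 0 < r"
    then have h: "h ~= 0" "norm h < r" by auto
    then show "norm (norm (f (w + h) - f w - (\<Sum>i\<in>UNIV. cpd i f w * h$i)) / norm h) <= norm h * (S / r^2)"
     using main[OF h(2)] by (simp add: divide_le_eq power2_eq_square mult_ac)
   qed (rule r)
  qed auto
 qed
qed

text \<open>All continuations below run along complex lines through 0, so the identity theorem of
  one variable is enough.\<close>

lemma multi_analytic_line:
 assumes "multi_analytic_on f D"
 shows "(%ze. f (\<chi> i. ze * v$i)) holomorphic_on {ze. (\<chi> i. ze * v$i) \<in> D}"
  and "open {ze. (\<chi> i. ze * v$i) \<in> D}"
proof -
 have der: "((%ze. (\<chi> i. ze * v$i)) has_derivative (%h. (\<chi> i. h * v$i))) (at ze)" for ze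
  by (subst has_derivative_componentwise_within) (auto simp: Basis_vec_def inner_axis intro!: derivative_eq_intros)
 then have "continuous_on UNIV (%ze. (\<chi> i. ze * v$i))"
  by (meson has_derivative_continuous continuous_at_imp_continuous_on)
 then show op: "open {ze. (\<chi> i. ze * v$i) \<in> D}"
  using continuous_open_vimage multi_analytic_open[OF assms]
  by (metis (no_types, lifting) Collect_cong continuous_on_open_vimage inf_top.right_neutral open_UNIV vimage_def)
 show "(%ze. f (\<chi> i. ze * v$i)) holomorphic_on {ze. (\<chi> i. ze * v$i) \<in> D}"
  unfolding holomorphic_on_open[OF op]
 proof (intro ballI)
  fix ze assume "ze \<in> {ze. (\<chi> i. ze * v$i) \<in> D}"
  then have "(f has_derivative (%h. \<Sum>i\<in>UNIV. cpd i f (\<chi> i. ze * v$i) * h$i)) (at (\<chi> i. ze * v$i))"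
   by (intro multi_analytic_has_derivative[OF assms]) auto
  from has_derivative_compose[OF der this]
  have "((%ze. f (\<chi> i. ze * v$i)) has_derivative (%h. \<Sum>i\<in>UNIV. cpd i f (\<chi> i. ze * v$i) * (h * v$i))) (at ze)"
   by simp
  then show "\<exists>f'. ((%ze. f (\<chi> i. ze * v$i)) has_field_derivative f') (at ze)"
   unfolding has_field_derivative_def
   by (intro exI[of _ "\<Sum>i\<in>UNIV. cpd i f (\<chi> i. ze * v$i) * v$i"], elim has_derivative_eq_rhs)
     (simp add: fun_eq_iff sum_distrib_right sum_distrib_left mult_ac)
 qed
qed

text \<open>The segment from 0 to x lies in the component of 0 in U, and the zeros on the short
  segment accumulate at 0.\<close>

lemma segment_identity:
 assumes hol: "g holomorphic_on U" and U: "open U" "!!\<tau>. 0 <= \<tau> ==> \<tau> <= x ==> cor \<tau> \<in> U"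
  and \<delta>: "\<delta> > 0" "!!\<tau>. 0 < \<tau> ==> \<tau> < \<delta> ==> g (cor \<tau>) = 0"
  and x: "x > 0"
 shows "g (cor x) = 0"
proof -
 define S where "S = connected_component_set U 0"
 have S: "open S" "connected S" "S \<subseteq> U"
  by (auto simp: S_def U open_connected_component connected_component_subset)
 have sub: "cor ` {0..x} \<subseteq> S" unfolding S_def
 proof (rule connected_component_maximal)
  show "connected (cor ` {0..x})"
   by (intro connected_continuous_image continuous_intros) auto
  show "0 \<in> cor ` {0..x}" using x by (intro image_eqI[of _ _ 0]) auto
 qed (use U in auto)
 define \<delta>' where "\<delta>' = min \<delta> x"
 have \<delta>': "\<delta>' > 0" "\<delta>' <= \<delta>" "\<delta>' <= x" using \<delta> x by (auto simp: \<delta>'_def)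
 show ?thesis
 proof (rule analytic_continuation[of g S "cor ` {0<..<\<delta>'}" 0])
  show "g holomorphic_on S" using hol S(3) by (rule holomorphic_on_subset)
  show "(0::complex) islimpt cor ` {0<..<\<delta>'}"
   unfolding islimpt_approachable
  proof (intro allI impI)
   fix e :: real assume "e > 0"
   then have "cor (min (e/2) (\<delta>'/2)) \<in> cor ` {0<..<\<delta>'}"
    using \<delta>' by (intro imageI) (auto simp: min_less_iff_disj)
   then show "\<exists>x'\<in>cor ` {0<..<\<delta>'}. x' ~= 0 & dist x' 0 < e"
    using \<open>e > 0\<close> \<delta>' by (intro bexI[of _ "cor (min (e/2) (\<delta>'/2))"]) (auto simp: min_def)
  qed
  show "cor ` {0<..<\<delta>'} \<subseteq> S" using sub \<delta>'(3) by (auto intro!: subsetD[OF sub])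
  show "(0::complex) \<in> S" using subsetD[OF sub, of 0] x by (force intro: image_eqI[of _ _ 0])
 qed (use S sub \<delta> \<delta>' x in auto)
qed

definition cvec :: "real^'n => complex^'n" where
 "cvec r = (\<chi> i. cor (r$i))"

lemma cvec_nth [simp]: "cvec r $ i = cor (r$i)"
 by (simp add: cvec_def)

lemma cvec_upd: "cvec (upd r i t) = upd (cvec r) i (cor t)"
 by (simp add: vec_eq_iff)

lemma partial3_upd: "partial3 i F r = deriv (%t. F (upd r i t)) (r$i)"
 by (simp add: partial3_def upd_def)

lemma open_open_cube: "open open_cube"
proof -
 have "open_cube = box (0::real^3) 1"
  by (auto simp: open_cube_def box_def Basis_vec_def inner_axis)
 then show ?thesis using open_box by metis
qed

text \<open>Real functions on the open cube that are restrictions of analytic ones. The class is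
  closed under partial derivatives (\<open>continues_real_cpd\<close>), so derivatives of F of every
  order exist.\<close>

definition continues_real :: "(complex^3 => complex) => (complex^3) set => (real^3 => real) => bool" where
 "continues_real f D F \<longleftrightarrow> multi_analytic_on f D &
  (\<forall>r\<in>open_cube. cvec r \<in> D & f (cvec r) = cor (F r))"

text \<open>At a real point the complex partial derivative is the derivative of a real-valued
  function of a real variable, so its imaginary part is 0.\<close>

lemma continues_real_partial:
 assumes F: "continues_real f D F" and r: "r \<in> open_cube"
 shows "((%t. F (upd r i t)) has_real_derivative partial3 i F r) (at (r$i))"
  and "cpd i f (cvec r) = cor (partial3 i F r)"
proof -
 have ma: "multi_analytic_on f D" and FD: "!!r. r \<in> open_cube ==> cvec r \<in> D & f (cvec r) = cor (F r)"
  using F by (auto simp: continues_real_def)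
 define d where "d = cpd i f (cvec r)"
 have "((%t. f (upd (cvec r) i t)) has_field_derivative d) (at (cor (r$i)))"
  using multi_analytic_slice[OF ma, of "cvec r" i] FD[OF r] by (simp add: d_def)
 then have "((%t. f (upd (cvec r) i (cor t))) has_vector_derivative d) (at (r$i))"
  by (rule has_vector_derivative_real_field)
 then have v: "((%t. cor (F (upd r i t))) has_vector_derivative d) (at (r$i))"
 proof (rule has_vector_derivative_transform_within_open)
  show "open {0<..<(1::real)}" "r$i \<in> {0<..<1}" using r by (auto simp: open_cube_def)
  fix t :: real assume "t \<in> {0<..<1}"
  then have "upd r i t \<in> open_cube" using r by (auto simp: open_cube_def)
  then show "f (upd (cvec r) i (cor t)) = cor (F (upd r i t))"
   using FD by (simp add: cvec_upd[symmetric])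
 qed
 have re: "((%t. F (upd r i t)) has_real_derivative Re d) (at (r$i))"
  using bounded_linear.has_vector_derivative[OF bounded_linear_Re v]
  by (simp add: has_real_derivative_iff_has_vector_derivative)
 have im: "((%t::real. 0::real) has_real_derivative Im d) (at (r$i))"
  using bounded_linear.has_vector_derivative[OF bounded_linear_Im v]
  by (simp add: has_real_derivative_iff_has_vector_derivative)
 have "Im d = 0" by (rule DERIV_unique[OF im]) simp
 moreover have p: "partial3 i F r = Re d" unfolding partial3_upd by (rule DERIV_imp_deriv[OF re])
 ultimately show "cpd i f (cvec r) = cor (partial3 i F r)"
  by (simp add: d_def complex_eq_iff)
 show "((%t. F (upd r i t)) has_real_derivative partial3 i F r) (at (r$i))" using re p by simp
qed

lemma continues_real_cpd:
 "continues_real f D F ==> continues_real (cpd i f) D (partial3 i F)"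
 using continues_real_partial(2)[of f D F] by (auto simp: continues_real_def multi_analytic_cpd)

lemma continues_real_has_derivative:
 assumes F: "continues_real f D F" and r: "r \<in> open_cube"
 shows "(F has_derivative (%h. \<Sum>i\<in>UNIV. partial3 i F r * h$i)) (at r)"
proof -
 have ma: "multi_analytic_on f D" and FD: "!!r. r \<in> open_cube ==> cvec r \<in> D & f (cvec r) = cor (F r)"
  using F by (auto simp: continues_real_def)
 have c: "(cvec has_derivative cvec) (at r)"
  by (subst has_derivative_componentwise_within)
   (auto simp: Basis_vec_def inner_axis cvec_def Basis_complex_def intro!: derivative_eq_intros bounded_linear_imp_has_derivative bounded_linear_vec_nth)
 have "(f has_derivative (%h. \<Sum>i\<in>UNIV. cpd i f (cvec r) * h$i)) (at (cvec r))"
  by (rule multi_analytic_has_derivative[OF ma]) (use FD r in auto)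
 from has_derivative_compose[OF c this]
 have "((%r. f (cvec r)) has_derivative (%h. \<Sum>i\<in>UNIV. cor (partial3 i F r * h$i))) (at r)"
  unfolding continues_real_partial(2)[OF F r] cvec_nth of_real_mult .
 then have "((%r. cor (F r)) has_derivative (%h. \<Sum>i\<in>UNIV. cor (partial3 i F r * h$i))) (at r)"
  by (rule has_derivative_transform_within_open[OF _ open_open_cube r]) (use FD in blast)
 from bounded_linear.has_derivative[OF bounded_linear_Re this] show ?thesis
  unfolding Re_complex_of_real Re_sum .
qed

lemma continues_real_continuous_on: "continues_real f D F ==> continuous_on open_cube F"
 by (meson continues_real_has_derivative has_derivative_continuous continuous_at_imp_continuous_on)

section \<open>The differential equations for F and G\<close>

definition powser_sum :: "(nat^'n => complex) => complex^'n => complex => bool" where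
 "powser_sum a z s \<longleftrightarrow> ((%n. a n * zmono z n) has_sum s) UNIV"

text \<open>The coefficients of z_i times the series, just as \<open>pderiv_coeff\<close> has those
  of the partial derivative.\<close>

definition shift_coeff :: "'n => (nat^'n => complex) => nat^'n => complex" where
 "shift_coeff i a n = (if n$i = 0 then 0 else a (n - axis i 1))"

lemma zmono_add_axis: "zmono z (n + axis i 1) = z$i * zmono z n"
 unfolding zmono_def
 by (subst (1 2) prod.remove[of _ i]) (auto simp: axis_def mult_ac intro!: prod.cong)

lemma powser_sum_shift:
 fixes a :: "nat^'n => complex"
 assumes "powser_sum a z s" shows "powser_sum (shift_coeff i a) z (z$i * s)"
proof -
 have inj: "inj (%n :: nat^'n. n + axis i 1)" by (auto simp: inj_def)
 have "((%n. z$i * (a n * zmono z n)) has_sum z$i * s) UNIV"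
  using assms unfolding powser_sum_def by (rule has_sum_cmult_right)
 moreover have "z$i * (a n * zmono z n) = shift_coeff i a (n + axis i 1) * zmono z (n + axis i 1)" for n
  by (simp add: shift_coeff_def zmono_add_axis del: One_nat_def)
 ultimately have "((%n. shift_coeff i a n * zmono z n) has_sum z$i * s) (range (%n. n + axis i 1))"
  unfolding has_sum_reindex[OF inj] by (simp add: o_def)
 then show ?thesis unfolding powser_sum_def
 proof (rule has_sum_cong_neutral[THEN iffD1, rotated -1])
  fix n :: "nat^'n" assume "n \<in> UNIV - range (%n. n + axis i 1)"
  then have "n$i = 0"
  proof (rule contrapos_pp)
   assume "n$i ~= 0"
   then have "n = (n - axis i 1) + axis i 1" by (auto simp: vec_eq_iff axis_def)
   then show "n \<notin> UNIV - range (%n. n + axis i 1)" by auto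
  qed
  then show "shift_coeff i a n * zmono z n = 0" by (simp add: shift_coeff_def)
 qed auto
qed

lemma powser_sum_add: "powser_sum a z s ==> powser_sum b z t ==> powser_sum (%n. a n + b n) z (s + t)"
 unfolding powser_sum_def distrib_right by (rule has_sum_add)

lemma powser_sum_cmult: "powser_sum a z s ==> powser_sum (%n. c * a n) z (c * s)"
 unfolding powser_sum_def mult.assoc by (rule has_sum_cmult_right)

lemma powser_sum_diff: "powser_sum a z s ==> powser_sum b z t ==> powser_sum (%n. a n - b n) z (s - t)"
 using powser_sum_add[OF _ powser_sum_cmult[of b z t "-1"], of a s] by simp

lemma powser_sum_zero: "powser_sum a z s ==> (!!n. a n = 0) ==> s = 0"
 unfolding powser_sum_def by (simp add: has_sum_unique[OF _ has_sum_0])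

lemma powser_sum_cpd:
 assumes "!!z. (!!i. cmod (z$i) < \<rho>) ==> powser_sum a z (f z)" "!!i. cmod (z$i) < \<rho>"
 shows "powser_sum (pderiv_coeff i a) z (cpd i f z)"
 using powser_cpd(2)[of 0 \<rho> a f z i] assms by (simp add: powser_sum_def)

lemma zero_extend_nat:
 fixes n :: "nat^3"
 defines "N \<equiv> (\<chi> i. int (n$i))"
 shows "zero_extend A N = A n" "zero_extend A (N + axis i 1) = A (n + axis i 1)"
  "cor (zero_extend B (N - axis i 1)) = shift_coeff i (%n. cor (B n)) n"
  "i ~= j ==> cor (zero_extend B (N - axis i 1 - axis j 1)) = shift_coeff i (shift_coeff j (%n. cor (B n))) n"
proof -
 have v: "(\<chi> k. nat ((N - axis i 1 - axis j 1)$k)) = n - axis i 1 - axis j 1"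
  "(\<chi> k. nat ((N - axis i 1)$k)) = n - axis i 1"
  "(\<chi> k. nat ((N + axis i 1)$k)) = n + axis i 1" "(\<chi> k. nat (N$k)) = n" for i j
  by (auto simp: vec_eq_iff axis_def N_def)
 show "zero_extend A N = A n" "zero_extend A (N + axis i 1) = A (n + axis i 1)"
  unfolding zero_extend_def v by (auto simp: N_def axis_def)
 have "(\<forall>k. 0 <= (N - axis i 1)$k) \<longleftrightarrow> n$i ~= 0" for i
  by (auto simp: N_def axis_def dest: spec[of _ i])
 then show "cor (zero_extend B (N - axis i 1)) = shift_coeff i (%n. cor (B n)) n"
  unfolding zero_extend_def v shift_coeff_def by simp
 assume ij: "i ~= j"
 have "(\<forall>k. 0 <= (N - axis i 1 - axis j 1)$k) \<longleftrightarrow> n$i ~= 0 & n$j ~= 0"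
  using ij by (auto simp: N_def axis_def dest: spec[of _ i] spec[of _ j])
 moreover have "(n - axis i 1)$j = n$j" using ij by (simp add: axis_def)
 ultimately show "cor (zero_extend B (N - axis i 1 - axis j 1)) = shift_coeff i (shift_coeff j (%n. cor (B n))) n"
  unfolding zero_extend_def v shift_coeff_def by simp
qed

lemma shift_pderiv_coeff:
 fixes a :: "nat^'n => complex"
 shows "shift_coeff l (pderiv_coeff l a) n = of_nat (n$l) * a n"
 by (cases "n$l") (auto simp: shift_coeff_def pderiv_coeff_def axis_def vec_eq_iff intro!: arg_cong[of _ _ a])

lemma pderiv_coeff_commute: "pderiv_coeff j (pderiv_coeff k a) = pderiv_coeff k (pderiv_coeff j a)"
 by (cases "j = k") (auto simp: pderiv_coeff_def fun_eq_iff axis_def add_ac)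

lemma shift_pderiv_coeff2:
 fixes a :: "nat^'n => complex"
 shows "shift_coeff l (shift_coeff l (pderiv_coeff l (pderiv_coeff l a))) n = of_nat (n$l) * (of_nat (n$l) - 1) * a n"
  and "j ~= k ==> shift_coeff j (shift_coeff k (pderiv_coeff j (pderiv_coeff k a))) n = of_nat (n$j) * of_nat (n$k) * a n"
proof -
 have *: "shift_coeff l (pderiv_coeff l a) = (%n. of_nat (n$l) * a n)" for a :: "nat^'n => complex" and l
  by (rule ext) (rule shift_pderiv_coeff)
 have c: "shift_coeff i (%n. of_nat (n$k) * pderiv_coeff i a n) n = of_nat (if i = k then n$k - 1 else n$k) * (of_nat (n$i) * a n)" for i k
  unfolding shift_pderiv_coeff[of i a n, symmetric] by (simp add: shift_coeff_def axis_def)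
 show "shift_coeff l (shift_coeff l (pderiv_coeff l (pderiv_coeff l a))) n = of_nat (n$l) * (of_nat (n$l) - 1) * a n"
  unfolding * c by (cases "n$l") (auto simp: mult_ac)
 assume jk: "j ~= k"
 show "shift_coeff j (shift_coeff k (pderiv_coeff j (pderiv_coeff k a))) n = of_nat (n$j) * of_nat (n$k) * a n"
  unfolding pderiv_coeff_commute[of j k] * c using jk by simp
qed

lemma open_cube_subset: "open_cube \<subseteq> half_open_cube" "half_open_cube \<subseteq> closed_cube" "open_cube \<subseteq> closed_cube"
 unfolding open_cube_def half_open_cube_def closed_cube_def by (auto intro: less_imp_le)

lemma continues_power_seriesE:
 assumes "continues_power_series A F"
 obtains D f where "continues_real f D F"
  "!!z. (!!i. cmod (z$i) < 1/10) ==> z \<in> D"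
  "!!z. (!!i. cmod (z$i) < 1/10) ==> powser_sum (%n. cor (A n)) z (f z)"
  "!!r. r \<in> half_open_cube ==> cvec r \<in> D & f (cvec r) = cor (F r)"
proof -
 obtain D f where D: "multi_analytic_on f D" "{z. \<forall>i. cmod (z$i) < 1/10} \<subseteq> D"
  "\<forall>z. (\<forall>i. cmod (z$i) < 1/10) \<longrightarrow> ((%n. cor (A n) * (\<Prod>i\<in>UNIV. (z$i) ^ (n$i))) has_sum f z) UNIV"
  "\<forall>r\<in>half_open_cube. cvec r \<in> D & f (cvec r) = cor (F r)"
  using assms unfolding continues_power_series_def cvec_def by blast
 show ?thesis
 proof (rule that[of f D])
  show "continues_real f D F" using D open_cube_subset(1) unfolding continues_real_def by blast
  show "z \<in> D" if "!!i. cmod (z$i) < 1/10" for z using D(2) that by blast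
  show "powser_sum (%n. cor (A n)) z (f z)" if "!!i. cmod (z$i) < 1/10" for z
   using D(3) that unfolding powser_sum_def zmono_def by blast
  show "cvec r \<in> D & f (cvec r) = cor (F r)" if "r \<in> half_open_cube" for r
   using D(4) that by blast
 qed
qed

lemma distinct_if_UNIV_3:
 assumes "{j,k,l} = {1,2,3::3}" shows "j ~= k" "l ~= j" "l ~= k"
proof -
 have "card {j,k,l} = 3" unfolding assms by simp
 then show "j ~= k" "l ~= j" "l ~= k" by (auto simp: card_insert_if split: if_splits)
qed

definition smul :: "complex => complex^'n => complex^'n" where
 "smul ze v = (\<chi> i. ze * v$i)"

lemma smul_nth [simp]: "smul ze v $ i = ze * v$i"
 by (simp add: smul_def)

lemma smul_1 [simp]: "smul 1 v = v"
 by (simp add: vec_eq_iff)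

lemma smul_cvec: "smul (cor \<tau>) (cvec r) = cvec (\<tau> *\<^sub>R r)"
 by (simp add: vec_eq_iff)

lemma scale_half_open_cube: "r \<in> half_open_cube ==> 0 <= \<tau> ==> \<tau> <= 1 ==> \<tau> *\<^sub>R r \<in> half_open_cube"
 unfolding half_open_cube_def
 by (auto simp: mult_left_le_one_le intro: order_le_less_trans[OF mult_left_le_one_le])

lemma segment_in_domain:
 assumes "!!r. r \<in> half_open_cube ==> cvec r \<in> D" "!!z. (!!i. cmod (z$i) < 1/10) ==> z \<in> D"
  and r: "r \<in> half_open_cube"
 shows "0 <= \<tau> ==> \<tau> <= 1 ==> smul (cor \<tau>) (cvec r) \<in> D"
  and "norm ze < 1/10 ==> cmod (smul ze (cvec r) $ i) < 1/10"
  and "norm ze < 1/10 ==> smul ze (cvec r) \<in> D"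
proof -
 show "0 <= \<tau> ==> \<tau> <= 1 ==> smul (cor \<tau>) (cvec r) \<in> D"
  unfolding smul_cvec using assms scale_half_open_cube by blast
 show *: "norm ze < 1/10 ==> cmod (smul ze (cvec r) $ i) < 1/10" for i
 proof -
  assume "norm ze < 1/10"
  moreover have "cmod (smul ze (cvec r) $ i) <= norm ze"
   using r mult_left_le[of "\<bar>r$i\<bar>" "norm ze"] by (auto simp: norm_mult half_open_cube_def less_imp_le)
  ultimately show ?thesis by linarith
 qed
 show "norm ze < 1/10 ==> smul ze (cvec r) \<in> D"
  by (rule assms(2)) (rule *)
qed

lemma line_holomorphic:
 assumes "multi_analytic_on f D"
 shows "(%ze. f (smul ze v)) holomorphic_on {ze. smul ze v \<in> D}" "open {ze. smul ze v \<in> D}"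
 using multi_analytic_line[OF assms, of v] by (simp_all add: smul_def)

lemma neighbor_coefficients_shift:
 assumes nc: "neighbor_coefficients b A0 B0" and jkl: "{j,k,l} = {1,2,3::3}"
 defines "A \<equiv> %n. cor (A0 n)" and "B \<equiv> %n. cor (B0 n)" and "\<beta> \<equiv> cor b"
 shows "(of_nat (n$l) + 1) * (of_nat (n$l) + 2*\<beta>) * A (n + axis l 1) - (of_nat (n$l) + \<beta>) * (of_nat (n$l) + 1 - \<beta>) * A n
   = B n - shift_coeff j B n - shift_coeff k B n + shift_coeff j (shift_coeff k B) n"
  and "(2 * of_nat (n$j) * of_nat (n$k) + \<beta> * of_nat (n$j) + \<beta> * of_nat (n$k) + \<beta> * of_nat (n$l) + \<beta>\<^sup>2) * A n
   = shift_coeff l (shift_coeff j B) n + shift_coeff l (shift_coeff k B) n - B n - shift_coeff j (shift_coeff k B) n"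
proof -
 have ne: "j ~= k" "l ~= j" "l ~= k" using distinct_if_UNIV_3[OF jkl] by auto
 define N where "N = (\<chi> i. int (n$i))"
 have Nn: "real_of_int (N$i) = real (n$i)" for i by (simp add: N_def)
 note z = zero_extend_nat(1,2)[of _ n, folded N_def]
 note zb = zero_extend_nat(3)[of B0 n, folded N_def B_def] zero_extend_nat(4)[of _ _ B0 n, folded N_def B_def]
 have main: "(real_of_int (N$l) + 1) * (real_of_int (N$l) + 2*b) * zero_extend A0 (N + axis l 1) - (real_of_int (N$l) + b) * (real_of_int (N$l) + 1 - b) * zero_extend A0 N
      = zero_extend B0 N - zero_extend B0 (N - axis j 1) - zero_extend B0 (N - axis k 1) + zero_extend B0 (N - axis j 1 - axis k 1) &
     (2 * real_of_int (N$j) * real_of_int (N$k) + b * real_of_int (N$j) + b * real_of_int (N$k) + b * real_of_int (N$l) + b\<^sup>2) * zero_extend A0 N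
      = zero_extend B0 (N - axis l 1 - axis j 1) + zero_extend B0 (N - axis l 1 - axis k 1) - zero_extend B0 N - zero_extend B0 (N - axis j 1 - axis k 1)"
  using nc jkl unfolding neighbor_coefficients_def Let_def by blast
 note c1 = main[THEN conjunct1, unfolded z Nn, THEN arg_cong[of _ _ cor]]
 note c2 = main[THEN conjunct2, unfolded z Nn, THEN arg_cong[of _ _ cor]]
 show "(of_nat (n$l) + 1) * (of_nat (n$l) + 2*\<beta>) * A (n + axis l 1) - (of_nat (n$l) + \<beta>) * (of_nat (n$l) + 1 - \<beta>) * A n
   = B n - shift_coeff j B n - shift_coeff k B n + shift_coeff j (shift_coeff k B) n"
  using c1 zb(1)[of j] zb(1)[of k] zb(2)[OF ne(1)] by (simp add: A_def B_def \<beta>_def)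
 show "(2 * of_nat (n$j) * of_nat (n$k) + \<beta> * of_nat (n$j) + \<beta> * of_nat (n$k) + \<beta> * of_nat (n$l) + \<beta>\<^sup>2) * A n
   = shift_coeff l (shift_coeff j B) n + shift_coeff l (shift_coeff k B) n - B n - shift_coeff j (shift_coeff k B) n"
  using c2 zb(2)[OF ne(1)] zb(2)[OF ne(2)] zb(2)[OF ne(3)] by (simp add: A_def B_def \<beta>_def)
qed

text \<open>Coefficient by coefficient the two equations are the two recurrences: multiplication by
  z_i shifts the coefficients, and z_i times the i-th derivative multiplies them by n_i.\<close>

lemma neighbor_pde_powser:
 assumes nc: "neighbor_coefficients b A0 B0" and jkl: "{j,k,l} = {1,2,3::3}"
  and f: "!!z. (!!i. cmod (z$i) < 1/10) ==> powser_sum (%n. cor (A0 n)) z (f z)"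
  and g: "!!z. (!!i. cmod (z$i) < 1/10) ==> powser_sum (%n. cor (B0 n)) z (g z)"
  and z: "!!i. cmod (z$i) < 1/10"
 defines "\<beta> \<equiv> cor b"
 shows "z$l * (1 - z$l) * cpd l (cpd l f) z + (2*\<beta> - 2*z$l) * cpd l f z - \<beta> * (1-\<beta>) * f z - (1 - z$j) * (1 - z$k) * g z = 0"
  and "2*z$j*z$k * cpd j (cpd k f) z + \<beta>*z$j*cpd j f z + \<beta>*z$k*cpd k f z + \<beta>*z$l*cpd l f z + \<beta>\<^sup>2 * f z
   - (z$l * (z$j + z$k) - (1 + z$j*z$k)) * g z = 0"
proof -
 have ne: "j ~= k" "l ~= j" "l ~= k" using distinct_if_UNIV_3[OF jkl] by auto
 define A where "A = (%n. cor (A0 n))"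
 define B where "B = (%n. cor (B0 n))"
 note nc' = neighbor_coefficients_shift[OF nc jkl, folded \<beta>_def]
 have pf: "powser_sum A z (f z)" if "!!i. cmod (z$i) < 1/10" for z unfolding A_def by (rule f) (rule that)
 have pf1: "powser_sum (pderiv_coeff i A) z (cpd i f z)" if "!!i. cmod (z$i) < 1/10" for z i
  by (rule powser_sum_cpd[OF pf that])
 have pf2: "powser_sum (pderiv_coeff i (pderiv_coeff i' A)) z (cpd i (cpd i' f) z)" for i i'
  by (rule powser_sum_cpd[OF pf1 z])
 have pg: "powser_sum B z (g z)" unfolding B_def by (rule g) (rule z)
 have "powser_sum (%n. (shift_coeff l (pderiv_coeff l (pderiv_coeff l A)) n - shift_coeff l (shift_coeff l (pderiv_coeff l (pderiv_coeff l A))) n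
   + (2*\<beta> * pderiv_coeff l A n - 2 * shift_coeff l (pderiv_coeff l A) n) - \<beta>*(1-\<beta>) * A n)
   - (B n - shift_coeff j B n - shift_coeff k B n + shift_coeff j (shift_coeff k B) n)) z
   ((z$l * cpd l (cpd l f) z - z$l * (z$l * cpd l (cpd l f) z) + (2*\<beta> * cpd l f z - 2 * (z$l * cpd l f z)) - \<beta>*(1-\<beta>) * f z)
    - (g z - z$j * g z - z$k * g z + z$j * (z$k * g z)))"
  by (intro powser_sum_diff powser_sum_add powser_sum_cmult powser_sum_shift pf pf1 pf2 pg z)
 then have "(z$l * cpd l (cpd l f) z - z$l * (z$l * cpd l (cpd l f) z) + (2*\<beta> * cpd l f z - 2 * (z$l * cpd l f z)) - \<beta>*(1-\<beta>) * f z)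
    - (g z - z$j * g z - z$k * g z + z$j * (z$k * g z)) = 0"
 proof (rule powser_sum_zero)
  fix n
  show "(shift_coeff l (pderiv_coeff l (pderiv_coeff l A)) n - shift_coeff l (shift_coeff l (pderiv_coeff l (pderiv_coeff l A))) n
   + (2*\<beta> * pderiv_coeff l A n - 2 * shift_coeff l (pderiv_coeff l A) n) - \<beta>*(1-\<beta>) * A n)
   - (B n - shift_coeff j B n - shift_coeff k B n + shift_coeff j (shift_coeff k B) n) = 0"
   using nc'(1)[of n] unfolding A_def B_def shift_pderiv_coeff shift_pderiv_coeff2(1) pderiv_coeff_def
   by (simp add: algebra_simps)
 qed
 then show "z$l * (1 - z$l) * cpd l (cpd l f) z + (2*\<beta> - 2*z$l) * cpd l f z - \<beta> * (1-\<beta>) * f z - (1 - z$j) * (1 - z$k) * g z = 0"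
  by (simp add: algebra_simps)
 have "powser_sum (%n. (2 * shift_coeff j (shift_coeff k (pderiv_coeff j (pderiv_coeff k A))) n + \<beta> * shift_coeff j (pderiv_coeff j A) n
   + \<beta> * shift_coeff k (pderiv_coeff k A) n + \<beta> * shift_coeff l (pderiv_coeff l A) n + \<beta>\<^sup>2 * A n)
   - (shift_coeff l (shift_coeff j B) n + shift_coeff l (shift_coeff k B) n - B n - shift_coeff j (shift_coeff k B) n)) z
   ((2 * (z$j * (z$k * cpd j (cpd k f) z)) + \<beta> * (z$j * cpd j f z) + \<beta> * (z$k * cpd k f z) + \<beta> * (z$l * cpd l f z) + \<beta>\<^sup>2 * f z)
    - (z$l * (z$j * g z) + z$l * (z$k * g z) - g z - z$j * (z$k * g z)))"
  by (intro powser_sum_diff powser_sum_add powser_sum_cmult powser_sum_shift pf pf1 pf2 pg z)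
 then have "(2 * (z$j * (z$k * cpd j (cpd k f) z)) + \<beta> * (z$j * cpd j f z) + \<beta> * (z$k * cpd k f z) + \<beta> * (z$l * cpd l f z) + \<beta>\<^sup>2 * f z)
    - (z$l * (z$j * g z) + z$l * (z$k * g z) - g z - z$j * (z$k * g z)) = 0"
 proof (rule powser_sum_zero)
  fix n
  show "(2 * shift_coeff j (shift_coeff k (pderiv_coeff j (pderiv_coeff k A))) n + \<beta> * shift_coeff j (pderiv_coeff j A) n
   + \<beta> * shift_coeff k (pderiv_coeff k A) n + \<beta> * shift_coeff l (pderiv_coeff l A) n + \<beta>\<^sup>2 * A n)
   - (shift_coeff l (shift_coeff j B) n + shift_coeff l (shift_coeff k B) n - B n - shift_coeff j (shift_coeff k B) n) = 0"
   using nc'(2)[of n] unfolding A_def B_def shift_pderiv_coeff shift_pderiv_coeff2(2)[OF ne(1)]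
   by (simp add: algebra_simps)
 qed
 then show "2*z$j*z$k * cpd j (cpd k f) z + \<beta>*z$j*cpd j f z + \<beta>*z$k*cpd k f z + \<beta>*z$l*cpd l f z + \<beta>\<^sup>2 * f z
   - (z$l * (z$j + z$k) - (1 + z$j*z$k)) * g z = 0"
  by (simp add: algebra_simps)
qed

text \<open>The two equations hold near 0 and are continued along the segment from 0 to r, on which
  all terms are holomorphic in the scaling parameter.\<close>

lemma neighbor_pde:
 assumes nc: "neighbor_coefficients b A B" and jkl: "{j,k,l} = {1,2,3::3}"
  and F: "continues_power_series A F" and G: "continues_power_series B G"
  and r: "r \<in> open_cube"
 shows "r$l * (1 - r$l) * partial3 l (partial3 l F) r + (2*b - 2 * r$l) * partial3 l F r - b * (1 - b) * F r
     = (1 - r$j) * (1 - r$k) * G r"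
  and "2 * r$j * r$k * partial3 j (partial3 k F) r + b * r$j * partial3 j F r
      + b * r$k * partial3 k F r + b * r$l * partial3 l F r + b\<^sup>2 * F r
     = (r$l * (r$j + r$k) - (1 + r$j * r$k)) * G r"
proof -
 obtain D f where f: "continues_real f D F" "!!z. (!!i. cmod (z$i) < 1/10) ==> z \<in> D"
  "!!z. (!!i. cmod (z$i) < 1/10) ==> powser_sum (%n. cor (A n)) z (f z)"
  "!!r. r \<in> half_open_cube ==> cvec r \<in> D & f (cvec r) = cor (F r)"
  by (rule continues_power_seriesE[OF F], blast)
 obtain E g where g: "continues_real g E G" "!!z. (!!i. cmod (z$i) < 1/10) ==> z \<in> E"
  "!!z. (!!i. cmod (z$i) < 1/10) ==> powser_sum (%n. cor (B n)) z (g z)"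
  "!!r. r \<in> half_open_cube ==> cvec r \<in> E & g (cvec r) = cor (G r)"
  by (rule continues_power_seriesE[OF G], blast)
 define v where "v = cvec r"
 define U where "U = {ze. smul ze v \<in> D} \<inter> {ze. smul ze v \<in> E}"
 have maf: "multi_analytic_on f D" and mag: "multi_analytic_on g E" using f g by (auto simp: continues_real_def)
 have rh: "r \<in> half_open_cube" using r open_cube_subset by auto
 have U: "open U" unfolding U_def by (intro open_Int line_holomorphic(2)[OF maf] line_holomorphic(2)[OF mag])
 have U1: "cor \<tau> \<in> U" if "0 <= \<tau>" "\<tau> <= 1" for \<tau>
  unfolding U_def v_def using segment_in_domain(1)[OF _ f(2) rh] segment_in_domain(1)[OF _ g(2) rh] f(4) g(4) that by auto
 have small: "cmod (smul ze v $ i) < 1/10" if "norm ze < 1/10" for ze i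
  unfolding v_def by (rule segment_in_domain(2)[OF _ f(2) rh that]) (use f(4) in auto)
 have U0: "ze \<in> U" if "norm ze < 1/10" for ze
  unfolding U_def using f(2) g(2) small[OF that] by auto
 have hol: "(%ze. f (smul ze v)) holomorphic_on U" "(%ze. cpd i f (smul ze v)) holomorphic_on U"
  "(%ze. cpd i (cpd i' f) (smul ze v)) holomorphic_on U" "(%ze. g (smul ze v)) holomorphic_on U" for i i'
  unfolding U_def
  by (rule holomorphic_on_subset[OF line_holomorphic(1)[where D=D]], (intro multi_analytic_cpd maf)?, blast)+
   (rule holomorphic_on_subset[OF line_holomorphic(1)[OF mag]], blast)
 define \<beta> where "\<beta> = cor b"
 define E1 where "E1 ze = (let z = smul ze v in z$l * (1 - z$l) * cpd l (cpd l f) z + (2*\<beta> - 2*z$l) * cpd l f z - \<beta> * (1-\<beta>) * f z - (1 - z$j) * (1 - z$k) * g z)" for ze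
 define E2 where "E2 ze = (let z = smul ze v in 2*z$j*z$k * cpd j (cpd k f) z + \<beta>*z$j*cpd j f z + \<beta>*z$k*cpd k f z + \<beta>*z$l*cpd l f z + \<beta>\<^sup>2 * f z
   - (z$l * (z$j + z$k) - (1 + z$j*z$k)) * g z)" for ze
 have E1: "E1 (cor 1) = 0"
 proof (rule segment_identity[OF _ U U1, where \<delta> = "1/10"])
  show "E1 holomorphic_on U" unfolding E1_def Let_def smul_nth by (intro holomorphic_intros hol)
  show "E1 (cor \<tau>) = 0" if "0 < \<tau>" "\<tau> < 1/10" for \<tau>
   unfolding E1_def Let_def \<beta>_def by (rule neighbor_pde_powser(1)[OF nc jkl f(3) g(3) small]) (use that in auto)
 qed auto
 have E2: "E2 (cor 1) = 0"
 proof (rule segment_identity[OF _ U U1, where \<delta> = "1/10"])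
  show "E2 holomorphic_on U" unfolding E2_def Let_def smul_nth by (intro holomorphic_intros hol)
  show "E2 (cor \<tau>) = 0" if "0 < \<tau>" "\<tau> < 1/10" for \<tau>
   unfolding E2_def Let_def \<beta>_def by (rule neighbor_pde_powser(2)[OF nc jkl f(3) g(3) small]) (use that in auto)
 qed auto
 have p: "cpd i f v = cor (partial3 i F r)"
  "cpd i (cpd i' f) v = cor (partial3 i (partial3 i' F) r)" for i i'
  unfolding v_def using continues_real_partial(2)[OF f(1) r] continues_real_partial(2)[OF continues_real_cpd[OF f(1)] r] by auto
 have fg: "f v = cor (F r)" "g v = cor (G r)"
  using f(4)[OF rh] g(4)[OF rh] by (auto simp: v_def)
 have *: "cor (r$l * (1 - r$l) * partial3 l (partial3 l F) r + (2*b - 2 * r$l) * partial3 l F r - b * (1 - b) * F r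
     - (1 - r$j) * (1 - r$k) * G r) = 0"
  and **: "cor (2 * r$j * r$k * partial3 j (partial3 k F) r + b * r$j * partial3 j F r
      + b * r$k * partial3 k F r + b * r$l * partial3 l F r + b\<^sup>2 * F r
     - (r$l * (r$j + r$k) - (1 + r$j * r$k)) * G r) = 0"
  using E1 E2 unfolding E1_def E2_def Let_def \<beta>_def of_real_1 smul_1 p fg by (simp_all add: v_def)
 show "r$l * (1 - r$l) * partial3 l (partial3 l F) r + (2*b - 2 * r$l) * partial3 l F r - b * (1 - b) * F r
     = (1 - r$j) * (1 - r$k) * G r"
  using * unfolding of_real_eq_0_iff by simp
 show "2 * r$j * r$k * partial3 j (partial3 k F) r + b * r$j * partial3 j F r
      + b * r$k * partial3 k F r + b * r$l * partial3 l F r + b\<^sup>2 * F r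
     = (r$l * (r$j + r$k) - (1 + r$j * r$k)) * G r"
  using ** unfolding of_real_eq_0_iff by simp
qed

section \<open>Summation of the generating functions\<close>

lemma has_sum_SigmaI_abs:
 fixes f :: "'a \<times> 'b => real"
 assumes "!!x. ((%y. f (x, y)) has_sum g x) UNIV" "(g has_sum S) UNIV"
  and "!!x. ((%y. \<bar>f (x, y)\<bar>) has_sum h x) UNIV" "h summable_on UNIV"
 shows "(f has_sum S) UNIV" "(%p. \<bar>f p\<bar>) summable_on UNIV"
proof -
 have "(%p. \<bar>f p\<bar>) summable_on (UNIV \<times> UNIV)"
  by (rule summable_on_SigmaI[OF assms(3,4)]) auto
 then show s: "(%p. \<bar>f p\<bar>) summable_on UNIV" by simp
 then have "f summable_on (UNIV \<times> UNIV)"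
  using summable_on_iff_abs_summable_on_real[of f UNIV] by simp
 from has_sum_SigmaI[OF assms(1,2) this] show "(f has_sum S) UNIV" by simp
qed

lemma powser_binomial:
 fixes a x :: real
 assumes "a > 0" "\<bar>x\<bar> < 1"
 shows "((%q. pochhammer a q / fact q * x ^ q) has_sum (1 - x) powr (-a)) UNIV"
proof -
 have *: "(%q. pochhammer a q / fact q * x ^ q) sums (1 - x) powr (-a)" if "\<bar>x\<bar> < 1" for x
 proof -
  have "(%n. ((-a) gchoose n) * (-x) ^ n) sums (1 + (-x)) powr (-a)"
   by (rule gen_binomial_real) (use that in auto)
  moreover have "((-a) gchoose n) * (-x) ^ n = pochhammer a n / fact n * x ^ n" for n
   by (simp add: gbinomial_pochhammer power_mult_distrib[symmetric] mult_ac)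
    (simp add: power_mult_distrib[symmetric] mult.assoc[symmetric])?
  ultimately show ?thesis by simp
 qed
 have p: "pochhammer a q >= 0" for q using assms by (intro less_imp_le pochhammer_pos)
 have "summable (%q. norm (pochhammer a q / fact q * x ^ q))"
  using sums_summable[OF *[of "\<bar>x\<bar>"]] assms p by (simp add: abs_mult power_abs)
 then show ?thesis by (rule norm_summable_imp_has_sum) (rule *[OF assms(2)])
qed

lemma powser_binomial_shift:
 fixes a x d :: real
 assumes "a > 0" "\<bar>x\<bar> < d"
 shows "((%q. pochhammer a q / fact q * x ^ q * d powr (- a - q)) has_sum (d - x) powr (-a)) UNIV"
proof -
 have d: "d > 0" using assms by linarith
 have h: "((%q. d powr (-a) * (pochhammer a q / fact q * (x/d) ^ q)) has_sum d powr (-a) * (1 - x/d) powr (-a)) UNIV"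
  by (intro has_sum_cmult_right powser_binomial) (use assms d in auto)
 have e1: "d powr (-a) * (1 - x/d) powr (-a) = (d - x) powr (-a)"
 proof -
  have "d - x = d * (1 - x/d)" using d by (simp add: field_simps)
  moreover have "1 - x/d >= 0" using assms d by (simp add: field_simps)
  ultimately show ?thesis using d by (simp add: powr_mult)
 qed
 have e2: "d powr (-a) * (pochhammer a q / fact q * (x/d) ^ q) = pochhammer a q / fact q * x ^ q * d powr (- a - q)" for q
  using d by (simp add: powr_diff powr_realpow power_divide)
 show ?thesis using h unfolding e1 e2 .
qed

definition trinom :: "real => real => real => real => nat \<times> nat \<times> nat => real" where
 "trinom a x y z = (%(i,j,k). pochhammer a (i+j+k) / (fact i * fact j * fact k) * x^i * y^j * z^k)"

lemma trinom_abs: "a > 0 ==> \<bar>trinom a x y z p\<bar> = trinom a \<bar>x\<bar> \<bar>y\<bar> \<bar>z\<bar> p"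
 by (cases p) (auto simp: trinom_def abs_mult power_abs intro!: abs_of_nonneg divide_nonneg_pos less_imp_le[OF pochhammer_pos])

lemma trinom_level1:
 assumes "a > 0" "\<bar>z\<bar> < 1"
 shows "((%k. trinom a x y z (i,j,k)) has_sum x^i / fact i * (pochhammer a (i+j) / fact j * y^j * (1-z) powr (-(a+real i)-real j))) UNIV"
proof -
 have h: "((%k. (pochhammer a (i+j) / (fact i * fact j) * x^i * y^j) * (pochhammer (a + real (i+j)) k / fact k * z ^ k * 1 powr (-(a + real (i+j)) - k)))
  has_sum (pochhammer a (i+j) / (fact i * fact j) * x^i * y^j) * (1 - z) powr (- (a + real (i+j)))) UNIV"
  by (intro has_sum_cmult_right powser_binomial_shift) (use assms in auto)
 have e1: "(pochhammer a (i+j) / (fact i * fact j) * x^i * y^j) * (pochhammer (a + real (i+j)) k / fact k * z ^ k * 1 powr (-(a + real (i+j)) - k)) = trinom a x y z (i,j,k)" for k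
  by (simp add: trinom_def pochhammer_product'[of a "i+j" k])
 have e: "- (a + real (i+j)) = -(a+real i) - real j" by simp
 have e2: "(pochhammer a (i+j) / (fact i * fact j) * x^i * y^j) * (1 - z) powr (- (a + real (i+j))) =
   x^i / fact i * (pochhammer a (i+j) / fact j * y^j * (1-z) powr (-(a+real i)-real j))"
  unfolding e by simp
 show ?thesis using h unfolding e1 e2 .
qed

lemma trinom_level2:
 fixes a x y z :: real
 assumes "a > 0" "\<bar>y\<bar> < 1 - z"
 shows "((%j. x^i / fact i * (pochhammer a (i+j) / fact j * y^j * (1-z) powr (-(a+real i)-real j))) has_sum
  pochhammer a i / fact i * x^i * (1 - z - y) powr (- a - real i)) UNIV"
proof -
 have h: "((%j. (pochhammer a i / fact i * x^i) * (pochhammer (a + real i) j / fact j * y^j * (1-z) powr (-(a+real i)-real j))) has_sum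
   (pochhammer a i / fact i * x^i) * (1 - z - y) powr (- (a + real i))) UNIV"
  by (intro has_sum_cmult_right powser_binomial_shift) (use assms in auto)
 have e1: "(pochhammer a i / fact i * x^i) * (pochhammer (a + real i) j / fact j * y^j * (1-z) powr (-(a+real i)-real j))
  = x^i / fact i * (pochhammer a (i+j) / fact j * y^j * (1-z) powr (-(a+real i)-real j))" for j
  by (simp add: pochhammer_product'[of a i])
 have e2: "- (a + real i) = - a - real i" by simp
 show ?thesis using h unfolding e1 unfolding e2 .
qed

text \<open>Three nested binomial series. Summability on triples follows from the same computation
  at |x|, |y|, |z|.\<close>

lemma trinom_has_sum:
 assumes a: "a > 0" and xyz: "\<bar>x\<bar> + \<bar>y\<bar> + \<bar>z\<bar> < 1"
 shows "(trinom a x y z has_sum (1 - x - y - z) powr (-a)) UNIV"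
  and "(%p. \<bar>trinom a x y z p\<bar>) summable_on UNIV"
proof -
 have e: "1 - x - y - z = 1 - z - y - x" by simp
 have 2: "((%jk. trinom a x y z (i,jk)) has_sum pochhammer a i / fact i * x^i * (1 - z - y) powr (- a - real i)) UNIV"
  "(%jk. \<bar>trinom a x y z (i,jk)\<bar>) summable_on UNIV"
  if xyz: "\<bar>x\<bar> + \<bar>y\<bar> + \<bar>z\<bar> < 1" for i x y z
 proof -
  have l1: "((%k. trinom a x y z (i,j,k)) has_sum x^i / fact i * (pochhammer a (i+j) / fact j * y^j * (1-z) powr (-(a+real i)-real j))) UNIV" for j
   by (rule trinom_level1) (use a xyz in auto)
  have l1': "((%k. \<bar>trinom a x y z (i,j,k)\<bar>) has_sum \<bar>x\<bar>^i / fact i * (pochhammer a (i+j) / fact j * \<bar>y\<bar>^j * (1-\<bar>z\<bar>) powr (-(a+real i)-real j))) UNIV" for j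
   unfolding trinom_abs[OF a] by (rule trinom_level1) (use a xyz in auto)
  have l2: "((%j. x^i / fact i * (pochhammer a (i+j) / fact j * y^j * (1-z) powr (-(a+real i)-real j))) has_sum
   pochhammer a i / fact i * x^i * (1 - z - y) powr (- a - real i)) UNIV"
   by (rule trinom_level2) (use a xyz in auto)
  have l2': "((%j. \<bar>x\<bar>^i / fact i * (pochhammer a (i+j) / fact j * \<bar>y\<bar>^j * (1-\<bar>z\<bar>) powr (-(a+real i)-real j))) has_sum
   pochhammer a i / fact i * \<bar>x\<bar>^i * (1 - \<bar>z\<bar> - \<bar>y\<bar>) powr (- a - real i)) UNIV"
   by (rule trinom_level2) (use a xyz in auto)
  show "((%jk. trinom a x y z (i,jk)) has_sum pochhammer a i / fact i * x^i * (1 - z - y) powr (- a - real i)) UNIV"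
   "(%jk. \<bar>trinom a x y z (i,jk)\<bar>) summable_on UNIV"
   using has_sum_SigmaI_abs[OF l1 l2 l1' has_sum_imp_summable[OF l2']] by auto
 qed
 have l3: "((%i. pochhammer a i / fact i * x^i * (1 - z - y) powr (- a - real i)) has_sum (1 - x - y - z) powr (-a)) UNIV"
  unfolding e by (rule powser_binomial_shift) (use a xyz in auto)
 have l3': "((%i. pochhammer a i / fact i * \<bar>x\<bar>^i * (1 - \<bar>z\<bar> - \<bar>y\<bar>) powr (- a - real i)) has_sum (1 - \<bar>z\<bar> - \<bar>y\<bar> - \<bar>x\<bar>) powr (-a)) UNIV"
  by (rule powser_binomial_shift) (use a xyz in auto)
 have 3: "((%jk. \<bar>trinom a x y z (i,jk)\<bar>) has_sum pochhammer a i / fact i * \<bar>x\<bar>^i * (1 - \<bar>z\<bar> - \<bar>y\<bar>) powr (- a - real i)) UNIV" for i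
  unfolding trinom_abs[OF a] by (rule 2(1)) (use xyz in auto)
 show "(trinom a x y z has_sum (1 - x - y - z) powr (-a)) UNIV"
  "(%p. \<bar>trinom a x y z p\<bar>) summable_on UNIV"
  using has_sum_SigmaI_abs[OF 2(1)[OF xyz] l3 3 has_sum_imp_summable[OF l3']] by auto
qed

text \<open>The principal power, set to 0 outside the right half-plane. The cutoff makes it Borel
  measurable on the whole plane, and inside the half-plane it stays holomorphic.\<close>

definition cpw :: "real => complex => complex" where
 "cpw a z = indicator {z. 0 < Re z} z *\<^sub>R (z powr cor a)"

text \<open>The function Re (P + i sqrt Y)^(-s). The real part removes the odd powers of sqrt Y, so
  this is a power series in Y.\<close>

definition Kr :: "real => real => real => real" where
 "Kr s P Y = Re (cpw (-s) (Complex P (sqrt Y)))"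

text \<open>The even part of the binomial series for (1 + i y)^(-s) with y = sqrt Y / S < 1; the odd
  terms are purely imaginary.\<close>

lemma has_sum_Kr:
 assumes s: "s > 0" and S: "S > 0" and Y: "0 <= Y" "Y < S^2"
 shows "((%m. pochhammer s (2*m) / fact (2*m) * (-Y)^m * S powr (- s - real (2*m))) has_sum Kr s S Y) UNIV"
  and "(%m. pochhammer s (2*m) / fact (2*m) * Y^m * S powr (- s - real (2*m))) summable_on UNIV"
proof -
 define y where "y = sqrt Y / S"
 have y: "0 <= y" "y < 1" using Y S real_sqrt_less_mono[OF Y(2)] by (auto simp: y_def)
 have SY: "Complex S (sqrt Y) = cor S * (1 + \<i> * y)"
  using S by (simp add: y_def complex_eq_iff)
 have y2: "y^2 = Y / S^2" using Y by (simp add: y_def power_divide)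
 define t where "t n = ((- cor s) gchoose n) * (\<i> * y) ^ n" for n
 have gb: "((- cor s) gchoose n) = cor ((-1)^n * pochhammer s n / fact n)" for n
  by (simp add: gbinomial_pochhammer pochhammer_of_real)
 have nt: "norm (t n) = pochhammer s n / fact n * y ^ n" for n
 proof -
  have "norm (t n) = \<bar>(-1)^n * pochhammer s n / fact n\<bar> * y^n"
   unfolding t_def gb norm_mult norm_power norm_of_real using y by simp
  then show ?thesis using pochhammer_pos[OF s, of n] by (simp add: abs_mult)
 qed
 have sm: "summable (%n. norm (t n))"
  unfolding nt using powser_binomial[OF s, of y] y by (intro sums_summable[OF has_sum_imp_sums]) auto
 have "t sums (1 + \<i> * y) powr (- cor s)"
  unfolding t_def by (rule gen_binomial_complex) (use y in \<open>simp add: norm_mult\<close>)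
 from norm_summable_imp_has_sum[OF sm this] have hs: "(t has_sum (1 + \<i> * y) powr (- cor s)) UNIV" .
 have Re_t: "((%n. Re (t n)) has_sum Re ((1 + \<i> * y) powr (- cor s))) UNIV"
  using has_sum_bounded_linear[OF bounded_linear_Re hs] by (simp add: o_def)
 have even: "Re (t (2*m)) = pochhammer s (2*m) / fact (2*m) * (- Y / S^2)^m" for m
 proof -
  have "(\<i> * cor y) ^ (2*m) = cor ((- (y^2)) ^ m)"
   by (simp add: power_mult power_mult_distrib)
  then have te: "t (2*m) = cor (pochhammer s (2*m) / fact (2*m) * (- (y^2)) ^ m)"
   unfolding t_def gb by simp
  show ?thesis unfolding te Re_complex_of_real y2 by simp
 qed
 have odd: "Re (t n) = 0" if "n \<notin> range (%m. 2*m)" for n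
 proof -
  have "odd n" using that by (auto elim!: evenE)
  then obtain m where n: "n = 2*m+1" by (auto elim!: oddE)
  have "(\<i> * cor y) ^ n = \<i> * cor (y * (- (y^2)) ^ m)"
   unfolding n by (simp add: power_add power_mult power_mult_distrib)
  then show ?thesis unfolding t_def gb by (simp only: times_complex.sel Re_complex_of_real Im_complex_of_real imaginary_unit.sel) simp
 qed
 have "((%n. Re (t n)) has_sum Re ((1 + \<i> * y) powr (- cor s))) (range (%m. 2*m))"
  using Re_t by (rule has_sum_cong_neutral[THEN iffD1, rotated -1]) (auto simp: odd)
 then have ev: "((%m. pochhammer s (2*m) / fact (2*m) * (- Y / S^2)^m) has_sum Re ((1 + \<i> * y) powr (- cor s))) UNIV"
  by (subst (asm) has_sum_reindex) (auto simp: inj_on_def o_def even)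
 have sc: "S powr (-s) * (c * (z / S^2)^m) = c * z^m * S powr (- s - real (2*m))" for c z m
 proof -
  have "S powr (- s - real (2*m)) = S powr (-s) / S ^ (2*m)" using S by (simp only: powr_diff powr_realpow)
  then show ?thesis by (simp add: power_divide power_mult)
 qed
 have K: "Kr s S Y = S powr (-s) * Re ((1 + \<i> * y) powr (- cor s))"
 proof -
  have nz: "1 + \<i> * cor y ~= 0" by (auto simp: complex_eq_iff)
  have "(cor S * (1 + \<i> * y)) powr (- cor s) = cor (S powr (-s)) * (1 + \<i> * y) powr (- cor s)"
  proof -
   have nz2: "cor S * (1 + \<i> * y) ~= 0" using S nz by (simp only: mult_eq_0_iff of_real_eq_0_iff) simp
   have L: "Ln (cor S * (1 + \<i> * y)) = cor (ln S) + Ln (1 + \<i> * y)"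
    using Ln_times_of_real[OF S nz] S by (simp add: Ln_of_real)
   have "cor (S powr (-s)) = exp (- cor s * cor (ln S))"
    using S by (simp add: powr_def exp_of_real[symmetric])
   then show ?thesis using nz nz2 unfolding powr_def L by (simp only: if_False distrib_left exp_add)
  qed
  moreover have "cpw (-s) (Complex S (sqrt Y)) = (cor S * (1 + \<i> * y)) powr (- cor s)"
   unfolding SY[symmetric] using S by (simp add: cpw_def)
  ultimately show ?thesis unfolding Kr_def by simp
 qed
 show "((%m. pochhammer s (2*m) / fact (2*m) * (-Y)^m * S powr (- s - real (2*m))) has_sum Kr s S Y) UNIV"
  using has_sum_cmult_right[OF ev, of "S powr (-s)"] unfolding K sc .
 have "(%n. pochhammer s n / fact n * y ^ n) summable_on UNIV"
  using powser_binomial[OF s, of y] y by (intro has_sum_imp_summable) auto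
 then have "(%n. pochhammer s n / fact n * y ^ n) summable_on (range (%m. 2*m))"
  by (rule summable_on_subset_banach) auto
 then have "(%m. pochhammer s (2*m) / fact (2*m) * (Y / S^2) ^ m) summable_on UNIV"
  by (subst (asm) summable_on_reindex) (auto simp: inj_on_def o_def power_mult y2)
 from summable_on_cmult_right[OF this, of "S powr (-s)"]
 show "(%m. pochhammer s (2*m) / fact (2*m) * Y^m * S powr (- s - real (2*m))) summable_on UNIV"
  unfolding sc .
qed

definition mon3 :: "real => real => real => nat \<times> nat \<times> nat => real" where
 "mon3 X Y Z = (%(x,y,w). X^x * Y^y * Z^w)"

lemma mon3_abs: "\<bar>mon3 X Y Z p\<bar> = mon3 \<bar>X\<bar> \<bar>Y\<bar> \<bar>Z\<bar> p"
 by (cases p) (auto simp: mon3_def abs_mult power_abs)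

definition tau3 :: "real => nat => nat \<times> nat \<times> nat => real" where
 "tau3 b m = (%(x,y,w). tau b m x y w)"

definition K3 :: "real => nat \<times> nat \<times> nat => real" where
 "K3 b = (%(x,y,w). K_cf b x y w)"

lemma tau_nonneg: "b > 1/2 ==> tau b m x y w >= 0"
 by (auto simp: tau_def rfact_def intro!: mult_nonneg_nonneg divide_nonneg_nonneg less_imp_le[OF pochhammer_pos])

definition kap_coeff :: "real => nat => real" where
 "kap_coeff b m = pochhammer (4*b-1) (2*m) / (pochhammer b m * fact m)"

lemma tau3_has_sum:
 assumes b: "b > 1/2" and XYZ: "\<bar>X\<bar> + \<bar>Y\<bar> + \<bar>Z\<bar> < 1"
 shows "((%p. tau3 b m p * mon3 X Y Z p) has_sum kap_coeff b m * (X*Y*Z)^m * (1 - X - Y - Z) powr (-(4*b-1) - real (2*m))) UNIV"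
proof -
 define C where "C = kap_coeff b m * (X*Y*Z)^m"
 define \<sigma> where "\<sigma> = (%(i,j,k). (i+m,j+m,k+m)) "
 have inj: "inj \<sigma>" by (auto simp: inj_def \<sigma>_def)
 have e: "- (4*b-1 + real (2*m)) = -(4*b-1) - real (2*m)" by simp
 have "((%p. C * trinom (4*b-1 + real (2*m)) X Y Z p) has_sum C * (1 - X - Y - Z) powr (- (4*b-1 + real (2*m)))) UNIV"
  by (intro has_sum_cmult_right trinom_has_sum(1)) (use b XYZ in auto)
 moreover have "C * trinom (4*b-1 + real (2*m)) X Y Z p = tau3 b m (\<sigma> p) * mon3 X Y Z (\<sigma> p)" for p
 proof (cases p)
  case (fields i j k)
  have n: "i+m+(j+m)+(k+m)-m = 2*m + (i+j+k)" by simp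
  have pp: "pochhammer (4*b-1) (i+m+(j+m)+(k+m)-m) = pochhammer (4*b-1) (2*m) * pochhammer (4*b-1 + real (2*m)) (i+j+k)"
   unfolding n by (rule pochhammer_product')
  show ?thesis unfolding fields C_def trinom_def \<sigma>_def tau3_def mon3_def kap_coeff_def tau_def prod.case pp
   by (simp add: rfact_def power_add power_mult_distrib) (simp add: mult_ac)?
 qed
 ultimately have "((%p. tau3 b m p * mon3 X Y Z p) has_sum C * (1 - X - Y - Z) powr (- (4*b-1 + real (2*m)))) (range \<sigma>)"
  by (subst has_sum_reindex[OF inj]) (simp add: o_def)
 then have "((%p. tau3 b m p * mon3 X Y Z p) has_sum C * (1 - X - Y - Z) powr (- (4*b-1 + real (2*m)))) UNIV"
 proof (rule has_sum_cong_neutral[THEN iffD1, rotated -1])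
  fix p assume p: "p \<in> UNIV - range \<sigma>"
  obtain x y w where xyw: "p = (x,y,w)" by (cases p)
  have "\<not> (m <= x & m <= y & m <= w)"
  proof
   assume "m <= x & m <= y & m <= w"
   then have "p = \<sigma> (x-m,y-m,w-m)" by (simp add: xyw \<sigma>_def)
   then show False using p by blast
  qed
  then show "tau3 b m p * mon3 X Y Z p = 0" by (auto simp: xyw tau3_def tau_eq_0 not_le)
 qed auto
 then show ?thesis unfolding C_def e .
qed

text \<open>By (2m)! = 4^m (1/2)_m m! the factor (1/2)_m / (b)_m splits off. It is the m-th moment
  of Beta(1/2,b-1/2), and what is left are the coefficients in the series of
  \<open>Kr\<close>.\<close>

lemma kap_coeff_eq:
 assumes "b > 1/2"
 shows "kap_coeff b m = pochhammer (4*b-1) (2*m) / fact (2*m) * 4^m * (pochhammer (1/2) m / pochhammer b m)"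
proof -
 have p: "pochhammer (1/2::real) m > 0" by (rule pochhammer_pos) simp
 have f: "fact (2*m) = (4^m * pochhammer (1/2) m * fact m :: real)" by (simp add: fact_double power_mult)
 show ?thesis unfolding kap_coeff_def f using p by simp
qed

lemma pochhammer_mono:
 fixes a c :: real
 assumes "0 < a" "a <= c" shows "pochhammer a m <= pochhammer c m"
 unfolding pochhammer_prod by (intro prod_mono) (use assms in auto)

lemma kap_coeff_bound:
 assumes "b > 1/2"
 shows "0 <= kap_coeff b m" "kap_coeff b m <= pochhammer (4*b-1) (2*m) / fact (2*m) * 4^m"
proof -
 show "0 <= kap_coeff b m" unfolding kap_coeff_def
  by (intro divide_nonneg_nonneg mult_nonneg_nonneg less_imp_le[OF pochhammer_pos]) (use assms in auto)
 have "pochhammer b m > 0" by (rule pochhammer_pos) (use assms in auto)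
 moreover have "pochhammer (1/2) m <= pochhammer b m" by (rule pochhammer_mono) (use assms in auto)
 ultimately have "pochhammer (1/2) m / pochhammer b m <= 1" by simp
 moreover have "pochhammer (4*b-1) (2*m) >= 0" by (intro less_imp_le[OF pochhammer_pos]) (use assms in auto)
 ultimately show "kap_coeff b m <= pochhammer (4*b-1) (2*m) / fact (2*m) * 4^m"
  unfolding kap_coeff_eq[OF assms] by (intro mult_left_le) auto
qed

lemma kap_summable:
 assumes b: "b > 1/2" and S: "S > 0" and W: "0 <= W" "4*W < S^2"
 shows "(%m. kap_coeff b m * W^m * S powr (-(4*b-1) - real (2*m))) summable_on UNIV"
proof (rule summable_on_comparison_test)
 show "(%m. pochhammer (4*b-1) (2*m) / fact (2*m) * (4*W)^m * S powr (-(4*b-1) - real (2*m))) summable_on UNIV"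
  by (rule has_sum_Kr(2)) (use assms in auto)
 fix m :: nat
 have "kap_coeff b m * W^m * S powr (-(4*b-1) - real (2*m)) <= (pochhammer (4*b-1) (2*m) / fact (2*m) * 4^m) * W^m * S powr (-(4*b-1) - real (2*m))"
  by (intro mult_right_mono kap_coeff_bound b) (use W in auto)
 then show "kap_coeff b m * W^m * S powr (-(4*b-1) - real (2*m)) <= pochhammer (4*b-1) (2*m) / fact (2*m) * (4*W)^m * S powr (-(4*b-1) - real (2*m))"
  by (simp add: power_mult_distrib mult_ac)
 show "0 <= kap_coeff b m * W^m * S powr (-(4*b-1) - real (2*m))"
  by (intro mult_nonneg_nonneg kap_coeff_bound b) (use W in auto)
qed

text \<open>The number 1/20 only has to be small enough for absolute convergence of the series over
  m and the exponents together.\<close>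

lemma small_kap:
 fixes X Y Z :: real
 assumes "\<bar>X\<bar> <= 1/20" "\<bar>Y\<bar> <= 1/20" "\<bar>Z\<bar> <= 1/20"
 shows "\<bar>X\<bar> + \<bar>Y\<bar> + \<bar>Z\<bar> < 1" "4 * \<bar>X*Y*Z\<bar> < (1 - \<bar>X\<bar> - \<bar>Y\<bar> - \<bar>Z\<bar>)^2"
proof -
 show "\<bar>X\<bar> + \<bar>Y\<bar> + \<bar>Z\<bar> < 1" using assms by linarith
 have "\<bar>X*Y*Z\<bar> <= 1/20 * (1/20) * (1/20)" unfolding abs_mult by (intro mult_mono assms) auto
 moreover have "(17/20)^2 <= (1 - \<bar>X\<bar> - \<bar>Y\<bar> - \<bar>Z\<bar>)^2" by (rule power_mono) (use assms in auto)
 ultimately show "4 * \<bar>X*Y*Z\<bar> < (1 - \<bar>X\<bar> - \<bar>Y\<bar> - \<bar>Z\<bar>)^2" by (simp add: power2_eq_square)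
qed

text \<open>The double sum over m and the exponents is taken in both orders. For fixed exponents the
  sum over m is finite and equals \<open>K_cf\<close>.\<close>

lemma K3_has_sum_aux:
 assumes b: "b > 1/2" and sm: "\<bar>X\<bar> <= 1/20" "\<bar>Y\<bar> <= 1/20" "\<bar>Z\<bar> <= 1/20"
  and kap: "((%m. kap_coeff b m * (X*Y*Z)^m * (1 - X - Y - Z) powr (-(4*b-1) - real (2*m))) has_sum \<kappa>) UNIV"
 shows "((%p. K3 b p * mon3 X Y Z p) has_sum \<kappa>) UNIV"
proof -
 note sk = small_kap[OF sm]
 define f where "f = (%(m,p). tau3 b m p * mon3 X Y Z p)"
 have ab: "\<bar>f (m,p)\<bar> = tau3 b m p * mon3 \<bar>X\<bar> \<bar>Y\<bar> \<bar>Z\<bar> p" for m p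
  using tau_nonneg[OF b] by (cases p) (simp add: f_def abs_mult mon3_abs tau3_def)
 have "(f has_sum \<kappa>) UNIV"
 proof (rule has_sum_SigmaI_abs(1)[OF _ kap])
  show "((%p. f (m,p)) has_sum kap_coeff b m * (X*Y*Z)^m * (1 - X - Y - Z) powr (-(4*b-1) - real (2*m))) UNIV" for m
   unfolding f_def prod.case by (rule tau3_has_sum[OF b sk(1)])
  show "((%p. \<bar>f (m,p)\<bar>) has_sum kap_coeff b m * (\<bar>X\<bar>*\<bar>Y\<bar>*\<bar>Z\<bar>)^m * (1 - \<bar>X\<bar> - \<bar>Y\<bar> - \<bar>Z\<bar>) powr (-(4*b-1) - real (2*m))) UNIV" for m
   unfolding ab by (rule tau3_has_sum[OF b]) (use sk in auto)
  show "(%m. kap_coeff b m * (\<bar>X\<bar>*\<bar>Y\<bar>*\<bar>Z\<bar>)^m * (1 - \<bar>X\<bar> - \<bar>Y\<bar> - \<bar>Z\<bar>) powr (-(4*b-1) - real (2*m))) summable_on UNIV"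
   by (rule kap_summable[OF b]) (use sk in \<open>auto simp: abs_mult\<close>)
 qed
 then have sw: "((%(p,m). f (m,p)) has_sum \<kappa>) (UNIV \<times> UNIV)"
  using has_sum_swap[of f UNIV UNIV \<kappa>] by simp
 have "((%m. (%(p,m). f (m,p)) (p,m)) has_sum K3 b p * mon3 X Y Z p) UNIV" for p
 proof -
  obtain x y w where p: "p = (x,y,w)" by (cases p)
  have "((%m. tau b m x y w * mon3 X Y Z p) has_sum (\<Sum>m\<le>x+y+w. tau b m x y w * mon3 X Y Z p)) UNIV"
   by (rule has_sum_finite_neutralI[of "{..x+y+w}"]) (auto simp: tau_eq_0)
  then show ?thesis unfolding f_def prod.case p tau3_def K3_def K_cf_def sum_distrib_right .
 qed
 from has_sum_SigmaD[OF sw this] show ?thesis .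
qed

lemma K_cf_nonneg: "b > 1/2 ==> K_cf b x y w >= 0"
 unfolding K_cf_def by (intro sum_nonneg tau_nonneg)

lemma K3_summable:
 assumes b: "b > 1/2" and sm: "\<bar>X\<bar> <= 1/20" "\<bar>Y\<bar> <= 1/20" "\<bar>Z\<bar> <= 1/20"
 shows "(%p. K3 b p * mon3 \<bar>X\<bar> \<bar>Y\<bar> \<bar>Z\<bar> p) summable_on UNIV"
proof -
 have "(%m. kap_coeff b m * (\<bar>X\<bar>*\<bar>Y\<bar>*\<bar>Z\<bar>)^m * (1 - \<bar>X\<bar> - \<bar>Y\<bar> - \<bar>Z\<bar>) powr (-(4*b-1) - real (2*m))) summable_on UNIV"
  by (rule kap_summable[OF b]) (use small_kap[OF sm] in \<open>auto simp: abs_mult\<close>)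
 then obtain \<kappa> where "((%m. kap_coeff b m * (\<bar>X\<bar>*\<bar>Y\<bar>*\<bar>Z\<bar>)^m * (1 - \<bar>X\<bar> - \<bar>Y\<bar> - \<bar>Z\<bar>) powr (-(4*b-1) - real (2*m))) has_sum \<kappa>) UNIV"
  by (auto simp: summable_on_def)
 then show ?thesis by (intro has_sum_imp_summable[OF K3_has_sum_aux[OF b]]) (use sm in auto)
qed

lemma Tker_has_sum:
 fixes \<rho> :: real
 assumes b: "b > 0" and \<rho>: "\<bar>\<rho>\<bar> < 1"
 shows "((%N. Tker b N n * \<rho>^N) has_sum \<rho>^n * (1 - \<rho>) powr (-2*b - n)) UNIV"
proof -
 have inj: "inj (%l. l + n)" by (auto simp: inj_def)
 have e: "- (2*b + real n) = - 2*b - n" by simp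
 have "((%l. \<rho>^n * (pochhammer (2*b + real n) l / fact l * \<rho>^l)) has_sum \<rho>^n * (1 - \<rho>) powr (- (2*b + real n))) UNIV"
  by (intro has_sum_cmult_right powser_binomial) (use b \<rho> in auto)
 moreover have "\<rho>^n * (pochhammer (2*b + real n) l / fact l * \<rho>^l) = Tker b (l + n) n * \<rho>^(l+n)" for l
  by (simp add: Tker_def rfact_def power_add)
 ultimately have "((%N. Tker b N n * \<rho>^N) has_sum \<rho>^n * (1 - \<rho>) powr (- (2*b + real n))) (range (%l. l + n))"
  by (subst has_sum_reindex[OF inj]) (simp add: o_def)
 then have "((%N. Tker b N n * \<rho>^N) has_sum \<rho>^n * (1 - \<rho>) powr (- (2*b + real n))) UNIV"
 proof (rule has_sum_cong_neutral[THEN iffD1, rotated -1])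
  fix N assume N: "N \<in> UNIV - range (%l. l + n)"
  have "N < n"
  proof (rule ccontr)
   assume "\<not> N < n"
   then have "N = (N - n) + n" by simp
   then show False using N by blast
  qed
  then show "Tker b N n * \<rho>^N = 0" by (simp add: Tker_eq_0)
 qed auto
 then show ?thesis unfolding e .
qed

section \<open>Powers in the right half-plane\<close>

lemma cpw_eq: "0 < Re z ==> cpw a z = z powr cor a"
 by (simp add: cpw_def)

lemma cpw_holomorphic: "cpw a holomorphic_on {z. 0 < Re z}"
proof -
 have "(%z. z powr cor a) holomorphic_on {z. 0 < Re z}"
  by (intro holomorphic_intros) (auto simp: complex_nonpos_Reals_iff)
 then show ?thesis by (rule holomorphic_transform) (simp add: cpw_eq)
qed

lemma open_right_halfplane: "open {z. 0 < Re z}"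
 by (rule open_halfspace_Re_gt)

lemma cpw_continuous_on: "continuous_on {z. 0 < Re z} (cpw a)"
 by (rule holomorphic_on_imp_continuous_on[OF cpw_holomorphic])

lemma continuous_on_cpw [continuous_intros]:
 assumes "continuous_on S f" "!!x. x \<in> S ==> 0 < Re (f x)"
 shows "continuous_on S (%x. cpw a (f x))"
 by (rule continuous_on_compose2[OF cpw_continuous_on assms(1)]) (use assms(2) in auto)

lemma tendsto_cpw:
 assumes "(f \<longlongrightarrow> z) F" "0 < Re z" shows "((%x. cpw a (f x)) \<longlongrightarrow> cpw a z) F"
proof -
 have "isCont (cpw a) z" using cpw_continuous_on open_right_halfplane assms(2)
  by (simp add: continuous_on_eq_continuous_at)
 then show ?thesis using assms(1) by (rule isCont_tendsto_compose)
qed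

lemma cpw_measurable [measurable]: "cpw a \<in> borel_measurable borel"
proof -
 have "continuous_on {z. 0 < Re z} (%z. z powr cor a)"
  using cpw_continuous_on[of a] by (rule continuous_on_eq) (simp add: cpw_eq)
 then have "(%z. indicator {z. 0 < Re z} z *\<^sub>R (z powr cor a)) \<in> borel_measurable borel"
  by (intro borel_measurable_continuous_on_indicator) (auto simp: borel_open open_right_halfplane)
 then show ?thesis by (simp add: cpw_def[abs_def])
qed

lemma norm_cpw: "0 < Re z ==> norm (cpw a z) = norm z powr a"
 by (simp add: cpw_eq norm_powr_real_powr')

lemma cpw_of_real: "0 < x ==> cpw a (cor x) = cor (x powr a)"
 by (simp add: cpw_eq powr_of_real)

lemma cpw_cnj: "0 < Re z ==> cpw a (cnj z) = cnj (cpw a z)"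
 by (simp add: cpw_eq cnj_powr complex_nonpos_Reals_iff)

lemma Kr_measurable [measurable]:
 assumes [measurable]: "f \<in> borel_measurable M" "g \<in> borel_measurable M"
 shows "(%x. Kr s (f x) (g x)) \<in> borel_measurable M"
proof -
 have e: "Complex P y = cor P + \<i> * cor y" for P y by (simp add: complex_eq_iff)
 show ?thesis unfolding Kr_def e by measurable
qed

lemma norm_Complex_sqrt: "0 <= Y ==> norm (Complex P (sqrt Y)) = sqrt (P^2 + Y)"
 by (simp add: complex_norm)

lemma Kr_bound:
 assumes "0 < P" "0 <= Y" shows "\<bar>Kr s P Y\<bar> <= (P^2 + Y) powr (-s/2)"
proof -
 have "\<bar>Kr s P Y\<bar> <= norm (cpw (-s) (Complex P (sqrt Y)))" unfolding Kr_def by (rule abs_Re_le_cmod)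
 also have "\<dots> = sqrt (P^2 + Y) powr (-s)" using assms by (simp add: norm_cpw norm_Complex_sqrt)
 also have "\<dots> = (P^2 + Y) powr (-s/2)" using assms by (simp add: powr_half_sqrt[symmetric] powr_powr)
 finally show ?thesis .
qed

lemma Kr_0: "0 < P ==> Kr s P 0 = P powr (-s)"
 by (simp add: Kr_def complex_of_real_def[symmetric] cpw_of_real)

lemma Kr_scale:
 assumes "0 < c" "0 < P" "0 <= Y" shows "Kr s (c * P) (c^2 * Y) = c powr (-s) * Kr s P Y"
proof -
 have e: "Complex (c * P) (sqrt (c^2 * Y)) = cor c * Complex P (sqrt Y)"
  using assms by (simp add: complex_eq_iff real_sqrt_mult)
 have nz: "Complex P (sqrt Y) ~= 0" using assms by (simp add: complex_eq_iff)
 have "cpw (-s) (cor c * Complex P (sqrt Y)) = cor (c powr (-s)) * cpw (-s) (Complex P (sqrt Y))"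
 proof -
  have L: "Ln (cor c * Complex P (sqrt Y)) = cor (ln c) + Ln (Complex P (sqrt Y))"
   using Ln_times_of_real[OF assms(1) nz] assms(1) by (simp add: Ln_of_real)
  have "cor (c powr (-s)) = exp (- cor s * cor (ln c))"
   using assms(1) by (simp add: powr_def exp_of_real[symmetric])
  moreover have "cor c * Complex P (sqrt Y) ~= 0" using nz assms(1) by (simp only: mult_eq_0_iff of_real_eq_0_iff) simp
  moreover have "0 < Re (cor c * Complex P (sqrt Y))" using assms by simp
  ultimately show ?thesis using nz assms(2) unfolding powr_def L
   by (simp only: cpw_eq complex.sel powr_def L if_False distrib_left exp_add of_real_minus)
 qed
 then show ?thesis unfolding Kr_def e by simp
qed

lemma tendsto_Kr:
 assumes "(f \<longlongrightarrow> P) F" "(g \<longlongrightarrow> Y) F" "0 < P"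
 shows "((%x. Kr s (f x) (g x)) \<longlongrightarrow> Kr s P Y) F"
 unfolding Kr_def
 by (intro tendsto_Re tendsto_cpw tendsto_Complex tendsto_real_sqrt assms) (use assms in auto)

section \<open>Beta distributions and the integral for F\<close>

text \<open>The Beta(p,q) distribution as a measure on the line.\<close>

definition bet :: "real => real => real measure" where
 "bet p q = density lborel (%t. ennreal (indicator {0<..<1} t * (t powr (p-1) * (1-t) powr (q-1) / Beta p q)))"

lemma sets_bet [measurable_cong, simp]: "sets (bet p q) = sets borel"
 by (simp add: bet_def)

lemma space_bet [simp]: "space (bet p q) = UNIV"
 by (simp add: bet_def)

lemma Beta_real_pos: "0 < p ==> 0 < q ==> 0 < Beta p (q::real)"
 by (simp add: Beta_def Gamma_real_pos)

lemma nn_integral_bet: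
 assumes "0 < p" "0 < q" "0 < p + a" "0 < q + c"
 shows "(\<integral>\<^sup>+t. ennreal (t powr a * (1-t) powr c) \<partial>bet p q) = ennreal (Beta (p+a) (q+c) / Beta p q)"
proof -
 have "(\<integral>\<^sup>+t. ennreal (t powr a * (1-t) powr c) \<partial>bet p q) =
  (\<integral>\<^sup>+t. ennreal (indicator {0<..<1} t * (t powr (p-1) * (1-t) powr (q-1) / Beta p q)) * ennreal (t powr a * (1-t) powr c) \<partial>lborel)"
  unfolding bet_def by (rule nn_integral_density) auto
 also have "\<dots> = (\<integral>\<^sup>+t. ennreal (indicator {0<..<1} t * (t powr (p+a-1) * (1-t) powr (q+c-1) / Beta p q)) \<partial>lborel)"
 proof (rule nn_integral_cong)
  fix t :: real
  show "ennreal (indicator {0<..<1} t * (t powr (p-1) * (1-t) powr (q-1) / Beta p q)) * ennreal (t powr a * (1-t) powr c) =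
    ennreal (indicator {0<..<1} t * (t powr (p+a-1) * (1-t) powr (q+c-1) / Beta p q))"
   using Beta_real_pos[OF assms(1,2)]
   by (cases "t \<in> {0<..<1}") (auto simp: ennreal_mult[symmetric] powr_add[symmetric] algebra_simps add_divide_distrib[symmetric] intro!: arg_cong[of _ _ ennreal])
 qed
 also have "\<dots> = ennreal (Beta (p+a) (q+c) / Beta p q)"
 proof (rule nn_integral_has_integral_lborel)
  have "((%t. t powr (p+a-1) * (1-t) powr (q+c-1) / Beta p q) has_integral (Beta (p+a) (q+c) / Beta p q)) {0..1}"
   using has_integral_divide[OF has_integral_Beta_real[OF assms(3,4)], of "Beta p q"] by simp
  then have "((%t. t powr (p+a-1) * (1-t) powr (q+c-1) / Beta p q) has_integral (Beta (p+a) (q+c) / Beta p q)) {0<..<1}"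
   by (simp add: has_integral_Icc_iff_Ioo)
  then show "((%t. indicator {0<..<1} t * (t powr (p+a-1) * (1-t) powr (q+c-1) / Beta p q)) has_integral Beta (p+a) (q+c) / Beta p q) UNIV"
   by (subst (asm) has_integral_restrict_UNIV[symmetric]) (auto elim!: has_integral_eq_rhs has_integral_eq[rotated] simp: indicator_def)
 qed (use Beta_real_pos[OF assms(1,2)] in auto)
 finally show ?thesis .
qed

lemma AE_bet:
 shows "AE t in bet p q. 0 < t & t < 1"
 unfolding bet_def by (subst AE_density) (auto simp: indicator_def)

lemma prob_space_bet: "0 < p ==> 0 < q ==> prob_space (bet p q)"
proof (rule prob_spaceI)
 assume pq: "0 < p" "0 < q"
 have "emeasure (bet p q) (space (bet p q)) = (\<integral>\<^sup>+t. 1 \<partial>bet p q)" by simp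
 also have "\<dots> = (\<integral>\<^sup>+t. ennreal (t powr 0 * (1-t) powr 0) \<partial>bet p q)"
  by (rule nn_integral_cong_AE) (use AE_bet[of p q] in \<open>auto elim: eventually_mono\<close>)
 also have "\<dots> = 1" using nn_integral_bet[of p q 0 0] pq Beta_real_pos[of p q] by simp
 finally show "emeasure (bet p q) (space (bet p q)) = 1" .
qed

lemma integral_bet:
 assumes "0 < p" "0 < q" "0 < p + a" "0 < q + c"
 shows "integrable (bet p q) (%t. t powr a * (1-t) powr c)"
  and "(\<integral>t. t powr a * (1-t) powr c \<partial>bet p q) = Beta (p+a) (q+c) / Beta p q"
proof -
 have pos: "0 <= Beta (p+a) (q+c) / Beta p q" using Beta_real_pos[of p q] Beta_real_pos[of "p+a" "q+c"] assms by simp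
 show i: "integrable (bet p q) (%t. t powr a * (1-t) powr c)"
  by (rule integrableI_nonneg) (auto simp: nn_integral_bet[OF assms])
 show "(\<integral>t. t powr a * (1-t) powr c \<partial>bet p q) = Beta (p+a) (q+c) / Beta p q"
  using pos nn_integral_eq_integral[OF i] by (simp add: nn_integral_bet[OF assms])
qed

lemma Beta_shift:
 assumes "0 < p" "0 < (q::real)"
 shows "Beta (p + real n) q / Beta p q = pochhammer p n / pochhammer (p+q) n"
proof -
 have g: "Gamma x ~= 0" if "0 < x" for x :: real using Gamma_real_pos[OF that] by simp
 have g4: "Gamma p ~= 0" "Gamma q ~= 0" "Gamma (p+q) ~= 0" "Gamma (p + q + real n) ~= 0"
  using assms by (auto intro!: g)
 have n: "p \<notin> \<int>\<^sub>\<le>\<^sub>0" "p + q \<notin> \<int>\<^sub>\<le>\<^sub>0" using assms by (auto elim!: nonpos_Ints_cases)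
 have e: "p + real n + q = p + q + real n" by simp
 show ?thesis unfolding Beta_def pochhammer_Gamma[OF n(1)] pochhammer_Gamma[OF n(2)] e using g4 by simp
qed

lemma moment_bet:
 assumes "0 < p" "0 < q"
 shows "integrable (bet p q) (%t. t ^ n)" "(\<integral>t. t ^ n \<partial>bet p q) = pochhammer p n / pochhammer (p+q) n"
proof -
 have e: "AE t in bet p q. t powr (real n) * (1-t) powr 0 = t ^ n"
  using AE_bet[of p q] by (rule eventually_mono) (simp add: powr_realpow)
 have i: "integrable (bet p q) (%t. t powr (real n) * (1-t) powr 0)" by (rule integral_bet) (use assms in auto)
 show "integrable (bet p q) (%t. t ^ n)"
  using i by (rule integrable_cong_AE_imp) (use e in \<open>auto elim: eventually_mono\<close>)
 have "(\<integral>t. t ^ n \<partial>bet p q) = (\<integral>t. t powr (real n) * (1-t) powr 0 \<partial>bet p q)"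
  by (rule integral_cong_AE) (use e in \<open>auto elim: eventually_mono\<close>)
 also have "\<dots> = Beta (p + real n) (q + 0) / Beta p q" by (rule integral_bet) (use assms in auto)
 finally show "(\<integral>t. t ^ n \<partial>bet p q) = pochhammer p n / pochhammer (p+q) n"
  using Beta_shift[OF assms] by simp
qed

text \<open>The law of independent t1, t2, t3, u: three Beta(b,b) variables and one Beta(1/2,b-1/2)
  variable.\<close>

definition M4 :: "real => (real \<times> real \<times> real \<times> real) measure" where
 "M4 b = bet b b \<Otimes>\<^sub>M (bet b b \<Otimes>\<^sub>M (bet b b \<Otimes>\<^sub>M bet (1/2) (b-1/2)))"

lemma sets_M4 [measurable_cong]: "sets (M4 b) = sets (borel \<Otimes>\<^sub>M (borel \<Otimes>\<^sub>M (borel \<Otimes>\<^sub>M borel)))"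
 unfolding M4_def by (intro sets_pair_measure_cong sets_bet)

lemma space_M4 [simp]: "space (M4 b) = UNIV"
 by (simp add: M4_def space_pair_measure)

lemma prob_space_M4:
 assumes "b > 1/2"
 shows "prob_space (bet b b)" "prob_space (bet (1/2) (b-1/2))"
  "prob_space (bet b b \<Otimes>\<^sub>M bet (1/2) (b-1/2))"
  "prob_space (bet b b \<Otimes>\<^sub>M (bet b b \<Otimes>\<^sub>M bet (1/2) (b-1/2)))" "prob_space (M4 b)"
proof -
 show 1: "prob_space (bet b b)" "prob_space (bet (1/2) (b-1/2))"
  using assms by (auto intro!: prob_space_bet)
 show 2: "prob_space (bet b b \<Otimes>\<^sub>M bet (1/2) (b-1/2))" by (rule prob_space_pair[OF 1])
 show 3: "prob_space (bet b b \<Otimes>\<^sub>M (bet b b \<Otimes>\<^sub>M bet (1/2) (b-1/2)))" by (rule prob_space_pair[OF 1(1) 2])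
 show "prob_space (M4 b)" unfolding M4_def by (rule prob_space_pair[OF 1(1) 3])
qed

lemma AE_pair_prob:
 assumes "prob_space M1" "prob_space M2" "Measurable.pred (M1 \<Otimes>\<^sub>M M2) P"
  and "AE x in M1. AE y in M2. P (x, y)"
 shows "AE p in M1 \<Otimes>\<^sub>M M2. P p"
proof -
 interpret pair_sigma_finite M1 M2
  using assms by (auto simp: pair_sigma_finite_def prob_space_imp_sigma_finite)
 show ?thesis by (rule AE_pair_measure) (use assms in auto)
qed

lemma AE_pair_conj:
 assumes M: "prob_space M1" "prob_space M2" and [measurable]: "Measurable.pred M1 P" "Measurable.pred M2 Q"
  and "AE x in M1. P x" and Q: "AE y in M2. Q y"
 shows "AE p in M1 \<Otimes>\<^sub>M M2. P (fst p) & Q (snd p)"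
proof (rule AE_pair_prob[OF M])
 show "AE x in M1. AE y in M2. P (fst (x, y)) & Q (snd (x, y))"
  using assms(5) by (rule eventually_mono) (use Q in auto)
qed measurable

lemma AE_M4:
 assumes "b > 1/2"
 shows "AE p in M4 b. case p of (t1,t2,t3,u) => (0 < t1 & t1 < 1) & (0 < t2 & t2 < 1) & (0 < t3 & t3 < 1) & (0 < u & u < 1)"
proof -
 note P = prob_space_M4[OF assms]
 have 1: "AE p in bet b b \<Otimes>\<^sub>M bet (1/2) (b-1/2). (0 < fst p & fst p < 1) & (0 < snd p & snd p < 1)"
  by (rule AE_pair_conj[OF P(1,2) _ _ AE_bet AE_bet]) measurable
 have 2: "AE p in bet b b \<Otimes>\<^sub>M (bet b b \<Otimes>\<^sub>M bet (1/2) (b-1/2)). (0 < fst p & fst p < 1) &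
   (0 < fst (snd p) & fst (snd p) < 1) & (0 < snd (snd p) & snd (snd p) < 1)"
  by (rule AE_pair_conj[OF P(1,3) _ _ AE_bet 1]) measurable
 have 3: "AE p in M4 b. (0 < fst p & fst p < 1) & (0 < fst (snd p) & fst (snd p) < 1) &
   (0 < fst (snd (snd p)) & fst (snd (snd p)) < 1) & (0 < snd (snd (snd p)) & snd (snd (snd p)) < 1)"
  unfolding M4_def by (rule AE_pair_conj[OF P(1,4) _ _ AE_bet 2]) measurable
 show ?thesis using 3 by (rule eventually_mono) auto
qed

lemma integrable_pair_mult:
 fixes f :: "'a => real" and g :: "'b => real"
 assumes M: "prob_space M1" "prob_space M2" and f: "integrable M1 f" and g: "integrable M2 g"
 shows "integrable (M1 \<Otimes>\<^sub>M M2) (%(x,y). f x * g y)"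
  and "(\<integral>p. (case p of (x,y) => f x * g y) \<partial>(M1 \<Otimes>\<^sub>M M2)) = (\<integral>x. f x \<partial>M1) * (\<integral>y. g y \<partial>M2)"
proof -
 interpret pair_sigma_finite M1 M2
  using M by (auto simp: pair_sigma_finite_def prob_space_imp_sigma_finite)
 have [measurable]: "f \<in> borel_measurable M1" "g \<in> borel_measurable M2" using f g by auto
 show i: "integrable (M1 \<Otimes>\<^sub>M M2) (%(x,y). f x * g y)"
  by (rule Fubini_integrable) (use f g in \<open>auto simp: abs_mult\<close>)
 show "(\<integral>p. (case p of (x,y) => f x * g y) \<partial>(M1 \<Otimes>\<^sub>M M2)) = (\<integral>x. f x \<partial>M1) * (\<integral>y. g y \<partial>M2)"
  using integral_fst[of "%x y. f x * g y", OF i] by simp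
qed

lemma integral_M4_mult:
 fixes f1 f2 f3 g :: "real => real"
 assumes b: "b > 1/2" and f: "integrable (bet b b) f1" "integrable (bet b b) f2" "integrable (bet b b) f3" "integrable (bet (1/2) (b-1/2)) g"
 shows "integrable (M4 b) (%(t1,t2,t3,u). f1 t1 * (f2 t2 * (f3 t3 * g u)))"
  and "(\<integral>p. (case p of (t1,t2,t3,u) => f1 t1 * (f2 t2 * (f3 t3 * g u))) \<partial>M4 b) =
   (\<integral>t. f1 t \<partial>bet b b) * ((\<integral>t. f2 t \<partial>bet b b) * ((\<integral>t. f3 t \<partial>bet b b) * (\<integral>u. g u \<partial>bet (1/2) (b-1/2))))"
proof -
 note P = prob_space_M4[OF b]
 note i1 = integrable_pair_mult[OF P(1,2) f(3,4)]
 note i2 = integrable_pair_mult[OF P(1,3) f(2) i1(1)]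
 note i3 = integrable_pair_mult[OF P(1,4) f(1) i2(1)]
 have e: "(%(t1,t2,t3,u). f1 t1 * (f2 t2 * (f3 t3 * g u))) = (%(x, y). f1 x * (case y of (x, y) => f2 x * (case y of (x, y) => f3 x * g y)))"
  by auto
 show "integrable (M4 b) (%(t1,t2,t3,u). f1 t1 * (f2 t2 * (f3 t3 * g u)))"
  unfolding M4_def e by (rule i3(1))
 show "(\<integral>p. (case p of (t1,t2,t3,u) => f1 t1 * (f2 t2 * (f3 t3 * g u))) \<partial>M4 b) =
   (\<integral>t. f1 t \<partial>bet b b) * ((\<integral>t. f2 t \<partial>bet b b) * ((\<integral>t. f3 t \<partial>bet b b) * (\<integral>u. g u \<partial>bet (1/2) (b-1/2))))"
  unfolding M4_def e i3(2) i2(2) i1(2) ..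
qed

definition pol :: "real => real => real => real" where
 "pol a1 a2 a3 = a2*a3 + a1*a3 + a1*a2 - 2*a1*a2*a3"

text \<open>Put a_i = 1 - \<rho>_i and w_i = \<rho>_i / a_i. On the cube this is (a1 a2 a3)^(-2b) Re
  (1 + w1 + w2 + w3 + 2i sqrt(w1 w2 w3 u))^(-(4b-1)), with the base multiplied by a1 a2 a3 so that
  no denominators remain at a_i = 0.\<close>

definition FI :: "real => real => real => real => real => real" where
 "FI b a1 a2 a3 u = (a1*a2*a3) powr (2*b-1) * Kr (4*b-1) (pol a1 a2 a3) (4*((1-a1)*(1-a2)*(1-a3))*(a1*a2*a3)*u)"

definition Fint :: "real => real^3 => real \<times> real \<times> real \<times> real => real" where
 "Fint b r = (%(t1,t2,t3,u). FI b (1 - r$1*t1) (1 - r$2*t2) (1 - r$3*t3) u)"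

definition Fbar :: "real => real^3 => real" where
 "Fbar b r = (\<integral>p. Fint b r p \<partial>M4 b)"

lemma Fint_measurable [measurable]: "Fint b r \<in> borel_measurable (M4 b)"
 unfolding Fint_def FI_def pol_def by measurable

lemma pol_ge:
 assumes "0 < a1" "a1 <= 1" "0 < a2" "a2 <= 1" "0 < a3" "a3 <= 1"
 shows "a1*a2 <= pol a1 a2 a3" "a2*a3 <= pol a1 a2 a3" "a1*a3 <= pol a1 a2 a3" "0 < pol a1 a2 a3"
proof -
 have *: "0 <= z * (x * (1-y) + y * (1-x))" if "0 < x" "x <= 1" "0 < y" "y <= 1" "0 < z" for x y z :: real
  using that by (intro mult_nonneg_nonneg add_nonneg_nonneg) auto
 show 1: "a1*a2 <= pol a1 a2 a3" using *[of a1 a2 a3] assms by (simp add: pol_def algebra_simps)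
 show "a2*a3 <= pol a1 a2 a3" using *[of a2 a3 a1] assms by (simp add: pol_def algebra_simps)
 show "a1*a3 <= pol a1 a2 a3" using *[of a1 a3 a2] assms by (simp add: pol_def algebra_simps)
 have "0 < a1 * a2" using assms by simp
 then show "0 < pol a1 a2 a3" using 1 by linarith
qed

text \<open>Two lower bounds that control |P + i sqrt Y|^2. For the first, P^2 alone suffices if
  some a_i \<ge> 1/2; otherwise all 1 - a_i exceed 1/2 and Y suffices. The second multiplies the
  three bounds in \<open>pol_ge\<close> and takes the power 2/3.\<close>

lemma pol_sq_ge:
 assumes a: "0 < a1" "a1 <= 1" "0 < a2" "a2 <= 1" "0 < a3" "a3 <= 1" and u: "0 < u" "u < 1"
 shows "a1*a2*a3*u/2 <= (pol a1 a2 a3)^2 + 4*((1-a1)*(1-a2)*(1-a3))*(a1*a2*a3)*u"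
  and "(a1*a2*a3) powr (4/3) <= (pol a1 a2 a3)^2"
proof -
 note p = pol_ge[OF a]
 define Pi where "Pi = a1*a2*a3"
 have Pi: "0 < Pi" using a by (simp add: Pi_def)
 have X0: "0 <= (1-a1)*(1-a2)*(1-a3)" using a by simp
 have half: "x * Pi <= (pol a1 a2 a3)^2" if "0 < x" "0 < y" "0 < z" "x*y <= pol a1 a2 a3" "x*z <= pol a1 a2 a3" "x*y*z = Pi" for x y z
 proof -
  have "(x*y)*(x*z) <= pol a1 a2 a3 * pol a1 a2 a3" by (intro mult_mono that) (use that p in auto)
  then show ?thesis using that(6) by (simp add: power2_eq_square mult_ac)
 qed
 have c: "Pi*u/2 <= x * Pi" if "1/2 <= x" for x
 proof -
  have "Pi * (u/2) <= Pi * x" by (intro mult_left_mono) (use that u Pi in auto)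
  then show ?thesis by (simp add: mult_ac)
 qed
 have X: "0 <= 4*((1-a1)*(1-a2)*(1-a3))*Pi*u" using X0 Pi u by simp
 consider "1/2 <= a1" | "1/2 <= a2" | "1/2 <= a3" | "a1 < 1/2" "a2 < 1/2" "a3 < 1/2" by linarith
 then have "Pi*u/2 <= (pol a1 a2 a3)^2 + 4*((1-a1)*(1-a2)*(1-a3))*Pi*u"
 proof cases
  case 1
  have "a1 * Pi <= (pol a1 a2 a3)^2" by (rule half[of a1 a2 a3]) (use p a in \<open>auto simp: Pi_def mult_ac\<close>)
  then show ?thesis using c[OF 1] X by linarith
 next
  case 2
  have "a2 * Pi <= (pol a1 a2 a3)^2" by (rule half[of a2 a1 a3]) (use p a in \<open>auto simp: Pi_def mult_ac\<close>)
  then show ?thesis using c[OF 2] X by linarith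
 next
  case 3
  have "a3 * Pi <= (pol a1 a2 a3)^2" by (rule half[of a3 a1 a2]) (use p a in \<open>auto simp: Pi_def mult_ac\<close>)
  then show ?thesis using c[OF 3] X by linarith
 next
  case 4
  have "(1/2)*(1/2)*(1/2) <= (1-a1)*(1-a2)*(1-a3)" by (intro mult_mono) (use 4 in auto)
  then have "(1/8) * (4*Pi*u) <= (1-a1)*(1-a2)*(1-a3) * (4*Pi*u)" by (intro mult_right_mono) (use Pi u in auto)
  moreover have "(1/8) * (4*Pi*u) = Pi*u/2" "(1-a1)*(1-a2)*(1-a3) * (4*Pi*u) = 4*((1-a1)*(1-a2)*(1-a3))*Pi*u"
   by (simp, simp only: mult_ac)
  ultimately show ?thesis using zero_le_power2[of "pol a1 a2 a3"] by linarith
 qed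
 then show "a1*a2*a3*u/2 <= (pol a1 a2 a3)^2 + 4*((1-a1)*(1-a2)*(1-a3))*(a1*a2*a3)*u"
  by (simp add: Pi_def)
 have "(a1*a2)*(a2*a3)*(a1*a3) <= pol a1 a2 a3 * pol a1 a2 a3 * pol a1 a2 a3"
  by (intro mult_mono p) (use a p in auto)
 moreover have "(a1*a2)*(a2*a3)*(a1*a3) = Pi^2" unfolding Pi_def power2_eq_square by (simp only: mult_ac)
 ultimately have "Pi^2 <= pol a1 a2 a3 ^ 3" by (simp only: power3_eq_cube)
 then have "(Pi^2) powr (2/3) <= (pol a1 a2 a3 ^ 3) powr (2/3)" by (intro powr_mono2) auto
 then show "(a1*a2*a3) powr (4/3) <= (pol a1 a2 a3)^2"
 proof -
  have "(Pi^2) powr (2/3) = Pi powr (4/3)" unfolding powr_realpow[OF Pi, symmetric] powr_powr by simp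
  moreover have "(pol a1 a2 a3 ^ 3) powr (2/3) = (pol a1 a2 a3)^2"
   unfolding powr_realpow[OF p(4), symmetric] powr_powr by simp
  ultimately show ?thesis using \<open>(Pi^2) powr (2/3) <= _\<close> unfolding Pi_def by simp
 qed
qed

text \<open>Interpolation between the two bounds of \<open>pol_sq_ge\<close>: the exponent (4b-1)/2
  is split into q and 2b - 1/2 - q.\<close>

lemma FI_bound:
 assumes a: "0 < a1" "a1 <= 1" "0 < a2" "a2 <= 1" "0 < a3" "a3 <= 1" and u: "0 < u" "u < 1"
  and b: "b > 1/2" and q: "0 <= q" "q <= 2*b - 1/2"
 shows "\<bar>FI b a1 a2 a3 u\<bar> <= 2 powr q * ((a1*a2*a3) powr (-((2*b+1-q)/3)) * u powr (-q))"
proof -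
 define Pi where "Pi = a1*a2*a3"
 define P where "P = pol a1 a2 a3"
 define Y where "Y = 4*((1-a1)*(1-a2)*(1-a3))*Pi*u"
 have Pi: "0 < Pi" using a by (simp add: Pi_def)
 have Y: "0 <= Y" using a u Pi by (simp add: Y_def)
 have P: "0 < P" unfolding P_def by (rule pol_ge[OF a])
 have s1: "Pi*u/2 <= P^2 + Y" using pol_sq_ge(1)[OF a u] by (simp add: Pi_def P_def Y_def)
 have s2: "Pi powr (4/3) <= P^2 + Y" using pol_sq_ge(2)[OF a u] Y by (simp add: Pi_def P_def)
 have "(P^2 + Y) powr (-(4*b-1)/2) = (P^2 + Y) powr (-q) * (P^2 + Y) powr (-(2*b - 1/2 - q))"
  unfolding powr_add[symmetric] by (rule arg_cong[of _ _ "%x. (P^2 + Y) powr x"]) (simp add: field_simps)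
 also have "\<dots> <= (Pi*u/2) powr (-q) * (Pi powr (4/3)) powr (-(2*b - 1/2 - q))"
 proof (rule mult_mono)
  have "0 < Pi*u/2" using Pi u by simp
  then show "(P^2 + Y) powr (-q) <= (Pi*u/2) powr (-q)"
   using s1 q by (intro powr_mono2') auto
  have "0 < Pi powr (4/3)" using Pi by simp
  then show "(P^2 + Y) powr (-(2*b - 1/2 - q)) <= (Pi powr (4/3)) powr (-(2*b - 1/2 - q))"
   by (rule powr_mono2'[rotated 1, OF _ s2]) (use q in linarith)
 qed (rule powr_ge_zero)+
 also have "\<dots> = 2 powr q * (Pi powr (- q - 4/3*(2*b-1/2-q)) * u powr (-q))"
 proof -
  have x: "(Pi*u/2) powr (-q) = Pi powr (-q) * u powr (-q) * 2 powr q"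
  proof -
   have "(Pi*u/2) powr (-q) = Pi powr (-q) * u powr (-q) / 2 powr (-q)"
    using Pi u by (simp only: powr_mult powr_divide)
   moreover have "(2::real) powr (-q) = inverse (2 powr q)" by (rule powr_minus)
   ultimately show ?thesis by (simp only: divide_inverse inverse_inverse_eq)
  qed
  have y: "(Pi powr (4/3)) powr (-(2*b - 1/2 - q)) = Pi powr (-(4/3*(2*b-1/2-q)))"
   unfolding powr_powr by (rule arg_cong[of _ _ "%x. Pi powr x"]) (simp add: field_simps)
  have z: "Pi powr (- q - 4/3*(2*b-1/2-q)) = Pi powr (-q) * Pi powr (-(4/3*(2*b-1/2-q)))"
   unfolding powr_add[symmetric] by simp
  show ?thesis unfolding x y z by (simp only: mult_ac)
 qed
 finally have K: "(P^2 + Y) powr (-(4*b-1)/2) <= \<dots>" .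
 have "\<bar>FI b a1 a2 a3 u\<bar> = Pi powr (2*b-1) * \<bar>Kr (4*b-1) P Y\<bar>"
  unfolding FI_def by (simp add: abs_mult Pi_def P_def Y_def)
 also have "\<dots> <= Pi powr (2*b-1) * (2 powr q * (Pi powr (- q - 4/3*(2*b-1/2-q)) * u powr (-q)))"
  by (intro mult_left_mono order_trans[OF Kr_bound[OF P Y] K]) auto
 also have "\<dots> = 2 powr q * ((Pi powr (2*b-1) * Pi powr (- q - 4/3*(2*b-1/2-q))) * u powr (-q))"
  by (simp only: mult_ac)
 also have "Pi powr (2*b-1) * Pi powr (- q - 4/3*(2*b-1/2-q)) = Pi powr (-((2*b+1-q)/3))"
  unfolding powr_add[symmetric] by (rule arg_cong[of _ _ "%x. Pi powr x"]) (simp add: field_simps)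
 finally show ?thesis by (simp add: Pi_def)
qed

text \<open>A number q strictly between 1-b and 1/2. By q < 1/2 the power u^(-q) is integrable for
  Beta(1/2,b-1/2); by q > 1-b the exponent p = (2b+1-q)/3 is below b, so (1-t)^(-p) is integrable
  for Beta(b,b).\<close>

definition maj_exp :: "real => real" where
 "maj_exp b = 1/2 - min (1/4) ((b - 1/2)/2)"

definition maj :: "real => real \<times> real \<times> real \<times> real => real" where
 "maj b = (%(t1,t2,t3,u). 2 powr maj_exp b * ((1-t1) powr (-((2*b+1-maj_exp b)/3)) * ((1-t2) powr (-((2*b+1-maj_exp b)/3)) *
   ((1-t3) powr (-((2*b+1-maj_exp b)/3)) * u powr (- maj_exp b)))))"

lemma maj_exp:
 assumes "b > 1/2"
 shows "0 <= maj_exp b" "maj_exp b < 1/2" "maj_exp b <= 2*b - 1/2" "(2*b+1-maj_exp b)/3 < b" "0 <= (2*b+1-maj_exp b)/3"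
 using assms by (auto simp: maj_exp_def min_def field_simps)

lemma integrable_bet_one:
 assumes "0 < p" "0 < q"
 shows "0 < p + a ==> integrable (bet p q) (%t. t powr a)"
  and "0 < q + c ==> integrable (bet p q) (%t. (1-t) powr c)"
proof -
 show "integrable (bet p q) (%t. t powr a)" if "0 < p + a"
 proof (rule integrable_cong_AE_imp)
  show "integrable (bet p q) (%t. t powr a * (1-t) powr 0)" by (rule integral_bet(1)) (use assms that in auto)
  show "AE t in bet p q. t powr a * (1-t) powr 0 = t powr a"
   using AE_bet[of p q] by (rule eventually_mono) auto
 qed measurable
 show "integrable (bet p q) (%t. (1-t) powr c)" if "0 < q + c"
 proof (rule integrable_cong_AE_imp)
  show "integrable (bet p q) (%t. t powr 0 * (1-t) powr c)" by (rule integral_bet(1)) (use assms that in auto)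
  show "AE t in bet p q. t powr 0 * (1-t) powr c = (1-t) powr c"
   using AE_bet[of p q] by (rule eventually_mono) auto
 qed measurable
qed

lemma maj_integrable: "b > 1/2 ==> integrable (M4 b) (maj b)"
proof -
 assume b: "b > 1/2"
 have i: "integrable (bet b b) (%t. (1-t) powr (-((2*b+1-maj_exp b)/3)))"
  by (rule integrable_bet_one) (use maj_exp[OF b] b in auto)
 have j: "integrable (bet (1/2) (b-1/2)) (%u. u powr (- maj_exp b))"
  by (rule integrable_bet_one) (use maj_exp[OF b] b in auto)
 from integrable_mult_right[OF integral_M4_mult(1)[OF b i i i j], of "2 powr maj_exp b"] show ?thesis
  by (rule Bochner_Integration.integrable_cong[THEN iffD1, rotated -1]) (auto simp: maj_def split: prod.splits)
qed

lemma FI_arg_bounds: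
 fixes r :: real
 assumes "0 <= r" "r <= 1" "0 < t" "t < 1"
 shows "1 - t <= 1 - r*t" "0 < 1 - r*t" "1 - r*t <= 1"
proof -
 have "r * t <= t" "0 <= r * t" using assms mult_right_mono[of r 1 t] by auto
 then show "1 - t <= 1 - r*t" "0 < 1 - r*t" "1 - r*t <= 1" using assms by linarith+
qed

text \<open>Since 1 - r t \<ge> 1 - t for r in [0,1], the bound of \<open>FI_bound\<close> is
  largest at r = 1; this makes \<open>maj\<close> independent of r.\<close>

lemma Fint_bound:
 assumes b: "b > 1/2" and r: "r \<in> closed_cube" and t: "0 < t1" "t1 < 1" "0 < t2" "t2 < 1" "0 < t3" "t3 < 1" "0 < u" "u < 1"
 shows "\<bar>Fint b r (t1,t2,t3,u)\<bar> <= maj b (t1,t2,t3,u)"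
proof -
 have r01: "0 <= r$i" "r$i <= 1" for i using r by (auto simp: closed_cube_def)
 note a1 = FI_arg_bounds[OF r01[of 1] t(1,2)]
 note a2 = FI_arg_bounds[OF r01[of 2] t(3,4)]
 note a3 = FI_arg_bounds[OF r01[of 3] t(5,6)]
 define a1 a2 a3 where "a1 = 1 - r$1*t1" and "a2 = 1 - r$2*t2" and "a3 = 1 - r$3*t3"
 define p where "p = (2*b+1-maj_exp b)/3"
 have p: "0 <= p" using maj_exp[OF b] by (simp add: p_def)
 have "\<bar>FI b a1 a2 a3 u\<bar> <= 2 powr maj_exp b * ((a1*a2*a3) powr (-p) * u powr (- maj_exp b))"
  unfolding p_def by (rule FI_bound) (use a1 a2 a3 t b maj_exp[OF b] in \<open>auto simp: a1_def a2_def a3_def\<close>)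
 also have "\<dots> <= 2 powr maj_exp b * (((1-t1)*(1-t2)*(1-t3)) powr (-p) * u powr (- maj_exp b))"
 proof (intro mult_left_mono mult_right_mono)
  have "0 < (1-t1)*(1-t2)*(1-t3)" using t by simp
  moreover have "(1-t1)*(1-t2)*(1-t3) <= a1*a2*a3"
   unfolding a1_def a2_def a3_def by (intro mult_mono a1 a2 a3 mult_nonneg_nonneg) (use a1 a2 a3 t in \<open>auto simp: less_imp_le\<close>)
  ultimately show "(a1*a2*a3) powr (-p) <= ((1-t1)*(1-t2)*(1-t3)) powr (-p)"
   using p by (intro powr_mono2') auto
 qed auto
 also have "((1-t1)*(1-t2)*(1-t3)) powr (-p) = (1-t1) powr (-p) * (1-t2) powr (-p) * (1-t3) powr (-p)"
  using t by (simp add: powr_mult)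
 finally show ?thesis
  unfolding Fint_def maj_def prod.case p_def[symmetric] a1_def a2_def a3_def by (simp only: mult_ac)
qed

lemma Fint_AE_bound:
 assumes "b > 1/2" "r \<in> closed_cube"
 shows "AE p in M4 b. norm (Fint b r p) <= maj b p"
 using AE_M4[OF assms(1)] by (rule eventually_mono) (use Fint_bound[OF assms] in auto)

lemma Fint_integrable:
 assumes "b > 1/2" "r \<in> closed_cube" shows "integrable (M4 b) (Fint b r)"
proof (rule Bochner_Integration.integrable_bound[OF maj_integrable[OF assms(1)]])
 show "AE p in M4 b. norm (Fint b r p) <= norm (maj b p)"
  using Fint_AE_bound[OF assms] by (rule eventually_mono) auto
qed measurable

lemma tendsto_FI:
 assumes "(f1 \<longlongrightarrow> a1) F" "(f2 \<longlongrightarrow> a2) F" "(f3 \<longlongrightarrow> a3) F"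
  and a: "0 < a1" "a1 <= 1" "0 < a2" "a2 <= 1" "0 < a3" "a3 <= 1"
 shows "((%x. FI b (f1 x) (f2 x) (f3 x) u) \<longlongrightarrow> FI b a1 a2 a3 u) F"
proof -
 have P: "((%x. pol (f1 x) (f2 x) (f3 x)) \<longlongrightarrow> pol a1 a2 a3) F"
  unfolding pol_def by (intro tendsto_intros assms)
 show ?thesis unfolding FI_def
  by (intro tendsto_mult tendsto_powr tendsto_Kr P pol_ge(4)[OF a]) (use a in \<open>auto intro!: tendsto_intros assms\<close>)
qed

text \<open>Dominated convergence with \<open>maj\<close> as the common majorant.\<close>

lemma Fbar_continuous:
 assumes b: "b > 1/2" shows "continuous_on closed_cube (Fbar b)"
proof (rule continuous_on_sequentiallyI)
 fix x :: "nat => real^3" and r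
 assume x: "\<forall>n. x n \<in> closed_cube" and r: "r \<in> closed_cube" and lim: "x \<longlonglongrightarrow> r"
 show "(%n. Fbar b (x n)) \<longlonglongrightarrow> Fbar b r" unfolding Fbar_def
 proof (rule integral_dominated_convergence[OF _ _ maj_integrable[OF b]])
  show "AE p in M4 b. (%n. Fint b (x n) p) \<longlonglongrightarrow> Fint b r p"
   using AE_M4[OF b]
  proof (rule eventually_mono)
   fix p :: "real \<times> real \<times> real \<times> real" assume p: "case p of (t1,t2,t3,u) => (0 < t1 & t1 < 1) & (0 < t2 & t2 < 1) & (0 < t3 & t3 < 1) & (0 < u & u < 1)"
   obtain t1 t2 t3 u where e: "p = (t1,t2,t3,u)" by (cases p)
   have r01: "0 <= r$i" "r$i <= 1" for i using r by (auto simp: closed_cube_def)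
   have l: "(%n. x n $ i) \<longlonglongrightarrow> r$i" for i by (rule tendsto_vec_nth[OF lim])
   show "(%n. Fint b (x n) p) \<longlonglongrightarrow> Fint b r p" unfolding Fint_def e prod.case
    by (intro tendsto_FI tendsto_intros l FI_arg_bounds r01) (use p e in auto)
  qed
  show "AE p in M4 b. norm (Fint b (x n) p) <= maj b p" for n
   by (rule Fint_AE_bound[OF b]) (use x in auto)
 qed measurable
qed

lemma integral_pos_prob:
 fixes f :: "'a => real"
 assumes M: "prob_space M" and i: "integrable M f" and pos: "AE x in M. 0 < f x"
 shows "0 < (\<integral>x. f x \<partial>M)"
proof -
 interpret prob_space M by (rule M)
 have nn: "AE x in M. 0 <= f x" using pos by (rule eventually_mono) auto
 have "(\<integral>x. f x \<partial>M) ~= 0"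
 proof
  assume "(\<integral>x. f x \<partial>M) = 0"
  then have "AE x in M. f x = 0" using integral_nonneg_eq_0_iff_AE[OF i nn] by simp
  with pos have "AE x in M. False" by eventually_elim auto
  then show False by simp
 qed
 moreover have "0 <= (\<integral>x. f x \<partial>M)" by (rule integral_nonneg_AE[OF nn])
 ultimately show ?thesis by simp
qed

text \<open>If some r_i is 0, then Y = 0 and the kernel reduces to the positive power
  P^(-(4b-1)).\<close>

lemma Fbar_pos_zero_face:
 assumes b: "b > 1/2" and r: "r \<in> closed_cube" and i: "r$i = 0"
 shows "0 < Fbar b r"
 unfolding Fbar_def
proof (rule integral_pos_prob[OF prob_space_M4(5)[OF b] Fint_integrable[OF b r]])
 show "AE p in M4 b. 0 < Fint b r p" using AE_M4[OF b]
 proof (rule eventually_mono)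
  fix p :: "real \<times> real \<times> real \<times> real" assume p: "case p of (t1,t2,t3,u) => (0 < t1 & t1 < 1) & (0 < t2 & t2 < 1) & (0 < t3 & t3 < 1) & (0 < u & u < 1)"
  obtain t1 t2 t3 u where e: "p = (t1,t2,t3,u)" by (cases p)
  have t: "0 < t1" "t1 < 1" "0 < t2" "t2 < 1" "0 < t3" "t3 < 1" using p e by auto
  have r01: "0 <= r$i" "r$i <= 1" for i using r by (auto simp: closed_cube_def)
  note a = FI_arg_bounds[OF r01[of 1] t(1,2)] FI_arg_bounds[OF r01[of 2] t(3,4)] FI_arg_bounds[OF r01[of 3] t(5,6)]
  have "i = 1 \<or> i = 2 \<or> i = 3" using exhaust_3 by blast
  then have X: "(1-(1-r$1*t1))*(1-(1-r$2*t2))*(1-(1-r$3*t3)) = 0" using i by auto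
  have P: "0 < pol (1-r$1*t1) (1-r$2*t2) (1-r$3*t3)" using a by (intro pol_ge) auto
  show "0 < Fint b r p" unfolding Fint_def e prod.case FI_def X
   using a P by (simp add: Kr_0)
 qed
qed

section \<open>Power series of the integral\<close>

text \<open>Termwise integration: the tail of the summable majorant B bounds the error of every
  finite partial sum, pointwise and hence after integration.\<close>

lemma has_sum_integral:
 fixes f :: "'i => 'a => real"
 assumes M: "prob_space M" and f: "!!i. integrable M (f i)" and g: "integrable M g"
  and B: "B summable_on UNIV" and sum: "AE x in M. ((%i. f i x) has_sum g x) UNIV & (\<forall>i. \<bar>f i x\<bar> <= B i)"
 shows "((%i. \<integral>x. f i x \<partial>M) has_sum (\<integral>x. g x \<partial>M)) UNIV"
proof -
 interpret prob_space M by (rule M)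
 define T where "T = infsum B UNIV"
 have le: "\<bar>(\<Sum>i\<in>X. \<integral>x. f i x \<partial>M) - (\<integral>x. g x \<partial>M)\<bar> <= T - sum B X" if X: "finite X" for X
 proof -
  have "(\<Sum>i\<in>X. \<integral>x. f i x \<partial>M) - (\<integral>x. g x \<partial>M) = (\<integral>x. (\<Sum>i\<in>X. f i x) - g x \<partial>M)"
   by (subst Bochner_Integration.integral_diff[OF Bochner_Integration.integrable_sum[OF f] g])
     (simp add: Bochner_Integration.integral_sum[OF f])
  also have "\<bar>\<dots>\<bar> <= (\<integral>x. \<bar>(\<Sum>i\<in>X. f i x) - g x\<bar> \<partial>M)" by (rule integral_abs_bound)
  also have "\<dots> <= (\<integral>x. T - sum B X \<partial>M)"
  proof (rule integral_mono_AE)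
   show "integrable M (%x. \<bar>(\<Sum>i\<in>X. f i x) - g x\<bar>)" by (intro integrable_abs Bochner_Integration.integrable_diff Bochner_Integration.integrable_sum f g)
   show "AE x in M. \<bar>(\<Sum>i\<in>X. f i x) - g x\<bar> <= T - sum B X" using sum
   proof (rule eventually_mono)
    fix x assume x: "((%i. f i x) has_sum g x) UNIV & (\<forall>i. \<bar>f i x\<bar> <= B i)"
    have "((%i. f i x) has_sum (g x - (\<Sum>i\<in>X. f i x))) (UNIV - X)"
     by (rule has_sum_Diff) (use x X in \<open>auto intro: has_sum_finite\<close>)
    moreover have "(B has_sum (T - sum B X)) (UNIV - X)"
     by (rule has_sum_Diff) (use B X in \<open>auto intro: has_sum_finite simp: T_def\<close>)
    ultimately have "norm (g x - (\<Sum>i\<in>X. f i x)) <= T - sum B X"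
     by (rule norm_infsum_le) (use x in auto)
    then show "\<bar>(\<Sum>i\<in>X. f i x) - g x\<bar> <= T - sum B X" by simp
   qed
  qed auto
  also have "\<dots> = T - sum B X" by (simp add: prob_space)
  finally show ?thesis .
 qed
 have "(sum B \<longlongrightarrow> T) (finite_subsets_at_top UNIV)"
  using has_sum_infsum[OF B] by (simp add: has_sum_def T_def)
 then have lim: "((%X. T - sum B X) \<longlongrightarrow> 0) (finite_subsets_at_top UNIV)"
  by (auto intro!: tendsto_eq_intros)
 have "((%X. (\<Sum>i\<in>X. \<integral>x. f i x \<partial>M) - (\<integral>x. g x \<partial>M)) \<longlongrightarrow> 0) (finite_subsets_at_top UNIV)"
 proof (rule Lim_null_comparison[OF _ lim])
  show "\<forall>\<^sub>F X in finite_subsets_at_top UNIV. norm ((\<Sum>i\<in>X. \<integral>x. f i x \<partial>M) - (\<integral>x. g x \<partial>M)) <= T - sum B X"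
   using eventually_finite_subsets_at_top_weakI[of UNIV "%X. norm ((\<Sum>i\<in>X. \<integral>x. f i x \<partial>M) - (\<integral>x. g x \<partial>M)) <= T - sum B X"] le by auto
 qed
 then show ?thesis unfolding has_sum_def by (simp add: LIM_zero_iff)
qed

text \<open>The series of \<open>Kr\<close> in Y = 4Wu is integrated termwise, and the moments of u
  restore \<open>kap_coeff\<close> by \<open>kap_coeff_eq\<close>.\<close>

lemma kap_has_sum:
 assumes b: "b > 1/2" and S: "S > 0" and W: "0 <= W" "4*W < S^2"
 shows "((%m. kap_coeff b m * (-W)^m * S powr (-(4*b-1) - real (2*m))) has_sum
  (\<integral>u. Kr (4*b-1) S (4*W*u) \<partial>bet (1/2) (b-1/2))) UNIV"
proof -
 define s where "s = 4*b-1"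
 have s: "s > 0" using b by (simp add: s_def)
 define M where "M = bet (1/2) (b-1/2)"
 have M: "prob_space M" unfolding M_def by (rule prob_space_M4[OF b])
 interpret prob_space M by (rule M)
 have [measurable_cong]: "sets M = sets borel" by (simp add: M_def)
 define f where "f m u = pochhammer s (2*m) / fact (2*m) * (-(4*W*u))^m * S powr (- s - real (2*m))" for m u
 define B where "B m = pochhammer s (2*m) / fact (2*m) * (4*W)^m * S powr (- s - real (2*m))" for m
 have mom: "integrable M (%u. u ^ m)" "(\<integral>u. u ^ m \<partial>M) = pochhammer (1/2) m / pochhammer b m" for m
  using moment_bet[of "1/2" "b-1/2" m] b by (auto simp: M_def)
 have fe: "f m u = (pochhammer s (2*m) / fact (2*m) * (-(4*W))^m * S powr (- s - real (2*m))) * u^m" for m u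
  unfolding f_def by (simp add: power_mult_distrib[symmetric] mult_ac)
 have "((%m. \<integral>u. f m u \<partial>M) has_sum (\<integral>u. Kr s S (4*W*u) \<partial>M)) UNIV"
 proof (rule has_sum_integral[OF M])
  show "integrable M (f m)" for m unfolding fe by (rule integrable_mult_right[OF mom(1)])
  show "integrable M (%u. Kr s S (4*W*u))"
  proof (rule integrable_const_bound[of _ "(S^2) powr (-s/2)"])
   show "AE u in M. norm (Kr s S (4*W*u)) <= (S^2) powr (-s/2)"
    using AE_bet[of "1/2" "b-1/2", folded M_def]
   proof (rule eventually_mono)
    fix u :: real assume u: "0 < u & u < 1"
    have "\<bar>Kr s S (4*W*u)\<bar> <= (S^2 + 4*W*u) powr (-s/2)" by (rule Kr_bound) (use S W u in auto)
    also have "\<dots> <= (S^2) powr (-s/2)" by (rule powr_mono2') (use S W u s in auto)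
    finally show "norm (Kr s S (4*W*u)) <= (S^2) powr (-s/2)" by simp
   qed
  qed measurable
  show "B summable_on UNIV" unfolding B_def by (rule has_sum_Kr(2)) (use s S W in auto)
  show "AE u in M. ((%m. f m u) has_sum Kr s S (4*W*u)) UNIV & (\<forall>m. \<bar>f m u\<bar> <= B m)"
   using AE_bet[of "1/2" "b-1/2", folded M_def]
  proof (rule eventually_mono)
   fix u :: real assume u: "0 < u & u < 1"
   have le: "4*W*u <= 4*W" using u W mult_left_le[of u "4*W"] by auto
   have "\<bar>f m u\<bar> <= B m" for m
   proof -
    have "\<bar>f m u\<bar> = pochhammer s (2*m) / fact (2*m) * (4*W*u)^m * S powr (- s - real (2*m))"
     unfolding f_def using pochhammer_pos[OF s, of "2*m"] W u by (simp add: abs_mult power_abs)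
    also have "\<dots> <= B m" unfolding B_def
     by (intro mult_right_mono mult_left_mono power_mono le) (use pochhammer_pos[OF s, of "2*m"] W u in auto)
    finally show ?thesis .
   qed
   moreover have "((%m. f m u) has_sum Kr s S (4*W*u)) UNIV"
    unfolding f_def by (rule has_sum_Kr(1)) (use s S W u le in auto)
   ultimately show "((%m. f m u) has_sum Kr s S (4*W*u)) UNIV & (\<forall>m. \<bar>f m u\<bar> <= B m)" by blast
  qed
 qed
 moreover have "(\<integral>u. f m u \<partial>M) = kap_coeff b m * (-W)^m * S powr (-(4*b-1) - real (2*m))" for m
 proof -
  have "(-(4*W))^m = 4^m * (-W)^m" by (simp add: power_mult_distrib[symmetric])
  then show ?thesis unfolding fe kap_coeff_eq[OF b] by (simp add: mom(2) s_def) (simp add: mult_ac)?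
 qed
 ultimately show ?thesis by (simp add: M_def s_def)
qed

lemma has_sum_mult3:
 fixes f g h :: "nat => real"
 assumes f: "(f has_sum a) UNIV" "!!n. 0 <= f n" and g: "(g has_sum c) UNIV" "!!n. 0 <= g n" and h: "(h has_sum d) UNIV" "!!n. 0 <= h n"
 shows "((%(x,y,w). f x * (g y * h w)) has_sum a * (c * d)) UNIV"
proof -
 have 1: "((%(y,w). g y * h w) has_sum c * d) UNIV"
  by (rule has_sum_SigmaI_abs[where g="%y. g y * d" and h="%y. g y * d"])
    (use g h in \<open>auto simp: abs_mult intro!: has_sum_cmult_right has_sum_cmult_left has_sum_imp_summable[OF g(1)] summable_on_cmult_left\<close>)
 show ?thesis
  by (rule has_sum_SigmaI_abs[where g="%x. f x * (c*d)" and h="%x. f x * (c*d)"])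
    (use f g h 1 in \<open>auto simp: abs_mult split_def intro!: has_sum_cmult_right has_sum_cmult_left has_sum_imp_summable[OF f(1)] summable_on_cmult_left\<close>)
qed

definition T3 :: "real => nat \<times> nat \<times> nat => nat \<times> nat \<times> nat => real" where
 "T3 b = (%(x,y,w) (i,j,k). Tker b x i * (Tker b y j * Tker b w k))"

lemma Tker_nonneg: "b > 0 ==> 0 <= Tker b N n"
 by (auto simp: Tker_def rfact_def intro!: mult_nonneg_nonneg divide_nonneg_nonneg less_imp_le[OF pochhammer_pos])

lemma T3_nonneg: "b > 0 ==> 0 <= T3 b p n"
 by (cases p; cases n) (simp add: T3_def Tker_nonneg)

lemma mon3_nonneg: "0 <= X ==> 0 <= Y ==> 0 <= Z ==> 0 <= mon3 X Y Z p"
 by (cases p) (simp add: mon3_def)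

lemma T3_has_sum:
 assumes b: "b > 0" and \<rho>: "0 <= \<rho>1" "\<rho>1 < 1" "0 <= \<rho>2" "\<rho>2 < 1" "0 <= \<rho>3" "\<rho>3 < 1"
 shows "((%N. T3 b N n * mon3 \<rho>1 \<rho>2 \<rho>3 N) has_sum
  mon3 (\<rho>1/(1-\<rho>1)) (\<rho>2/(1-\<rho>2)) (\<rho>3/(1-\<rho>3)) n * ((1-\<rho>1)*(1-\<rho>2)*(1-\<rho>3)) powr (-2*b)) UNIV"
proof -
 obtain i j k where n: "n = (i,j,k)" by (cases n)
 have e: "\<rho>^n * (1 - \<rho>) powr (-2*b - n) = (\<rho>/(1-\<rho>))^n * (1-\<rho>) powr (-2*b)" if "\<rho> < 1" for \<rho> :: real and n
  using that by (simp add: powr_diff powr_realpow power_divide)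
 have T: "((%N. Tker b N n * \<rho>^N) has_sum (\<rho>/(1-\<rho>))^n * (1-\<rho>) powr (-2*b)) UNIV" if "0 <= \<rho>" "\<rho> < 1" for \<rho> n
  using Tker_has_sum[of b \<rho> n] b that unfolding e[OF that(2)] by simp
 have nn: "0 <= Tker b N n * \<rho>^N" if "0 <= \<rho>" for \<rho> N n using Tker_nonneg[OF b, of N n] that by simp
 have "((%(x,y,w). (Tker b x i * \<rho>1^x) * ((Tker b y j * \<rho>2^y) * (Tker b w k * \<rho>3^w))) has_sum
   ((\<rho>1/(1-\<rho>1))^i * (1-\<rho>1) powr (-2*b)) * (((\<rho>2/(1-\<rho>2))^j * (1-\<rho>2) powr (-2*b)) * ((\<rho>3/(1-\<rho>3))^k * (1-\<rho>3) powr (-2*b)))) UNIV"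
  by (rule has_sum_mult3) (use T nn \<rho> in auto)
 moreover have "(%(x,y,w). (Tker b x i * \<rho>1^x) * ((Tker b y j * \<rho>2^y) * (Tker b w k * \<rho>3^w))) = (%N. T3 b N n * mon3 \<rho>1 \<rho>2 \<rho>3 N)"
  by (auto simp: T3_def mon3_def n fun_eq_iff mult_ac)
 moreover have "((\<rho>1/(1-\<rho>1))^i * (1-\<rho>1) powr (-2*b)) * (((\<rho>2/(1-\<rho>2))^j * (1-\<rho>2) powr (-2*b)) * ((\<rho>3/(1-\<rho>3))^k * (1-\<rho>3) powr (-2*b))) =
  mon3 (\<rho>1/(1-\<rho>1)) (\<rho>2/(1-\<rho>2)) (\<rho>3/(1-\<rho>3)) n * ((1-\<rho>1)*(1-\<rho>2)*(1-\<rho>3)) powr (-2*b)"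
 proof -
  have "((1-\<rho>1)*(1-\<rho>2)*(1-\<rho>3)) powr (-2*b) = (1-\<rho>1) powr (-2*b) * (1-\<rho>2) powr (-2*b) * (1-\<rho>3) powr (-2*b)"
   using \<rho> by (simp only: powr_mult)
  then show ?thesis unfolding mon3_def n prod.case by (simp only: mult_ac)
 qed
 ultimately show ?thesis by simp
qed

definition sg3 :: "nat \<times> nat \<times> nat => real" where
 "sg3 = (%(x,y,w). (-1)^(x+y+w))"

lemma mon3_minus: "mon3 (-X) (-Y) (-Z) p = sg3 p * mon3 X Y Z p"
proof -
 obtain x y w where p: "p = (x,y,w)" by (cases p)
 have "(-X)^x = (-1)^x * X^x" for X :: real and x by (simp add: power_mult_distrib[symmetric])
 then show ?thesis unfolding p mon3_def sg3_def prod.case power_add by (metis (no_types, lifting) mult.assoc mult.left_commute)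
qed

definition Tsum :: "real => (nat \<times> nat \<times> nat => real) => nat \<times> nat \<times> nat => real" where
 "Tsum b f N = (case N of (x,y,w) => \<Sum>n\<in>{..x}\<times>{..y}\<times>{..w}. T3 b N n * f n)"

lemma Tsum_Tr3: "Tsum b (%(i,j,k). f i j k) (x,y,w) = Tr3 b f x y w"
 unfolding Tsum_def Tr_def T3_def sum.cartesian_product[symmetric]
 by (simp add: sum.cartesian_product' sum_distrib_left mult_ac)

text \<open>The generating function of a transformed sequence. Summing over the outer index first
  gives each n the weight in \<open>T3_has_sum\<close>, that is, the substitution \<rho>/(1-\<rho>)
  and the factors (1-\<rho>)^(-2b).\<close>

lemma Tsum_has_sum:
 assumes b: "b > 0" and \<rho>: "0 <= \<rho>1" "\<rho>1 < 1" "0 <= \<rho>2" "\<rho>2 < 1" "0 <= \<rho>3" "\<rho>3 < 1"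
  and f: "((%n. f n * mon3 (\<rho>1/(1-\<rho>1)) (\<rho>2/(1-\<rho>2)) (\<rho>3/(1-\<rho>3)) n) has_sum \<kappa>) UNIV"
  and abs: "(%n. \<bar>f n\<bar> * mon3 (\<rho>1/(1-\<rho>1)) (\<rho>2/(1-\<rho>2)) (\<rho>3/(1-\<rho>3)) n) summable_on UNIV"
 shows "((%N. Tsum b f N * mon3 \<rho>1 \<rho>2 \<rho>3 N) has_sum \<kappa> * ((1-\<rho>1)*(1-\<rho>2)*(1-\<rho>3)) powr (-2*b)) UNIV"
proof -
 define w where "w = mon3 (\<rho>1/(1-\<rho>1)) (\<rho>2/(1-\<rho>2)) (\<rho>3/(1-\<rho>3))"
 define c where "c = ((1-\<rho>1)*(1-\<rho>2)*(1-\<rho>3)) powr (-2*b)"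
 define F where "F = (%(n,N). f n * (T3 b N n * mon3 \<rho>1 \<rho>2 \<rho>3 N))"
 have T: "((%N. T3 b N n * mon3 \<rho>1 \<rho>2 \<rho>3 N) has_sum w n * c) UNIV" for n
  unfolding w_def c_def by (rule T3_has_sum[OF b \<rho>])
 have nn: "0 <= T3 b N n * mon3 \<rho>1 \<rho>2 \<rho>3 N" for n N
  by (intro mult_nonneg_nonneg T3_nonneg b mon3_nonneg \<rho>)
 have "(F has_sum \<kappa> * c) UNIV"
 proof (rule has_sum_SigmaI_abs(1))
  show "((%N. F (n, N)) has_sum f n * (w n * c)) UNIV" for n
   unfolding F_def prod.case by (rule has_sum_cmult_right[OF T])
  show "((%N. \<bar>F (n, N)\<bar>) has_sum \<bar>f n\<bar> * (w n * c)) UNIV" for n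
   unfolding F_def prod.case abs_mult[of "f n"] abs_of_nonneg[OF nn] by (rule has_sum_cmult_right[OF T])
  show "((%n. f n * (w n * c)) has_sum \<kappa> * c) UNIV"
   unfolding mult.assoc[symmetric] by (rule has_sum_cmult_left) (use f in \<open>simp add: w_def\<close>)
  show "(%n. \<bar>f n\<bar> * (w n * c)) summable_on UNIV"
   unfolding mult.assoc[symmetric] by (rule summable_on_cmult_left) (use abs in \<open>simp add: w_def\<close>)
 qed
 then have sw: "((%(N,n). F (n,N)) has_sum \<kappa> * c) (UNIV \<times> UNIV)"
  using has_sum_swap[of F UNIV UNIV "\<kappa> * c"] by simp
 have "((%n. (%(N,n). F (n,N)) (N,n)) has_sum Tsum b f N * mon3 \<rho>1 \<rho>2 \<rho>3 N) UNIV" for N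
 proof -
  obtain x y z where N: "N = (x,y,z)" by (cases N)
  have tz: "n <= N" if "Tker b N n ~= 0" for N n using that Tker_eq_0[of N n b] not_le by blast
  have "((%n. F (n,N)) has_sum (\<Sum>n\<in>{..x}\<times>{..y}\<times>{..z}. F (n,N))) UNIV"
   by (rule has_sum_finite_neutralI) (auto simp: F_def N T3_def intro!: tz)
  moreover have "(\<Sum>n\<in>{..x}\<times>{..y}\<times>{..z}. F (n,N)) = Tsum b f N * mon3 \<rho>1 \<rho>2 \<rho>3 N"
   unfolding Tsum_def N prod.case sum_distrib_right F_def by (intro sum.cong) auto
  ultimately show ?thesis by simp
 qed
 from has_sum_SigmaD[OF sw this] show ?thesis by (simp add: c_def)
qed

text \<open>Differentiation under the integral sign. Cauchy's inequality turns the uniform bound C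
  into the bound C/r for difference quotients, and dominated convergence applies.\<close>

lemma holomorphic_integral:
 fixes h :: "complex => 'a => complex"
 assumes M: "prob_space M" and U: "open U"
  and hol: "!!y. y \<in> space M ==> (%ze. h ze y) holomorphic_on U"
  and bd: "!!ze y. ze \<in> U ==> y \<in> space M ==> norm (h ze y) <= C"
  and meas: "!!ze. ze \<in> U ==> h ze \<in> borel_measurable M"
 shows "(%ze. \<integral>y. h ze y \<partial>M) holomorphic_on U"
 unfolding holomorphic_on_open[OF U]
proof
 interpret prob_space M by (rule M)
 fix z assume z: "z \<in> U"
 obtain e where e: "e > 0" "cball z e \<subseteq> U" using open_contains_cball U z by blast
 define r where "r = e/2"
 have r: "r > 0" using e by (simp add: r_def)
 have sub: "cball x r \<subseteq> U" if "x \<in> ball z r" for x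
 proof -
  have "cball x r \<subseteq> cball z e"
  proof
   fix y assume "y \<in> cball x r"
   then show "y \<in> cball z e" using that dist_triangle[of z y x] by (simp add: r_def)
  qed
  then show ?thesis using e by blast
 qed
 have int: "integrable M (h ze)" if "ze \<in> U" for ze
  by (rule integrable_const_bound[of _ C]) (use bd[OF that] meas[OF that] in \<open>auto intro!: AE_I2\<close>)
 define h' where "h' y = deriv (%ze. h ze y) z" for y
 have zb: "z \<in> ball z r" using r by simp
 have bU: "ball z r \<subseteq> U" using sub[OF zb] by (meson ball_subset_cball order_trans)
 have der: "((%ze. h ze y) has_field_derivative deriv (%ze. h ze y) x) (at x)" if "y \<in> space M" "x \<in> U" for x y
  by (rule holomorphic_derivI[OF hol[OF that(1)] U that(2)])
 have lip: "norm (h x y - h z y) <= C / r * norm (x - z)" if "y \<in> space M" "x \<in> ball z r" for x y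
 proof (rule field_differentiable_bound[of "ball z r"])
  fix w assume w: "w \<in> ball z r"
  show "((%ze. h ze y) has_field_derivative deriv (%ze. h ze y) w) (at w within ball z r)"
   by (rule has_field_derivative_at_within[OF der[OF that(1)]]) (use w bU in auto)
  have "norm ((deriv ^^ 1) (%ze. h ze y) w) <= fact 1 * C / r ^ 1"
  proof (rule Cauchy_inequality)
   have hs: "(%ze. h ze y) holomorphic_on cball w r" by (rule holomorphic_on_subset[OF hol[OF that(1)] sub[OF w]])
   then show "(%ze. h ze y) holomorphic_on ball w r" by (rule holomorphic_on_subset) auto
   show "continuous_on (cball w r) (%ze. h ze y)" using hs by (rule holomorphic_on_imp_continuous_on)
   show "norm (h x y) <= C" if "norm (w - x) = r" for x
    by (rule bd[OF _ \<open>y \<in> space M\<close>]) (use sub[OF w] that in \<open>auto simp: dist_norm\<close>)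
  qed (rule r)
  then show "norm (deriv (%ze. h ze y) w) <= C / r" by simp
 qed (use that r in auto)
 have quot: "(%n. (h (X n) y - h z y) / (X n - z)) \<longlonglongrightarrow> h' y"
  if "y \<in> space M" "!!n. X n \<in> ball z r - {z}" "X \<longlonglongrightarrow> z" for X y
 proof -
  have "((%x. (h x y - h z y) / (x - z)) \<longlongrightarrow> h' y) (at z)"
   using der[OF that(1) z] unfolding h'_def has_field_derivative_iff .
  then show ?thesis
   unfolding tendsto_at_iff_sequentially comp_def using that by blast
 qed
 \<comment> \<open>The derivative is measurable as a pointwise limit of difference quotients along
   one sequence.\<close>
 have h'_meas: "h' \<in> borel_measurable M"
 proof (rule borel_measurable_LIMSEQ_metric)
  define X where "X n = z + cor (r / real (n + 2))" for n
  have Xr: "r / real (n + 2) < r" for n using r by (simp add: divide_less_eq)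
  have dd: "z + cor d \<in> ball z r - {z}" if "0 < d" "d < r" for d using that by (simp add: dist_norm)
  have X: "X n \<in> ball z r - {z}" for n unfolding X_def by (rule dd) (use r Xr[of n] in auto)
  have XU: "X n \<in> U" for n using X bU by blast
  have "(%n. r / real (n + 2)) \<longlonglongrightarrow> 0" by real_asymp
  then have "(%n. cor (r / real (n + 2))) \<longlonglongrightarrow> cor 0" by (rule tendsto_of_real)
  then have lim: "X \<longlonglongrightarrow> z" unfolding X_def using tendsto_add[OF tendsto_const[of z]] by fastforce
  show "(%n. (h (X n) y - h z y) / (X n - z)) \<longlonglongrightarrow> h' y" if "y \<in> space M" for y
   by (rule quot[OF that X lim])
  have [measurable]: "h (X n) \<in> borel_measurable M" "h z \<in> borel_measurable M" for n using meas XU z by auto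
  show "(%y. (h (X n) y - h z y) / (X n - z)) \<in> borel_measurable M" for n by measurable
 qed
 show "\<exists>f'. ((%ze. \<integral>y. h ze y \<partial>M) has_field_derivative f') (at z)"
 proof (intro exI[of _ "\<integral>y. h' y \<partial>M"])
  have "((%x. ((\<integral>y. h x y \<partial>M) - (\<integral>y. h z y \<partial>M)) / (x - z)) \<longlongrightarrow> (\<integral>y. h' y \<partial>M)) (at z within ball z r)"
   unfolding tendsto_at_iff_sequentially comp_def
  proof (intro allI impI)
   fix X assume X0: "\<forall>n. X n \<in> ball z r - {z}" and lim: "X \<longlonglongrightarrow> z"
   then have X: "X n \<in> ball z r - {z}" "X n \<in> U" for n using bU by auto
   have [measurable]: "h (X n) \<in> borel_measurable M" "h z \<in> borel_measurable M" for n using meas X z by auto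
   have "(%n. \<integral>y. (h (X n) y - h z y) / (X n - z) \<partial>M) \<longlonglongrightarrow> (\<integral>y. h' y \<partial>M)"
   proof (rule integral_dominated_convergence[where w = "%_. C / r"])
    show "AE y in M. (%n. (h (X n) y - h z y) / (X n - z)) \<longlonglongrightarrow> h' y"
     by (rule AE_I2) (rule quot[OF _ X(1) lim])
    show "AE y in M. norm ((h (X n) y - h z y) / (X n - z)) <= C / r" for n
    proof (rule AE_I2)
     fix y assume "y \<in> space M"
     then show "norm ((h (X n) y - h z y) / (X n - z)) <= C / r"
      using lip[of y "X n"] X(1)[of n] by (simp add: norm_divide divide_le_eq)
    qed
   qed (use h'_meas in auto)
   moreover have "(\<integral>y. (h (X n) y - h z y) / (X n - z) \<partial>M) = ((\<integral>y. h (X n) y \<partial>M) - (\<integral>y. h z y \<partial>M)) / (X n - z)" for n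
    by (simp add: Bochner_Integration.integral_diff int X z)
   ultimately show "(%n. ((\<integral>y. h (X n) y \<partial>M) - (\<integral>y. h z y \<partial>M)) / (X n - z)) \<longlonglongrightarrow> (\<integral>y. h' y \<partial>M)" by (simp only:)
  qed
  moreover have "at z within ball z r = at z" by (rule at_within_open[OF zb]) simp
  ultimately show "((%ze. \<integral>y. h ze y \<partial>M) has_field_derivative (\<integral>y. h' y \<partial>M)) (at z)"
   unfolding has_field_derivative_iff by simp
 qed
qed

text \<open>Used to replace the integrand by its average over u. The sections of an integrable
  function are integrable almost everywhere, so the variables can be integrated one after
  another.\<close>

lemma M4_integral_cong:
 fixes h k :: "real \<times> real \<times> real \<times> real => real"
 assumes b: "b > 1/2" and h: "integrable (M4 b) h" and k: "integrable (M4 b) k"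
  and eq: "!!t1 t2 t3. 0 < t1 ==> t1 < 1 ==> 0 < t2 ==> t2 < 1 ==> 0 < t3 ==> t3 < 1 ==>
   (\<integral>u. h (t1,t2,t3,u) \<partial>bet (1/2) (b-1/2)) = (\<integral>u. k (t1,t2,t3,u) \<partial>bet (1/2) (b-1/2))"
 shows "(\<integral>p. h p \<partial>M4 b) = (\<integral>p. k p \<partial>M4 b)"
proof -
 define N0 where "N0 = bet (1/2) (b-1/2)"
 define B where "B = bet b b"
 note P = prob_space_M4[OF b, folded N0_def B_def]
 interpret N0: prob_space N0 by (rule P)
 interpret B: prob_space B by (rule P)
 interpret N1: prob_space "B \<Otimes>\<^sub>M N0" by (rule P)
 interpret N2: prob_space "B \<Otimes>\<^sub>M (B \<Otimes>\<^sub>M N0)" by (rule P)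
 interpret P1: pair_sigma_finite B N0 ..
 interpret P2: pair_sigma_finite B "B \<Otimes>\<^sub>M N0" ..
 interpret P3: pair_sigma_finite B "B \<Otimes>\<^sub>M (B \<Otimes>\<^sub>M N0)" ..
 define f where "f p = h p - k p" for p
 have f: "integrable (B \<Otimes>\<^sub>M (B \<Otimes>\<^sub>M (B \<Otimes>\<^sub>M N0))) f"
  unfolding f_def using Bochner_Integration.integrable_diff[OF h k] by (simp add: M4_def B_def N0_def)
 have hk: "integrable (B \<Otimes>\<^sub>M (B \<Otimes>\<^sub>M (B \<Otimes>\<^sub>M N0))) h" "integrable (B \<Otimes>\<^sub>M (B \<Otimes>\<^sub>M (B \<Otimes>\<^sub>M N0))) k"
  using h k by (simp_all add: M4_def B_def N0_def)
 have good: "AE t in B. 0 < t & t < 1" unfolding B_def by (rule AE_bet)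
 have z3: "(\<integral>q. f (t1,t2,q) \<partial>(B \<Otimes>\<^sub>M N0)) = 0"
  if t: "0 < t1 & t1 < 1" "0 < t2 & t2 < 1" and i: "integrable (B \<Otimes>\<^sub>M N0) (%q. h (t1,t2,q))" "integrable (B \<Otimes>\<^sub>M N0) (%q. k (t1,t2,q))" for t1 t2
 proof -
  have "(\<integral>q. h (t1,t2,q) \<partial>(B \<Otimes>\<^sub>M N0)) = (\<integral>t3. (\<integral>u. h (t1,t2,t3,u) \<partial>N0) \<partial>B)"
   using P1.integral_fst'[OF i(1)] by simp
  also have "\<dots> = (\<integral>t3. (\<integral>u. k (t1,t2,t3,u) \<partial>N0) \<partial>B)"
  proof (rule integral_cong_AE)
   show "AE t3 in B. (\<integral>u. h (t1,t2,t3,u) \<partial>N0) = (\<integral>u. k (t1,t2,t3,u) \<partial>N0)"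
    using good by (rule eventually_mono) (use t eq in \<open>auto simp: N0_def\<close>)
  qed (use i in \<open>auto intro!: N0.borel_measurable_lebesgue_integral simp: split_def\<close>)
  also have "\<dots> = (\<integral>q. k (t1,t2,q) \<partial>(B \<Otimes>\<^sub>M N0))"
   using P1.integral_fst'[OF i(2)] by simp
  finally show ?thesis unfolding f_def using i by simp
 qed
 have z2: "(\<integral>q. f (t1,q) \<partial>(B \<Otimes>\<^sub>M (B \<Otimes>\<^sub>M N0))) = 0"
  if t: "0 < t1 & t1 < 1" and i: "integrable (B \<Otimes>\<^sub>M (B \<Otimes>\<^sub>M N0)) (%q. h (t1,q))" "integrable (B \<Otimes>\<^sub>M (B \<Otimes>\<^sub>M N0)) (%q. k (t1,q))" for t1
 proof -
  have "integrable (B \<Otimes>\<^sub>M (B \<Otimes>\<^sub>M N0)) (%q. f (t1,q))" unfolding f_def using i by simp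
  then have "(\<integral>q. f (t1,q) \<partial>(B \<Otimes>\<^sub>M (B \<Otimes>\<^sub>M N0))) = (\<integral>t2. (\<integral>q. f (t1,t2,q) \<partial>(B \<Otimes>\<^sub>M N0)) \<partial>B)"
   using P2.integral_fst' by fastforce
  also have "\<dots> = 0"
  proof (rule integral_eq_zero_AE)
   show "AE t2 in B. (\<integral>q. f (t1,t2,q) \<partial>(B \<Otimes>\<^sub>M N0)) = 0"
    using good P2.AE_integrable_fst'[OF i(1)] P2.AE_integrable_fst'[OF i(2)] by eventually_elim (rule z3[OF t])
  qed
  finally show ?thesis .
 qed
 have "(\<integral>p. f p \<partial>(B \<Otimes>\<^sub>M (B \<Otimes>\<^sub>M (B \<Otimes>\<^sub>M N0)))) = (\<integral>t1. (\<integral>q. f (t1,q) \<partial>(B \<Otimes>\<^sub>M (B \<Otimes>\<^sub>M N0))) \<partial>B)"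
  using P3.integral_fst'[OF f] by simp
 also have "\<dots> = 0"
 proof (rule integral_eq_zero_AE)
  show "AE t1 in B. (\<integral>q. f (t1,q) \<partial>(B \<Otimes>\<^sub>M (B \<Otimes>\<^sub>M N0))) = 0"
   using good P3.AE_integrable_fst'[OF hk(1)] P3.AE_integrable_fst'[OF hk(2)] by eventually_elim (rule z2)
 qed
 finally have "(\<integral>p. f p \<partial>M4 b) = 0" by (simp add: M4_def B_def N0_def)
 then show ?thesis unfolding f_def using h k by simp
qed

definition sgK3 :: "real => nat \<times> nat \<times> nat => real" where
 "sgK3 b = (%(i,j,k). sgK b i j k)"

lemma sgK3_eq: "sgK3 b n = sg3 n * K3 b n"
 by (cases n) (simp add: sgK3_def sgK_def sg3_def K3_def)

lemma abs_sgK3: "b > 1/2 ==> \<bar>sgK3 b n\<bar> = K3 b n"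
 using K_cf_nonneg by (cases n) (simp add: sgK3_eq sg3_def K3_def abs_mult)

definition FG :: "real => real => real => real => real" where
 "FG b \<rho>1 \<rho>2 \<rho>3 = (\<integral>u. FI b (1-\<rho>1) (1-\<rho>2) (1-\<rho>3) u \<partial>bet (1/2) (b-1/2))"

lemma odds_small:
 fixes \<rho> :: real assumes "0 <= \<rho>" "\<rho> <= 1/100"
 shows "0 <= \<rho>/(1-\<rho>)" "\<rho>/(1-\<rho>) <= 1/20" "\<bar>\<rho>/(1-\<rho>)\<bar> <= 1/20"
proof -
 show "0 <= \<rho>/(1-\<rho>)" "\<rho>/(1-\<rho>) <= 1/20" using assms by (auto simp: field_simps)
 then show "\<bar>\<rho>/(1-\<rho>)\<bar> <= 1/20" by (simp only: abs_of_nonneg)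
qed

text \<open>The integrand with u averaged out is the generating function of the transformed signed
  coefficients. Combine \<open>kap_has_sum\<close> for S = 1 + w1 + w2 + w3 and W = w1 w2 w3, the
  interchange in \<open>K3_has_sum_aux\<close> at (-w1,-w2,-w3), and
  \<open>Tsum_has_sum\<close>.\<close>

lemma FG_has_sum:
 assumes b: "b > 1/2" and \<rho>: "0 <= \<rho>1" "\<rho>1 <= 1/100" "0 <= \<rho>2" "\<rho>2 <= 1/100" "0 <= \<rho>3" "\<rho>3 <= 1/100"
 shows "((%N. Tsum b (sgK3 b) N * mon3 \<rho>1 \<rho>2 \<rho>3 N) has_sum FG b \<rho>1 \<rho>2 \<rho>3) UNIV"
proof -
 define w1 w2 w3 where "w1 = \<rho>1/(1-\<rho>1)" and "w2 = \<rho>2/(1-\<rho>2)" and "w3 = \<rho>3/(1-\<rho>3)"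
 have w: "0 <= w1" "\<bar>w1\<bar> <= 1/20" "0 <= w2" "\<bar>w2\<bar> <= 1/20" "0 <= w3" "\<bar>w3\<bar> <= 1/20"
  unfolding w1_def w2_def w3_def by (intro odds_small \<rho>)+
 define S where "S = 1 + w1 + w2 + w3"
 define W where "W = w1*w2*w3"
 have S: "S >= 1" using w by (simp add: S_def)
 have W: "0 <= W" using w by (simp add: W_def)
 have W4: "4*W < S^2"
 proof -
  have "4*\<bar>w1*w2*w3\<bar> < (1 - \<bar>w1\<bar> - \<bar>w2\<bar> - \<bar>w3\<bar>)^2" by (rule small_kap(2)) (use w in auto)
  also have "\<dots> <= S^2" by (rule power_mono) (use w in \<open>auto simp: S_def\<close>)
  finally show ?thesis using W by (simp add: W_def)
 qed
 define \<kappa> where "\<kappa> = (\<integral>u. Kr (4*b-1) S (4*W*u) \<partial>bet (1/2) (b-1/2))"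
 have m: "(-w1)*(-w2)*(-w3) = -W" "1 - (-w1) - (-w2) - (-w3) = S" by (simp_all add: W_def S_def)
 have "((%m. kap_coeff b m * ((-w1)*(-w2)*(-w3))^m * (1 - (-w1) - (-w2) - (-w3)) powr (-(4*b-1) - real (2*m))) has_sum \<kappa>) UNIV"
  unfolding m \<kappa>_def by (rule kap_has_sum[OF b]) (use S W W4 in auto)
 then have "((%p. K3 b p * mon3 (-w1) (-w2) (-w3) p) has_sum \<kappa>) UNIV"
  by (intro K3_has_sum_aux[OF b]) (use w in auto)
 then have hs: "((%n. sgK3 b n * mon3 w1 w2 w3 n) has_sum \<kappa>) UNIV"
  unfolding mon3_minus sgK3_eq by (simp add: mult_ac)
 have sm: "(%n. \<bar>sgK3 b n\<bar> * mon3 w1 w2 w3 n) summable_on UNIV"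
  unfolding abs_sgK3[OF b] using K3_summable[OF b, of w1 w2 w3] w by simp
 define Pi where "Pi = (1-\<rho>1)*(1-\<rho>2)*(1-\<rho>3)"
 have Pi: "Pi > 0" using \<rho> by (simp add: Pi_def)
 have main: "((%N. Tsum b (sgK3 b) N * mon3 \<rho>1 \<rho>2 \<rho>3 N) has_sum \<kappa> * Pi powr (-2*b)) UNIV"
  unfolding Pi_def by (rule Tsum_has_sum) (use b \<rho> hs sm in \<open>auto simp: w1_def w2_def w3_def\<close>)
 have "FG b \<rho>1 \<rho>2 \<rho>3 = (\<integral>u. Pi powr (-2*b) * Kr (4*b-1) S (4*W*u) \<partial>bet (1/2) (b-1/2))"
  unfolding FG_def
 proof (rule integral_cong_AE)
  show "AE u in bet (1/2) (b-1/2). FI b (1-\<rho>1) (1-\<rho>2) (1-\<rho>3) u = Pi powr (-2*b) * Kr (4*b-1) S (4*W*u)"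
   using AE_bet[of "1/2" "b-1/2"]
  proof (rule eventually_mono)
   fix u :: real assume u: "0 < u & u < 1"
   have d: "1-\<rho>1 ~= 0" "1-\<rho>2 ~= 0" "1-\<rho>3 ~= 0" using \<rho> by auto
   have r: "\<rho>1 = w1*(1-\<rho>1)" "\<rho>2 = w2*(1-\<rho>2)" "\<rho>3 = w3*(1-\<rho>3)" using d by (simp_all add: w1_def w2_def w3_def)
   have "w1 * Pi = \<rho>1*(1-\<rho>2)*(1-\<rho>3)" "w2 * Pi = \<rho>2*(1-\<rho>1)*(1-\<rho>3)" "w3 * Pi = \<rho>3*(1-\<rho>1)*(1-\<rho>2)"
    unfolding Pi_def w1_def w2_def w3_def using d by simp_all
   moreover have "Pi * S = Pi + w1*Pi + w2*Pi + w3*Pi" by (simp add: S_def algebra_simps)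
   ultimately have P: "pol (1-\<rho>1) (1-\<rho>2) (1-\<rho>3) = Pi * S"
    unfolding pol_def by (simp add: Pi_def algebra_simps)
   have "\<rho>1*\<rho>2*\<rho>3 = W*Pi" unfolding W_def Pi_def w1_def w2_def w3_def using d by simp
   then have Y: "4*((1-(1-\<rho>1))*(1-(1-\<rho>2))*(1-(1-\<rho>3)))*((1-\<rho>1)*(1-\<rho>2)*(1-\<rho>3))*u = Pi^2 * (4*W*u)"
    by (simp add: Pi_def[symmetric] power2_eq_square)
   \<comment> \<open>The base and the square root in \<open>Kr\<close> share the factor Pi, which
     leaves by homogeneity and combines with the prefactor to Pi^(-2b).\<close>
   have "FI b (1-\<rho>1) (1-\<rho>2) (1-\<rho>3) u = Pi powr (2*b-1) * Kr (4*b-1) (Pi * S) (Pi^2 * (4*W*u))"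
    unfolding FI_def P Y Pi_def ..
   also have "\<dots> = Pi powr (2*b-1) * (Pi powr (-(4*b-1)) * Kr (4*b-1) S (4*W*u))"
    by (subst Kr_scale) (use Pi S W u in auto)
   also have "\<dots> = Pi powr (-2*b) * Kr (4*b-1) S (4*W*u)"
    unfolding mult.assoc[symmetric] powr_add[symmetric] by (simp add: algebra_simps)
   finally show "FI b (1-\<rho>1) (1-\<rho>2) (1-\<rho>3) u = Pi powr (-2*b) * Kr (4*b-1) S (4*W*u)" .
  qed
  show "FI b (1-\<rho>1) (1-\<rho>2) (1-\<rho>3) \<in> borel_measurable (bet (1/2) (b-1/2))"
   unfolding FI_def[abs_def] by measurable
 qed measurable
 then have "FG b \<rho>1 \<rho>2 \<rho>3 = \<kappa> * Pi powr (-2*b)" by (simp add: \<kappa>_def)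
 then show ?thesis using main by simp
qed

lemma Tsum_abs_le: "b > 1/2 ==> \<bar>Tsum b (sgK3 b) N\<bar> <= Tsum b (K3 b) N"
 unfolding Tsum_def
 by (cases N) (auto intro!: order_trans[OF sum_abs] sum_mono simp: abs_mult abs_sgK3 abs_of_nonneg[OF T3_nonneg])

lemma Tsum_K3_summable:
 assumes b: "b > 1/2"
 shows "(%N. Tsum b (K3 b) N * mon3 (1/100) (1/100) (1/100) N) summable_on UNIV"
proof -
 define w :: real where "w = (1/100)/(1-1/100)"
 have w: "0 <= w" "\<bar>w\<bar> <= 1/20" by (auto simp: w_def)
 have "(%n. K3 b n * mon3 w w w n) summable_on UNIV"
  using K3_summable[OF b w(2,2,2)] w by simp
 then obtain \<kappa> where "((%n. K3 b n * mon3 w w w n) has_sum \<kappa>) UNIV" by (auto simp: summable_on_def)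
 moreover have "\<bar>K3 b n\<bar> = K3 b n" for n using abs_sgK3[OF b, of n] by (metis abs_idempotent)
 ultimately show ?thesis
  using Tsum_has_sum[of b "1/100" "1/100" "1/100" "K3 b" \<kappa>] b by (auto simp: w_def intro: has_sum_imp_summable)
qed

lemma A_cf_Tsum: "A_cf b x y w = mu b x * mu b y * mu b w * Tsum b (sgK3 b) (x,y,w)"
 unfolding A_cf_def P3_def sgK3_def Tsum_Tr3 ..

lemma FG_measurable [measurable]:
 assumes "b > 1/2"
 and [measurable]: "f \<in> borel_measurable M" "g \<in> borel_measurable M" "h \<in> borel_measurable M"
 shows "(%x. FG b (f x) (g x) (h x)) \<in> borel_measurable M"
proof -
 interpret prob_space "bet (1/2) (b-1/2)" by (rule prob_space_M4[OF assms(1)])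
 show ?thesis unfolding FG_def FI_def pol_def by measurable
qed

text \<open>Averaging \<open>FG\<close> over the t_i multiplies the coefficients by Beta(b,b)
  moments, which are the factors \<open>mu\<close> in \<open>A_cf\<close>.\<close>

lemma Fbar_has_sum:
 assumes b: "b > 1/2" and r: "!!i. 0 <= r$i" "!!i. r$i <= 1/100"
 shows "((%(x,y,w). A_cf b x y w * mon3 (r$1) (r$2) (r$3) (x,y,w)) has_sum Fbar b r) UNIV"
proof -
 note P = prob_space_M4[OF b]
 have "r$i <= 1" for i using r(2)[of i] by linarith
 then have rc: "r \<in> closed_cube" using r(1) by (simp add: closed_cube_def)
 define f where "f N = (%(t1,t2,t3,u::real). Tsum b (sgK3 b) N * mon3 (r$1*t1) (r$2*t2) (r$3*t3) N)" for N
 define g where "g = (%(t1,t2,t3,u::real). FG b (r$1*t1) (r$2*t2) (r$3*t3))"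
 define B where "B N = Tsum b (K3 b) N * mon3 (1/100) (1/100) (1/100) N" for N
 have tr: "0 <= r$i * t" "r$i * t <= 1/100" if "0 < t" "t < 1" for t i
  using r[of i] that mult_left_le[of t "r$i"] by auto
 have f_int: "integrable (M4 b) (f N)" "(\<integral>p. f N p \<partial>M4 b) = (case N of (x,y,w) => A_cf b x y w * mon3 (r$1) (r$2) (r$3) (x,y,w))" for N
 proof -
  obtain x y w where N: "N = (x,y,w)" by (cases N)
  define C where "C = Tsum b (sgK3 b) N * mon3 (r$1) (r$2) (r$3) N"
  have fe: "f N = (%p. C * (case p of (t1,t2,t3,u) => t1^x * (t2^y * (t3^w * 1))))"
  proof (rule ext)
   fix p :: "real \<times> real \<times> real \<times> real"
   obtain t1 t2 t3 u where p: "p = (t1,t2,t3,u)" by (cases p)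
   show "f N p = C * (case p of (t1,t2,t3,u) => t1^x * (t2^y * (t3^w * 1)))"
    unfolding f_def C_def N mon3_def p prod.case power_mult_distrib by (simp only: mult_ac mult_1_right)
  qed
  have bb: "integrable (bet b b) (%t. t^n)" "(\<integral>t. t^n \<partial>bet b b) = mu b n" for n
   using moment_bet[of b b n] b unfolding mu_def by (simp_all add: mult_2[symmetric])
  interpret N0: prob_space "bet (1/2) (b-1/2)" by (rule P)
  have one: "integrable (bet (1/2) (b-1/2)) (%_. 1::real)" "(\<integral>u. 1 \<partial>bet (1/2) (b-1/2)) = (1::real)"
   using N0.prob_space by auto
  note i = integral_M4_mult[OF b bb(1)[of x] bb(1)[of y] bb(1)[of w] one(1), unfolded bb(2) one(2)]
  show "integrable (M4 b) (f N)" unfolding fe by (rule integrable_mult_right[OF i(1)])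
  show "(\<integral>p. f N p \<partial>M4 b) = (case N of (x,y,w) => A_cf b x y w * mon3 (r$1) (r$2) (r$3) (x,y,w))"
   unfolding fe integral_mult_right_zero i(2) by (simp add: C_def N A_cf_Tsum)
 qed
 have hs: "((%N. f N p) has_sum g p) UNIV & (\<forall>N. \<bar>f N p\<bar> <= B N)"
  if "case p of (t1,t2,t3,u) => (0 < t1 & t1 < 1) & (0 < t2 & t2 < 1) & (0 < t3 & t3 < 1) & (0 < u & u < 1)" for p :: "real \<times> real \<times> real \<times> real"
 proof -
  obtain t1 t2 t3 u where p: "p = (t1,t2,t3,u)" by (cases p)
  have t: "0 < t1" "t1 < 1" "0 < t2" "t2 < 1" "0 < t3" "t3 < 1" using that p by auto
  have "((%N. f N p) has_sum g p) UNIV" unfolding f_def g_def p prod.case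
   by (rule FG_has_sum[OF b]) (use tr t in auto)
  moreover have "\<bar>f N p\<bar> <= B N" for N
  proof -
   obtain x y w where N: "N = (x,y,w)" by (cases N)
   have "mon3 (r$1*t1) (r$2*t2) (r$3*t3) N <= mon3 (1/100) (1/100) (1/100) N"
    unfolding mon3_def N prod.case by (intro mult_mono power_mono tr t mult_nonneg_nonneg zero_le_power) auto
   moreover have "0 <= mon3 (r$1*t1) (r$2*t2) (r$3*t3) N" by (intro mon3_nonneg tr t)
   ultimately show ?thesis unfolding f_def B_def p prod.case abs_mult
    by (intro mult_mono Tsum_abs_le b order_trans[OF abs_ge_zero Tsum_abs_le[OF b]]) auto
  qed
  ultimately show ?thesis by blast
 qed
 have Bsum: "B summable_on UNIV" unfolding B_def by (rule Tsum_K3_summable[OF b])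
 have g_int: "integrable (M4 b) g"
 proof -
  interpret M: prob_space "M4 b" by (rule P)
  have "AE p in M4 b. norm (g p) <= infsum B UNIV" using AE_M4[OF b]
  proof (rule eventually_mono)
   fix p :: "real \<times> real \<times> real \<times> real"
   assume p: "case p of (t1,t2,t3,u) => (0 < t1 & t1 < 1) & (0 < t2 & t2 < 1) & (0 < t3 & t3 < 1) & (0 < u & u < 1)"
   show "norm (g p) <= infsum B UNIV"
    by (rule norm_infsum_le[OF _ has_sum_infsum[OF Bsum]]) (use hs[OF p] in auto)
  qed
  then show ?thesis
  proof (rule M.integrable_const_bound)
   show "g \<in> borel_measurable (M4 b)" unfolding g_def split_def by (intro FG_measurable b) measurable
  qed
 qed
 have "((%N. \<integral>p. f N p \<partial>M4 b) has_sum (\<integral>p. g p \<partial>M4 b)) UNIV"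
 proof (rule has_sum_integral[OF P(5) f_int(1) g_int Bsum])
  show "AE p in M4 b. ((%N. f N p) has_sum g p) UNIV & (\<forall>N. \<bar>f N p\<bar> <= B N)"
   using AE_M4[OF b] by (rule eventually_mono) (rule hs)
 qed
 moreover have "(\<integral>p. g p \<partial>M4 b) = Fbar b r"
  unfolding Fbar_def
 proof (rule M4_integral_cong[OF b g_int Fint_integrable[OF b rc]])
  fix t1 t2 t3 :: real
  interpret N0: prob_space "bet (1/2) (b-1/2)" by (rule P)
  show "(\<integral>u. g (t1,t2,t3,u) \<partial>bet (1/2) (b-1/2)) = (\<integral>u. Fint b r (t1,t2,t3,u) \<partial>bet (1/2) (b-1/2))"
   using N0.prob_space unfolding g_def Fint_def prod.case by (simp add: FG_def)
 qed
 ultimately show ?thesis unfolding f_int(2) by (simp add: split_def)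
qed

section \<open>Analytic continuation of the integral\<close>

type_synonym quad = "real \<times> real \<times> real \<times> real"

definition qbox :: "quad set" where "qbox = {0<..<1} \<times> {0<..<1} \<times> {0<..<1} \<times> {0<..<1}"

definition cbx :: "quad set" where "cbx = {0..1} \<times> {0..1} \<times> {0..1} \<times> {0..1}"

text \<open>The complexified integrand lives on the curve r = \<open>ze\<close>^2 v. The square is
  there because sqrt Y contains sqrt(r_1 r_2 r_3), which on this curve becomes a constant times
  \<open>ze\<close>^3.\<close>

definition ec :: "real => complex => real => complex" where
 "ec v ze t = 1 - ze^2 * cor (v * t)"

definition cP :: "real^3 => complex => quad => complex" where
 "cP v ze y = (let e1 = ec (v$1) ze (fst y); e2 = ec (v$2) ze (fst (snd y)); e3 = ec (v$3) ze (fst (snd (snd y))) in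
   e2*e3 + e1*e3 + e1*e2 - 2*e1*e2*e3)"

definition cQ :: "real^3 => complex => quad => complex" where
 "cQ v ze y = (let e1 = ec (v$1) ze (fst y); e2 = ec (v$2) ze (fst (snd y)); e3 = ec (v$3) ze (fst (snd (snd y))) in
   2 * ze^3 * cor (sqrt (v$1 * fst y * (v$2 * fst (snd y)) * (v$3 * fst (snd (snd y))) * snd (snd (snd y))))
    * (cpw (1/2) e1 * cpw (1/2) e2 * cpw (1/2) e3))"

text \<open>The real part in \<open>Kr\<close> is replaced by the mean of two powers that are
  conjugate on the real axis; the mean is holomorphic in \<open>ze\<close>.\<close>

definition CI :: "real => real^3 => complex => quad => complex" where
 "CI b v ze y = (let e1 = ec (v$1) ze (fst y); e2 = ec (v$2) ze (fst (snd y)); e3 = ec (v$3) ze (fst (snd (snd y))) in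
   cpw (2*b-1) e1 * cpw (2*b-1) e2 * cpw (2*b-1) e3 *
   ((cpw (-(4*b-1)) (cP v ze y + \<i> * cQ v ze y) + cpw (-(4*b-1)) (cP v ze y - \<i> * cQ v ze y)) / 2))"

lemma CI_measurable [measurable]: "CI b v ze \<in> borel_measurable (M4 b)"
 unfolding CI_def[abs_def] cP_def cQ_def ec_def Let_def by measurable

lemma ec_bounds:
 assumes "norm ze <= R" "R^2 * v < 1" "0 <= v" "0 <= t" "t <= 1"
 shows "0 < Re (ec v ze t)" "norm (ec v ze t) <= 2"
proof -
 have "norm (ze^2 * cor (v * t)) <= R^2 * v"
 proof -
  have "norm ze ^ 2 * (v * t) <= R^2 * v"
   by (intro mult_mono power_mono assms mult_left_le mult_nonneg_nonneg) (use assms in auto)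
  then show ?thesis using assms by (simp add: norm_mult norm_power)
 qed
 then have n: "norm (ze^2 * cor (v * t)) < 1" using assms by linarith
 then show "0 < Re (ec v ze t)" unfolding ec_def using complex_Re_le_cmod[of "ze^2 * cor (v * t)"] by simp
 show "norm (ec v ze t) <= 2" unfolding ec_def
  using norm_triangle_ineq4[of 1 "ze^2 * cor (v * t)"] n by simp
qed

lemma CI_of_real:
 assumes v: "!!i. 0 <= v$i" "!!i. v$i < 1" and \<tau>: "0 <= \<tau>" "\<tau> <= 1" and y: "y \<in> cbx"
 shows "0 < Re (cP v (cor \<tau>) y + \<i> * cQ v (cor \<tau>) y)"
  "0 < Re (cP v (cor \<tau>) y - \<i> * cQ v (cor \<tau>) y)"
  "CI b v (cor \<tau>) y = cor (Fint b (\<tau>^2 *\<^sub>R v) y)"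
proof -
 obtain t1 t2 t3 u where e: "y = (t1,t2,t3,u)" by (cases y)
 have t: "0 <= t1" "t1 <= 1" "0 <= t2" "t2 <= 1" "0 <= t3" "t3 <= 1" "0 <= u" "u <= 1" using y e by (auto simp: cbx_def)
 define a where "a i t = 1 - (\<tau>^2 *\<^sub>R v)$i * t" for i t
 have a: "0 < a i t" "a i t <= 1" if "0 <= t" "t <= 1" for i t
 proof -
  have "\<tau>^2 * v$i * t <= 1 * v$i * 1" using v[of i] \<tau> that by (intro mult_mono) (auto simp: power_le_one)
  moreover have "0 <= \<tau>^2 * v$i * t" using v[of i] that by simp
  ultimately show "0 < a i t" "a i t <= 1" unfolding a_def using v(2)[of i] by auto
 qed
 have ec: "ec (v$i) (cor \<tau>) t = cor (a i t)" for i t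
  by (simp add: ec_def a_def)
 define P where "P = pol (a 1 t1) (a 2 t2) (a 3 t3)"
 have P: "0 < P" unfolding P_def by (intro pol_ge a t)
 define Y where "Y = 4*((1-a 1 t1)*(1-a 2 t2)*(1-a 3 t3))*(a 1 t1*a 2 t2*a 3 t3)*u"
 have cP: "cP v (cor \<tau>) y = cor P"
  by (simp add: cP_def Let_def e ec P_def pol_def)
 have cQ: "cQ v (cor \<tau>) y = cor (sqrt Y)"
 proof -
  have m: "1 - a i t = \<tau>^2 * (v$i * t)" for i t by (simp add: a_def)
  have "Y = (2 * \<tau>^3)^2 * (v$1 * t1 * (v$2 * t2) * (v$3 * t3) * u) * (a 1 t1 * a 2 t2 * a 3 t3)"
   unfolding Y_def m power2_eq_square power3_eq_cube by (simp only: mult_ac)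
  moreover have "sqrt ((2 * \<tau>^3)^2) = 2 * \<tau>^3" using \<tau> by (simp only: real_sqrt_abs) simp
  ultimately have "sqrt Y = 2 * \<tau>^3 * sqrt (v$1 * t1 * (v$2 * t2) * (v$3 * t3) * u) * (sqrt (a 1 t1) * sqrt (a 2 t2) * sqrt (a 3 t3))"
   by (simp only: real_sqrt_mult mult_ac)
  moreover have "cpw (1/2) (cor (a i t)) = cor (sqrt (a i t))" if "0 <= t" "t <= 1" for i t
   using a(1)[OF that] a(1)[OF that, THEN less_imp_le] by (simp only: cpw_of_real powr_half_sqrt)
  ultimately show ?thesis using t by (simp add: cQ_def Let_def e ec)
 qed
 have C: "cor P + \<i> * cor (sqrt Y) = Complex P (sqrt Y)"
  "cor P - \<i> * cor (sqrt Y) = cnj (Complex P (sqrt Y))"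
  by (simp_all add: complex_eq_iff)
 show "0 < Re (cP v (cor \<tau>) y + \<i> * cQ v (cor \<tau>) y)"
  "0 < Re (cP v (cor \<tau>) y - \<i> * cQ v (cor \<tau>) y)"
  unfolding cP cQ C using P by auto
 have K: "(cpw (-(4*b-1)) (Complex P (sqrt Y)) + cpw (-(4*b-1)) (cnj (Complex P (sqrt Y)))) / 2 = cor (Kr (4*b-1) P Y)"
  using P by (simp add: cpw_cnj complex_add_cnj Kr_def)
 have F: "Fint b (\<tau>^2 *\<^sub>R v) y = (a 1 t1 * a 2 t2 * a 3 t3) powr (2*b-1) * Kr (4*b-1) P Y"
  unfolding Fint_def e prod.case FI_def P_def Y_def a_def ..
 have p: "(a 1 t1 * a 2 t2 * a 3 t3) powr (2*b-1) = a 1 t1 powr (2*b-1) * a 2 t2 powr (2*b-1) * a 3 t3 powr (2*b-1)"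
  using a t by (simp add: powr_mult less_imp_le)
 show "CI b v (cor \<tau>) y = cor (Fint b (\<tau>^2 *\<^sub>R v) y)"
  unfolding CI_def Let_def cP cQ C K F p using a t by (simp add: e ec cpw_of_real)
qed

text \<open>On the compact set of \<open>ze\<close> in [0,1] and y in \<open>cbx\<close>, the real
  parts of P + iQ and P - iQ are positive, hence bounded below. Uniform continuity keeps half of
  these bounds on a neighborhood U of [0,1], the same for all y.\<close>

lemma CI_domain:
 assumes v: "!!i. 0 <= v$i" "!!i. v$i < 1" and b: "b > 1/2"
 obtains U C where "open U" "!!\<tau>. 0 <= \<tau> ==> \<tau> <= 1 ==> cor \<tau> \<in> U"
  "!!y. y \<in> cbx ==> (%ze. CI b v ze y) holomorphic_on U"
  "!!ze y. ze \<in> U ==> y \<in> cbx ==> norm (CI b v ze y) <= C"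
proof -
 define vm where "vm = Max (range (($) v))"
 have vm: "v$i <= vm" for i unfolding vm_def by (rule Max_ge) auto
 have "vm \<in> range (($) v)" unfolding vm_def by (rule Max_in) auto
 then have vm1: "0 <= vm" "vm < 1" using v by auto
 \<comment> \<open>This radius satisfies R > 1 and R^2 v_i < 1, so all 1 - \<open>ze\<close>^2 v_i t
   stay in the right half-plane.\<close>
 define R where "R = sqrt (2 / (1 + vm))"
 have R2: "R^2 = 2 / (1 + vm)" using vm1 by (simp add: R_def)
 have R1: "R > 1" using vm1 by (simp add: R_def)
 have Rv: "R^2 * v$i < 1" for i
 proof -
  have "R^2 * v$i <= R^2 * vm" by (rule mult_left_mono[OF vm]) auto
  also have "\<dots> < 1" unfolding R2 using vm1 by (simp add: divide_less_eq)
  finally show ?thesis .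
 qed
 define K where "K = cball (0::complex) R \<times> cbx"
 have cK: "compact K" unfolding K_def cbx_def by (intro compact_Times compact_cball compact_Icc)
 have ecK: "0 < Re (ec (v$i) ze t)" "norm (ec (v$i) ze t) <= 2" if "ze \<in> cball 0 R" "0 <= t" "t <= 1" for i ze t
  by (rule ec_bounds[OF _ Rv v(1)]; use that in simp)+
 have yb: "0 <= fst y" "fst y <= 1" "0 <= fst (snd y)" "fst (snd y) <= 1" "0 <= fst (snd (snd y))" "fst (snd (snd y)) <= 1" if "y \<in> cbx" for y
  using that by (auto simp: cbx_def)
 define H where "H sg p = cP v (fst p) (snd p) + sg * (\<i> * cQ v (fst p) (snd p))" for sg p
 have cont: "continuous_on K (%p. fst p)" "continuous_on K (%p. fst (snd p))" "continuous_on K (%p. fst (snd (snd p)))"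
  "continuous_on K (%p. fst (snd (snd (snd p))))" "continuous_on K (%p. snd (snd (snd (snd p))))"
  by (intro continuous_on_fst continuous_on_snd continuous_on_id)+
 have ecc: "continuous_on K (%p. ec (v$i) (fst p) (T p))" if "continuous_on K T" for i T
  unfolding ec_def by (intro continuous_on_diff continuous_on_mult continuous_on_power continuous_on_const continuous_on_of_real cont that)
 have pos: "0 < Re (ec (v$i) (fst p) (fst (snd p)))" "0 < Re (ec (v$i) (fst p) (fst (snd (snd p))))" "0 < Re (ec (v$i) (fst p) (fst (snd (snd (snd p)))))"
  if "p \<in> K" for p i
 proof -
  have "fst p \<in> cball 0 R" "snd p \<in> cbx" using that by (auto simp: K_def)
  then show "0 < Re (ec (v$i) (fst p) (fst (snd p)))" "0 < Re (ec (v$i) (fst p) (fst (snd (snd p))))" "0 < Re (ec (v$i) (fst p) (fst (snd (snd (snd p)))))"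
   by (simp_all add: ecK(1) yb)
 qed
 have Pc: "continuous_on K (%p. cP v (fst p) (snd p))"
  unfolding cP_def Let_def by (intro continuous_on_add continuous_on_diff continuous_on_mult continuous_on_const ecc cont)
 have Qc: "continuous_on K (%p. cQ v (fst p) (snd p))"
  unfolding cQ_def Let_def
  by (intro continuous_on_mult continuous_on_const continuous_on_power continuous_on_of_real continuous_on_real_sqrt continuous_on_cpw ecc cont pos)
 have Hc: "continuous_on K (H sg)" for sg
  unfolding H_def[abs_def] by (intro continuous_on_add continuous_on_mult continuous_on_const Pc Qc)
 define S where "S = (cor ` {0..1}) \<times> cbx"
 have "compact S" unfolding S_def cbx_def
  by (intro compact_Times compact_continuous_image continuous_on_of_real continuous_on_id compact_Icc)
 moreover have "(cor 0, (0,0,0,0)) \<in> S" unfolding S_def cbx_def by (intro SigmaI imageI) auto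
 moreover have "S \<subseteq> K" unfolding S_def K_def by (intro Sigma_mono) (use R1 in auto)
 ultimately have S: "compact S" "S ~= {}" "S \<subseteq> K" by blast+
 have ex: "\<exists>\<delta> \<eta>. \<delta> > 0 & \<eta> > 0 & (\<forall>ze y \<tau>. ze \<in> cball 0 R \<longrightarrow> y \<in> cbx \<longrightarrow> 0 <= \<tau> \<longrightarrow> \<tau> <= 1 \<longrightarrow> dist ze (cor \<tau>) < \<eta> \<longrightarrow> \<delta> <= Re (H sg (ze,y)))"
  if sg: "sg = 1 \<or> sg = -1" for sg
 proof -
  have "continuous_on S (%p. Re (H sg p))" by (intro continuous_intros continuous_on_subset[OF Hc S(3)])
  then obtain p0 where p0: "p0 \<in> S" "!!p. p \<in> S ==> Re (H sg p0) <= Re (H sg p)"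
   using continuous_attains_inf[OF S(1,2)] by blast
  define d where "d = Re (H sg p0)"
  obtain \<tau>0 y0 where p0': "p0 = (cor \<tau>0, y0)" "0 <= \<tau>0" "\<tau>0 <= 1" "y0 \<in> cbx"
   using p0(1) by (auto simp: S_def)
  have d: "d > 0" unfolding d_def H_def p0' using CI_of_real(1,2)[OF v p0'(2-4)] sg by auto
  have "uniformly_continuous_on K (H sg)" by (rule compact_uniformly_continuous[OF Hc cK])
  then obtain \<eta> where \<eta>: "\<eta> > 0" "!!p q. p \<in> K ==> q \<in> K ==> dist q p < \<eta> ==> dist (H sg q) (H sg p) < d/2"
   using d unfolding uniformly_continuous_on_def by (metis half_gt_zero)
  have "d/2 <= Re (H sg (ze,y))" if "ze \<in> cball 0 R" "y \<in> cbx" "0 <= \<tau>" "\<tau> <= 1" "dist ze (cor \<tau>) < \<eta>" for ze y \<tau>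
  proof -
   have s: "(cor \<tau>, y) \<in> S" using that by (auto simp: S_def)
   have "dist (H sg (ze,y)) (H sg (cor \<tau>, y)) < d/2"
    by (rule \<eta>(2)) (use s S(3) that in \<open>auto simp: K_def dist_Pair_Pair\<close>)
   then have "\<bar>Re (H sg (ze,y)) - Re (H sg (cor \<tau>, y))\<bar> < d/2"
    using abs_Re_le_cmod[of "H sg (ze,y) - H sg (cor \<tau>, y)"] by (simp add: dist_norm)
   then show ?thesis using p0(2)[OF s] unfolding d_def by linarith
  qed
  then show ?thesis using d \<eta>(1) by (intro exI[of _ "d/2"] exI[of _ \<eta>]) auto
 qed
 obtain d1 \<eta>1 where 1: "d1 > 0" "\<eta>1 > 0" "!!ze y \<tau>. ze \<in> cball 0 R ==> y \<in> cbx ==> 0 <= \<tau> ==> \<tau> <= 1 ==> dist ze (cor \<tau>) < \<eta>1 ==> d1 <= Re (H 1 (ze,y))"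
  using ex[of 1] by blast
 obtain d2 \<eta>2 where 2: "d2 > 0" "\<eta>2 > 0" "!!ze y \<tau>. ze \<in> cball 0 R ==> y \<in> cbx ==> 0 <= \<tau> ==> \<tau> <= 1 ==> dist ze (cor \<tau>) < \<eta>2 ==> d2 <= Re (H (-1) (ze,y))"
  using ex[of "-1"] by blast
 define \<eta> where "\<eta> = min (min \<eta>1 \<eta>2) (R - 1)"
 have \<eta>: "\<eta> > 0" "\<eta> <= \<eta>1" "\<eta> <= \<eta>2" "\<eta> <= R - 1" using 1 2 R1 by (auto simp: \<eta>_def)
 define U where "U = (\<Union>\<tau>\<in>{0..1}. ball (cor \<tau>) \<eta>)"
 have UR: "ze \<in> cball 0 R" and Re1: "y \<in> cbx ==> d1 <= Re (H 1 (ze,y))" and Re2: "y \<in> cbx ==> d2 <= Re (H (-1) (ze,y))"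
  if "ze \<in> U" for ze y
 proof -
  from that[unfolded U_def] obtain \<tau> where \<tau>0: "\<tau> \<in> {0..1}" "ze \<in> ball (cor \<tau>) \<eta>" by (rule UN_E)
  then have \<tau>: "0 <= \<tau>" "\<tau> <= 1" "dist (cor \<tau>) ze < \<eta>" by auto
  have "norm ze <= norm (cor \<tau>) + dist (cor \<tau>) ze"
   using norm_triangle_sub[of ze "cor \<tau>"] by (simp add: dist_norm norm_minus_commute)
  then show R: "ze \<in> cball 0 R" using \<tau> \<eta>(4) by simp
  show "y \<in> cbx ==> d1 <= Re (H 1 (ze,y))" "y \<in> cbx ==> d2 <= Re (H (-1) (ze,y))"
   using 1(3)[OF R _ \<tau>(1,2)] 2(3)[OF R _ \<tau>(1,2)] \<tau>(3) \<eta>(2,3) by (auto simp: dist_commute)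
 qed
 have Hp: "cP v ze y + \<i> * cQ v ze y = H 1 (ze,y)" "cP v ze y - \<i> * cQ v ze y = H (-1) (ze,y)" for ze y
  by (simp_all add: H_def)
 define C where "C = 2 powr (2*b-1) * 2 powr (2*b-1) * 2 powr (2*b-1) * ((d1 powr (-(4*b-1)) + d2 powr (-(4*b-1))) / 2)"
 show ?thesis
 proof (rule that[of U C])
  show "open U" by (auto simp: U_def)
  show "cor \<tau> \<in> U" if "0 <= \<tau>" "\<tau> <= 1" for \<tau> using that \<eta>(1) by (force simp: U_def)
  fix y assume y: "y \<in> cbx"
  have ch: "(%ze. cpw a (f ze)) holomorphic_on U" if "f holomorphic_on U" "!!ze. ze \<in> U ==> 0 < Re (f ze)" for a f
   using holomorphic_on_compose_gen[OF that(1) cpw_holomorphic[of a]] that(2) by (auto simp: o_def)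
  have eh: "(%ze. ec (v$i) ze t) holomorphic_on U" for i t unfolding ec_def by (intro holomorphic_intros)
  have ep: "0 < Re (ec (v$i) ze t)" if "ze \<in> U" "0 <= t" "t <= 1" for i ze t using ecK(1)[OF UR[OF that(1)] that(2,3)] .
  have cPh: "(%ze. cP v ze y) holomorphic_on U" unfolding cP_def Let_def by (intro holomorphic_intros eh)
  have cQh: "(%ze. cQ v ze y) holomorphic_on U" unfolding cQ_def Let_def
   by (intro holomorphic_intros ch eh ep) (use yb[OF y] in auto)
  show "(%ze. CI b v ze y) holomorphic_on U" unfolding CI_def Let_def
  proof (intro holomorphic_intros ch eh ep cPh cQh yb[OF y])
   show "0 < Re (cP v ze y + \<i> * cQ v ze y)" if "ze \<in> U" for ze unfolding Hp using Re1[OF that y] 1(1) by linarith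
   show "0 < Re (cP v ze y - \<i> * cQ v ze y)" if "ze \<in> U" for ze unfolding Hp using Re2[OF that y] 2(1) by linarith
  qed auto
  fix ze assume z: "ze \<in> U"
  have ne: "norm (cpw (2*b-1) (ec (v$i) ze t)) <= 2 powr (2*b-1)" if "0 <= t" "t <= 1" for i t
   using ecK[OF UR[OF z] that] ep[OF z that] b by (simp add: norm_cpw powr_mono2)
  have nh: "norm (cpw (-(4*b-1)) w) <= d powr (-(4*b-1))" if "d <= Re w" "0 < d" for w d
  proof -
   have "norm (cpw (-(4*b-1)) w) = norm w powr (-(4*b-1))" by (rule norm_cpw) (use that in auto)
   also have "\<dots> <= d powr (-(4*b-1))" by (rule powr_mono2') (use that complex_Re_le_cmod[of w] b in auto)
   finally show ?thesis .
  qed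
  have "norm ((cpw (-(4*b-1)) (H 1 (ze,y)) + cpw (-(4*b-1)) (H (-1) (ze,y))) / 2) <= (d1 powr (-(4*b-1)) + d2 powr (-(4*b-1))) / 2"
   unfolding norm_divide using order_trans[OF norm_triangle_ineq add_mono[OF nh[OF Re1[OF z y] 1(1)] nh[OF Re2[OF z y] 2(1)]]] by simp
  then show "norm (CI b v ze y) <= C" unfolding CI_def Let_def Hp norm_mult C_def
   by (intro mult_mono ne yb[OF y] mult_nonneg_nonneg) auto
 qed
qed

lemma has_sum_vec3:
 "((%n. f n) has_sum s) (UNIV :: (nat^3) set) \<longleftrightarrow> ((%(x,y,w). f (vector [x,y,w])) has_sum s) UNIV"
proof -
 have "bij_betw (%(x,y,w). vector [x,y,w] :: nat^3) UNIV UNIV"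
  by (rule bij_betwI[where g = "%n. (n$1, n$2, n$3)"]) (auto simp: vec_eq_iff forall_3)
 from has_sum_reindex_bij_betw[OF this, of f s] show ?thesis by (simp add: split_def)
qed

text \<open>Along r = \<open>ze\<close>^2 v both sides extend holomorphically to a neighborhood of
  [0,1]. They agree for small real \<open>ze\<close>, where both are given by the series with
  coefficients \<open>A_cf\<close>.\<close>

lemma neighbor_function_eq_Fbar:
 assumes b: "b > 1/2" and nc: "neighbor_coefficients b A B" and F: "continues_power_series A F"
  and r: "r \<in> half_open_cube"
 shows "F r = Fbar b r"
proof -
 obtain D f where f: "continues_real f D F" "!!z. (!!i. cmod (z$i) < 1/10) ==> z \<in> D"
  "!!z. (!!i. cmod (z$i) < 1/10) ==> powser_sum (%n. cor (A n)) z (f z)"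
  "!!r. r \<in> half_open_cube ==> cvec r \<in> D & f (cvec r) = cor (F r)"
  by (rule continues_power_seriesE[OF F], blast)
 have ma: "multi_analytic_on f D" using f by (simp add: continues_real_def)
 have v: "0 <= r$i" "r$i < 1" for i using r by (auto simp: half_open_cube_def)
 obtain U C where U: "open U" "!!\<tau>. 0 <= \<tau> ==> \<tau> <= 1 ==> cor \<tau> \<in> U"
  "!!y. y \<in> cbx ==> (%ze. CI b r ze y) holomorphic_on U"
  "!!ze y. ze \<in> U ==> y \<in> cbx ==> norm (CI b r ze y) <= C"
  using CI_domain[OF v b] by blast
 \<comment> \<open>Almost every point lies in \<open>qbox\<close>; setting the integrand to 0
   elsewhere makes holomorphy and the bound valid at every point.\<close>
 define h where "h ze y = indicator qbox y *\<^sub>R CI b r ze y" for ze y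
 have qc: "qbox \<subseteq> cbx" by (auto simp: qbox_def cbx_def)
 have qm: "qbox \<in> sets (M4 b)" unfolding sets_M4 qbox_def by measurable
 define J where "J ze = (\<integral>y. h ze y \<partial>M4 b)" for ze
 have Jhol: "J holomorphic_on U" unfolding J_def
 proof (rule holomorphic_integral[OF prob_space_M4(5)[OF b] U(1)])
  show "(%ze. h ze y) holomorphic_on U" for y
   using U(3)[of y] qc by (cases "y \<in> qbox") (auto simp: h_def)
  show "norm (h ze y) <= \<bar>C\<bar>" if "ze \<in> U" for ze y
   using U(4)[OF that, of y] qc by (cases "y \<in> qbox") (auto simp: h_def)
  show "h ze \<in> borel_measurable (M4 b)" for ze unfolding h_def using qm by measurable
 qed
 have J: "J (cor \<tau>) = cor (Fbar b (\<tau>^2 *\<^sub>R r))" if "0 <= \<tau>" "\<tau> <= 1" for \<tau>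
 proof -
  have "J (cor \<tau>) = (\<integral>y. cor (Fint b (\<tau>^2 *\<^sub>R r) y) \<partial>M4 b)" unfolding J_def
  proof (rule integral_cong_AE)
   show "AE y in M4 b. h (cor \<tau>) y = cor (Fint b (\<tau>^2 *\<^sub>R r) y)"
    using AE_M4[OF b]
   proof (rule eventually_mono)
    fix y :: quad
    assume "case y of (t1,t2,t3,u) => (0 < t1 & t1 < 1) & (0 < t2 & t2 < 1) & (0 < t3 & t3 < 1) & (0 < u & u < 1)"
    then have y: "y \<in> qbox" by (auto simp: qbox_def)
    then show "h (cor \<tau>) y = cor (Fint b (\<tau>^2 *\<^sub>R r) y)"
     using CI_of_real(3)[OF v that, of y b] qc by (auto simp: h_def)
   qed
   show "h (cor \<tau>) \<in> borel_measurable (M4 b)" unfolding h_def using qm by measurable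
  qed measurable
  then show ?thesis by (simp add: Fbar_def)
 qed
 define V where "V = {ze. smul ze (cvec r) \<in> D}"
 have V: "open V" "(%ze. f (smul ze (cvec r))) holomorphic_on V"
  unfolding V_def by (rule line_holomorphic[OF ma])+
 define U' where "U' = U \<inter> ((%ze. ze^2) -` V)"
 have U': "open U'" unfolding U'_def
  by (intro open_Int U continuous_open_vimage V continuous_intros)
 have sq: "0 <= \<tau>^2" "\<tau>^2 <= 1" if "0 <= \<tau>" "\<tau> <= 1" for \<tau> :: real using that by (auto simp: power_le_one)
 have sD: "smul (cor \<tau> ^ 2) (cvec r) \<in> D" "f (smul (cor \<tau> ^ 2) (cvec r)) = cor (F (\<tau>^2 *\<^sub>R r))"
  if "0 <= \<tau>" "\<tau> <= 1" for \<tau>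
 proof -
  have e: "smul (cor \<tau> ^ 2) (cvec r) = cvec (\<tau>^2 *\<^sub>R r)" using smul_cvec[of "\<tau>^2" r] by simp
  show "smul (cor \<tau> ^ 2) (cvec r) \<in> D" "f (smul (cor \<tau> ^ 2) (cvec r)) = cor (F (\<tau>^2 *\<^sub>R r))"
   unfolding e using f(4)[OF scale_half_open_cube[OF r sq[OF that]]] by auto
 qed
 have "(%ze. f (smul (ze^2) (cvec r)) - J ze) (cor 1) = 0"
 proof (rule segment_identity[OF _ U', where \<delta> = "1/10"])
  have "(%ze. f (smul (ze^2) (cvec r))) holomorphic_on U'"
  proof -
   have "(%ze. ze^2) holomorphic_on U'" by (intro holomorphic_intros)
   moreover have "(%ze. ze^2) ` U' \<subseteq> V" by (auto simp: U'_def)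
   ultimately show ?thesis using holomorphic_on_compose_gen[OF _ V(2)] unfolding o_def by blast
  qed
  moreover have "J holomorphic_on U'" by (rule holomorphic_on_subset[OF Jhol]) (auto simp: U'_def)
  ultimately show "(%ze. f (smul (ze^2) (cvec r)) - J ze) holomorphic_on U'" by (rule holomorphic_on_diff)
  show "cor \<tau> \<in> U'" if "0 <= \<tau>" "\<tau> <= 1" for \<tau>
   using U(2)[OF that] sD(1)[OF that] by (simp add: U'_def V_def)
  fix \<tau> :: real assume \<tau>: "0 < \<tau>" "\<tau> < 1/10"
  define r' where "r' = \<tau>^2 *\<^sub>R r"
  \<comment> \<open>Thus \<tau> < 1/10 brings all coordinates below 1/100, where
    \<open>Fbar_has_sum\<close> applies.\<close>
  have \<tau>2: "\<tau>^2 <= 1/100" using power_mono[of \<tau> "1/10" 2] \<tau> by (simp add: power2_eq_square)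
  have r': "0 <= r'$i" "r'$i <= 1/100" for i
  proof -
   show "0 <= r'$i" using v[of i] by (simp add: r'_def)
   have "\<tau>^2 * r$i <= \<tau>^2" using v[of i] mult_left_le[of "r$i" "\<tau>^2"] by simp
   then show "r'$i <= 1/100" using \<tau>2 by (simp add: r'_def)
  qed
  have "r' \<in> half_open_cube" unfolding r'_def by (rule scale_half_open_cube[OF r sq]) (use \<tau> in auto)
  then have fr: "f (cvec r') = cor (F r')" using f(4) by blast
  have "powser_sum (%n. cor (A n)) (cvec r') (f (cvec r'))"
  proof (rule f(3))
   fix i show "cmod (cvec r' $ i) < 1/10" using r'[of i] by simp
  qed
  then have h: "((%(x,y,w). cor (A (vector [x,y,w])) * zmono (cvec r') (vector [x,y,w])) has_sum f (cvec r')) UNIV"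
   unfolding powser_sum_def has_sum_vec3 .
  define F0 where "F0 = (%(x,y,w). A_cf b x y w * mon3 (r'$1) (r'$2) (r'$3) (x,y,w))"
  have eq: "(%(x,y,w). cor (A (vector [x,y,w])) * zmono (cvec r') (vector [x,y,w])) = (%p. cor (F0 p))"
  proof (rule ext)
   fix p :: "nat \<times> nat \<times> nat"
   obtain x y w where p: "p = (x,y,w)" by (cases p)
   have "zmono (cvec r') (vector [x,y,w]) = cor (mon3 (r'$1) (r'$2) (r'$3) (x,y,w))"
    unfolding zmono_def UNIV_3 mon3_def prod.case by (simp add: of_real_mult of_real_power)
   then show "(case p of (x,y,w) => cor (A (vector [x,y,w])) * zmono (cvec r') (vector [x,y,w])) = cor (F0 p)"
    unfolding p prod.case F0_def neighbor_coefficients_unique(1)[OF b nc] of_real_mult by (simp only:)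
  qed
  have "(F0 has_sum Fbar b r') UNIV" unfolding F0_def by (rule Fbar_has_sum[OF b r'])
  from has_sum_bounded_linear[OF bounded_linear_of_real this]
  have h2: "((%p. cor (F0 p)) has_sum cor (Fbar b r')) UNIV" unfolding o_def .
  have "f (cvec r') = cor (Fbar b r')" by (rule has_sum_unique[OF h[unfolded eq] h2])
  then show "f (smul (cor \<tau> ^ 2) (cvec r)) - J (cor \<tau>) = 0"
   using J[of \<tau>] sD(2)[of \<tau>] \<tau> fr by (simp add: r'_def)
 qed auto
 then show ?thesis using J[of 1] sD(2)[of 1] by simp
qed

section \<open>Symmetry in the three variables\<close>

definition vperm :: "('n => 'n) => 'a^'n => 'a^'n" where
 "vperm \<pi> z = (\<chi> i. z $ \<pi> i)"

lemma vperm_nth [simp]: "vperm \<pi> z $ i = z $ \<pi> i"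
 by (simp add: vperm_def)

lemma bij_vperm: "bij \<pi> ==> bij (vperm \<pi>)"
 by (rule bij_betwI[where g = "vperm (inv_into UNIV \<pi>)"]) (auto simp: vec_eq_iff bij_is_inj bij_is_surj surj_f_inv_f)

lemma powser_sum_vperm:
 assumes \<pi>: "bij \<pi>" and sym: "!!n. a (vperm \<pi> n) = a n" and s: "powser_sum a (vperm \<pi> z) s"
 shows "powser_sum a z s"
proof -
 have e: "zmono (vperm \<pi> z) (vperm \<pi> n) = zmono z n" for n
  unfolding zmono_def using prod.reindex_bij_betw[OF \<pi>, of "%i. (z$i) ^ (n$i)"] by simp
 show ?thesis
  using s has_sum_reindex_bij_betw[OF bij_vperm[OF \<pi>], of "%n. a n * zmono (vperm \<pi> z) n" s]
  by (simp add: powser_sum_def sym e)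
qed

lemma continues_power_series_symmetric:
 assumes F: "continues_power_series A F" and \<pi>: "bij \<pi>" and sym: "!!n. A (vperm \<pi> n) = A n"
  and r: "r \<in> half_open_cube"
 shows "F (vperm \<pi> r) = F r"
proof -
 obtain D f where f: "continues_real f D F" "!!z. (!!i. cmod (z$i) < 1/10) ==> z \<in> D"
  "!!z. (!!i. cmod (z$i) < 1/10) ==> powser_sum (%n. cor (A n)) z (f z)"
  "!!r. r \<in> half_open_cube ==> cvec r \<in> D & f (cvec r) = cor (F r)"
  by (rule continues_power_seriesE[OF F], blast)
 have r': "vperm \<pi> r \<in> half_open_cube" using r by (simp add: half_open_cube_def)
 have D: "!!r. r \<in> half_open_cube ==> cvec r \<in> D" using f(4) by blast
 have ma: "multi_analytic_on f D" using f by (simp add: continues_real_def)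
 define U where "U = {ze. smul ze (cvec r) \<in> D} \<inter> {ze. smul ze (cvec (vperm \<pi> r)) \<in> D}"
 have "(%ze. f (smul ze (cvec (vperm \<pi> r))) - f (smul ze (cvec r))) (cor 1) = 0"
 proof (rule segment_identity[where U = U and \<delta> = "1/10"])
  show "(%ze. f (smul ze (cvec (vperm \<pi> r))) - f (smul ze (cvec r))) holomorphic_on U"
   unfolding U_def by (intro holomorphic_on_diff; rule holomorphic_on_subset[OF line_holomorphic(1)[OF ma]]) auto
  show "open U" unfolding U_def by (intro open_Int line_holomorphic(2)[OF ma])
  show "cor \<tau> \<in> U" if "0 <= \<tau>" "\<tau> <= 1" for \<tau>
   using segment_in_domain(1)[OF D f(2) r that] segment_in_domain(1)[OF D f(2) r' that] by (simp add: U_def)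
  fix \<tau> :: real assume "0 < \<tau>" "\<tau> < 1/10"
  then have n: "norm (cor \<tau>) < 1/10" by simp
  have e: "smul (cor \<tau>) (cvec (vperm \<pi> r)) = vperm \<pi> (smul (cor \<tau>) (cvec r))"
   by (simp add: vec_eq_iff)
  have "powser_sum (%n. cor (A n)) (smul (cor \<tau>) (cvec r)) (f (smul (cor \<tau>) (cvec (vperm \<pi> r))))"
   by (rule powser_sum_vperm[OF \<pi>]) (use sym f(3)[OF segment_in_domain(2)[OF D f(2) r' n]] in \<open>simp_all add: e\<close>)
  moreover have "powser_sum (%n. cor (A n)) (smul (cor \<tau>) (cvec r)) (f (smul (cor \<tau>) (cvec r)))"
   by (rule f(3)[OF segment_in_domain(2)[OF D f(2) r n]])
  ultimately show "f (smul (cor \<tau>) (cvec (vperm \<pi> r))) - f (smul (cor \<tau>) (cvec r)) = 0"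
   unfolding powser_sum_def using has_sum_unique by fastforce
 qed auto
 then show ?thesis using f(4)[OF r] f(4)[OF r'] by simp
qed

lemma neighbor_function_symmetric:
 assumes b: "b > 1/2" and nc: "neighbor_coefficients b A B" and F: "continues_power_series A F"
  and \<pi>: "bij \<pi>" and r: "r \<in> half_open_cube"
 shows "F (vperm \<pi> r) = F r"
proof (rule continues_power_series_symmetric[OF F \<pi> _ r])
 fix n :: "nat^3"
 have v: "A m = A_cf b (m$1) (m$2) (m$3)" for m
 proof -
  have "m = vector [m$1, m$2, m$3]" by (simp add: vec_eq_iff forall_3)
  then show ?thesis using neighbor_coefficients_unique(1)[OF b nc, of "m$1" "m$2" "m$3"] by simp
 qed
 note inj = inj_eq[OF bij_is_inj[OF \<pi>]]
 then have d: "\<pi> 1 ~= \<pi> 2" "\<pi> 1 ~= \<pi> 3" "\<pi> 2 ~= \<pi> 3" by (simp_all add: inj)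
 define x y z where "x = n$1" and "y = n$2" and "z = n$3"
 have p: "A_cf b y x z = A_cf b x y z" "A_cf b x z y = A_cf b x y z" "A_cf b y z x = A_cf b x y z"
  "A_cf b z x y = A_cf b x y z" "A_cf b z y x = A_cf b x y z"
  using A_cf_swap(1)[of b y x z] A_cf_swap(2)[of b x z y] A_cf_swap(2)[of b y z x]
   A_cf_swap(1)[of b z x y] A_cf_swap(1)[of b z y x] by simp_all
 show "A (vperm \<pi> n) = A n"
  unfolding v vperm_nth using d exhaust_3[of "\<pi> 1"] exhaust_3[of "\<pi> 2"] exhaust_3[of "\<pi> 3"]
  by (elim disjE) (simp_all add: p[unfolded x_def y_def z_def])
qed

text \<open>The points n/(n+1) r lie in the half-open cube, where \<open>Fbar\<close> is the
  symmetric function F; continuity carries the symmetry to the closed cube.\<close>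

lemma Fbar_symmetric:
 assumes b: "b > 1/2" and nc: "neighbor_coefficients b A B" and F: "continues_power_series A F"
  and \<pi>: "bij \<pi>" and r: "r \<in> closed_cube"
 shows "Fbar b (vperm \<pi> r) = Fbar b r"
proof -
 define \<tau> where "\<tau> n = real n / real (Suc n)" for n
 have t1: "0 <= \<tau> n" "\<tau> n < 1" for n by (auto simp: \<tau>_def)
 have r': "vperm \<pi> r \<in> closed_cube" using r by (simp add: closed_cube_def)
 have tr: "\<tau> n *\<^sub>R s \<in> half_open_cube" "\<tau> n *\<^sub>R s \<in> closed_cube" if "s \<in> closed_cube" for n s
 proof -
  have "0 <= \<tau> n * s$i" "\<tau> n * s$i <= \<tau> n" for i
   using that t1[of n] mult_left_le[of "s$i" "\<tau> n"] by (auto simp: closed_cube_def)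
  then show "\<tau> n *\<^sub>R s \<in> half_open_cube" using t1(2)[of n]
   by (auto simp: half_open_cube_def intro: le_less_trans)
  then show "\<tau> n *\<^sub>R s \<in> closed_cube" by (auto simp: half_open_cube_def closed_cube_def less_imp_le)
 qed
 have "\<tau> \<longlonglongrightarrow> 1" unfolding \<tau>_def using LIMSEQ_n_over_Suc_n by simp
 then have l: "(%n. Fbar b (\<tau> n *\<^sub>R s)) \<longlonglongrightarrow> Fbar b s" if "s \<in> closed_cube" for s
  by (intro continuous_on_tendsto_compose[OF Fbar_continuous[OF b]])
    (use that tr(2)[OF that] tendsto_scaleR[of \<tau> 1 sequentially "%_. s" s] in auto)
 have "Fbar b (\<tau> n *\<^sub>R vperm \<pi> r) = Fbar b (\<tau> n *\<^sub>R r)" for n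
 proof -
  have "vperm \<pi> (\<tau> n *\<^sub>R r) = \<tau> n *\<^sub>R vperm \<pi> r" by (simp add: vec_eq_iff)
  then show ?thesis
   using neighbor_function_symmetric[OF b nc F \<pi> tr(1)[OF r, of n]] neighbor_function_eq_Fbar[OF b nc F tr(1)[OF r, of n]]
    neighbor_function_eq_Fbar[OF b nc F tr(1)[OF r', of n]] by simp
 qed
 then show ?thesis using LIMSEQ_unique[OF l[OF r']] l[OF r] by simp
qed

section \<open>Values on the faces r_i = 1\<close>

lemma Beta_shift2:
 assumes "0 < p" "0 < (q::real)"
 shows "Beta (p + real m) (q + real m) / Beta p q = pochhammer p m * pochhammer q m / pochhammer (p+q) (2*m)"
proof -
 have 1: "Beta (p + real m) q / Beta p q = pochhammer p m / pochhammer (p+q) m" by (rule Beta_shift[OF assms])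
 have 2: "Beta (q + real m) (p + real m) / Beta q (p + real m) = pochhammer q m / pochhammer (p + q + real m) m"
  using Beta_shift[of q "p + real m" m] assms by (simp add: add_ac)
 have "pochhammer (p+q) (m+m) = pochhammer (p+q) m * pochhammer (p + q + real m) m" by (rule pochhammer_product')
 moreover have "Beta (p + real m) q > 0" using assms by (intro Beta_real_pos) auto
 ultimately show ?thesis
  using arg_cong2[OF 1 2, of "(*)"] by (simp add: Beta_commute[of q] Beta_commute[of "q + real m"] mult_2)
qed

definition Jm :: "real => (real \<times> real) measure" where
 "Jm b = bet b (3*b-1) \<Otimes>\<^sub>M bet (1/2) (b-1/2)"

text \<open>The kernel on the face r_3 = 1 after the substitution in
  \<open>face_substitution\<close>, for v with law Beta(b,3b-1) and u with law Beta(1/2,b-1/2). Its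
  mean is the plain power (1+x)^(-(3b-1)).\<close>

definition Ji :: "real => real => real \<times> real => real" where
 "Ji b x = (%(v,u). Kr (4*b-1) 1 (4*(x*(v * (1-v)))*u))"

lemma sets_Jm [measurable_cong]: "sets (Jm b) = sets (borel \<Otimes>\<^sub>M borel)"
 unfolding Jm_def by (intro sets_pair_measure_cong sets_bet)

lemma space_Jm [simp]: "space (Jm b) = UNIV"
 by (simp add: Jm_def space_pair_measure)

lemma prob_space_Jm:
 assumes "b > 1/2" shows "prob_space (bet b (3*b-1))" "prob_space (bet (1/2) (b-1/2))" "prob_space (Jm b)"
proof -
 show 1: "prob_space (bet b (3*b-1))" "prob_space (bet (1/2) (b-1/2))"
  by (rule prob_space_bet; use assms in simp)+
 show "prob_space (Jm b)" unfolding Jm_def by (rule prob_space_pair[OF 1])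
qed

lemma AE_Jm:
 assumes b: "b > 1/2"
 shows "AE p in Jm b. (0 < fst p & fst p < 1) & (0 < snd p & snd p < 1)"
 unfolding Jm_def by (rule AE_pair_conj[OF prob_space_Jm(1,2)[OF b] _ _ AE_bet AE_bet]) measurable

lemma Ji_measurable [measurable]: "Ji b x \<in> borel_measurable (Jm b)"
 unfolding Ji_def by measurable

lemma Kr_one_bound: "b > 1/2 ==> 0 <= Y ==> \<bar>Kr (4*b-1) 1 Y\<bar> <= 1"
proof -
 assume b: "b > 1/2" and Y: "0 <= Y"
 have "\<bar>Kr (4*b-1) 1 Y\<bar> <= (1^2 + Y) powr (-(4*b-1)/2)" by (rule Kr_bound) (use Y in auto)
 also have "\<dots> <= (1^2 + Y) powr 0" by (rule powr_mono) (use b Y in auto)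
 finally show ?thesis using Y by simp
qed

lemma Ji_integrable: assumes b: "b > 1/2" and x: "0 <= x" shows "integrable (Jm b) (Ji b x)"
proof -
 interpret prob_space "Jm b" by (rule prob_space_Jm[OF b])
 have "AE p in Jm b. norm (Ji b x p) <= 1"
  using AE_Jm[OF b] by (rule eventually_mono) (use x in \<open>auto simp: Ji_def split_def intro!: Kr_one_bound[OF b]\<close>)
 then show ?thesis by (rule integrable_const_bound) measurable
qed

text \<open>Expand in x. The mean of v^m (1-v)^m is (b)_m (3b-1)_m / (4b-1)_{2m}, which reduces
  \<open>kap_coeff\<close> to (3b-1)_m / m!; a binomial series remains.\<close>

lemma Ji_integral_small:
 assumes b: "b > 1/2" and x: "0 <= x" "x < 1"
 shows "(\<integral>p. Ji b x p \<partial>Jm b) = (1 + x) powr (-(3*b-1))"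
proof -
 define V where "V = bet b (3*b-1)"
 define N where "N = bet (1/2) (b-1/2)"
 note P = prob_space_Jm[OF b, folded V_def N_def]
 interpret V: prob_space V by (rule P)
 interpret N: prob_space N by (rule P)
 interpret pair_sigma_finite V N ..
 define g where "g v = (\<integral>u. Ji b x (v,u) \<partial>N)" for v
 have i: "integrable (V \<Otimes>\<^sub>M N) (Ji b x)" using Ji_integrable[OF b x(1)] by (simp add: Jm_def V_def N_def)
 have gi: "integrable V g" and g: "(\<integral>v. g v \<partial>V) = (\<integral>p. Ji b x p \<partial>Jm b)"
  using integrable_fst'[OF i] integral_fst'[OF i] unfolding g_def[abs_def] Jm_def V_def N_def by simp_all
 define f where "f m v = kap_coeff b m * (-x)^m * (v powr real m * (1-v) powr real m)" for m v
 define B where "B m = kap_coeff b m * (x/4)^m" for m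
 have 1: "integrable V (%v. v powr real m * (1-v) powr real m)" "(\<integral>v. v powr real m * (1-v) powr real m \<partial>V) = pochhammer b m * pochhammer (3*b-1) m / pochhammer (4*b-1) (2*m)" for m
  using integral_bet[of b "3*b-1" "real m" "real m"] Beta_shift2[of b "3*b-1" m] b by (simp_all add: V_def)
 have f1: "integrable V (f m)" for m unfolding f_def by (rule integrable_mult_right[OF 1(1)])
 have f2: "(\<integral>v. f m v \<partial>V) = pochhammer (3*b-1) m / fact m * (-x)^m" for m
 proof -
  have "pochhammer (4*b-1) (2*m) > 0" "pochhammer b m > 0" by (rule pochhammer_pos; use b in simp)+
  then show ?thesis unfolding f_def integral_mult_right_zero 1(2) kap_coeff_def by (simp add: field_simps)
 qed
 have Bs: "B summable_on UNIV" using kap_summable[OF b, of 1 "x/4"] x by (simp add: B_def[abs_def])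
 have "((%m. \<integral>v. f m v \<partial>V) has_sum (\<integral>v. g v \<partial>V)) UNIV"
 proof (rule has_sum_integral[OF P(1) f1 gi Bs])
  show "AE v in V. ((%m. f m v) has_sum g v) UNIV & (\<forall>m. \<bar>f m v\<bar> <= B m)"
   using AE_bet[of b "3*b-1"] unfolding V_def[symmetric]
  proof (rule eventually_mono)
   fix v :: real assume v: "0 < v & v < 1"
   have q: "v * (1-v) <= 1/4" using sum_squares_bound[of v "1-v"] v by (simp add: power2_eq_square algebra_simps)
   define W where "W = x*(v * (1-v))"
   have W: "0 <= W" "4*W < 1^2"
    using mult_mono[of x 1 "v * (1-v)" "1/4"] mult_left_mono[OF q x(1)] x v by (auto simp: W_def)
   have e: "f m v = kap_coeff b m * (-W)^m" for m
    using v by (simp add: f_def W_def powr_realpow power_mult_distrib[symmetric])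
   have "((%m. f m v) has_sum g v) UNIV"
    using kap_has_sum[OF b _ W] by (simp add: e g_def Ji_def W_def N_def)
   moreover have "\<bar>f m v\<bar> <= B m" for m
   proof -
    have "W <= x/4" using mult_left_mono[OF q x(1)] by (simp add: W_def)
    then show ?thesis unfolding e B_def abs_mult power_abs abs_minus_cancel
     using W kap_coeff_bound(1)[OF b, of m] by (intro mult_mono power_mono) auto
   qed
   ultimately show "((%m. f m v) has_sum g v) UNIV & (\<forall>m. \<bar>f m v\<bar> <= B m)" by blast
  qed
 qed
 moreover have "((%m. pochhammer (3*b-1) m / fact m * (-x)^m) has_sum (1 - (-x)) powr (-(3*b-1))) UNIV"
  by (rule powser_binomial) (use b x in auto)
 ultimately show ?thesis unfolding f2 g using has_sum_unique by fastforce
qed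

lemma Ji_integral:
 assumes b: "b > 1/2" and x: "0 <= x"
 shows "(\<integral>p. Ji b x p \<partial>Jm b) = (1 + x) powr (-(3*b-1))"
proof (cases "x = 0")
 case True
 then show ?thesis using Ji_integral_small[OF b, of x] by simp
next
 case False
 \<comment> \<open>Almost everywhere this is 2 sqrt(v(1-v)u); clamping to [0,1] makes the bounds
   hold at every point.\<close>
 define \<theta> where "\<theta> = (%(v,u). max 0 (min 1 (2 * sqrt (v * (1-v)*u))))"
 define \<theta>c where "\<theta>c p = cor (\<theta> p)" for p
 have \<theta>: "0 <= \<theta> p" "\<theta> p <= 1" for p by (auto simp: \<theta>_def split_def)
 define s where "s = -(4*b-1)"
 define h where "h \<xi> p = (cpw s (1 + \<i> * \<xi> * \<theta>c p) + cpw s (1 - \<i> * \<xi> * \<theta>c p)) / 2" for \<xi> p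
 define J where "J \<xi> = (\<integral>p. h \<xi> p \<partial>Jm b)" for \<xi>
 define R where "R \<xi> = cpw (-(3*b-1)) (1 + \<i> * \<xi>) * cpw (-(3*b-1)) (1 - \<i> * \<xi>)" for \<xi>
 define U where "U = {\<xi>. \<bar>Im \<xi>\<bar> < 1/2}"
 have U: "open U" unfolding U_def by (intro open_Collect_less continuous_intros)
 have re: "1/2 <= Re (1 + \<i> * \<xi> * cor t)" "1/2 <= Re (1 - \<i> * \<xi> * cor t)" if "\<xi> \<in> U" "0 <= t" "t <= 1" for \<xi> t
 proof -
  have "\<bar>Im \<xi> * t\<bar> <= 1/2" using that mult_mono[of "\<bar>Im \<xi>\<bar>" "1/2" t 1] by (simp add: U_def abs_mult)
  then show "1/2 <= Re (1 + \<i> * \<xi> * cor t)" "1/2 <= Re (1 - \<i> * \<xi> * cor t)" by (simp_all add: abs_le_iff)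
 qed
 have re0: "0 < Re (1 + \<i> * \<xi> * cor t)" "0 < Re (1 - \<i> * \<xi> * cor t)" if "\<xi> \<in> U" "0 <= t" "t <= 1" for \<xi> t
  using re[OF that] by linarith+
 have ch: "(%ze. cpw a (f ze)) holomorphic_on U" if "f holomorphic_on U" "!!ze. ze \<in> U ==> 0 < Re (f ze)" for a f
  using holomorphic_on_compose_gen[OF that(1) cpw_holomorphic[of a]] that(2) by (auto simp: o_def)
 have Jh: "J holomorphic_on U" unfolding J_def
 proof (rule holomorphic_integral[OF prob_space_Jm(3)[OF b] U])
  show "(%\<xi>. h \<xi> p) holomorphic_on U" for p
   unfolding h_def \<theta>c_def by (intro holomorphic_intros ch re0 \<theta>) auto
  fix \<xi> p assume \<xi>: "\<xi> \<in> U"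
  have n: "norm (cpw s z) <= (1/2) powr s" if "1/2 <= Re z" for z
  proof -
   have "norm (cpw s z) = norm z powr s" by (rule norm_cpw) (use that in auto)
   also have "\<dots> <= (1/2) powr s" by (rule powr_mono2') (use that complex_Re_le_cmod[of z] b in \<open>auto simp: s_def\<close>)
   finally show ?thesis .
  qed
  show "norm (h \<xi> p) <= (1/2) powr s" unfolding h_def norm_divide \<theta>c_def
   using order_trans[OF norm_triangle_ineq add_mono[OF n[OF re(1)[OF \<xi> \<theta>]] n[OF re(2)[OF \<xi> \<theta>]]], of p p] by simp
 next
  show "h \<xi> \<in> borel_measurable (Jm b)" for \<xi> unfolding h_def[abs_def] \<theta>c_def \<theta>_def split_def by measurable
 qed
 have J: "J (cor \<tau>) = cor (\<integral>p. Ji b (\<tau>^2) p \<partial>Jm b)" if "0 <= \<tau>" for \<tau>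
 proof -
  have "J (cor \<tau>) = (\<integral>p. cor (Ji b (\<tau>^2) p) \<partial>Jm b)" unfolding J_def
  proof (rule integral_cong_AE)
   show "AE p in Jm b. h (cor \<tau>) p = cor (Ji b (\<tau>^2) p)" using AE_Jm[OF b]
   proof (rule eventually_mono)
    fix p :: "real \<times> real" assume p: "(0 < fst p & fst p < 1) & (0 < snd p & snd p < 1)"
    obtain v u where pe: "p = (v,u)" by (cases p)
    have vu: "0 < v" "v < 1" "0 < u" "u < 1" using p pe by auto
    have q: "v * (1-v) <= 1/4" using sum_squares_bound[of v "1-v"] by (simp add: power2_eq_square algebra_simps)
    have "v * (1-v)*u <= 1/4 * 1" by (rule mult_mono[OF q]) (use vu in auto)
    then have "sqrt (v * (1-v)*u) <= sqrt ((1/2)^2)" by (intro real_sqrt_le_mono) (simp add: power2_eq_square)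
    then have t: "\<theta> p = 2 * sqrt (v * (1-v)*u)" using vu by (simp add: \<theta>_def pe)
    have sq: "sqrt (4*(\<tau>^2*(v * (1-v)))*u) = \<tau> * \<theta> p"
     using that by (simp add: t real_sqrt_mult mult_ac)
    have c: "Complex 1 (\<tau> * \<theta> p) = 1 + \<i> * cor \<tau> * \<theta>c p" "cnj (1 + \<i> * cor \<tau> * \<theta>c p) = 1 - \<i> * cor \<tau> * \<theta>c p"
     by (simp_all add: complex_eq_iff \<theta>c_def)
    have "cpw s (cnj (1 + \<i> * cor \<tau> * \<theta>c p)) = cnj (cpw s (1 + \<i> * cor \<tau> * \<theta>c p))"
     by (rule cpw_cnj) (simp add: \<theta>c_def)
    then show "h (cor \<tau>) p = cor (Ji b (\<tau>^2) p)"
     unfolding h_def Ji_def pe prod.case Kr_def sq[unfolded pe] c(1)[unfolded pe] c(2)[unfolded pe] s_def[symmetric]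
     by (simp add: complex_add_cnj)
   qed
   show "h (cor \<tau>) \<in> borel_measurable (Jm b)" unfolding h_def[abs_def] \<theta>c_def \<theta>_def split_def by measurable
  qed measurable
  then show ?thesis by simp
 qed
 have R: "R (cor \<tau>) = cor ((1 + \<tau>^2) powr (-(3*b-1)))" for \<tau>
 proof -
  define z where "z = 1 + \<i> * cor \<tau>"
  have z: "0 < Re z" "cnj z = 1 - \<i> * cor \<tau>" by (simp_all add: z_def complex_eq_iff)
  have "norm z ^ 2 = 1 + \<tau>^2" by (simp add: z_def cmod_power2)
  moreover have "norm z > 0" using z by auto
  ultimately have n: "(norm z powr (-(3*b-1)))^2 = (1 + \<tau>^2) powr (-(3*b-1))"
   by (metis powr_power power2_eq_square powr_mult less_imp_le)
  have "R (cor \<tau>) = cpw (-(3*b-1)) z * cnj (cpw (-(3*b-1)) z)"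
   unfolding R_def z(2)[symmetric] cpw_cnj[OF z(1)] by (simp add: z_def)
  then show ?thesis unfolding complex_norm_square[symmetric] norm_cpw[OF z(1)] n[symmetric] by simp
 qed
 have "(%\<xi>. J \<xi> - R \<xi>) (cor (sqrt x)) = 0"
 proof (rule segment_identity[OF _ U, where \<delta> = 1])
  have re1: "0 < Re (1 + \<i> * \<xi>)" "0 < Re (1 - \<i> * \<xi>)" if "\<xi> \<in> U" for \<xi>
   using re0[OF that, of 1] by simp_all
  show "(%\<xi>. J \<xi> - R \<xi>) holomorphic_on U" unfolding R_def by (intro holomorphic_intros Jh ch re1) auto
  show "cor \<tau> \<in> U" for \<tau> by (simp add: U_def)
  fix \<tau> :: real assume \<tau>: "0 < \<tau>" "\<tau> < 1"
  then have "\<tau>^2 < 1" by (simp add: power_less_one_iff)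
  then show "J (cor \<tau>) - R (cor \<tau>) = 0"
   using \<tau> Ji_integral_small[OF b, of "\<tau>^2"] J[of \<tau>] R[of \<tau>] by simp
 qed (use x False in auto)
 then show ?thesis using x J[of "sqrt x"] R[of "sqrt x"] by simp
qed

lemma integral_bet_lborel:
 fixes f :: "real => real"
 assumes pq: "0 < p" "0 < q" and [measurable]: "f \<in> borel_measurable borel"
 shows "(\<integral>t. f t \<partial>bet p q) = (\<integral>t. (t powr (p-1) * (1-t) powr (q-1) * f t) * indicator {0..1} t \<partial>lborel) / Beta p q"
  and "integrable (bet p q) f ==> set_integrable lborel {0..1} (%t. t powr (p-1) * (1-t) powr (q-1) * f t)"
proof -
 define w where "w t = indicator {0<..<1} t * (t powr (p-1) * (1-t) powr (q-1) / Beta p q)" for t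
 have w: "0 <= w t" for t using Beta_real_pos[OF pq] by (auto simp: w_def indicator_def)
 have [measurable]: "w \<in> borel_measurable borel" unfolding w_def[abs_def] by measurable
 have M: "bet p q = density lborel (%t. ennreal (w t))" by (simp add: bet_def w_def)
 have e: "(t powr (p-1) * (1-t) powr (q-1) * f t) * indicator {0..1} t / Beta p q = w t * f t" for t
  by (cases "t = 0 \<or> t = 1") (auto simp: w_def indicator_def)
 have i: "(\<integral>t. f t \<partial>bet p q) = (\<integral>t. w t * f t \<partial>lborel)" "integrable (bet p q) f \<longleftrightarrow> integrable lborel (%t. w t * f t)"
  unfolding M by (subst integral_real_density integrable_real_density; use w in simp)+
 show "(\<integral>t. f t \<partial>bet p q) = (\<integral>t. (t powr (p-1) * (1-t) powr (q-1) * f t) * indicator {0..1} t \<partial>lborel) / Beta p q"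
  unfolding i(1) by (simp only: e[symmetric] integral_divide_zero)
 assume "integrable (bet p q) f"
 then have "integrable lborel (%t. Beta p q * (w t * f t))" unfolding i(2) by (rule integrable_mult_right)
 moreover have "Beta p q * (w t * f t) = indicator {0..1} t *\<^sub>R (t powr (p-1) * (1-t) powr (q-1) * f t)" for t
  using Beta_real_pos[OF pq] unfolding e[symmetric] by simp
 ultimately show "set_integrable lborel {0..1} (%t. t powr (p-1) * (1-t) powr (q-1) * f t)"
  unfolding set_integrable_def by (simp only:)
qed

text \<open>On the face \<open>r\<^sub>3 = 1\<close> the substitution \<open>v = g t / (g t + a (1 - t))\<close> makes the argument of the
 kernel homogeneous and turns \<open>Beta(b, b)\<close> into \<open>Beta(b, 3b - 1)\<close>.\<close>

lemma face_substitution: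
 assumes b: "b > 1/2" and a: "0 < a1" "a1 <= 1" "0 < a2" "a2 <= 1" and u: "0 < u" "u < 1"
 defines "g \<equiv> a1 * a2" and "a \<equiv> a1 + a2 - a1 * a2"
 shows "(\<integral>t. FI b a1 a2 (1-t) u \<partial>bet b b) = Beta b (3*b-1) / Beta b b *
  (g powr (b-1) * a powr (-(3*b-1)) * (\<integral>v. Ji b ((1-a1)*(1-a2)/a) (v,u) \<partial>bet b (3*b-1)))"
proof -
 define x where "x = (1-a1)*(1-a2)/a"
 have g: "0 < g" using a by (simp add: g_def)
 have ga: "a = 1 - (1-a1)*(1-a2)" by (simp add: a_def algebra_simps)
 have "(1-a1)*(1-a2) <= 1 - a1" using a by (intro mult_left_le) auto
 then have a0: "0 < a" using a ga by linarith
 have x: "0 <= x" using a a0 by (simp add: x_def)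
 define P where "P t = g * t + a * (1 - t)" for t
 have P: "0 < P t" if "0 <= t" "t <= 1" for t
 proof (cases "t = 1")
  case True then show ?thesis using g by (simp add: P_def)
 next
  case False
  then have "0 < a * (1-t)" "0 <= g * t" using that a0 g by auto
  then show ?thesis by (simp add: P_def)
 qed
 define V where "V t = g * t / P t" for t
 define V' where "V' t = g * a / (P t)^2" for t
 define f where "f v = v powr (b-1) * (1-v) powr (3*b-1-1) * Ji b x (v,u)" for v
 have Jm: "(%v. Ji b x (v,u)) \<in> borel_measurable borel" unfolding Ji_def prod.case by measurable
 interpret B3: prob_space "bet b (3*b-1)" by (rule prob_space_Jm[OF b])
 have Jint: "integrable (bet b (3*b-1)) (%v. Ji b x (v,u))"
 proof (rule B3.integrable_const_bound)
  show "AE v in bet b (3*b-1). norm (Ji b x (v,u)) <= 1"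
   using AE_bet[of b "3*b-1"] by (rule eventually_mono) (use x u in \<open>auto simp: Ji_def intro!: Kr_one_bound[OF b]\<close>)
 qed (use Jm in measurable)
 have V01: "V 0 = 0" "V 1 = 1" using g by (simp_all add: V_def P_def)
 have V: "(V has_real_derivative V' t) (at t)" if "t \<in> {0..1}" for t
  unfolding V_def[abs_def] V'_def P_def
  by (rule derivative_eq_intros refl | use P[of t] that in \<open>simp add: P_def power2_eq_square field_simps\<close>)+
 have sub: "(LBINT v. f v * indicator {V 0..V 1} v) = (LBINT t. f (V t) * V' t * indicator {0..1} t)"
 proof (rule integral_substitution(2))
  show "set_integrable lborel {V 0..V 1} f" unfolding V01 f_def
   by (rule integral_bet_lborel(2)[OF _ _ Jm Jint]) (use b in auto)
  show "continuous_on {0..1} V'" unfolding V'_def P_def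
   by (intro continuous_intros) (use P in \<open>fastforce simp: P_def\<close>)
  show "V' t >= 0" for t using g a0 by (simp add: V'_def)
 qed (use V in auto)
 have pt: "(t powr (b-1) * (1-t) powr (b-1) * FI b a1 a2 (1-t) u) * indicator {0..1} t =
   g powr (b-1) * a powr (-(3*b-1)) * (f (V t) * V' t * indicator {0..1} t)" for t
 proof (cases "0 < t & t < 1")
  case False
  then consider "t = 0" | "t = 1" | "t \<notin> {0..1}" by fastforce
  then show ?thesis by cases (auto simp: f_def V01)
 next
  case True
  define \<tau> where "\<tau> = 1 - t"
  have t: "0 < t" "0 < \<tau>" "0 < P t" using True P[of t] by (auto simp: \<tau>_def)
  have V1: "1 - V t = a * \<tau> / P t" using t by (simp add: V_def P_def \<tau>_def field_simps)
  have pol: "pol a1 a2 (1-t) = P t * 1" by (simp add: pol_def P_def g_def a_def algebra_simps)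
  have xa: "(1-a1)*(1-a2) = x * a" using a0 by (simp add: x_def)
  have "(1-a1)*(1-a2)*t*(g*\<tau>) = (P t)^2 * (x * (V t * (1 - V t)))"
   unfolding V1 unfolding V_def xa using t by (simp add: power2_eq_square)
  then have Y: "4*((1-a1)*(1-a2)*(1-(1-t)))*(a1*a2*(1-t))*u = (P t)^2 * (4*(x*(V t * (1-V t)))*u)"
   by (simp add: g_def \<tau>_def)
  have V0: "0 <= V t" "0 <= 1 - V t" unfolding V1 using t g a0 by (auto simp: V_def)
  have "FI b a1 a2 (1-t) u = (g*\<tau>) powr (2*b-1) * (P t powr (-(4*b-1)) * Ji b x (V t,u))"
   unfolding FI_def pol Y Ji_def prod.case
   by (subst Kr_scale) (use t x V0 u in \<open>auto simp: g_def \<tau>_def\<close>)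
  \<comment> \<open>Both sides are monomials in g, a, t, \<tau> and P(t); they are compared through
    their logarithms.\<close>
  moreover have "t powr (b-1) * \<tau> powr (b-1) * ((g*\<tau>) powr (2*b-1) * P t powr (-(4*b-1))) =
   g powr (b-1) * a powr (-(3*b-1)) * ((V t) powr (b-1) * (a * \<tau> / P t) powr (3*b-1-1) * V' t)"
  proof -
   have V': "V' t = exp (ln g + ln a - 2 * ln (P t))" unfolding V'_def using g a0 t by (simp add: exp_add exp_diff exp_double)
   have "V t > 0" using g t by (simp add: V_def)
   have L: "ln (V t) = ln g + ln t - ln (P t)" "ln (a * \<tau> / P t) = ln a + ln \<tau> - ln (P t)" "ln (g*\<tau>) = ln g + ln \<tau>"
    using g t a0 by (simp_all add: V_def ln_mult ln_div)
   show ?thesis using g t a0 \<open>V t > 0\<close> unfolding V' powr_def L by (simp add: exp_add[symmetric]) (simp add: algebra_simps)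
  qed
  ultimately show ?thesis using True unfolding f_def V1 \<tau>_def by simp
 qed
 have FIm: "(%t. FI b a1 a2 (1-t) u) \<in> borel_measurable borel" unfolding FI_def pol_def by measurable
 have b3: "0 < b" "0 < 3*b-1" using b by auto
 have "(\<integral>t. FI b a1 a2 (1-t) u \<partial>bet b b) = g powr (b-1) * a powr (-(3*b-1)) * (LBINT v. f v * indicator {0..1} v) / Beta b b"
  unfolding integral_bet_lborel(1)[OF b3(1) b3(1) FIm] pt integral_mult_right_zero sub[symmetric] V01 ..
 also have "(LBINT v. f v * indicator {0..1} v) = Beta b (3*b-1) * (\<integral>v. Ji b x (v,u) \<partial>bet b (3*b-1))"
  unfolding integral_bet_lborel(1)[OF b3 Jm] f_def using Beta_real_pos[OF b3] by simp
 finally show ?thesis unfolding x_def by simp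
qed

lemma face_integrable:
 assumes b: "b > 1/2" and a: "0 < a1" "a1 <= 1" "0 < a2" "a2 <= 1"
 shows "integrable (bet b b \<Otimes>\<^sub>M bet (1/2) (b-1/2)) (%(t,u). FI b a1 a2 (1-t) u)"
proof -
 define p where "p = (2*b+1-maj_exp b)/3"
 define C where "C = 2 powr maj_exp b * (a1*a2) powr (-p)"
 note P = prob_space_M4[OF b]
 have "integrable (bet b b \<Otimes>\<^sub>M bet (1/2) (b-1/2)) (%(t,u). (C * (1-t) powr (-p)) * u powr (-maj_exp b))"
  using maj_exp[OF b] b by (intro integrable_pair_mult[OF P(1,2)] integrable_mult_right integrable_bet_one) (auto simp: p_def)
 then show ?thesis
 proof (rule Bochner_Integration.integrable_bound)
  have "AE q in bet b b \<Otimes>\<^sub>M bet (1/2) (b-1/2). (0 < fst q & fst q < 1) & (0 < snd q & snd q < 1)"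
   by (rule AE_pair_conj[OF P(1,2) _ _ AE_bet AE_bet]) measurable
  then show "AE q in bet b b \<Otimes>\<^sub>M bet (1/2) (b-1/2). norm (case q of (t,u) => FI b a1 a2 (1-t) u) <= norm (case q of (t,u) => (C * (1-t) powr (-p)) * u powr (-maj_exp b))"
  proof (rule eventually_mono)
   fix q :: "real \<times> real" assume q: "(0 < fst q & fst q < 1) & (0 < snd q & snd q < 1)"
   obtain t u where qe: "q = (t,u)" by (cases q)
   have "\<bar>FI b a1 a2 (1-t) u\<bar> <= 2 powr maj_exp b * ((a1*a2*(1-t)) powr (-p) * u powr (-maj_exp b))"
    unfolding p_def by (rule FI_bound) (use a q qe b maj_exp[OF b] in auto)
   also have "(a1*a2*(1-t)) powr (-p) = (a1*a2) powr (-p) * (1-t) powr (-p)"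
    by (rule powr_mult)
   finally show "norm (case q of (t,u) => FI b a1 a2 (1-t) u) <= norm (case q of (t,u) => (C * (1-t) powr (-p)) * u powr (-maj_exp b))"
    by (simp add: qe C_def mult_ac)
  qed
 qed (unfold FI_def pol_def split_def, measurable)
qed

text \<open>After \<open>Ji_integral\<close> the factors a^(-(3b-1)) and (1+x)^(-(3b-1)) cancel,
  since a (1+x) = a + (1-a1)(1-a2) = 1. What is left separates in a1 and a2.\<close>

lemma face_inner_integral:
 assumes b: "b > 1/2" and a: "0 < a1" "a1 <= 1" "0 < a2" "a2 <= 1"
 shows "(\<integral>q. (case q of (t,u) => FI b a1 a2 (1-t) u) \<partial>(bet b b \<Otimes>\<^sub>M bet (1/2) (b-1/2))) =
  Beta b (3*b-1) / Beta b b * (a1 powr (b-1) * a2 powr (b-1))"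
proof -
 define N where "N = bet (1/2) (b-1/2)"
 define B where "B = bet b b"
 define V where "V = bet b (3*b-1)"
 note P = prob_space_M4[OF b, folded N_def B_def]
 interpret N: prob_space N by (rule P)
 interpret B: prob_space B by (rule P)
 interpret V: prob_space V unfolding V_def by (rule prob_space_Jm[OF b])
 interpret P1: pair_sigma_finite B N ..
 interpret P2: pair_sigma_finite V N ..
 define a where "a = a1 + a2 - a1*a2"
 define x where "x = (1-a1)*(1-a2)/a"
 have ga: "a = 1 - (1-a1)*(1-a2)" by (simp add: a_def algebra_simps)
 have "(1-a1)*(1-a2) <= 1 - a1" using assms by (intro mult_left_le) auto
 then have a0: "0 < a" using assms ga by linarith
 have x: "0 <= x" using assms a0 by (simp add: x_def)
 have i: "integrable (B \<Otimes>\<^sub>M N) (%(t,u). FI b a1 a2 (1-t) u)" using face_integrable[OF assms] by (simp add: B_def N_def)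
 have j: "integrable (V \<Otimes>\<^sub>M N) (%(v,u). Ji b x (v,u))" using Ji_integrable[OF b x] by (simp add: Jm_def V_def N_def)
 define D where "D = Beta b (3*b-1) / Beta b b * ((a1*a2) powr (b-1) * a powr (-(3*b-1)))"
 have "(\<integral>q. (case q of (t,u) => FI b a1 a2 (1-t) u) \<partial>(B \<Otimes>\<^sub>M N)) = (\<integral>u. (\<integral>t. FI b a1 a2 (1-t) u \<partial>B) \<partial>N)"
  using P1.integral_snd[OF i] by simp
 also have "\<dots> = (\<integral>u. D * (\<integral>v. Ji b x (v,u) \<partial>V) \<partial>N)"
 proof (rule integral_cong_AE)
  show "AE u in N. (\<integral>t. FI b a1 a2 (1-t) u \<partial>B) = D * (\<integral>v. Ji b x (v,u) \<partial>V)"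
   using AE_bet[of "1/2" "b-1/2"] unfolding N_def[symmetric]
   by (rule eventually_mono) (use face_substitution[OF assms] in \<open>simp add: D_def x_def a_def B_def V_def\<close>)
  show "(%u. \<integral>t. FI b a1 a2 (1-t) u \<partial>B) \<in> borel_measurable N"
   using P1.integrable_snd[OF i] by (rule borel_measurable_integrable)
  show "(%u. D * (\<integral>v. Ji b x (v,u) \<partial>V)) \<in> borel_measurable N"
   using P2.integrable_snd[OF j] by (intro borel_measurable_times borel_measurable_const borel_measurable_integrable)
 qed
 also have "\<dots> = D * (\<integral>p. Ji b x p \<partial>Jm b)"
  using P2.integral_snd[OF j] by (simp add: Jm_def V_def N_def)
 also have "\<dots> = D * (1 + x) powr (-(3*b-1))" by (simp add: Ji_integral[OF b x])
 also have "1 + x = 1 / a" using a0 unfolding x_def by (simp add: field_simps a_def)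
 also have "D * (1 / a) powr (-(3*b-1)) = Beta b (3*b-1) / Beta b b * (a1 powr (b-1) * a2 powr (b-1))"
  using a0 a by (simp add: D_def powr_divide powr_mult)
 finally show ?thesis by (simp add: B_def N_def)
qed

section \<open>Euler's integral for the hypergeometric function\<close>

text \<open>Euler's integral for the function \<open>f_hyp\<close>; see
  \<open>f_hyp_eq_hypint\<close>.\<close>

definition hypint :: "real => real => real" where
 "hypint b r = (\<integral>t. (1 - r*t) powr (b-1) \<partial>bet b b)"

text \<open>The integral over t3 and u separates by \<open>face_inner_integral\<close>, and each of
  the remaining integrals over t1 and t2 is an Euler integral.\<close>

lemma Fbar_face:
 assumes b: "b > 1/2" and r: "r \<in> closed_cube" and r3: "r$3 = 1"
 shows "Fbar b r = Beta b (3*b-1) / Beta b b * (hypint b (r$1) * hypint b (r$2))"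
proof -
 define N where "N = bet (1/2) (b-1/2)"
 define B where "B = bet b b"
 define C where "C = Beta b (3*b-1) / Beta b b"
 note P = prob_space_M4[OF b, folded N_def B_def]
 interpret N: prob_space N by (rule P)
 interpret B: prob_space B by (rule P)
 interpret N1: prob_space "B \<Otimes>\<^sub>M N" by (rule P)
 interpret N2: prob_space "B \<Otimes>\<^sub>M (B \<Otimes>\<^sub>M N)" by (rule P)
 interpret P2: pair_sigma_finite B "B \<Otimes>\<^sub>M N" ..
 interpret P3: pair_sigma_finite B "B \<Otimes>\<^sub>M (B \<Otimes>\<^sub>M N)" ..
 have r01: "0 <= r$i" "r$i <= 1" for i using r by (auto simp: closed_cube_def)
 have good: "AE t in B. 0 < t & t < 1" unfolding B_def by (rule AE_bet)
 have i3: "integrable (B \<Otimes>\<^sub>M (B \<Otimes>\<^sub>M (B \<Otimes>\<^sub>M N))) (Fint b r)"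
  using Fint_integrable[OF b r] by (simp add: M4_def B_def N_def)
 have in1: "(\<integral>q. Fint b r (t1,t2,q) \<partial>(B \<Otimes>\<^sub>M N)) = C * ((1 - r$1*t1) powr (b-1) * (1 - r$2*t2) powr (b-1))"
  if t: "0 < t1" "t1 < 1" "0 < t2" "t2 < 1" for t1 t2
 proof -
  have "Fint b r (t1,t2,q) = (case q of (t,u) => FI b (1 - r$1*t1) (1 - r$2*t2) (1-t) u)" for q
   by (cases q) (simp add: Fint_def r3)
  then show ?thesis unfolding C_def B_def N_def
   using face_inner_integral[OF b FI_arg_bounds(2,3)[OF r01 t(1,2)] FI_arg_bounds(2,3)[OF r01 t(3,4)]] by simp
 qed
 have in2: "(\<integral>q. Fint b r (t1,q) \<partial>(B \<Otimes>\<^sub>M (B \<Otimes>\<^sub>M N))) = C * hypint b (r$2) * (1 - r$1*t1) powr (b-1)"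
  if t: "0 < t1 & t1 < 1" and i: "integrable (B \<Otimes>\<^sub>M (B \<Otimes>\<^sub>M N)) (%q. Fint b r (t1,q))" for t1
 proof -
  have "(\<integral>q. Fint b r (t1,q) \<partial>(B \<Otimes>\<^sub>M (B \<Otimes>\<^sub>M N))) = (\<integral>t2. (\<integral>q. Fint b r (t1,t2,q) \<partial>(B \<Otimes>\<^sub>M N)) \<partial>B)"
   using P2.integral_fst'[OF i] by simp
  also have "\<dots> = (\<integral>t2. C * (1 - r$1*t1) powr (b-1) * (1 - r$2*t2) powr (b-1) \<partial>B)"
  proof (rule integral_cong_AE)
   show "AE t2 in B. (\<integral>q. Fint b r (t1,t2,q) \<partial>(B \<Otimes>\<^sub>M N)) = C * (1 - r$1*t1) powr (b-1) * (1 - r$2*t2) powr (b-1)"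
    using good by (rule eventually_mono) (use t in1 in auto)
   show "(%t2. \<integral>q. Fint b r (t1,t2,q) \<partial>(B \<Otimes>\<^sub>M N)) \<in> borel_measurable B"
    using P2.integrable_fst'[OF i] by (rule borel_measurable_integrable)
  qed (simp add: B_def, measurable)
  finally show ?thesis by (simp add: hypint_def B_def)
 qed
 have "(\<integral>p. Fint b r p \<partial>(B \<Otimes>\<^sub>M (B \<Otimes>\<^sub>M (B \<Otimes>\<^sub>M N)))) = (\<integral>t1. (\<integral>q. Fint b r (t1,q) \<partial>(B \<Otimes>\<^sub>M (B \<Otimes>\<^sub>M N))) \<partial>B)"
  using P3.integral_fst'[OF i3] by simp
 also have "\<dots> = (\<integral>t1. C * hypint b (r$2) * (1 - r$1*t1) powr (b-1) \<partial>B)"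
 proof (rule integral_cong_AE)
  show "AE t1 in B. (\<integral>q. Fint b r (t1,q) \<partial>(B \<Otimes>\<^sub>M (B \<Otimes>\<^sub>M N))) = C * hypint b (r$2) * (1 - r$1*t1) powr (b-1)"
   using good P3.AE_integrable_fst'[OF i3] by eventually_elim (rule in2)
  show "(%t1. \<integral>q. Fint b r (t1,q) \<partial>(B \<Otimes>\<^sub>M (B \<Otimes>\<^sub>M N))) \<in> borel_measurable B"
   using P3.integrable_fst'[OF i3] by (rule borel_measurable_integrable)
 qed (simp add: B_def, measurable)
 finally show ?thesis by (simp add: Fbar_def M4_def B_def N_def hypint_def C_def mult_ac)
qed

definition bc :: "real => nat => real" where
 "bc b n = pochhammer (1-b) n / fact n"

lemma bc_sums:
 assumes "\<bar>x\<bar> < 1"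
 shows "(%n. bc b n * x ^ n) sums (1 - x) powr (b-1)"
proof -
 have "(%n. ((b-1) gchoose n) * (-x) ^ n) sums (1 + (-x)) powr (b-1)"
  by (rule gen_binomial_real) (use assms in auto)
 moreover have "((b-1) gchoose n) * (-x) ^ n = bc b n * x ^ n" for n
 proof -
  have "(-1::real) ^ n * (-1) ^ n = 1" by (simp add: power_mult_distrib[symmetric])
  moreover have "((b-1) gchoose n) * (-x) ^ n = ((-1) ^ n * (-1) ^ n) * (bc b n * x ^ n)"
   unfolding gbinomial_pochhammer bc_def power_minus[of x] by simp
  ultimately show ?thesis by simp
 qed
 ultimately show ?thesis by simp
qed

text \<open>The coefficients (1-b)_n / n! have constant sign from some index on, so the sum of their
  absolute values differs from plus or minus the series by finitely many terms. This supplies the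
  majorant that lets \<open>hyp_sums\<close> reach r = 1.\<close>

lemma bc_partial_sums_bounded:
 obtains Q where "!!N x. 0 <= x ==> x < 1 ==> \<bar>\<Sum>n<N. bc b n * x ^ n\<bar> <= Q + (1 - x) powr (b-1)"
proof -
 \<comment> \<open>From this index on the factors 1 - b + n are positive.\<close>
 define n0 where "n0 = nat \<lceil>b\<rceil>"
 define \<sigma> where "\<sigma> = sgn (pochhammer (1-b) n0)"
 define d where "d n = \<bar>bc b n\<bar> - \<sigma> * bc b n" for n
 have \<sigma>: "\<bar>\<sigma>\<bar> <= 1" by (simp add: \<sigma>_def abs_sgn_eq)
 have d0: "d n = 0" if "n0 <= n" for n
 proof -
  have "real n0 >= b" unfolding n0_def by linarith
  then have p: "pochhammer (1 - b + real n0) (n - n0) > 0" by (intro pochhammer_pos) auto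
  have e: "pochhammer (1-b) n = pochhammer (1-b) n0 * pochhammer (1 - b + real n0) (n - n0)"
   using pochhammer_product[OF that, of "1-b"] .
  show ?thesis unfolding d_def bc_def e using p
   by (cases "pochhammer (1-b) n0 = 0") (auto simp: \<sigma>_def abs_mult sgn_mult abs_sgn mult_ac)
 qed
 define Q where "Q = (\<Sum>n<n0. \<bar>d n\<bar>)"
 have "\<bar>\<Sum>n<N. bc b n * x ^ n\<bar> <= Q + (1 - x) powr (b-1)" if x: "0 <= x" "x < 1" for N x
 proof -
  have ax: "\<bar>x\<bar> < 1" using x by simp
  define S where "S = (1 - x) powr (b-1)"
  have "(%n. \<sigma> * (bc b n * x ^ n)) sums (\<sigma> * S)" unfolding S_def by (intro sums_mult bc_sums ax)
  moreover have "(%n. d n * x ^ n) sums (\<Sum>n<n0. d n * x ^ n)" by (rule sums_finite) (use d0 in auto)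
  ultimately have "(%n. d n * x ^ n + \<sigma> * (bc b n * x ^ n)) sums ((\<Sum>n<n0. d n * x ^ n) + \<sigma> * S)"
   by (intro sums_add)
  moreover have "d n * x ^ n + \<sigma> * (bc b n * x ^ n) = \<bar>bc b n\<bar> * x ^ n" for n by (simp add: d_def algebra_simps)
  ultimately have s: "(%n. \<bar>bc b n\<bar> * x ^ n) sums ((\<Sum>n<n0. d n * x ^ n) + \<sigma> * S)" by simp
  have "\<bar>\<Sum>n<N. bc b n * x ^ n\<bar> <= (\<Sum>n<N. \<bar>bc b n\<bar> * x ^ n)"
   using x by (intro order_trans[OF sum_abs]) (simp add: abs_mult)
  also have "\<dots> <= (\<Sum>n<n0. d n * x ^ n) + \<sigma> * S"
   using sum_le_suminf[OF sums_summable[OF s], of "{..<N}"] x sums_unique[OF s] by simp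
  also have "\<dots> <= Q + S"
  proof (rule add_mono)
   have "d n * x ^ n <= \<bar>d n\<bar>" for n
    using mult_mono[of "d n" "\<bar>d n\<bar>" "x^n" 1] x by (simp add: power_le_one)
   then show "(\<Sum>n<n0. d n * x ^ n) <= Q" unfolding Q_def by (intro sum_mono)
   have "S >= 0" by (simp add: S_def)
   then show "\<sigma> * S <= S" using \<sigma> mult_right_mono[of \<sigma> 1 S] by (simp add: abs_le_iff)
  qed
  finally show ?thesis by (simp add: S_def)
 qed
 then show ?thesis by (rule that)
qed

lemma hypint_bound:
 fixes r t b :: real
 assumes "0 <= r" "r <= 1" "0 < t" "t < 1"
 shows "(1 - r*t) powr (b-1) <= 1 + (1-t) powr (b-1)"
proof (cases "b <= 1")
 case True
 then have "(1 - r*t) powr (b-1) <= (1-t) powr (b-1)"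
  using FI_arg_bounds[OF assms] assms by (intro powr_mono2') auto
 then show ?thesis by simp
next
 case False
 then have "(1 - r*t) powr (b-1) <= 1" using FI_arg_bounds[OF assms] by (intro powr_le1) auto
 then show ?thesis by (smt (verit) powr_ge_zero)
qed

lemma hypint_bound_integrable: "b > 1/2 ==> integrable (bet b b) (%t. C + (1-t) powr (b-1))"
proof -
 assume b: "b > 1/2"
 interpret prob_space "bet b b" by (rule prob_space_M4[OF b])
 have "integrable (bet b b) (%t. (1-t) powr (b-1))" by (rule integrable_bet_one) (use b in auto)
 then show ?thesis by simp
qed

lemma hypint_pos: assumes b: "b > 1/2" and r: "0 <= r" "r <= 1" shows "0 < hypint b r"
 unfolding hypint_def
proof (rule integral_pos_prob[OF prob_space_M4(1)[OF b]])
 show "integrable (bet b b) (%t. (1 - r*t) powr (b-1))"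
 proof (rule Bochner_Integration.integrable_bound[OF hypint_bound_integrable[OF b, of 1]])
  show "AE t in bet b b. norm ((1 - r*t) powr (b-1)) <= norm (1 + (1-t) powr (b-1))"
   using AE_bet by (rule eventually_mono) (use hypint_bound[OF r] in auto)
 qed measurable
 show "AE t in bet b b. 0 < (1 - r*t) powr (b-1)"
  using AE_bet by (rule eventually_mono) (use FI_arg_bounds[OF r] in fastforce)
qed

lemma hyp_fps_nth:
 "fps_nth (fps_hypergeo [1 - b, b] [2*b] 1) n = bc b n * (pochhammer b n / pochhammer (2*b) n)"
 by (simp add: fps_hypergeo_nth bc_def)

text \<open>Dominated convergence for the partial sums of the binomial series under the Beta(b,b)
  law, whose moments are the missing factors of the hypergeometric coefficients.\<close>

lemma hyp_sums:
 assumes b: "b > 1/2" and r: "0 <= r" "r <= 1"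
 shows "(%n. fps_nth (fps_hypergeo [1 - b, b] [2*b] 1) n * r ^ n) sums hypint b r"
proof -
 have bb: "integrable (bet b b) (%t. t^n)" "(\<integral>t. t^n \<partial>bet b b) = pochhammer b n / pochhammer (2*b) n" for n
  using moment_bet[of b b n] b by (simp_all add: mult_2[symmetric])
 obtain Q where Q: "!!N x. 0 <= x ==> x < 1 ==> \<bar>\<Sum>n<N. bc b n * x ^ n\<bar> <= Q + (1 - x) powr (b-1)"
  using bc_partial_sums_bounded[of b] by blast
 have rt: "0 <= r*t" "r*t < 1" if "0 < t" "t < 1" for t using FI_arg_bounds(2)[OF r that] r that by auto
 have "(%N. \<integral>t. (\<Sum>n<N. bc b n * (r*t) ^ n) \<partial>bet b b) \<longlonglongrightarrow> hypint b r"
  unfolding hypint_def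
 proof (rule integral_dominated_convergence[where w = "%t. (Q + 1) + (1-t) powr (b-1)"])
  show "AE t in bet b b. (%N. \<Sum>n<N. bc b n * (r*t) ^ n) \<longlonglongrightarrow> (1 - r*t) powr (b-1)"
   using AE_bet by (rule eventually_mono) (use bc_sums rt in \<open>auto simp: sums_def\<close>)
  show "AE t in bet b b. norm (\<Sum>n<N. bc b n * (r*t) ^ n) <= (Q + 1) + (1-t) powr (b-1)" for N
   using AE_bet
  proof (rule eventually_mono)
   fix t :: real assume t: "0 < t & t < 1"
   show "norm (\<Sum>n<N. bc b n * (r*t) ^ n) <= (Q + 1) + (1-t) powr (b-1)"
    using Q[of "r*t" N] rt[of t] t hypint_bound[OF r, of t b] by simp
  qed
 qed (use hypint_bound_integrable[OF b] in auto)
 moreover have "(\<integral>t. (\<Sum>n<N. bc b n * (r*t) ^ n) \<partial>bet b b) = (\<Sum>n<N. fps_nth (fps_hypergeo [1 - b, b] [2*b] 1) n * r ^ n)" for N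
 proof -
  have "(\<integral>t. (\<Sum>n<N. bc b n * (r*t) ^ n) \<partial>bet b b) = (\<integral>t. (\<Sum>n<N. bc b n * r ^ n * t ^ n) \<partial>bet b b)"
   by (simp add: power_mult_distrib mult.assoc)
  also have "\<dots> = (\<Sum>n<N. bc b n * r ^ n * (pochhammer b n / pochhammer (2*b) n))"
   by (subst Bochner_Integration.integral_sum) (simp_all add: bb)
  finally show ?thesis unfolding hyp_fps_nth by (simp add: mult_ac)
 qed
 ultimately show ?thesis by (simp add: sums_def)
qed

lemma f_hyp_eq_hypint: "b > 1/2 ==> 0 <= r ==> r <= 1 ==> f_hyp b r = hypint b r"
 unfolding f_hyp_def eval_fps_def by (rule sums_unique[symmetric, OF hyp_sums])

lemma f_hyp_pos: "b > 1/2 ==> 0 <= r ==> r <= 1 ==> 0 < f_hyp b r"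
 by (simp add: f_hyp_eq_hypint hypint_pos)

lemma hypint_1: "b > 1/2 ==> hypint b 1 = Beta b (2*b-1) / Beta b b"
proof -
 assume b: "b > 1/2"
 have "hypint b 1 = (\<integral>t. t powr 0 * (1-t) powr (b-1) \<partial>bet b b)" unfolding hypint_def
 proof (rule integral_cong_AE)
  show "AE t in bet b b. (1 - 1*t) powr (b-1) = t powr 0 * (1-t) powr (b-1)"
   using AE_bet by (rule eventually_mono) auto
 qed measurable
 also have "\<dots> = Beta (b+0) (b+(b-1)) / Beta b b" by (rule integral_bet) (use b in auto)
 finally show ?thesis by (simp add: algebra_simps)
qed

lemma c_F_eq: assumes b: "b > 1/2" shows "c_F b = Beta b (3*b-1) / Beta b b * hypint b 1"
proof -
 have "Gamma b > 0" "Gamma (2*b) > 0" using b by (auto intro!: Gamma_real_pos)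
 moreover have e: "b + b = 2*b" "b + (3*b-1) = 4*b-1" by auto
 ultimately show ?thesis unfolding c_F_def using b by (simp add: f_hyp_eq_hypint Beta_def e mult_ac)
qed

lemma c_F_pos: "b > 1/2 ==> 0 < c_F b"
 using Beta_real_pos[of b "3*b-1"] Beta_real_pos[of b b] hypint_pos[of b 1] by (simp add: c_F_eq)

lemma c_alpha_eq:
 assumes b: "b > 1/2"
 shows "c_alpha b = Gamma b * Gamma (4*b - 1) / (Gamma (2*b) * Gamma (3*b - 1)) *
    (Gamma b * Gamma (3*b - 1) / (Gamma (2*b) * Gamma (2*b - 1)))\<^sup>2"
proof -
 have g: "Gamma b > 0" "Gamma (2*b) > 0" "Gamma (3*b-1) > 0" "Gamma (4*b-1) > 0" "Gamma (2*b-1) > 0"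
  using b by (auto intro!: Gamma_real_pos)
 have e: "b + b = 2*b" "b + (2*b-1) = 3*b-1" by auto
 have f1: "f_hyp b 1 = Gamma (2*b) * Gamma (2*b-1) / (Gamma b * Gamma (3*b-1))"
  using g b by (simp add: f_hyp_eq_hypint hypint_1 Beta_def e mult_ac)
 show ?thesis unfolding c_alpha_def c_F_def f1 using g by (simp add: power2_eq_square field_simps)
qed

text \<open>Up to a nonzero constant this is \<open>Fbar\<close> along the edge (r,1,1).\<close>

lemma continuous_on_hypint: assumes b: "b > 1/2" shows "continuous_on {0..1} (hypint b)"
proof -
 define C where "C = Beta b (3*b-1) / Beta b b * hypint b 1"
 have C: "C > 0" using c_F_pos[OF b] c_F_eq[OF b] by (simp add: C_def)
 define \<gamma> where "\<gamma> r = ((\<chi> i. if i = 1 then r else 1) :: real^3)" for r :: real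
 have "continuous_on {0..1} (%r::real. if i = (1::3) then r else 1)" for i
  by (cases "i = 1") (simp_all add: continuous_on_id)
 then have "continuous_on {0..1} \<gamma>" unfolding \<gamma>_def by (rule continuous_on_vec_lambda)
 moreover have \<gamma>c: "\<gamma> r \<in> closed_cube" if "r \<in> {0..1}" for r
  using that by (simp add: \<gamma>_def closed_cube_def)
 ultimately have "continuous_on {0..1} (%r. Fbar b (\<gamma> r) / C)"
  using C by (intro continuous_intros continuous_on_compose2[OF Fbar_continuous[OF b]]) auto
 then show ?thesis
 proof (rule continuous_on_eq)
  fix r :: real assume r: "r \<in> {0..1}"
  have "Fbar b (\<gamma> r) = C * hypint b r"
   using Fbar_face[OF b \<gamma>c[OF r]] by (simp add: \<gamma>_def C_def mult_ac)
  then show "Fbar b (\<gamma> r) / C = hypint b r" using C by simp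
 qed
qed

text \<open>The hypergeometric equation for \<open>f_hyp\<close>; for \<open>b < 1\<close> all coefficients are nonnegative.\<close>

lemma f_hyp_ode:
 assumes b: "b > 1/2"
 obtains f1 f2 where
  "!!r. 0 < r ==> r < 1 ==> (f_hyp b has_real_derivative f1 r) (at r)"
  "!!r. 0 < r ==> r < 1 ==> (f1 has_real_derivative f2 r) (at r)"
  "!!r. 0 < r ==> r < 1 ==> r*(1-r) * f2 r + (2*b - 2*r) * f1 r - b*(1-b) * f_hyp b r = 0"
  "!!r. b < 1 ==> 0 < r ==> r < 1 ==> 0 <= f1 r"
proof -
 define H where "H = fps_hypergeo [1 - b, b] [2*b] (1::real)"
 define h where "h = fps_nth H"
 have rad: "fps_conv_radius H >= 1" unfolding fps_conv_radius_def
 proof (rule conv_radius_geI_ex')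
  fix r :: real assume "0 < r" "ereal r < 1"
  then show "summable (%n. fps_nth H n * of_real r ^ n)"
   using hyp_sums[OF b, of r] by (auto simp: H_def dest: sums_summable)
 qed
 have rad1: "fps_conv_radius (fps_deriv H) >= 1" using rad fps_conv_radius_deriv by (rule order_trans)
 have rad2: "fps_conv_radius (fps_deriv (fps_deriv H)) >= 1" using rad1 fps_conv_radius_deriv by (rule order_trans)
 have lt: "ereal (norm r) < fps_conv_radius H" "ereal (norm r) < fps_conv_radius (fps_deriv H)"
  "ereal (norm r) < fps_conv_radius (fps_deriv (fps_deriv H))" if "0 < r" "r < 1" for r :: real
  using that rad rad1 rad2 by (auto intro: less_le_trans[where y = 1])
 have rec: "(real n + 1) * (real n + 2*b) * h (Suc n) = (real n + b) * (real n + 1 - b) * h n" for n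
 proof -
  have p: "pochhammer (2*b) n > 0" "2*b + real n > 0" using b by (auto intro!: pochhammer_pos)
  define Y where "Y = (2*b + real n) * (real n + 1)"
  have Y: "Y ~= 0" "(real n + 1) * (real n + 2*b) = Y" using p by (auto simp: Y_def mult_ac add_ac)
  define X where "X = (1 - b + real n) * (b + real n)"
  have X: "(real n + b) * (real n + 1 - b) = X" by (simp add: X_def algebra_simps)
  have "h (Suc n) = h n * (X / Y)"
   unfolding h_def H_def hyp_fps_nth bc_def pochhammer_Suc fact_Suc Y_def X_def by (simp add: mult_ac add_ac)
  then show ?thesis unfolding Y(2) X using Y(1) by simp
 qed
 have ode: "fps_X * fps_deriv (fps_deriv H) - fps_X * (fps_X * fps_deriv (fps_deriv H)) + fps_const (2*b) * fps_deriv H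
   - fps_const 2 * (fps_X * fps_deriv H) - fps_const (b*(1-b)) * H = 0"
 proof (rule fps_ext)
  fix n
  show "fps_nth (fps_X * fps_deriv (fps_deriv H) - fps_X * (fps_X * fps_deriv (fps_deriv H)) + fps_const (2*b) * fps_deriv H
   - fps_const 2 * (fps_X * fps_deriv H) - fps_const (b*(1-b)) * H) n = fps_nth 0 n"
  proof (cases n)
   case 0 then show ?thesis using rec[of 0] by (simp add: h_def algebra_simps)
  next
   case (Suc m)
   then show ?thesis using rec[of n] by (cases m) (simp_all add: h_def algebra_simps)
  qed
 qed
 show ?thesis
 proof (rule that[of "eval_fps (fps_deriv H)" "eval_fps (fps_deriv (fps_deriv H))"])
  fix r :: real assume r: "0 < r" "r < 1"
  note l = lt[OF r]
  show "(f_hyp b has_real_derivative eval_fps (fps_deriv H) r) (at r)"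
   unfolding f_hyp_def[abs_def] H_def[symmetric] by (rule has_field_derivative_eval_fps[OF l(1)])
  show "(eval_fps (fps_deriv H) has_real_derivative eval_fps (fps_deriv (fps_deriv H)) r) (at r)"
   by (rule has_field_derivative_eval_fps[OF l(2)])
  have X: "ereal (norm r) < fps_conv_radius (fps_X * f)" "eval_fps (fps_X * f) r = r * eval_fps f r"
   if "ereal (norm r) < fps_conv_radius f" for f
   using that fps_conv_radius_mult[of fps_X f] eval_fps_mult[of r fps_X f] by (auto intro: less_le_trans)
  have C: "ereal (norm r) < fps_conv_radius (fps_const c * f)" "eval_fps (fps_const c * f) r = c * eval_fps f r"
   if "ereal (norm r) < fps_conv_radius f" for c f
   using that fps_conv_radius_mult[of "fps_const c" f] eval_fps_mult[of r "fps_const c" f] by (auto intro: less_le_trans)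
  have A: "ereal (norm r) < fps_conv_radius (f + g)" "ereal (norm r) < fps_conv_radius (f - g)"
   if "ereal (norm r) < fps_conv_radius f" "ereal (norm r) < fps_conv_radius g" for f g
   using that fps_conv_radius_add[of f g] fps_conv_radius_diff[of f g] by (auto intro: less_le_trans[rotated])
  have "eval_fps (fps_X * fps_deriv (fps_deriv H) - fps_X * (fps_X * fps_deriv (fps_deriv H)) + fps_const (2*b) * fps_deriv H
   - fps_const 2 * (fps_X * fps_deriv H) - fps_const (b*(1-b)) * H) r =
   r * eval_fps (fps_deriv (fps_deriv H)) r - r * (r * eval_fps (fps_deriv (fps_deriv H)) r) + 2*b * eval_fps (fps_deriv H) r
    - 2 * (r * eval_fps (fps_deriv H) r) - b*(1-b) * f_hyp b r"
   by (simp only: eval_fps_diff eval_fps_add X C A l f_hyp_def H_def[symmetric])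
  then show "r*(1-r) * eval_fps (fps_deriv (fps_deriv H)) r + (2*b - 2*r) * eval_fps (fps_deriv H) r - b*(1-b) * f_hyp b r = 0"
   unfolding ode by (simp add: algebra_simps)
  assume b1: "b < 1"
  have "0 <= h n" for n unfolding h_def H_def hyp_fps_nth bc_def
   using b b1 by (auto intro!: mult_nonneg_nonneg divide_nonneg_nonneg pochhammer_nonneg)
  then have nn: "0 <= fps_nth (fps_deriv H) n * r ^ n" for n using r by (simp add: h_def)
  show "0 <= eval_fps (fps_deriv H) r"
   unfolding eval_fps_def using l(2) by (intro suminf_nonneg summable_fps nn) auto
 qed
qed

section \<open>Positivity in the interior by a maximum principle\<close>

text \<open>On the line through p in direction v the first derivative vanishes at p; a negative
  second derivative would make w decrease there.\<close>

lemma second_order_minimum: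
 fixes w :: "real^'n => real"
 assumes S: "open S" "p \<in> S"
  and d1: "!!x. x \<in> S ==> (w has_derivative (%h. \<Sum>i\<in>UNIV. w1 i x * h$i)) (at x)"
  and d2: "!!i. (w1 i has_derivative (%h. \<Sum>j\<in>UNIV. w2 i j * h$j)) (at p)"
  and min: "!!x. x \<in> S ==> w p <= w x"
 shows "w1 i p = 0" "0 <= (\<Sum>i\<in>UNIV. \<Sum>j\<in>UNIV. w2 i j * v$j * v$i)"
proof -
 have z: "(%h. \<Sum>i\<in>UNIV. w1 i p * h$i) = (%h. 0)"
  by (rule differential_zero_maxmin[OF S(2,1) d1[OF S(2)]]) (use min in auto)
 have grad: "w1 i p = 0" for i
  using fun_cong[OF z, of "axis i 1"] by (simp add: axis_def if_distrib cong: if_cong)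
 then show "w1 i p = 0" .
 define \<gamma> where "\<gamma> t = p + t *\<^sub>R v" for t
 have \<gamma>: "(\<gamma> has_derivative (%s. s *\<^sub>R v)) (at t)" for t
  unfolding \<gamma>_def by (auto intro!: derivative_eq_intros)
 define \<phi>1 where "\<phi>1 t = (\<Sum>i\<in>UNIV. w1 i (\<gamma> t) * v$i)" for t
 define D where "D = (\<Sum>i\<in>UNIV. \<Sum>j\<in>UNIV. w2 i j * v$j * v$i)"
 have \<gamma>0: "\<gamma> 0 = p" by (simp add: \<gamma>_def)
 have \<phi>: "((%t. w (\<gamma> t)) has_real_derivative \<phi>1 t) (at t)" if "\<gamma> t \<in> S" for t
 proof -
  have "((%t. w (\<gamma> t)) has_derivative (%s. \<Sum>i\<in>UNIV. w1 i (\<gamma> t) * (s *\<^sub>R v)$i)) (at t)"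
   by (rule has_derivative_compose[OF \<gamma> d1[OF that]])
  then show ?thesis unfolding has_field_derivative_def
   by (rule has_derivative_eq_rhs) (auto simp: \<phi>1_def sum_distrib_right sum_distrib_left mult_ac)
 qed
 have \<phi>1: "(\<phi>1 has_real_derivative D) (at 0)"
 proof -
  have "((%t. w1 i (\<gamma> t)) has_derivative (%s. \<Sum>j\<in>UNIV. w2 i j * (s *\<^sub>R v)$j)) (at 0)" for i
   by (rule has_derivative_compose[OF \<gamma>]) (use d2 in \<open>simp add: \<gamma>0\<close>)
  then have "((%t. w1 i (\<gamma> t)) has_real_derivative (\<Sum>j\<in>UNIV. w2 i j * v$j)) (at 0)" for i
   unfolding has_field_derivative_def by (rule has_derivative_eq_rhs) (auto simp: sum_distrib_left mult_ac)
  then show ?thesis unfolding \<phi>1_def[abs_def] D_def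
   by (auto intro!: derivative_eq_intros simp: sum_distrib_right)
 qed
 show "0 <= (\<Sum>i\<in>UNIV. \<Sum>j\<in>UNIV. w2 i j * v$j * v$i)"
 proof (rule ccontr)
  assume "\<not> 0 <= (\<Sum>i\<in>UNIV. \<Sum>j\<in>UNIV. w2 i j * v$j * v$i)"
  then have "D < 0" by (simp add: D_def)
  then obtain d where d: "d > 0" "!!h. 0 < h ==> h < d ==> \<phi>1 (0 + h) < \<phi>1 0"
   using DERIV_neg_dec_right[OF \<phi>1] by blast
  have "isCont \<gamma> 0" unfolding \<gamma>_def by (intro continuous_intros)
  then have "eventually (%t. \<gamma> t \<in> S) (at 0)"
   using S \<gamma>0 topological_tendstoD[of \<gamma> p "at 0" S] by (simp add: isCont_def)
  then obtain e where e: "e > 0" "!!t. t ~= 0 ==> dist t 0 < e ==> \<gamma> t \<in> S"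
   unfolding eventually_at by blast
  define h where "h = min d e / 2"
  have h: "0 < h" "h < d" "h < e" using d e by (auto simp: h_def)
  have gS: "\<gamma> t \<in> S" if "0 <= t" "t <= h" for t
   using e(2)[of t] S(2) \<gamma>0 that h by (cases "t = 0") auto
  have "\<phi>1 0 = 0" by (simp add: \<phi>1_def \<gamma>0 grad)
  have "w (\<gamma> h) < w (\<gamma> 0)"
  proof (rule DERIV_neg_imp_decreasing_open[OF h(1)])
   fix t assume t: "0 < t" "t < h"
   then show "\<exists>y. ((%t. w (\<gamma> t)) has_real_derivative y) (at t) & y < 0"
    using \<phi>[OF gS[of t]] d(2)[of t] \<open>\<phi>1 0 = 0\<close> h by (intro exI[of _ "\<phi>1 t"]) auto
  next
   show "continuous_on {0..h} (%t. w (\<gamma> t))"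
    using DERIV_isCont[OF \<phi>[OF gS]] by (intro continuous_at_imp_continuous_on) auto
  qed
  then show False using min[OF gS[of h]] h \<gamma>0 by auto
 qed
qed

lemma prod_nth_has_derivative:
 fixes G :: "'n::finite => real => real"
 assumes "!!k. (G k has_real_derivative G' k) (at (r$k))"
 shows "((%r. \<Prod>k\<in>UNIV. G k (r$k)) has_derivative (%h. \<Sum>i\<in>UNIV. (\<Prod>k\<in>UNIV. if k = i then G' k else G k (r$k)) * h$i)) (at r)"
proof -
 have "((%r. G k (r$k)) has_derivative (%h. h$k * G' k)) (at r)" for k
  using has_derivative_compose[OF bounded_linear_imp_has_derivative[OF bounded_linear_vec_nth], of "G k" "(*) (G' k)" r k] assms[of k]
  by (simp add: has_field_derivative_def mult_ac)
 from has_derivative_prod[OF this]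
 have "((%r. \<Prod>k\<in>UNIV. G k (r$k)) has_derivative (%h. \<Sum>i\<in>UNIV. (h$i * G' i) * (\<Prod>k\<in>UNIV - {i}. G k (r$k)))) (at r)" .
 moreover have "(h$i * G' i) * (\<Prod>k\<in>UNIV - {i}. G k (r$k)) = (\<Prod>k\<in>UNIV. if k = i then G' k else G k (r$k)) * h$i" for h :: "real^'n" and i
 proof -
  have "(\<Prod>k\<in>UNIV - {i}. if k = i then G' k else G k (r$k)) = (\<Prod>k\<in>UNIV - {i}. G k (r$k))"
   by (rule prod.cong) auto
  then show ?thesis by (subst prod.remove[of _ i]) auto
 qed
 ultimately show ?thesis by (simp only:)
qed

text \<open>The first two equations (for \<open>l = 1, 2\<close>) and the mixed one (for \<open>l = 3\<close>) combined so that \<open>G\<close>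
 cancels; the operator is elliptic in the first two variables.\<close>

definition lop :: "real => real^3 => real => (3 => real) => (3 => 3 => real) => real" where
 "lop b r u u1 u2 = (let q = 1 + r$1*r$2 - r$3*(r$1+r$2) in
  q / (2*(1-r$2)*(1-r$3)) * (r$1*(1-r$1) * u2 1 1 + (2*b-2*r$1) * u1 1 - b*(1-b) * u) +
  q / (2*(1-r$1)*(1-r$3)) * (r$2*(1-r$2) * u2 2 2 + (2*b-2*r$2) * u1 2 - b*(1-b) * u) +
  (2*r$1*r$2 * u2 1 2 + b*r$1*u1 1 + b*r$2*u1 2 + b*r$3*u1 3 + b^2*u))"

lemma lop_linear:
 "lop b r (u - x * v0 - y*w) (%i. u1 i - x * v1 i - y * w1 i) (%i j. u2 i j - x * v2 i j - y * w2 i j)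
  = lop b r u u1 u2 - x * lop b r v0 v1 v2 - y * lop b r w w1 w2"
proof -
 have "p*(a*(k-x*l-y*m) + c*(k1-x*l1-y*m1) - d*(k0-x*l0-y*m0)) = p*(a*k+c*k1-d*k0) - x*(p*(a*l+c*l1-d*l0)) - y*(p*(a*m+c*m1-d*m0))"
  for p a k l m c k1 l1 m1 d k0 l0 m0 :: real by (simp add: algebra_simps)
 note e = this
 have "2*r$1*r$2*(k-x*l-y*m) + b*r$1*(k1-x*l1-y*m1) + b*r$2*(k2-x*l2-y*m2) + b*r$3*(k3-x*l3-y*m3) + b^2*(k0-x*l0-y*m0)
  = (2*r$1*r$2*k + b*r$1*k1 + b*r$2*k2 + b*r$3*k3 + b^2*k0) - x*(2*r$1*r$2*l + b*r$1*l1 + b*r$2*l2 + b*r$3*l3 + b^2*l0)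
   - y*(2*r$1*r$2*m + b*r$1*m1 + b*r$2*m2 + b*r$3*m3 + b^2*m0)" for k l m k1 l1 m1 k2 l2 m2 k3 l3 m3 k0 l0 m0
  by (simp add: algebra_simps)
 note f = this
 have "(A - x*B - y*C) + (A' - x*B' - y*C') + (A'' - x*B'' - y*C'') = (A+A'+A'') - x*(B+B'+B'') - y*(C+C'+C'')"
  for A B C A' B' C' A'' B'' C'' :: real by (simp add: algebra_simps)
 then show ?thesis unfolding lop_def Let_def e f by (simp only:)
qed

definition qpol :: "real => real => real => real" where
 "qpol x y z = 1 + x*y - z*(x+y)"

text \<open>The last inequality is the ellipticity of the second-order part of \<open>lop\<close> in
  the first two variables; it rests on 4xy \<le> (x+y)^2.\<close>

lemma qpol_pos:
 assumes "0 < x" "x < 1" "0 < y" "y < 1" "0 < z" "z < 1"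
 shows "qpol x y z = (1-x)*(1-y) + (x+y)*(1-z)" "0 < qpol x y z" "4*x*y*(1-z)^2 <= (qpol x y z)^2"
proof -
 show 1: "qpol x y z = (1-x)*(1-y) + (x+y)*(1-z)" by (simp add: qpol_def algebra_simps)
 have p: "0 < (1-x)*(1-y)" "0 < (x+y)*(1-z)" using assms by auto
 then show "0 < qpol x y z" by (simp add: 1)
 have "4*x*y*(1-z)^2 = (4*(x*y)) * (1-z)^2" by simp
 also have "\<dots> <= (x+y)^2 * (1-z)^2"
 proof (rule mult_right_mono)
  show "4*(x*y) <= (x+y)^2" using zero_le_power2[of "x-y"] by (simp add: power2_eq_square algebra_simps)
 qed simp
 also have "\<dots> = ((x+y)*(1-z))^2" by (simp add: power_mult_distrib)
 also have "\<dots> <= (qpol x y z)^2" unfolding 1 by (intro power_mono) (use p in auto)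
 finally show "4*x*y*(1-z)^2 <= (qpol x y z)^2" .
qed

text \<open>The coefficient matrix of the second-order part has diagonal \<alpha>, \<gamma> and
  off-diagonal entry xy with (xy)^2 \<le> \<alpha>\<gamma>, so its pairing with a positive
  semidefinite Hessian is nonnegative. It is enough to test the Hessian on (sqrt \<alpha>, sqrt
  \<gamma>) and (sqrt \<alpha>, -sqrt \<gamma>).\<close>

lemma lop_minimum_nonneg:
 assumes r: "r \<in> open_cube" and sym: "u2 1 2 = u2 2 1"
  and psd: "!!v. 0 <= (\<Sum>i\<in>UNIV. \<Sum>j\<in>UNIV. u2 i j * v$j * v$i)"
 shows "0 <= lop b r 0 (%_. 0) u2"
proof -
 define x y z where "x = r$1" and "y = r$2" and "z = r$3"
 have h: "0 < x" "x < 1" "0 < y" "y < 1" "0 < z" "z < 1" using r by (auto simp: open_cube_def x_def y_def z_def)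
 define q where "q = qpol x y z"
 have q: "0 < q" "4*x*y*(1-z)^2 <= q^2" unfolding q_def by (rule qpol_pos[OF h])+
 define \<alpha> \<gamma> where "\<alpha> = q / (2*(1-y)*(1-z)) * (x*(1-x))" and "\<gamma> = q / (2*(1-x)*(1-z)) * (y*(1-y))"
 have p: "0 < \<alpha>" "0 < \<gamma>" using h q by (auto simp: \<alpha>_def \<gamma>_def)
 have quad: "0 <= u2 1 1 * s^2 + 2 * u2 1 2 * s * t + u2 2 2 * t^2" for s t
  using psd[of "vector [s, t, 0]"] sym by (simp add: sum_3 power2_eq_square algebra_simps)
 have L: "lop b r 0 (%_. 0) u2 = \<alpha> * u2 1 1 + \<gamma> * u2 2 2 + 2*(x*y) * u2 1 2"
  unfolding lop_def Let_def \<alpha>_def \<gamma>_def q_def qpol_def x_def y_def z_def by simp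
 have "q/(2*D*E)*(x*C) * (q/(2*C*E)*(y*D)) = x*y*(q^2/(4*E^2))" if "C ~= 0" "D ~= 0" "E ~= 0" for C D E
  using that by (simp add: field_simps power2_eq_square)
 from this[of "1-x" "1-y" "1-z"] have "\<alpha> * \<gamma> = x*y*(q^2 / (4*(1-z)^2))" using h unfolding \<alpha>_def \<gamma>_def by simp
 moreover have "x*y <= q^2 / (4*(1-z)^2)" using q h by (simp add: field_simps)
 ultimately have "x*y*(x*y) <= \<alpha>*\<gamma>"
  using h mult_left_mono[of "x*y" "q^2 / (4*(1-z)^2)" "x*y"] by (simp only: mult_pos_pos less_imp_le)
 then have "sqrt ((x*y)^2) <= sqrt (\<alpha>*\<gamma>)" by (intro real_sqrt_le_mono) (simp add: power2_eq_square)
 then have s: "x*y <= sqrt \<alpha> * sqrt \<gamma>" using h by (simp add: real_sqrt_mult)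
 define S where "S = sqrt \<alpha> * sqrt \<gamma>"
 have "0 <= \<alpha> * u2 1 1 + 2 * u2 1 2 * S + \<gamma> * u2 2 2" "0 <= \<alpha> * u2 1 1 - 2 * u2 1 2 * S + \<gamma> * u2 2 2"
  using quad[of "sqrt \<alpha>" "sqrt \<gamma>"] quad[of "sqrt \<alpha>" "- sqrt \<gamma>"] p by (simp_all add: S_def mult_ac)
 then have "2 * (S * \<bar>u2 1 2\<bar>) <= \<alpha> * u2 1 1 + \<gamma> * u2 2 2" by (cases "u2 1 2 >= 0") (auto simp: algebra_simps)
 moreover have "x*y * \<bar>u2 1 2\<bar> <= S * \<bar>u2 1 2\<bar>" using s by (intro mult_right_mono) (auto simp: S_def)
 moreover have "- (x*y * \<bar>u2 1 2\<bar>) <= x*y * u2 1 2" using h mult_left_mono[of "-\<bar>u2 1 2\<bar>" "u2 1 2" "x*y"] by simp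
 ultimately show ?thesis unfolding L by linarith
qed

text \<open>The left side is \<open>lop\<close> of the barrier divided by the barrier. As a
  quadratic polynomial in a its coefficients are at most 0, negative, and at most 0, in this order;
  the first is (1 - v - w)/4 with v + w \<ge> 1.\<close>

lemma barrier_inequality:
 assumes h: "0 < x" "x < 1" "0 < y" "y < 1" "0 < z" "z < 1" and a: "0 < a"
 defines "q \<equiv> qpol x y z"
 shows "q/(2*(1-y)*(1-z)) * (-1/4 - a^2*(1/(x*(1-x)) - 1)) + q/(2*(1-x)*(1-z)) * (-1/4 - a^2*(1/(y*(1-y)) - 1))
  + (2*a^2/((1-x)*(1-y)) - (a+1/2)*a*(1/(1-x)+1/(1-y)+1/(1-z)) + (a+1/2)^2) < 0"
proof -
 define c d e where "c = 1-x" and "d = 1-y" and "e = 1-z"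
 have e: "0 < c" "c < 1" "0 < d" "d < 1" "0 < e" "e < 1" using h by (auto simp: c_def d_def e_def)
 have q: "0 < q" "q = c*d + (2-c-d)*e" using qpol_pos[OF h] by (auto simp: q_def c_def d_def e_def)
 define v w where "v = q/(2*d*e)" and "w = q/(2*c*e)"
 have vw: "0 < v" "0 < w" using e q by (auto simp: v_def w_def)
 have K0: "1 <= v + w"
 proof -
  have cd: "c*d <= c" "c*d <= d" "0 < c*d" using e by (auto simp: mult_left_le mult_le_cancel_right2)
  have "(c+d)*(c*d)*(1-e) + (2-c-d)*(c+d-c*d)*e >= 0"
   using e cd by (intro add_nonneg_nonneg mult_nonneg_nonneg) auto
  moreover have "q*(c+d) - 2*c*d*e = (c+d)*(c*d)*(1-e) + (2-c-d)*(c+d-c*d)*e"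
   unfolding q(2) by (simp add: algebra_simps)
  ultimately have "2*c*d*e <= q*(c+d)" by linarith
  moreover have "v + w = q*(c+d)/(2*c*d*e)" using e unfolding v_def w_def by (simp add: field_simps)
  ultimately show ?thesis using e by (simp add: le_divide_eq)
 qed
 have inv: "1 < 1/c" "1 < 1/d" "1 < 1/e" using e by auto
 have inv1: "1/c <= 1/(x*c) - 1" if "0 < c" "0 < x" "c = 1 - x" for c x :: real
 proof -
  have "1/x - c - 1 = (x-1)^2/x" using that(2) unfolding that(3) by (simp add: field_simps power2_eq_square)
  then have "1 <= 1/x - c" using that by (smt (verit) divide_nonneg_pos zero_le_power2)
  then have "1/c * 1 <= 1/c * (1/x - c)" using that by (intro mult_left_mono) auto
  also have "\<dots> = 1/(x*c) - 1" using that(1) by (simp add: right_diff_distrib)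
  finally show ?thesis by simp
 qed
 have K2: "- (v) * (1/(x*c) - 1) - w*(1/(y*d) - 1) + (2/(c*d) - (1/c+1/d+1/e) + 1) <= 0"
 proof -
  have "v * (1/c) <= v * (1/(x*c) - 1)" "w*(1/d) <= w*(1/(y*d) - 1)"
   by (intro mult_left_mono inv1; use e h vw in \<open>auto simp: c_def d_def\<close>)+
  moreover have "v * (1/c) + w*(1/d) = 1/e + 2/(c*d) - 1/d - 1/c"
   using e unfolding v_def w_def q(2) by (simp add: field_simps)
  ultimately show ?thesis using inv by linarith
 qed
 have "v * (-1/4 - a^2*(1/(x*c) - 1)) + w * (-1/4 - a^2*(1/(y*d) - 1)) + (2*a^2/(c*d) - (a+1/2)*a*(1/c+1/d+1/e) + (a+1/2)^2)
  = (1 - (v+w))/4 + a * (1 - (1/c+1/d+1/e)/2) + a^2 * (- (v) * (1/(x*c) - 1) - w*(1/(y*d) - 1) + (2/(c*d) - (1/c+1/d+1/e) + 1))"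
  by (simp add: algebra_simps power2_eq_square add_divide_distrib diff_divide_distrib)
 moreover have "(1 - (v+w))/4 <= 0" using K0 by simp
 moreover have "a * (1 - (1/c+1/d+1/e)/2) < 0" using a inv by (intro mult_pos_neg) auto
 moreover have "a^2 * (- (v) * (1/(x*c) - 1) - w*(1/(y*d) - 1) + (2/(c*d) - (1/c+1/d+1/e) + 1)) <= 0"
  using K2 by (intro mult_nonneg_nonpos) auto
 ultimately have "v * (-1/4 - a^2*(1/(x*c) - 1)) + w * (-1/4 - a^2*(1/(y*d) - 1)) + (2*a^2/(c*d) - (a+1/2)*a*(1/c+1/d+1/e) + (a+1/2)^2) < 0"
  by linarith
 then show ?thesis by (simp only: v_def w_def c_def d_def e_def)
qed

text \<open>The barrier is the product of the ((1-x)/x)^a with a = b - 1/2. This exponent makes the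
  one-variable operator act on each factor as multiplication by -1/4 - a^2 (1/(x(1-x)) - 1).\<close>

lemma lop_barrier_neg:
 assumes r: "r \<in> open_cube" and b: "b > 1/2"
 defines "a \<equiv> b - 1/2"
 defines "g \<equiv> %x. (x/(1-x)) powr (-a)"
 defines "g1 \<equiv> %x. - a / (x*(1-x)) * g x"
 defines "g2 \<equiv> %x. (a^2 + a*(1-2*x)) / (x*(1-x))^2 * g x"
 shows "lop b r (\<Prod>k\<in>UNIV. g (r$k)) (%i. \<Prod>k\<in>UNIV. if k = i then g1 (r$k) else g (r$k))
  (%i j. \<Prod>k\<in>UNIV. if k = j then (if k = i then g2 else g1) (r$k) else (if k = i then g1 else g) (r$k)) < 0"
proof -
 define x y z where "x = r$1" and "y = r$2" and "z = r$3"
 have h: "0 < x" "x < 1" "0 < y" "y < 1" "0 < z" "z < 1" using r by (auto simp: open_cube_def x_def y_def z_def)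
 have a: "0 < a" "b = a + 1/2" using b by (auto simp: a_def)
 define X where "X = g x * g y * g z"
 have X: "0 < X" using h by (simp add: X_def g_def)
 define p1 p2 where "p1 = qpol x y z/(2*(1-y)*(1-z))" and "p2 = qpol x y z/(2*(1-x)*(1-z))"
 have D: "x*(1-x) * ((a^2 + a*(1-2*x)) / (x*(1-x))^2) + (2*b-2*x) * (- a/(x*(1-x))) - b*(1-b) = -1/4 - a^2*(1/(x*(1-x)) - 1)"
  if "0 < x" "x < 1" for x :: real
 proof -
  define E where "E = x*(1-x)"
  have E: "E ~= 0" using that by (simp add: E_def)
  have "E * ((a^2 + a*(1-2*x)) / E^2) + (2*b-2*x) * (- a/E) = -(a^2/E)"
   using E unfolding a(2) by (simp add: field_simps power2_eq_square E_def[symmetric])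
  moreover have "b*(1-b) = 1/4 - a^2" unfolding a(2) by (simp add: field_simps power2_eq_square)
  ultimately show ?thesis unfolding E_def[symmetric] by (simp add: right_diff_distrib)
 qed
 have F: "x * (- a/(x*(1-x))) = - a/(1-x)" if "0 < x" "x < 1" for x :: real using that by simp
 have M: "2*x*y*((- a/(x*(1-x)))*(- a/(y*(1-y)))) = 2*a^2/((1-x)*(1-y))"
  using h by (simp add: power2_eq_square)
 have g12: "g1 t = - a/(t*(1-t)) * g t" "g2 t = (a^2 + a*(1-2*t)) / (t*(1-t))^2 * g t" for t by (simp_all add: g1_def g2_def)
 have "lop b r (\<Prod>k\<in>UNIV. g (r$k)) (%i. \<Prod>k\<in>UNIV. if k = i then g1 (r$k) else g (r$k))
  (%i j. \<Prod>k\<in>UNIV. if k = j then (if k = i then g2 else g1) (r$k) else (if k = i then g1 else g) (r$k))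
  = p1 * (x*(1-x) * (g2 x * g y * g z) + (2*b-2*x) * (g1 x * g y * g z) - b*(1-b) * X)
   + p2 * (y*(1-y) * (g x * g2 y * g z) + (2*b-2*y) * (g x * g1 y * g z) - b*(1-b) * X)
   + (2*x*y*(g1 x * g1 y * g z) + b*x*(g1 x * g y * g z) + b*y*(g x * g1 y * g z) + b*z*(g x * g y * g1 z) + b^2*X)"
  unfolding lop_def Let_def p1_def p2_def X_def x_def y_def z_def qpol_def UNIV_3 by (simp add: mult.assoc)
 also have "\<dots> = (p1 * (x*(1-x) * ((a^2 + a*(1-2*x)) / (x*(1-x))^2) + (2*b-2*x) * (- a/(x*(1-x))) - b*(1-b))
   + p2 * (y*(1-y) * ((a^2 + a*(1-2*y)) / (y*(1-y))^2) + (2*b-2*y) * (- a/(y*(1-y))) - b*(1-b))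
   + (2*x*y*((- a/(x*(1-x)))*(- a/(y*(1-y)))) + b*(x * (- a/(x*(1-x)))) + b*(y * (- a/(y*(1-y)))) + b*(z * (- a/(z*(1-z)))) + b^2)) * X"
 proof -
  have "q1 * (A*(k2*gx*gy*gz) + B*(k1*gx*gy*gz) - C*(gx*gy*gz)) + q2 * (A'*(gx*(l2*gy)*gz) + B'*(gx*(l1*gy)*gz) - C*(gx*gy*gz))
   + (M*((k1*gx)*(l1*gy)*gz) + b*x*((k1*gx)*gy*gz) + b*y*(gx*(l1*gy)*gz) + b*z*(gx*gy*(m1*gz)) + b^2*(gx*gy*gz))
   = (q1*(A*k2+B*k1-C) + q2*(A'*l2+B'*l1-C) + (M*(k1*l1) + b*(x*k1)+b*(y*l1)+b*(z*m1)+b^2))*(gx*gy*gz)"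
   for q1 q2 A B C A' B' M k1 k2 l1 l2 m1 gx gy gz :: real by (simp add: algebra_simps)
  then show ?thesis unfolding g12 X_def .
 qed
 also have "\<dots> < 0"
 proof (rule mult_neg_pos[OF _ X])
  have "b*(- a/(1-x)) + b*(- a/(1-y)) + b*(- a/(1-z)) = - ((a+1/2)*a*(1/(1-x)+1/(1-y)+1/(1-z)))" unfolding a(2)
   by (simp add: algebra_simps add_divide_distrib)
  then show "p1 * (x*(1-x) * ((a^2 + a*(1-2*x)) / (x*(1-x))^2) + (2*b-2*x) * (- a/(x*(1-x))) - b*(1-b))
   + p2 * (y*(1-y) * ((a^2 + a*(1-2*y)) / (y*(1-y))^2) + (2*b-2*y) * (- a/(y*(1-y))) - b*(1-b))
   + (2*x*y*((- a/(x*(1-x)))*(- a/(y*(1-y)))) + b*(x * (- a/(x*(1-x)))) + b*(y * (- a/(y*(1-y)))) + b*(z * (- a/(z*(1-z)))) + b^2) < 0"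
   unfolding D[OF h(1,2)] D[OF h(3,4)] F[OF h(1,2)] F[OF h(3,4)] F[OF h(5,6)] M
   using barrier_inequality[OF h a(1)] unfolding p1_def p2_def a(2) by linarith
 qed
 finally show ?thesis .
qed

lemma barrier_derivs:
 fixes a x :: real
 assumes x: "0 < x" "x < 1"
 defines "g \<equiv> %x. (x/(1-x)) powr (-a)"
 defines "g1 \<equiv> %x. - a / (x*(1-x)) * g x"
 shows "(g has_real_derivative g1 x) (at x)"
  and "(g1 has_real_derivative (a^2 + a*(1-2*x)) / (x*(1-x))^2 * g x) (at x)"
proof -
 have p: "0 < x/(1-x)" "x ~= 0" "x ~= 1" "1 - x ~= 0" using x by auto
 have p1: "(x/(1-x)) powr (-a-1) = g x * ((1-x)/x)"
  using p x by (simp add: g_def powr_diff)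
 have q: "((%x. x/(1-x)) has_real_derivative 1/(1-x)^2) (at x)"
  by (rule derivative_eq_intros refl p(4))+ (use p(4) in \<open>simp add: power2_eq_square\<close>)
 have c: "((%x. -a/(x*(1-x))) has_real_derivative a*(1-2*x)/(x*(1-x))^2) (at x)"
  by (rule derivative_eq_intros refl)+ (use p in \<open>simp_all add: power2_eq_square algebra_simps\<close>)
 show g: "(g has_real_derivative g1 x) (at x)"
  unfolding g_def
 proof (rule DERIV_cong[OF DERIV_chain2[OF has_real_derivative_powr[OF p(1)] q]])
  have "1/(1-x)^2 * ((1-x)/x) = 1/(x*(1-x))" using p by (simp add: power2_eq_square)
  moreover have "-a * (g x * ((1-x)/x)) * (1/(1-x)^2) = (-a * g x) * (1/(1-x)^2 * ((1-x)/x))" by (simp only: mult_ac)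
  ultimately show "-a * (x/(1-x)) powr (-a-1) * (1/(1-x)^2) = g1 x" unfolding p1 g1_def by simp
 qed
 have "(g1 has_real_derivative a*(1-2*x)/(x*(1-x))^2 * g x + g1 x * (-a/(x*(1-x)))) (at x)"
  unfolding g1_def[abs_def] by (rule DERIV_mult[OF c g, unfolded g1_def])
 then show "(g1 has_real_derivative (a^2 + a*(1-2*x)) / (x*(1-x))^2 * g x) (at x)"
  by (rule DERIV_cong) (simp add: g1_def power2_eq_square add_divide_distrib distrib_right)
qed

text \<open>For b \<ge> 1 the constant 1 works, as -b(1-b) \<ge> 0. For b < 1 take the product of
  the f(r_k): each factor is annihilated by its one-variable operator, and the mixed and first-order
  terms are nonnegative because f is positive and increasing.\<close>

lemma supersolution:
 assumes b: "b > 1/2"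
 obtains g g1 g2 :: "real => real" where
  "continuous_on {0..1} g" "!!x. 0 < x ==> x < 1 ==> 0 < g x"
  "!!x. 0 < x ==> x < 1 ==> (g has_real_derivative g1 x) (at x)"
  "!!x. 0 < x ==> x < 1 ==> (g1 has_real_derivative g2 x) (at x)"
  "!!r. r \<in> open_cube ==> 0 <= lop b r (\<Prod>k\<in>UNIV. g (r$k)) (%i. \<Prod>k\<in>UNIV. if k = i then g1 (r$k) else g (r$k))
   (%i j. \<Prod>k\<in>UNIV. if k = j then (if k = i then g2 else g1) (r$k) else (if k = i then g1 else g) (r$k))"
proof (cases "b < 1")
 case False
 show ?thesis
 proof (rule that[of "%_. 1" "%_. 0" "%_. 0"])
  fix r :: "real^3" assume r: "r \<in> open_cube"
  have h: "0 < r$i" "r$i < 1" for i using r by (auto simp: open_cube_def)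
  have q: "0 < 1 + r$1*r$2 - r$3*(r$1+r$2)" using qpol_pos(2)[OF h[of 1] h[of 2] h[of 3]] by (simp add: qpol_def)
  have c: "0 <= - (b*(1-b))" using False by (simp add: mult_nonneg_nonpos)
  define W where "W = (1 + r$1*r$2 - r$3*(r$1+r$2)) / (2*(1-r$2)*(1-r$3)) + (1 + r$1*r$2 - r$3*(r$1+r$2)) / (2*(1-r$1)*(1-r$3))"
  have "0 <= W" unfolding W_def using q h by (intro add_nonneg_nonneg divide_nonneg_nonneg) (auto simp: less_imp_le)
  then have "0 <= W * (- (b*(1-b))) + b^2" using c by (intro add_nonneg_nonneg mult_nonneg_nonneg) auto
  then show "0 <= lop b r (\<Prod>k\<in>UNIV. (%_. 1) (r$k)) (%i. \<Prod>k\<in>UNIV. if k = i then (%_. 0) (r$k) else (%_. 1) (r$k))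
   (%i j. \<Prod>k\<in>UNIV. if k = j then (if k = i then (%_. 0) else (%_. 0)) (r$k) else (if k = i then (%_. 0) else (%_. 1)) (r$k))"
   unfolding lop_def Let_def UNIV_3 W_def by (simp add: algebra_simps)
 qed auto
next
 case True
 obtain f1 f2 where f: "!!r. 0 < r ==> r < 1 ==> (f_hyp b has_real_derivative f1 r) (at r)"
  "!!r. 0 < r ==> r < 1 ==> (f1 has_real_derivative f2 r) (at r)"
  "!!r. 0 < r ==> r < 1 ==> r*(1-r) * f2 r + (2*b - 2*r) * f1 r - b*(1-b) * f_hyp b r = 0"
  "!!r. b < 1 ==> 0 < r ==> r < 1 ==> 0 <= f1 r" by (rule f_hyp_ode[OF b], blast)
 show ?thesis
 proof (rule that[of "f_hyp b" f1 f2])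
  show "continuous_on {0..1} (f_hyp b)"
   by (rule continuous_on_eq[OF continuous_on_hypint[OF b]]) (simp add: f_hyp_eq_hypint[OF b])
  show "0 < f_hyp b x" if "0 < x" "x < 1" for x using f_hyp_pos[OF b, of x] that by simp
  fix r :: "real^3" assume r: "r \<in> open_cube"
  have h: "0 < r$i" "r$i < 1" for i using r by (auto simp: open_cube_def)
  define p1 p2 where "p1 = (1 + r$1*r$2 - r$3*(r$1+r$2)) / (2*(1-r$2)*(1-r$3))" and "p2 = (1 + r$1*r$2 - r$3*(r$1+r$2)) / (2*(1-r$1)*(1-r$3))"
  have f0: "0 <= f_hyp b (r$i)" "0 <= f1 (r$i)" for i using f_hyp_pos[OF b, of "r$i"] f(4)[OF True] h[of i] by auto
  note D = f(3)[OF h]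
  define g where "g i = f_hyp b (r$i)" for i
  have "lop b r (\<Prod>k\<in>UNIV. f_hyp b (r$k)) (%i. \<Prod>k\<in>UNIV. if k = i then f1 (r$k) else f_hyp b (r$k))
   (%i j. \<Prod>k\<in>UNIV. if k = j then (if k = i then f2 else f1) (r$k) else (if k = i then f1 else f_hyp b) (r$k))
   = p1 * ((r$1*(1-r$1)*f2 (r$1) + (2*b-2*r$1)*f1 (r$1) - b*(1-b)*g 1) * (g 2 * g 3)) +
    p2 * ((r$2*(1-r$2)*f2 (r$2) + (2*b-2*r$2)*f1 (r$2) - b*(1-b)*g 2) * (g 1 * g 3)) +
    (2*r$1*r$2*(f1 (r$1) * f1 (r$2) * g 3) + b*r$1*(f1 (r$1) * g 2 * g 3) + b*r$2*(g 1 * f1 (r$2) * g 3) + b*r$3*(g 1 * g 2 * f1 (r$3)) + b^2*(g 1 * g 2 * g 3))"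
   unfolding lop_def Let_def UNIV_3 p1_def p2_def g_def by (simp add: algebra_simps)
  also have "\<dots> = 2*r$1*r$2*(f1 (r$1) * f1 (r$2) * g 3) + b*r$1*(f1 (r$1) * g 2 * g 3) + b*r$2*(g 1 * f1 (r$2) * g 3) + b*r$3*(g 1 * g 2 * f1 (r$3)) + b^2*(g 1 * g 2 * g 3)"
   unfolding g_def D by simp
  also have "\<dots> >= 0" unfolding g_def
   by (intro add_nonneg_nonneg mult_nonneg_nonneg f0) (use b h in \<open>auto simp: less_imp_le\<close>)
  finally show "0 <= lop b r (\<Prod>k\<in>UNIV. f_hyp b (r$k)) (%i. \<Prod>k\<in>UNIV. if k = i then f1 (r$k) else f_hyp b (r$k))
   (%i j. \<Prod>k\<in>UNIV. if k = j then (if k = i then f2 else f1) (r$k) else (if k = i then f1 else f_hyp b) (r$k))" .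
 qed (use f in auto)
qed

lemma bij_swap3: "bij (%k::'n. if k = i then j else if k = j then i else k)"
 by (rule involuntory_imp_bij) (auto simp: fun_eq_iff)

lemma Fbar_one_face:
 assumes b: "b > 1/2" and nc: "neighbor_coefficients b A B" and F: "continues_power_series A F"
  and r: "r \<in> closed_cube" and i: "r$i = 1"
 obtains j k where "{j,k,i} = {1,2,3}" "Fbar b r = Beta b (3*b-1) / Beta b b * (hypint b (r$j) * hypint b (r$k))"
proof -
 define \<pi> where "\<pi> k = (if k = i then 3 else if k = 3 then i else k)" for k :: 3
 have bij: "bij \<pi>" unfolding \<pi>_def by (rule bij_swap3)
 have "vperm \<pi> r \<in> closed_cube" "vperm \<pi> r $ 3 = 1" using r i by (auto simp: closed_cube_def \<pi>_def)
 from Fbar_face[OF b this] have e: "Fbar b r = Beta b (3*b-1) / Beta b b * (hypint b (r$\<pi> 1) * hypint b (r$\<pi> 2))"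
  using Fbar_symmetric[OF b nc F bij r] by simp
 have "{\<pi> 1, \<pi> 2, i} = {1,2,3}" using exhaust_3[of i] by (auto simp: \<pi>_def)
 then show ?thesis using e by (rule that)
qed

lemma Fbar_pos_boundary:
 assumes b: "b > 1/2" and nc: "neighbor_coefficients b A B" and F: "continues_power_series A F"
  and r: "r \<in> closed_cube" "r \<notin> open_cube"
 shows "0 < Fbar b r"
proof -
 have r01: "0 <= r$i" "r$i <= 1" for i using r(1) by (auto simp: closed_cube_def)
 obtain i where "\<not> (0 < r$i & r$i < 1)" using r(2) by (auto simp: open_cube_def)
 then have "r$i = 0 \<or> r$i = 1" using r01[of i] by auto
 then show ?thesis
 proof
  assume "r$i = 0" then show ?thesis by (rule Fbar_pos_zero_face[OF b r(1)])
 next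
  assume "r$i = 1"
  from Fbar_one_face[OF b nc F r(1) this] obtain j k where "Fbar b r = Beta b (3*b-1) / Beta b b * (hypint b (r$j) * hypint b (r$k))"
   by metis
  then show ?thesis
   using hypint_pos[OF b r01[of j]] hypint_pos[OF b r01[of k]] Beta_real_pos[of b "3*b-1"] Beta_real_pos[of b b] b by simp
 qed
qed

lemma compact_closed_cube: "compact closed_cube"
proof -
 have "closed_cube = cbox 0 1"
  by (auto simp: closed_cube_def cbox_def Basis_vec_def inner_axis)
 then show ?thesis using compact_cbox[of "0::real^3" 1] by (simp only:)
qed

text \<open>The weights in \<open>lop\<close> turn the right-hand sides of the two equations of the
  first kind into qG/2 each, and the mixed equation contributes -qG. That mixed partial derivatives
  commute is read off from the mixed equation, which is symmetric in j and k.\<close>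

lemma lop_neighbor_function:
 assumes nc: "neighbor_coefficients b A B" and F: "continues_power_series A F" and G: "continues_power_series B G"
  and r: "r \<in> open_cube"
 shows "lop b r (F r) (%i. partial3 i F r) (%i j. partial3 j (partial3 i F) r) = 0"
  and "j ~= k ==> partial3 j (partial3 k F) r = partial3 k (partial3 j F) r"
proof -
 have h: "0 < r$i" "r$i < 1" for i using r by (auto simp: open_cube_def)
 have J: "{1,2,3} = {1,2,3::3}" "{2,3,1} = {1,2,3::3}" "{1,3,2} = {1,2,3::3}" by auto
 have sym: "partial3 j (partial3 k F) r = partial3 k (partial3 j F) r" if "{j,k,l} = {1,2,3}" for j k l
 proof -
  have "{k,j,l} = {1,2,3}" using that by auto
  from neighbor_pde(2)[OF nc that F G r] neighbor_pde(2)[OF nc this F G r, unfolded mult.commute[of "r$k" "r$j"] add.commute[of "r$k" "r$j"]]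
  have "2*r$j*r$k * partial3 j (partial3 k F) r = 2*r$k*r$j * partial3 k (partial3 j F) r" by linarith
  then show ?thesis using h[of j] h[of k] by simp
 qed
 show "j ~= k ==> partial3 j (partial3 k F) r = partial3 k (partial3 j F) r"
 proof -
  assume "j ~= k"
  then have "\<exists>l. {j,k,l} = {1,2,3}" using exhaust_3[of j] exhaust_3[of k]
   by (elim disjE) (auto intro: exI[of _ 1] exI[of _ 2] exI[of _ 3])
  then show ?thesis using sym by blast
 qed
 define q where "q = 1 + r$1*r$2 - r$3*(r$1+r$2)"
 have "lop b r (F r) (%i. partial3 i F r) (%i j. partial3 j (partial3 i F) r)
  = q / (2*(1-r$2)*(1-r$3)) * ((1-r$2)*(1-r$3)*G r) + q / (2*(1-r$1)*(1-r$3)) * ((1-r$1)*(1-r$3)*G r) + (- q * G r)"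
 proof -
  have "2*r$1*r$2 * partial3 2 (partial3 1 F) r + b*r$1*partial3 1 F r + b*r$2*partial3 2 F r + b*r$3*partial3 3 F r + b^2*F r = - q * G r"
   using neighbor_pde(2)[OF nc J(1) F G r] sym[OF J(1)] by (simp add: q_def algebra_simps)
  then show ?thesis unfolding lop_def Let_def q_def[symmetric]
   using neighbor_pde(1)[OF nc J(2) F G r] neighbor_pde(1)[OF nc J(3) F G r] by simp
 qed
 also have "\<dots> = 0"
 proof -
  have "q / (2*c*e) * (c*e*G r) = q * G r / 2" if "c ~= 0" "e ~= 0" for c e :: real using that by simp
  from this[of "1-r$2" "1-r$3"] this[of "1-r$1" "1-r$3"] show ?thesis
   using less_imp_neq[OF h(2)[of 1]] less_imp_neq[OF h(2)[of 2]] less_imp_neq[OF h(2)[of 3]] by (simp only: right_minus_eq)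
 qed
 finally show "lop b r (F r) (%i. partial3 i F r) (%i j. partial3 j (partial3 i F) r) = 0" .
qed

lemma prod_jet:
 fixes g g1 g2 :: "real => real" and r :: "real^'n"
 assumes g: "!!x. 0 < x ==> x < 1 ==> (g has_real_derivative g1 x) (at x)"
  and g1: "!!x. 0 < x ==> x < 1 ==> (g1 has_real_derivative g2 x) (at x)"
  and r: "!!k. 0 < r$k" "!!k. r$k < 1"
 shows "((%r. \<Prod>k\<in>UNIV. g (r$k)) has_derivative (%h. \<Sum>i\<in>UNIV. (\<Prod>k\<in>UNIV. if k = i then g1 (r$k) else g (r$k)) * h$i)) (at r)"
  and "((%r. \<Prod>k\<in>UNIV. if k = i then g1 (r$k) else g (r$k)) has_derivative
   (%h. \<Sum>j\<in>UNIV. (\<Prod>k\<in>UNIV. if k = j then (if k = i then g2 else g1) (r$k) else (if k = i then g1 else g) (r$k)) * h$j)) (at r)"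
proof -
 show "((%r. \<Prod>k\<in>UNIV. g (r$k)) has_derivative (%h. \<Sum>i\<in>UNIV. (\<Prod>k\<in>UNIV. if k = i then g1 (r$k) else g (r$k)) * h$i)) (at r)"
  using prod_nth_has_derivative[of "%_. g" "%k. g1 (r$k)" r] g r by blast
 have "((%r. \<Prod>k\<in>UNIV. (if k = i then g1 else g) (r$k)) has_derivative
   (%h. \<Sum>j\<in>UNIV. (\<Prod>k\<in>UNIV. if k = j then (if k = i then g2 else g1) (r$k) else (if k = i then g1 else g) (r$k)) * h$j)) (at r)"
  by (rule prod_nth_has_derivative) (use g g1 r in auto)
 moreover have "(if k = i then g1 else g) x = (if k = i then g1 x else g x)" for k x by simp
 ultimately show "((%r. \<Prod>k\<in>UNIV. if k = i then g1 (r$k) else g (r$k)) has_derivative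
   (%h. \<Sum>j\<in>UNIV. (\<Prod>k\<in>UNIV. if k = j then (if k = i then g2 else g1) (r$k) else (if k = i then g1 else g) (r$k)) * h$j)) (at r)"
  by simp
qed

text \<open>Comparison with a small multiple \<delta>\<psi> of the function from
  \<open>supersolution\<close>. If F fell below it, the quotient of F - \<delta>\<psi> by the
  barrier would have a negative interior minimum, which contradicts the sign of \<open>lop\<close>
  there.\<close>

lemma neighbor_function_pos:
 assumes b: "b > 1/2" and nc: "neighbor_coefficients b A B" and F: "continues_power_series A F" and G: "continues_power_series B G"
  and r0: "r0 \<in> open_cube"
 shows "0 < F r0"
proof -
 obtain g g1 g2 where g: "continuous_on {0..1} g" "!!x. 0 < x ==> x < 1 ==> 0 < g x"
  "!!x. 0 < x ==> x < 1 ==> (g has_real_derivative g1 x) (at x)"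
  "!!x. 0 < x ==> x < 1 ==> (g1 has_real_derivative g2 x) (at x)"
  "!!r. r \<in> open_cube ==> 0 <= lop b r (\<Prod>k\<in>UNIV. g (r$k)) (%i. \<Prod>k\<in>UNIV. if k = i then g1 (r$k) else g (r$k))
   (%i j. \<Prod>k\<in>UNIV. if k = j then (if k = i then g2 else g1) (r$k) else (if k = i then g1 else g) (r$k))"
  by (rule supersolution[OF b], blast)
 obtain D f where f: "continues_real f D F" by (rule continues_power_seriesE[OF F], blast)
 define \<psi> where "\<psi> r = (\<Prod>k\<in>UNIV. g (r$k))" for r :: "real^3"
 define a where "a = b - 1/2"
 define p where "p x = (x/(1-x)) powr (-a)" for x :: real
 define p1 where "p1 x = - a / (x*(1-x)) * p x" for x :: real
 define p2 where "p2 x = (a^2 + a*(1-2*x)) / (x*(1-x))^2 * p x" for x :: real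
 define \<phi> where "\<phi> r = (\<Prod>k\<in>UNIV. p (r$k))" for r :: "real^3"
 have oc: "open_cube \<subseteq> closed_cube" by (auto simp: open_cube_def closed_cube_def less_imp_le)
 have FF: "F r = Fbar b r" if "r \<in> open_cube" for r
  by (rule neighbor_function_eq_Fbar[OF b nc F]) (use that open_cube_subset in blast)
 have h: "0 < r$k" "r$k < 1" if "r \<in> open_cube" for r k using that by (auto simp: open_cube_def)
 have \<psi>0: "0 < \<psi> r" if "r \<in> open_cube" for r unfolding \<psi>_def by (intro prod_pos g(2) ballI h[OF that])
 have \<phi>0: "0 < \<phi> r" if "r \<in> open_cube" for r unfolding \<phi>_def
 proof (intro prod_pos ballI)
  fix k show "0 < p (r$k)" using h[OF that, of k] by (simp add: p_def)
 qed
 have \<psi>c: "continuous_on closed_cube \<psi>" unfolding \<psi>_def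
  by (intro continuous_on_prod continuous_on_compose2[OF g(1)] continuous_intros) (auto simp: closed_cube_def)
 have Fc: "continuous_on closed_cube (Fbar b)" by (rule Fbar_continuous[OF b])
 define bd where "bd = closed_cube - open_cube"
 have bd: "compact bd" unfolding bd_def by (intro compact_diff compact_closed_cube open_open_cube)
 have "(vector [1,1,1] :: real^3) \<in> bd" by (simp add: bd_def closed_cube_def open_cube_def forall_3)
 then have bdne: "bd ~= {}" by blast
 obtain s where s: "s \<in> bd" "!!r. r \<in> bd ==> Fbar b s <= Fbar b r"
  using continuous_attains_inf[OF bd bdne continuous_on_subset[OF Fc]] by (auto simp: bd_def)
 define \<epsilon> where "\<epsilon> = Fbar b s"
 have \<epsilon>: "0 < \<epsilon>" unfolding \<epsilon>_def using s(1) by (intro Fbar_pos_boundary[OF b nc F]) (auto simp: bd_def)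
 have "closed_cube ~= {}" using bdne by (auto simp: bd_def)
 then obtain s' where s': "s' \<in> closed_cube" "!!r. r \<in> closed_cube ==> \<psi> r <= \<psi> s'"
  using continuous_attains_sup[OF compact_closed_cube _ \<psi>c] by blast
 define M where "M = \<bar>\<psi> s'\<bar> + 1"
 have M: "0 < M" "!!r. r \<in> closed_cube ==> \<psi> r < M" using s'(2) by (force simp: M_def)+
 \<comment> \<open>With \<epsilon> the minimum of \<open>Fbar\<close> on the boundary and M above
   the maximum of \<psi>, this gives \<delta>\<psi> < \<open>Fbar\<close> on the boundary.\<close>
 define \<delta> where "\<delta> = \<epsilon> / M"
 have \<delta>: "0 < \<delta>" using \<epsilon> M by (simp add: \<delta>_def)
 have bdy: "\<delta> * \<psi> r < Fbar b r" if "r \<in> bd" for r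
 proof -
  have "\<delta> * \<psi> r < \<delta> * M" using \<delta> M(2)[of r] that by (intro mult_strict_left_mono) (auto simp: bd_def)
  also have "\<dots> = \<epsilon>" using M by (simp add: \<delta>_def)
  finally show ?thesis using s(2)[OF that] by (simp add: \<epsilon>_def)
 qed
 \<comment> \<open>By the strict inequality on the boundary this is a compact subset of the open
   cube, where the barrier is positive and continuous.\<close>
 define K where "K = {r \<in> closed_cube. Fbar b r - \<delta> * \<psi> r <= 0}"
 have "closed K" unfolding K_def
  by (intro continuous_on_closed_Collect_le continuous_intros Fc \<psi>c compact_imp_closed[OF compact_closed_cube])
 moreover have "bounded K" by (rule bounded_subset[OF compact_imp_bounded[OF compact_closed_cube]]) (auto simp: K_def)
 ultimately have K: "compact K" by (simp add: compact_eq_bounded_closed)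
 have Ko: "K \<subseteq> open_cube"
 proof
  fix r assume "r \<in> K"
  then show "r \<in> open_cube" using bdy[of r] by (cases "r \<in> open_cube") (auto simp: K_def bd_def)
 qed
 have "\<delta> * \<psi> r0 <= F r0"
 proof (rule ccontr)
  assume "\<not> \<delta> * \<psi> r0 <= F r0"
  then have neg: "F r0 - \<delta> * \<psi> r0 < 0" by simp
  then have r0K: "r0 \<in> K" using r0 oc FF by (auto simp: K_def)
  have pd: "(p has_real_derivative p1 x) (at x)" "(p1 has_real_derivative p2 x) (at x)" if "0 < x" "x < 1" for x
   using barrier_derivs[OF that, of a] unfolding p_def[abs_def] p1_def[abs_def] p2_def by auto
  have pc: "continuous_on {0<..<1} p"
   using DERIV_isCont[OF pd(1)] by (intro continuous_at_imp_continuous_on) auto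
  have "(%r. r$k) ` K \<subseteq> {0<..<1}" for k
   by (intro image_subsetI) (simp add: h[OF subsetD[OF Ko]])
  then have \<phi>c: "continuous_on K \<phi>" unfolding \<phi>_def
   by (intro continuous_on_prod continuous_on_compose2[OF pc] continuous_on_component continuous_on_id)
  note Kc = subset_trans[OF Ko oc]
  have "\<phi> r ~= 0" if "r \<in> K" for r using \<phi>0[OF subsetD[OF Ko that]] by simp
  then have "continuous_on K (%r. (Fbar b r - \<delta> * \<psi> r) / \<phi> r)"
   by (intro continuous_intros \<phi>c continuous_on_subset[OF Fc Kc] continuous_on_subset[OF \<psi>c Kc]) auto
  then obtain q where q: "q \<in> K" "!!r. r \<in> K ==> (Fbar b q - \<delta> * \<psi> q) / \<phi> q <= (Fbar b r - \<delta> * \<psi> r) / \<phi> r"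
   using continuous_attains_inf[OF K] r0K by blast
  have qo: "q \<in> open_cube" by (rule subsetD[OF Ko q(1)])
  define m where "m = (Fbar b q - \<delta> * \<psi> q) / \<phi> q"
  have "m <= (Fbar b r0 - \<delta> * \<psi> r0) / \<phi> r0" unfolding m_def by (rule q(2)[OF r0K])
  also have "\<dots> < 0" using neg \<phi>0[OF r0] FF[OF r0] by (simp add: divide_neg_pos)
  finally have m: "m < 0" .
  \<comment> \<open>By minimality of m on K, and since m < 0 outside K, this function is nonnegative
    on the open cube; it vanishes at q.\<close>
  define w where "w r = F r - \<delta> * \<psi> r - m * \<phi> r" for r
  have wq: "w q = 0" using \<phi>0[OF qo] FF[OF qo] by (simp add: w_def m_def)
  have w: "0 <= w r" if "r \<in> open_cube" for r
  proof (cases "r \<in> K")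
   case True
   have "m * \<phi> r <= (Fbar b r - \<delta> * \<psi> r) / \<phi> r * \<phi> r"
    using q(2)[OF True] \<phi>0[OF that] by (intro mult_right_mono) (auto simp: m_def)
   then show ?thesis using \<phi>0[OF that] FF[OF that] by (simp add: w_def)
  next
   case False
   then have "0 < F r - \<delta> * \<psi> r" using that oc FF[OF that] by (auto simp: K_def)
   moreover have "m * \<phi> r < 0" using m \<phi>0[OF that] by (rule mult_neg_pos)
   ultimately show ?thesis by (simp add: w_def)
  qed
  define \<psi>1 where "\<psi>1 i r = (\<Prod>k\<in>UNIV. if k = i then g1 (r$k) else g (r$k))" for i and r :: "real^3"
  define \<phi>1 where "\<phi>1 i r = (\<Prod>k\<in>UNIV. if k = i then p1 (r$k) else p (r$k))" for i and r :: "real^3"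
  define \<psi>2 where "\<psi>2 i j = (\<Prod>k\<in>UNIV. if k = j then (if k = i then g2 else g1) (q$k) else (if k = i then g1 else g) (q$k))" for i j
  define \<phi>2 where "\<phi>2 i j = (\<Prod>k\<in>UNIV. if k = j then (if k = i then p2 else p1) (q$k) else (if k = i then p1 else p) (q$k))" for i j
  define w1 where "w1 i r = partial3 i F r - \<delta> * \<psi>1 i r - m * \<phi>1 i r" for i r
  define w2 where "w2 i j = partial3 j (partial3 i F) q - \<delta> * \<psi>2 i j - m * \<phi>2 i j" for i j
  have d1: "(w has_derivative (%h. \<Sum>i\<in>UNIV. w1 i x * h$i)) (at x)" if "x \<in> open_cube" for x
  proof -
   note j = prod_jet(1)[of g g1 g2 x, OF g(3,4) h[OF that], folded \<psi>_def \<psi>1_def] prod_jet(1)[of p p1 p2 x, OF pd h[OF that], folded \<phi>_def \<phi>1_def]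
   have "(w has_derivative (%h. (\<Sum>i\<in>UNIV. partial3 i F x * h$i) - \<delta> * (\<Sum>i\<in>UNIV. \<psi>1 i x * h$i) - m * (\<Sum>i\<in>UNIV. \<phi>1 i x * h$i))) (at x)"
    unfolding w_def[abs_def]
    by (intro has_derivative_diff has_derivative_mult_right continues_real_has_derivative[OF f that] j)
   then show ?thesis by (rule has_derivative_eq_rhs) (simp add: w1_def fun_eq_iff sum_distrib_left sum_subtractf[symmetric] algebra_simps)
  qed
  have d2: "(w1 i has_derivative (%h. \<Sum>j\<in>UNIV. w2 i j * h$j)) (at q)" for i
  proof -
   note j = prod_jet(2)[of g g1 g2 q i, OF g(3,4) h[OF qo], folded \<psi>2_def \<psi>1_def] prod_jet(2)[of p p1 p2 q i, OF pd h[OF qo], folded \<phi>2_def \<phi>1_def]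
   have "(w1 i has_derivative (%h. (\<Sum>j\<in>UNIV. partial3 j (partial3 i F) q * h$j) - \<delta> * (\<Sum>j\<in>UNIV. \<psi>2 i j * h$j) - m * (\<Sum>j\<in>UNIV. \<phi>2 i j * h$j))) (at q)"
    unfolding w1_def[abs_def]
    by (intro has_derivative_diff has_derivative_mult_right continues_real_has_derivative[OF continues_real_cpd[OF f] qo] j)
   then show ?thesis by (rule has_derivative_eq_rhs) (simp add: w2_def fun_eq_iff sum_distrib_left sum_subtractf[symmetric] algebra_simps)
  qed
  have min: "w q <= w x" if "x \<in> open_cube" for x using w[OF that] wq by simp
  have grad: "w1 i q = 0" for i
   by (rule second_order_minimum(1)[OF open_open_cube qo, of w w1 w2]) (use d1 d2 min in auto)
  have psd: "0 <= (\<Sum>i\<in>UNIV. \<Sum>j\<in>UNIV. w2 i j * v$j * v$i)" for v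
   by (rule second_order_minimum(2)[OF open_open_cube qo, of w w1 w2]) (use d1 d2 min in auto)
  have sym: "w2 1 2 = w2 2 1"
  proof -
   have n: "(1::3) ~= 2" by simp
   have "\<psi>2 1 2 = \<psi>2 2 1" unfolding \<psi>2_def by (rule prod.cong[OF refl]) (use n in auto)
   moreover have "\<phi>2 1 2 = \<phi>2 2 1" unfolding \<phi>2_def by (rule prod.cong[OF refl]) (use n in auto)
   ultimately show ?thesis unfolding w2_def lop_neighbor_function(2)[OF nc F G qo n] by simp
  qed
  \<comment> \<open>The value of \<open>lop\<close> on w at q is nonnegative at a minimum, but by
    linearity it is 0 - \<delta> L\<psi> - m L\<phi> with L\<psi> \<ge> 0, m < 0 and L\<phi> <
    0.\<close>
  have "0 <= lop b q 0 (%_. 0) w2" by (rule lop_minimum_nonneg[OF qo sym psd])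
  also have "lop b q 0 (%_. 0) w2 = lop b q (w q) (%i. w1 i q) w2" by (simp add: wq grad)
  also have "\<dots> = lop b q (F q) (%i. partial3 i F q) (%i j. partial3 j (partial3 i F) q)
   - \<delta> * lop b q (\<psi> q) (%i. \<psi>1 i q) \<psi>2 - m * lop b q (\<phi> q) (%i. \<phi>1 i q) \<phi>2"
   unfolding w_def w1_def w2_def[abs_def] by (rule lop_linear)
  also have "\<dots> < 0"
  proof -
   have "0 <= lop b q (\<psi> q) (%i. \<psi>1 i q) \<psi>2" using g(5)[OF qo] unfolding \<psi>_def \<psi>1_def \<psi>2_def[abs_def] .
   moreover have "lop b q (\<phi> q) (%i. \<phi>1 i q) \<phi>2 < 0"
    using lop_barrier_neg[OF qo b] unfolding \<phi>_def \<phi>1_def \<phi>2_def[abs_def] p_def[abs_def] p1_def[abs_def] p2_def[abs_def] a_def .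
   ultimately show ?thesis using m \<delta> lop_neighbor_function(1)[OF nc F G qo] mult_neg_neg[of m] mult_nonneg_nonneg[of \<delta>]
    by (smt (verit))
  qed
  finally show False by simp
 qed
 moreover have "0 < \<delta> * \<psi> r0" using \<delta> \<psi>0[OF r0] by simp
 ultimately show ?thesis by linarith
qed

section \<open>Power products and smooth functions on the chamber\<close>

abbreviation I6 :: "nat set" where "I6 \<equiv> {1..2*3}"

text \<open>The product of |x_a - x_c|^(s a c) over unordered pairs, for symmetric s; dividing by 2
  undoes the double count. All prefactors and cross-ratios have this form, so one derivative formula
  and one covariance formula serve them all.\<close>

definition pw :: "(nat => nat => real) => (nat => real) => real" where
 "pw s x = exp (\<Sum>a\<in>I6. \<Sum>c\<in>I6. s a c / 2 * ln (x a - x c))"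

text \<open>The term \<open>j = i\<close> of the sum vanishes because \<open>y / 0 = 0\<close>. Likewise \<open>ln 0 = 0\<close> in \<open>pw\<close>, and
 \<open>ln (- y) = ln y\<close>.\<close>

definition dl :: "(nat => nat => real) => nat => (nat => real) => real" where
 "dl s i x = (\<Sum>j\<in>I6. s i j / (x i - x j))"

definition sym_exp :: "(nat => nat => real) => bool" where
 "sym_exp s \<longleftrightarrow> (\<forall>a c. s a c = s c a)"

lemma pw_pos: "0 < pw s x"
 by (simp add: pw_def)

lemma chamber_neq: "x \<in> chamber 3 ==> a \<in> I6 ==> c \<in> I6 ==> a ~= c ==> x a ~= x c"
 by (cases a c rule: linorder_cases) (simp_all add: chamber_def less_imp_neq less_imp_neq[symmetric])

lemma ln_has_derivative: "z ~= 0 ==> (ln has_real_derivative 1/z) (at (z::real))"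
proof (cases "0 < z")
 case False
 assume "z ~= 0"
 then have "((%y. ln (-y)) has_real_derivative 1/(-z) * (-1)) (at z)"
  using False by (intro DERIV_chain2[OF DERIV_ln_divide]) (auto intro!: derivative_eq_intros)
 then show ?thesis by (simp add: ln_minus)
qed (rule DERIV_ln_divide)

lemma upd_deriv: "((%t. (x(i := t)) a) has_real_derivative of_bool (a = i)) (at (x i))"
 by (cases "a = i") auto

lemma inv_deriv:
 assumes x: "x \<in> chamber 3" and ac: "a \<in> I6" "c \<in> I6" "a ~= c"
 shows "((%t. 1/((x(i := t)) a - (x(i := t)) c)) has_real_derivative
  (of_bool (c = i) - of_bool (a = i)) * (1/(x a - x c) * (1/(x a - x c)))) (at (x i))"
proof -
 note u = DERIV_diff[OF upd_deriv[of x i a] upd_deriv[of x i c]]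
 show ?thesis
  by (rule DERIV_cong[OF DERIV_divide[OF DERIV_const u]])
   (use chamber_neq[OF x ac] in \<open>simp_all add: power2_eq_square\<close>)
qed

lemma pw_deriv:
 assumes x: "x \<in> chamber 3" and s: "sym_exp s" and i: "i \<in> I6"
 shows "((%t. pw s (x(i := t))) has_real_derivative pw s x * dl s i x) (at (x i))"
proof -
 define d where "d a c = s a c / 2 * ((of_bool (a = i) - of_bool (c = i)) / (x a - x c))" for a c
 have "((%t. s a c / 2 * ln ((x(i := t)) a - (x(i := t)) c)) has_real_derivative d a c) (at (x i))"
  if ac: "a \<in> I6" "c \<in> I6" for a c
 proof (cases "a = c")
  case False
  note u = DERIV_diff[OF upd_deriv[of x i a] upd_deriv[of x i c]]
  have "(ln has_real_derivative 1/(x a - x c)) (at ((x(i := x i)) a - (x(i := x i)) c))"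
   using ln_has_derivative[of "x a - x c"] chamber_neq[OF x ac False] by simp
  from DERIV_cmult[OF DERIV_chain2[OF this u], of "s a c / 2"] show ?thesis by (simp add: d_def)
 qed (simp add: d_def)
 then have "((%t. \<Sum>a\<in>I6. \<Sum>c\<in>I6. s a c / 2 * ln ((x(i := t)) a - (x(i := t)) c)) has_real_derivative (\<Sum>a\<in>I6. \<Sum>c\<in>I6. d a c)) (at (x i))"
  by (intro DERIV_sum)
 moreover have "(\<Sum>a\<in>I6. \<Sum>c\<in>I6. d a c) = dl s i x"
 proof -
  have m: "- (s a i / (x a - x i)) = s a i / (x i - x a)" for a using minus_divide_right[of "s a i" "x a - x i"] by simp
  have "s a c * ((of_bool (a = i) - of_bool (c = i)) / (x a - x c)) = (if a = i then s i c / (x i - x c) else 0) + (if c = i then s i a / (x i - x a) else 0)" for a c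
   using s m[of a] by (auto simp: sym_exp_def)
  then have "d a c = ((if a = i then s i c / (x i - x c) else 0) + (if c = i then s i a / (x i - x a) else 0)) / 2" for a c
   unfolding d_def by (metis times_divide_eq_left)
  moreover have "(\<Sum>a\<in>I6. \<Sum>c\<in>I6. if a = i then s i c / (x i - x c) else 0) = dl s i x"
   using i unfolding dl_def by (subst sum.swap) (simp add: sum.delta)
  moreover have "(\<Sum>a\<in>I6. \<Sum>c\<in>I6. if c = i then s i a / (x i - x a) else 0) = dl s i x"
   using i by (simp add: sum.delta dl_def)
  ultimately show ?thesis by (simp only: sum_divide_distrib[symmetric] sum.distrib) simp
 qed
 ultimately show ?thesis
  using DERIV_chain2[OF DERIV_exp, of "%t. \<Sum>a\<in>I6. \<Sum>c\<in>I6. s a c / 2 * ln ((x(i := t)) a - (x(i := t)) c)"] unfolding pw_def by fastforce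
qed

definition eps :: "nat => nat => real" where
 "eps a c = (if even a = even c then -1 else 1)"

text \<open>A link pattern with links numbered by the type \<open>3\<close> is encoded by the map \<open>lam\<close> that sends a point
 to its link. Since links join points of opposite parity, \<open>pw (cr_exp lam k)\<close> is the cross-ratio
 of the two links other than \<open>k\<close>.\<close>

definition cr_exp :: "(nat => 3) => 3 => nat => nat => real" where
 "cr_exp lam k a c = (if lam a ~= lam c & lam a ~= k & lam c ~= k then eps a c else 0)"

text \<open>The exponents of Z without F: linked points carry -2h = 1 - 3b/2, and the power
  2/\<kappa> = b/2 of the product of the cross-ratios contributes to all other pairs.\<close>

definition z_exp :: "real => (nat => 3) => nat => nat => real" where
 "z_exp b lam a c = (if a = c then 0 else if lam a = lam c then 1 - 3*b/2 else b/2 * eps a c)"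

definition Cv :: "(nat => 3) => (nat => real) => real^3" where
 "Cv lam x = (\<chi> k. pw (cr_exp lam k) x)"

lemma sym_exps: "sym_exp (cr_exp lam k)" "sym_exp (z_exp b lam)"
 by (auto simp: sym_exp_def cr_exp_def z_exp_def eps_def)

lemma comp_deriv:
 assumes x: "x \<in> chamber 3" and i: "i \<in> I6" and C: "Cv lam x \<in> open_cube"
  and F: "continues_real f D F"
 shows "((%t. F (Cv lam (x(i := t)))) has_real_derivative
  (\<Sum>k\<in>UNIV. partial3 k F (Cv lam x) * (pw (cr_exp lam k) x * dl (cr_exp lam k) i x))) (at (x i))"
proof -
 have "((%t. Cv lam (x(i := t)) $ k) has_derivative (%h. h * (pw (cr_exp lam k) x * dl (cr_exp lam k) i x))) (at (x i))" for k
  using pw_deriv[OF x sym_exps(1) i] by (simp add: Cv_def has_field_derivative_def mult_commute_abs)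
 then have "((%t. Cv lam (x(i := t))) has_derivative (%h. \<chi> k. h * (pw (cr_exp lam k) x * dl (cr_exp lam k) i x))) (at (x i))"
  by (subst has_derivative_componentwise_within) (auto simp: Basis_vec_def inner_axis)
 moreover have "(F has_derivative (%h. \<Sum>k\<in>UNIV. partial3 k F (Cv lam x) * h$k)) (at (Cv lam (x(i := x i))))"
  unfolding fun_upd_triv by (rule continues_real_has_derivative[OF F C])
 ultimately have "((%t. F (Cv lam (x(i := t)))) has_derivative (%h. \<Sum>k\<in>UNIV. partial3 k F (Cv lam x) * (h * (pw (cr_exp lam k) x * dl (cr_exp lam k) i x)))) (at (x i))"
  by (rule has_derivative_compose[THEN has_derivative_eq_rhs]) (simp add: fun_eq_iff)
 then show ?thesis unfolding has_field_derivative_def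
  by (rule has_derivative_eq_rhs) (simp add: fun_eq_iff sum_distrib_left sum_distrib_right mult_ac)
qed

text \<open>A class that contains Z, consists of functions continuous on the chamber and is closed
  under partial derivatives. Smoothness follows by induction, without formulas for higher
  derivatives.\<close>

inductive cf_algebra :: "(nat => 3) => ((nat => real) => real) => bool" for lam where
 const: "cf_algebra lam (%x. c)"
| inv: "a \<in> I6 ==> c \<in> I6 ==> a ~= c ==> cf_algebra lam (%x. 1/(x a - x c))"
| pw: "sym_exp s ==> cf_algebra lam (pw s)"
| comp: "continues_real f D F ==> cf_algebra lam (%x. F (Cv lam x))"
| add: "cf_algebra lam f ==> cf_algebra lam g ==> cf_algebra lam (%x. f x + g x)"
| mult: "cf_algebra lam f ==> cf_algebra lam g ==> cf_algebra lam (%x. f x * g x)"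

lemma cf_algebra_sum: "finite J ==> (!!j. j \<in> J ==> cf_algebra lam (f j)) ==> cf_algebra lam (%x. \<Sum>j\<in>J. f j x)"
 by (induction J rule: finite_induct) (auto intro: cf_algebra.intros)

lemma cf_algebra_dl: "i \<in> I6 ==> cf_algebra lam (dl s i)"
proof -
 assume i: "i \<in> I6"
 have "cf_algebra lam (%x. s i j * (1/(x i - x j)))" if "j \<in> I6" for j
 proof (cases "i = j")
  case False
  then show ?thesis by (intro cf_algebra.mult cf_algebra.const cf_algebra.inv i that)
 qed (simp add: cf_algebra.const)
 then show ?thesis using cf_algebra_sum[of I6 lam "%j x. s i j * (1/(x i - x j))"] by (simp add: dl_def[abs_def])
qed

lemma cf_algebra_deriv:
 assumes i: "i \<in> I6" and C: "!!x. x \<in> chamber 3 ==> Cv lam x \<in> open_cube"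
 shows "cf_algebra lam f ==> \<exists>g. cf_algebra lam g & (\<forall>x\<in>chamber 3. ((%t. f (x(i := t))) has_real_derivative g x) (at (x i)))"
proof (induction rule: cf_algebra.induct)
 case (const c)
 show ?case by (rule exI[of _ "%_. 0"]) (auto intro: cf_algebra.const)
next
 case (inv a c)
 show ?case
  by (rule exI[of _ "%x. (of_bool (c = i) - of_bool (a = i)) * (1/(x a - x c) * (1/(x a - x c)))"])
   (intro conjI ballI cf_algebra.mult cf_algebra.inv inv inv_deriv[OF _ inv] cf_algebra.const)
next
 case (pw s)
 show ?case by (rule exI[of _ "%x. pw s x * dl s i x"]) (use pw i pw_deriv cf_algebra_dl in \<open>blast intro: cf_algebra.intros\<close>)
next
 case (comp f D F)
 show ?case
 proof (rule exI[of _ "%x. \<Sum>k\<in>UNIV. partial3 k F (Cv lam x) * (pw (cr_exp lam k) x * dl (cr_exp lam k) i x)"], intro conjI ballI)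
  show "cf_algebra lam (%x. \<Sum>k\<in>UNIV. partial3 k F (Cv lam x) * (pw (cr_exp lam k) x * dl (cr_exp lam k) i x))"
   by (intro cf_algebra_sum cf_algebra.mult cf_algebra.pw sym_exps cf_algebra_dl i cf_algebra.comp[OF continues_real_cpd[OF comp]]) simp
 qed (rule comp_deriv[OF _ i C comp])
next
 case (add f g)
 then obtain f' g' where "cf_algebra lam f'" "cf_algebra lam g'"
  "\<forall>x\<in>chamber 3. ((%t. f (x(i := t))) has_real_derivative f' x) (at (x i))"
  "\<forall>x\<in>chamber 3. ((%t. g (x(i := t))) has_real_derivative g' x) (at (x i))" by blast
 then show ?case by (intro exI[of _ "%x. f' x + g' x"] conjI ballI cf_algebra.add DERIV_add; blast)
next
 case (mult f g)
 then obtain f' g' where "cf_algebra lam f'" "cf_algebra lam g'"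
  "\<forall>x\<in>chamber 3. ((%t. f (x(i := t))) has_real_derivative f' x) (at (x i))"
  "\<forall>x\<in>chamber 3. ((%t. g (x(i := t))) has_real_derivative g' x) (at (x i))" by blast
 moreover from this have "((%t. f (x(i := t)) * g (x(i := t))) has_real_derivative f' x * g x + g' x * f x) (at (x i))" if "x \<in> chamber 3" for x
  using DERIV_mult[of "%t. f (x(i := t))" "f' x" "x i" UNIV "%t. g (x(i := t))" "g' x"] that by simp
 ultimately show ?case
  by (intro exI[of _ "%x. f' x * g x + g' x * f x"] conjI ballI cf_algebra.add cf_algebra.mult mult.hyps)
qed

lemma cont_coord: "continuous_on S (%x::nat => real. x i)"
 by (rule continuous_on_subset[OF continuous_on_product_coordinates]) simp

lemma continuous_on_pw:
 assumes "!!x a c. x \<in> S ==> a \<in> I6 ==> c \<in> I6 ==> x a = x c ==> s a c = 0 \<or> a = c"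
 shows "continuous_on S (pw s)"
proof -
 have "continuous_on S (%x. s a c / 2 * ln (x a - x c))" if "a \<in> I6" "c \<in> I6" for a c
 proof (cases "s a c = 0 \<or> a = c")
  case False
  then show ?thesis using assms[OF _ that] by (intro continuous_intros cont_coord) auto
 qed (auto simp: continuous_on_const)
 then show ?thesis unfolding pw_def[abs_def] by (intro continuous_on_exp continuous_on_sum)
qed

lemma continuous_on_Cv: "continuous_on (chamber 3) (Cv lam)"
 unfolding Cv_def[abs_def] by (intro continuous_on_vec_lambda continuous_on_pw) (metis chamber_neq)

lemma cf_algebra_continuous:
 assumes C: "!!x. x \<in> chamber 3 ==> Cv lam x \<in> open_cube"
 shows "cf_algebra lam f ==> continuous_on (chamber 3) f"
proof (induction rule: cf_algebra.induct)
 case (inv a c)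
 then show ?case by (intro continuous_intros cont_coord) (auto simp: chamber_neq)
next
 case (pw s)
 show ?case by (rule continuous_on_pw) (metis chamber_neq)
next
 case (comp f D F)
 show ?case by (rule continuous_on_compose2[OF continues_real_continuous_on[OF comp] continuous_on_Cv]) (use C in auto)
qed (auto intro: continuous_intros)

lemma chamber_line: assumes x: "x \<in> chamber 3" and i: "i \<in> I6" shows "eventually (%t. x(i := t) \<in> chamber 3) (nhds (x i))"
proof -
 have "eventually (%t. j < k \<longrightarrow> (x(i := t)) j < (x(i := t)) k) (nhds (x i))" if "j \<in> I6" "k \<in> I6" for j k
 proof (cases "j < k")
  case True
  have "((%t. (x(i := t)) k - (x(i := t)) j) \<longlongrightarrow> x k - x j) (nhds (x i))"
   using DERIV_isCont[OF DERIV_diff[OF upd_deriv[of x i k] upd_deriv[of x i j]], unfolded isCont_def, THEN iffD1[OF tendsto_at_iff_tendsto_nhds]]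
   unfolding fun_upd_triv .
  moreover have "0 < x k - x j" using x that True by (auto simp: chamber_def)
  ultimately have "eventually (%t. 0 < (x(i := t)) k - (x(i := t)) j) (nhds (x i))" by (rule order_tendstoD)
  then show ?thesis by (rule eventually_mono) simp
 qed simp
 then have "eventually (%t. \<forall>j\<in>I6. \<forall>k\<in>I6. j < k \<longrightarrow> (x(i := t)) j < (x(i := t)) k) (nhds (x i))"
  by (intro eventually_ball_finite ballI finite_atLeastAtMost)
 then show ?thesis by (rule eventually_mono) (use x i in \<open>auto simp: chamber_def PiE_def extensional_def\<close>)
qed

lemma partial_on_chamber:
 assumes eq: "!!x. x \<in> chamber 3 ==> Z x = f x" and x: "x \<in> chamber 3" and i: "i \<in> I6"
  and d: "((%t. f (x(i := t))) has_real_derivative d) (at (x i))"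
 shows "((%t. Z (x(i := t))) has_real_derivative d) (at (x i))" "partial i Z x = d"
proof -
 have "eventually (%t. Z (x(i := t)) = f (x(i := t))) (nhds (x i))"
  using chamber_line[OF x i] by (rule eventually_mono) (rule eq)
 then show *: "((%t. Z (x(i := t))) has_real_derivative d) (at (x i))"
  using d by (simp add: DERIV_cong_ev[OF refl])
 then show "partial i Z x = d" unfolding partial_def by (rule DERIV_imp_deriv)
qed

lemma cf_algebra_smooth:
 assumes C: "!!x. x \<in> chamber 3 ==> Cv lam x \<in> open_cube"
  and f: "cf_algebra lam f" and eq: "!!x. x \<in> chamber 3 ==> Z x = f x"
 shows "smooth_on_chamber 3 Z"
proof -
 have it: "\<exists>g. cf_algebra lam g & (\<forall>x\<in>chamber 3. foldr partial js Z x = g x)" if "set js \<subseteq> I6" for js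
  using that
 proof (induction js)
  case (Cons i js)
  then obtain g where g: "cf_algebra lam g" "\<forall>x\<in>chamber 3. foldr partial js Z x = g x" and i: "i \<in> I6" by auto
  obtain g' where "cf_algebra lam g'" "\<forall>x\<in>chamber 3. ((%t. g (x(i := t))) has_real_derivative g' x) (at (x i))"
   using cf_algebra_deriv[OF i C g(1)] by blast
  then show ?case using partial_on_chamber(2)[of "foldr partial js Z" g] g(2) i by (intro exI[of _ g']) simp
 qed (use f eq in auto)
 show ?thesis unfolding smooth_on_chamber_def
 proof (intro allI impI conjI ballI)
  fix js assume "set js \<subseteq> I6"
  then obtain g where g: "cf_algebra lam g" "\<forall>x\<in>chamber 3. foldr partial js Z x = g x" using it by blast
  show "continuous_on (chamber 3) (foldr partial js Z)"
   by (rule continuous_on_eq[OF cf_algebra_continuous[OF C g(1)]]) (use g in auto)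
  fix x i assume x: "x \<in> chamber 3" and i: "i \<in> I6"
  obtain g' where "\<forall>x\<in>chamber 3. ((%t. g (x(i := t))) has_real_derivative g' x) (at (x i))"
   using cf_algebra_deriv[OF i C g(1)] by blast
  then show "(%t. foldr partial js Z (x(i := t))) differentiable (at (x i))"
   using partial_on_chamber(1)[of "foldr partial js Z" g] g(2) x i unfolding real_differentiable_def by blast
 qed
qed

text \<open>The equation at \<open>u\<close> in the coordinates \<open>v\<^sub>j = 1/(x\<^sub>j - u)\<close>, in which the cross-ratios are rational:
 \<open>A\<close> belongs to the partner of \<open>u\<close>, the links \<open>(B, C)\<close> and \<open>(D, E)\<close> are the other two. It is a linear
 combination of two second-order equations and the mixed one.\<close>

lemma pde_core:
 fixes A B C D E :: real
 assumes R: "R*(C-A) = B-A" and S: "S*(E-A) = D-A" and T: "T*((D-B)*(E-C)) = (E-B)*(D-C)"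
  and DR: "R*(1-R)*XRR + (2*b-2*R)*XR - b*(1-b)*X = (1-S)*(1-T)*G"
  and DS: "S*(1-S)*XSS + (2*b-2*S)*XS - b*(1-b)*X = (1-R)*(1-T)*G"
  and M: "2*R*S*XRS + b*R*XR + b*S*XS + b*T*XT + b^2*X = (T*(R+S) - (1+R*S))*G"
  and w: "w = -((1-3*b/2)*A + b/2*(C-B+E-D))" and w2: "w2 = (1-3*b/2)*A^2 + b/2*(C^2-B^2+E^2-D^2)"
  and K: "KR = B-C" "KS = D-E"
 shows "2*((w^2-w2)*X + 2*w*(KR*R*XR + KS*S*XS) + (KR^2-(C^2-B^2))*R*XR + (KS^2-(E^2-D^2))*S*XS
   + KR*R*(KR*R*XRR + KS*S*XRS) + KS*S*(KR*R*XRS + KS*S*XSS))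
  + b*(X*((2*w2 - 2*((1-3*b/2)*(B*C+D*E) + b/2*(A*B-A*C+A*D-A*E-B*D+B*E+C*D-C*E))) - (3*b/2-1)*(A^2+B^2+C^2+D^2+E^2))
   + R*XR*(2*(C^2-B^2) - 2*(A*B-A*C)) + S*XS*(2*(E^2-D^2) - 2*(A*D-A*E)) + T*XT*(2*(B-C)*(D-E))) = 0"
proof -
 define c e where "c = C-A" and "e = E-A"
 obtain g where g: "b = 2*g" by (metis field_sum_of_halves mult_2)
 have CE: "C = A + c" "E = A + e" by (simp_all add: c_def e_def)
 have BD: "B = A + R*c" "D = A + S*e" using R S by (simp_all add: c_def e_def)
 \<comment> \<open>The multipliers of the three equations are 2c^2 R(1-R), 2e^2 S(1-S) and
   2ce(1-R)(1-S) with c = C - A and e = E - A.\<close>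
 have "2*((w^2-w2)*X + 2*w*(KR*R*XR + KS*S*XS) + (KR^2-(C^2-B^2))*R*XR + (KS^2-(E^2-D^2))*S*XS
   + KR*R*(KR*R*XRR + KS*S*XRS) + KS*S*(KR*R*XRS + KS*S*XSS))
  + b*(X*((2*w2 - 2*((1-3*b/2)*(B*C+D*E) + b/2*(A*B-A*C+A*D-A*E-B*D+B*E+C*D-C*E))) - (3*b/2-1)*(A^2+B^2+C^2+D^2+E^2))
   + R*XR*(2*(C^2-B^2) - 2*(A*B-A*C)) + S*XS*(2*(E^2-D^2) - 2*(A*D-A*E)) + T*XT*(2*(B-C)*(D-E)))
  = 2*(c^2*R*(1-R)) * (R*(1-R)*XRR + (2*b-2*R)*XR - b*(1-b)*X) + 2*(e^2*S*(1-S)) * (S*(1-S)*XSS + (2*b-2*S)*XS - b*(1-b)*X)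
   + 2*(c*e*(1-R)*(1-S)) * (2*R*S*XRS + b*R*XR + b*S*XS + b*T*XT + b^2*X)"
  unfolding w w2 K BD CE g by (simp add: algebra_simps power2_eq_square)
 also have "\<dots> = 2*((1-R)*(1-S)*G) * ((c^2*R + e^2*S - c*e*(1+R*S)) - T*(c^2*R + e^2*S - c*e*(R+S)))"
  unfolding DR DS M by (simp add: algebra_simps power2_eq_square)
 \<comment> \<open>The relation that defines the third cross-ratio T is what cancels the terms with
   G.\<close>
 also have "T*(c^2*R + e^2*S - c*e*(R+S)) = c^2*R + e^2*S - c*e*(1+R*S)"
  using T unfolding BD CE by (simp add: algebra_simps power2_eq_square)
 finally show ?thesis by simp
qed

section \<open>Derivatives of Z and the second-order equation at one point\<close>

definition dl2 :: "(nat => nat => real) => nat => (nat => real) => real" where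
 "dl2 s i x = (\<Sum>j\<in>I6. s i j / (x i - x j)^2)"

lemma dl_deriv:
 assumes x: "x \<in> chamber 3" and i: "i \<in> I6"
 shows "((%t. dl s i (x(i := t))) has_real_derivative - dl2 s i x) (at (x i))"
proof -
 have "((%t. s i j / ((x(i := t)) i - (x(i := t)) j)) has_real_derivative - (s i j / (x i - x j)^2)) (at (x i))" if j: "j \<in> I6" for j
 proof (cases "i = j")
  case False
  from DERIV_cmult[OF inv_deriv[OF x i j False, of i], of "s i j"] False show ?thesis
   by (simp add: power2_eq_square)
 qed simp
 then show ?thesis unfolding dl_def dl2_def sum_negf[symmetric] by (intro DERIV_sum)
qed

text \<open>\<open>Z_neighbor\<close> without its constant, with the power in H absorbed into the
  exponents (\<open>Z_neighbor_eq\<close>).\<close>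

definition Zf :: "real => (nat => 3) => (real^3 => real) => (nat => real) => real" where
 "Zf b lam F x = pw (z_exp b lam) x * F (Cv lam x)"

definition Zf1 :: "real => (nat => 3) => (real^3 => real) => nat => (nat => real) => real" where
 "Zf1 b lam F i x = pw (z_exp b lam) x * (dl (z_exp b lam) i x * F (Cv lam x)
  + (\<Sum>k\<in>UNIV. dl (cr_exp lam k) i x * (Cv lam x $ k * partial3 k F (Cv lam x))))"

lemma Zf_deriv:
 assumes x: "x \<in> chamber 3" and i: "i \<in> I6" and C: "Cv lam x \<in> open_cube" and F: "continues_real f D F"
 shows "((%t. Zf b lam F (x(i := t))) has_real_derivative Zf1 b lam F i x) (at (x i))"
 unfolding Zf_def
 by (rule DERIV_cong[OF DERIV_mult[OF pw_deriv[OF x sym_exps(2) i] comp_deriv[OF x i C F]]])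
  (simp add: Zf1_def Cv_def distrib_left mult_ac)

lemma Zf1_deriv:
 fixes b :: real
 assumes x: "x \<in> chamber 3" and i: "i \<in> I6" and C: "Cv lam x \<in> open_cube" and F: "continues_real f D F"
 defines "w \<equiv> dl (z_exp b lam) i x" and "K \<equiv> %k. dl (cr_exp lam k) i x" and "r \<equiv> Cv lam x"
 shows "((%t. Zf1 b lam F i (x(i := t))) has_real_derivative pw (z_exp b lam) x *
  ((w^2 - dl2 (z_exp b lam) i x) * F r + 2*w*(\<Sum>k\<in>UNIV. K k * r$k * partial3 k F r)
   + (\<Sum>k\<in>UNIV. (K k^2 - dl2 (cr_exp lam k) i x) * r$k * partial3 k F r + K k * r$k * (\<Sum>l\<in>UNIV. K l * r$l * partial3 l (partial3 k F) r)))) (at (x i))"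
proof -
 have r: "pw (cr_exp lam k) x = r$k" for k by (simp add: r_def Cv_def)
 have K: "dl (cr_exp lam k) i x = K k" for k by (simp add: K_def)
 note d = pw_deriv[OF x sym_exps(1) i, of lam, unfolded r] comp_deriv[OF x i C F, folded r_def, unfolded r]
  comp_deriv[OF x i C continues_real_cpd[OF F], folded r_def, unfolded r]
 have "((%t. dl (z_exp b lam) i (x(i := t)) * F (Cv lam (x(i := t)))) has_real_derivative
   - dl2 (z_exp b lam) i x * F r + (\<Sum>k\<in>UNIV. partial3 k F r * (r$k * K k)) * w) (at (x i))"
  using DERIV_mult[OF dl_deriv[OF x i, of "z_exp b lam"] d(2)] by (simp add: r_def w_def K_def)
 moreover have "((%t. dl (cr_exp lam k) i (x(i := t)) * (Cv lam (x(i := t)) $ k * partial3 k F (Cv lam (x(i := t))))) has_real_derivative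
   - dl2 (cr_exp lam k) i x * (r$k * partial3 k F r) + (r$k * K k * partial3 k F r + (\<Sum>l\<in>UNIV. partial3 l (partial3 k F) r * (r$l * K l)) * r$k) * K k) (at (x i))" for k
  using DERIV_mult[OF dl_deriv[OF x i, of "cr_exp lam k"] DERIV_mult[OF d(1)[of k] d(3)[of k]]] by (simp add: r_def K_def Cv_def)
 ultimately have "((%t. dl (z_exp b lam) i (x(i := t)) * F (Cv lam (x(i := t))) + (\<Sum>k\<in>UNIV. dl (cr_exp lam k) i (x(i := t)) * (Cv lam (x(i := t)) $ k * partial3 k F (Cv lam (x(i := t))))))
  has_real_derivative (- dl2 (z_exp b lam) i x * F r + (\<Sum>k\<in>UNIV. partial3 k F r * (r$k * K k)) * w)
   + (\<Sum>k\<in>UNIV. - dl2 (cr_exp lam k) i x * (r$k * partial3 k F r) + (r$k * K k * partial3 k F r + (\<Sum>l\<in>UNIV. partial3 l (partial3 k F) r * (r$l * K l)) * r$k) * K k)) (at (x i))"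
  by (intro DERIV_add DERIV_sum)
 from DERIV_mult[OF pw_deriv[OF x sym_exps(2) i, of b lam] this] show ?thesis unfolding Zf1_def
  by (rule DERIV_cong) (simp add: r_def[symmetric] w_def[symmetric] K sum_3 power2_eq_square algebra_simps)
qed

text \<open>In the part of the sum that does not involve the exponents at i, symmetrize over j and
  m: (v_j - v_m)/(x_j - x_m) = -v_j v_m for v_j = 1/(x_j - x_i). All differences not containing x_i
  disappear, and polynomials in the v_j remain.\<close>

lemma drift_formula:
 assumes x: "x \<in> chamber 3" and i: "i \<in> I6" and s: "sym_exp s" "!!j. s j j = 0"
 defines "v \<equiv> %j. 1/(x j - x i)"
 shows "(\<Sum>j\<in>I6-{i}. 2 * v j * dl s j x) = 2 * dl2 s i x - (\<Sum>j\<in>I6-{i}. \<Sum>m\<in>I6-{i}. s j m * v j * v m)"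
proof -
 define T where "T = (\<Sum>j\<in>I6-{i}. \<Sum>m\<in>I6-{i}. 2 * v j * s j m / (x j - x m))"
 have vs: "(1/(x i - x j))^2 = (v j)^2" for j by (simp add: v_def power2_eq_square divide_simps) (simp add: algebra_simps)
 have "dl s j x = s i j * v j + (\<Sum>m\<in>I6-{i}. s j m / (x j - x m))" for j
  unfolding dl_def using i s(1) by (subst sum.remove[of _ i]) (auto simp: v_def sym_exp_def)
 then have "(\<Sum>j\<in>I6-{i}. 2 * v j * dl s j x) = (\<Sum>j\<in>I6-{i}. 2 * (s i j * (v j)^2)) + T"
  by (simp add: T_def sum.distrib[symmetric] distrib_left sum_distrib_left power2_eq_square mult_ac)
 moreover have "(\<Sum>j\<in>I6-{i}. 2 * (s i j * (v j)^2)) = 2 * dl2 s i x"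
  unfolding dl2_def using i s(2) by (subst (2) sum.remove[of _ i]) (simp_all add: vs[symmetric] power_one_over sum_distrib_left)
 moreover have "2 * T = 2 * (- (\<Sum>j\<in>I6-{i}. \<Sum>m\<in>I6-{i}. s j m * v j * v m))"
 proof -
  have "T = (\<Sum>j\<in>I6-{i}. \<Sum>m\<in>I6-{i}. 2 * v m * s m j / (x m - x j))" unfolding T_def by (rule sum.swap)
  then have "2 * T = (\<Sum>j\<in>I6-{i}. \<Sum>m\<in>I6-{i}. 2 * v j * s j m / (x j - x m) + 2 * v m * s m j / (x m - x j))"
   unfolding mult_2 by (subst (1) T_def) (simp add: sum.distrib)
  also have "\<dots> = (\<Sum>j\<in>I6-{i}. \<Sum>m\<in>I6-{i}. - (2 * (s j m * v j * v m)))"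
  proof (intro sum.cong refl)
   fix j m assume jm: "j \<in> I6-{i}" "m \<in> I6-{i}"
   show "2 * v j * s j m / (x j - x m) + 2 * v m * s m j / (x m - x j) = - (2 * (s j m * v j * v m))"
   proof (cases "j = m")
    case False
    have n: "x j - x i ~= 0" "x m - x i ~= 0" "x j - x m ~= 0" using chamber_neq[OF x] jm i False by auto
    have "2*(1/p)*t/q + 2*(1/(p-q))*t/(-q) = - (2*(t*(1/p)*(1/(p-q))))" if "p ~= 0" "p - q ~= 0" "q ~= 0" for p q t :: real
     using that by (simp add: divide_simps) (simp add: algebra_simps)
    from this[of "x j - x i" "x j - x m" "s j m"] n s(1) show ?thesis by (simp add: v_def sym_exp_def)
   qed (simp add: s)
  qed
  finally show ?thesis by (simp add: sum_distrib_left sum_negf)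
 qed
 ultimately show ?thesis by simp
qed

text \<open>\<open>p\<close> and \<open>q\<close> are joined, so are \<open>p2, q2\<close> and \<open>p3, q3\<close>; the parity of \<open>p\<close>, \<open>p2\<close>, \<open>p3\<close> is the same.\<close>

definition roles :: "(nat => 3) => nat => nat => nat => nat => nat => nat => bool" where
 "roles lam p q p2 q2 p3 q3 \<longleftrightarrow> I6 = {p,q,p2,q2,p3,q3} & distinct [p,q,p2,q2,p3,q3] &
  lam q = lam p & lam q2 = lam p2 & lam q3 = lam p3 & distinct [lam p, lam p2, lam p3] &
  even p2 = even p & even p3 = even p & even q = (\<not> even p) & even q2 = (\<not> even p) & even q3 = (\<not> even p)"

lemma roles_perm: "roles lam p q p2 q2 p3 q3 ==> roles lam p2 q2 p3 q3 p q" "roles lam p q p2 q2 p3 q3 ==> roles lam p q p3 q3 p2 q2"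
 by (auto simp: roles_def)

lemma roles_sum:
 assumes "roles lam p q p2 q2 p3 q3"
 shows "(\<Sum>j\<in>I6-{p}. f j) = f q + f p2 + f q2 + f p3 + f q3" "(\<Sum>j\<in>I6. f j) = f p + f q + f p2 + f q2 + f p3 + (f q3 :: real)"
proof -
 have d: "distinct [p,q,p2,q2,p3,q3]" and I: "I6 = {p,q,p2,q2,p3,q3}" using assms by (auto simp: roles_def)
 then have "I6 - {p} = {q,p2,q2,p3,q3}" by auto
 then show "(\<Sum>j\<in>I6-{p}. f j) = f q + f p2 + f q2 + f p3 + f q3" using d by (simp add: add.assoc)
 show "(\<Sum>j\<in>I6. f j) = f p + f q + f p2 + f q2 + f p3 + f q3" unfolding I using d by (simp add: add.assoc)
qed

definition sgood :: "(nat => 3) => (nat => real) => bool" where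
 "sgood lam x \<longleftrightarrow> (\<forall>p q p2 q2 p3 q3. roles lam p q p2 q2 p3 q3 \<longrightarrow>
  0 < (x p - x q2) * (x q - x p2) / ((x p - x p2) * (x q - x q2)) & 0 < (x p - x q) * (x p2 - x q2) / ((x p - x p2) * (x q - x q2)))"

lemma Cv_value:
 assumes x: "x \<in> chamber 3" and r: "roles lam p q p2 q2 p3 q3" and g: "sgood lam x"
 shows "Cv lam x $ (lam p3) = (x p - x q2) * (x q - x p2) / ((x p - x p2) * (x q - x q2))"
  and "1 - Cv lam x $ (lam p3) = (x p - x q) * (x p2 - x q2) / ((x p - x p2) * (x q - x q2))"
  and "0 < Cv lam x $ (lam p3)" "Cv lam x $ (lam p3) < 1"
proof -
 have d: "distinct [p,q,p2,q2,p3,q3]" and I: "I6 = {p,q,p2,q2,p3,q3}" using r by (auto simp: roles_def)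
 have n: "x a - x c ~= 0" if "a \<in> {p,q,p2,q2,p3,q3}" "c \<in> {p,q,p2,q2,p3,q3}" "a ~= c" for a c
  using chamber_neq[OF x, of a c] that unfolding I by simp
 have n4: "x p - x q2 ~= 0" "x q - x p2 ~= 0" "x p - x p2 ~= 0" "x q - x q2 ~= 0" by (rule n; use d in auto)+
 define V where "V = (x p - x q2) * (x q - x p2) / ((x p - x p2) * (x q - x q2))"
 have V: "0 < V" using g r unfolding sgood_def V_def by blast
 have sw: "ln (x q2 - x p) = ln (x p - x q2)" "ln (x p2 - x q) = ln (x q - x p2)" "ln (x p2 - x p) = ln (x p - x p2)" "ln (x q2 - x q) = ln (x q - x q2)"
  using ln_minus[of "x p - x q2"] ln_minus[of "x q - x p2"] ln_minus[of "x p - x p2"] ln_minus[of "x q - x q2"] by simp_all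
 have "(\<Sum>a\<in>I6. \<Sum>c\<in>I6. cr_exp lam (lam p3) a c / 2 * ln (x a - x c)) = ln (x p - x q2) + ln (x q - x p2) - ln (x p - x p2) - ln (x q - x q2)"
  unfolding roles_sum(2)[OF r] using r by (auto simp: roles_def cr_exp_def eps_def sw)
 also have "\<dots> = ln V" unfolding V_def using n4 by (simp add: ln_div ln_mult)
 finally have "Cv lam x $ (lam p3) = V" using V by (simp add: Cv_def pw_def)
 moreover have V1: "1 - V = (x p - x q) * (x p2 - x q2) / ((x p - x p2) * (x q - x q2))"
 proof -
  have n: "(a-c)*(e-d) - (a-d)*(e-c) = (a-e)*(c-d)" for a c d e :: real by (simp add: algebra_simps)
  have q: "1 - V/W = U/W" if "W ~= 0" "W - V = U" for U V W :: real
   using that(1) unfolding that(2)[symmetric] by (simp add: diff_divide_distrib)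
  have "1 - (a-d)*(e-c)/((a-c)*(e-d)) = (a-e)*(c-d)/((a-c)*(e-d))" if "a-c ~= 0" "e-d ~= 0" for a c d e :: real
   by (rule q[OF _ n]) (use that in simp)
  then show ?thesis unfolding V_def using n4 by blast
 qed
 moreover have "0 < 1 - V" unfolding V1 using g r unfolding sgood_def by blast
 ultimately show "Cv lam x $ (lam p3) = (x p - x q2) * (x q - x p2) / ((x p - x p2) * (x q - x q2))"
  "1 - Cv lam x $ (lam p3) = (x p - x q) * (x p2 - x q2) / ((x p - x p2) * (x q - x q2))"
  "0 < Cv lam x $ (lam p3)" "Cv lam x $ (lam p3) < 1" using V unfolding V_def by simp_all
qed

lemma roles_exhaust: assumes "roles lam p q p2 q2 p3 q3" shows "UNIV = {lam p, lam p2, lam p3}"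
 using assms exhaust_3[of "lam p"] exhaust_3[of "lam p2"] exhaust_3[of "lam p3"] unfolding roles_def UNIV_3
 by (elim conjE disjE) auto

lemma Cv_open_cube:
 assumes x: "x \<in> chamber 3" and r: "roles lam p q p2 q2 p3 q3" and g: "sgood lam x"
 shows "Cv lam x \<in> open_cube"
proof -
 note r2 = roles_perm(1)[OF r] note r3 = roles_perm(1)[OF r2]
 have "0 < Cv lam x $ k & Cv lam x $ k < 1" if "k \<in> {lam p, lam p2, lam p3}" for k
  using that Cv_value(3,4)[OF x r g] Cv_value(3,4)[OF x r2 g] Cv_value(3,4)[OF x r3 g] by blast
 then show ?thesis unfolding open_cube_def using roles_exhaust[OF r] by blast
qed

text \<open>In the coordinates v_j all derivative terms are polynomials in A, B, C, D, E, and the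
  claim becomes \<open>pde_core\<close> times a power product. The cross-ratio indexed by the link
  of i does not depend on x_i, so only two cross-ratios are differentiated twice.\<close>

lemma Zf_pde:
 assumes x: "x \<in> chamber 3" and r: "roles lam i q p2 q2 p3 q3" and g: "sgood lam x" and b: "b > 0"
  and nc: "neighbor_coefficients b A0 B0" and F: "continues_power_series A0 F" and G: "continues_power_series B0 G"
  and f: "continues_real f D F"
 defines "w \<equiv> dl (z_exp b lam) i x" and "K \<equiv> %k. dl (cr_exp lam k) i x" and "c \<equiv> Cv lam x"
 shows "2/b * (pw (z_exp b lam) x *
  ((w^2 - dl2 (z_exp b lam) i x) * F c + 2*w*(\<Sum>k\<in>UNIV. K k * c$k * partial3 k F c)
   + (\<Sum>k\<in>UNIV. (K k^2 - dl2 (cr_exp lam k) i x) * c$k * partial3 k F c + K k * c$k * (\<Sum>l\<in>UNIV. K l * c$l * partial3 l (partial3 k F) c))))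
  + (\<Sum>j\<in>I6-{i}. 2 / (x j - x i) * Zf1 b lam F j x - (3*b/2-1) / (x j - x i)^2 * (pw (z_exp b lam) x * F c)) = 0"
proof -
 define W where "W = pw (z_exp b lam) x"
 define v where "v j = 1/(x j - x i)" for j
 define k1 k2 k3 where "k1 = lam i" and "k2 = lam p2" and "k3 = lam p3"
 define A B C D' E where "A = v q" and "B = v p2" and "C = v q2" and "D' = v p3" and "E = v q3"
 have d: "distinct [i,q,p2,q2,p3,q3]" and I: "I6 = {i,q,p2,q2,p3,q3}" and kd: "distinct [k1,k2,k3]" using r by (auto simp: roles_def k1_def k2_def k3_def)
 have i: "i \<in> I6" using I by simp
 have U: "UNIV = {k1,k2,k3}" using roles_exhaust[OF r] by (simp add: k1_def k2_def k3_def)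
 have sum3: "(\<Sum>k\<in>UNIV. h k) = h k1 + h k2 + h k3" for h :: "3 => real" unfolding U using kd by simp
 have jkl: "{k1,k2,k3} = {1,2,3}" "{k1,k3,k2} = {1,2,3}" "{k3,k2,k1} = {1,2,3}" using U UNIV_3 by auto
 have n: "x a - x c ~= 0" if "a \<in> {i,q,p2,q2,p3,q3}" "c \<in> {i,q,p2,q2,p3,q3}" "a ~= c" for a c
  using chamber_neq[OF x, of a c] that unfolding I by simp
 have dlv: "dl s i x = - (\<Sum>j\<in>I6-{i}. s i j * v j)" "dl2 s i x = (\<Sum>j\<in>I6-{i}. s i j * (v j)^2)" if "s i i = 0" for s
 proof -
  have "s i j / (x i - x j) = - (s i j * v j)" "s i j / (x i - x j)^2 = s i j * (v j)^2" for j
   using minus_divide_right[of "s i j" "x j - x i"] by (simp_all add: v_def power_divide power2_commute)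
  then show "dl s i x = - (\<Sum>j\<in>I6-{i}. s i j * v j)" "dl2 s i x = (\<Sum>j\<in>I6-{i}. s i j * (v j)^2)"
   unfolding dl_def dl2_def using i that by (subst sum.remove[of _ i]; simp add: sum_negf)+
 qed
 have z0: "z_exp b lam j j = 0" "cr_exp lam k j j = 0" for j k by (simp_all add: z_exp_def cr_exp_def)
 note dr = drift_formula[OF x i sym_exps(2) z0(1)] drift_formula[OF x i sym_exps(1) z0(2)]
 note ev = dlv[OF z0(1)] dlv[OF z0(2)] roles_sum(1)[OF r] A_def[symmetric] B_def[symmetric] C_def[symmetric] D'_def[symmetric] E_def[symmetric] v_def[symmetric]
 have rs: "lam i = k1" "lam q = k1" "lam p2 = k2" "lam q2 = k2" "lam p3 = k3" "lam q3 = k3"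
  "even p2 = even i" "even p3 = even i" "even q = odd i" "even q2 = odd i" "even q3 = odd i"
  "k2 ~= k1" "k3 ~= k1" "k3 ~= k2" "k1 ~= k2" "k1 ~= k3" "k2 ~= k3"
  using r by (auto simp: roles_def k1_def k2_def k3_def)
 have w: "w = -((1-3*b/2)*A + b/2*(C-B+E-D'))" "dl2 (z_exp b lam) i x = (1-3*b/2)*A^2 + b/2*(C^2-B^2+E^2-D'^2)"
  unfolding w_def ev using d kd by (simp_all add: rs z_exp_def eps_def algebra_simps add_divide_distrib diff_divide_distrib)
 have K: "K k1 = 0" "K k3 = B - C" "K k2 = D' - E"
  unfolding K_def ev using d kd by (simp_all add: rs cr_exp_def eps_def)
 have K2: "dl2 (cr_exp lam k1) i x = 0" "dl2 (cr_exp lam k3) i x = C^2-B^2" "dl2 (cr_exp lam k2) i x = E^2-D'^2"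
  unfolding ev using d kd by (simp_all add: rs cr_exp_def eps_def)
 define dz where "dz = (\<Sum>j\<in>I6-{i}. 2 * v j * dl (z_exp b lam) j x)"
 define dc where "dc k = (\<Sum>j\<in>I6-{i}. 2 * v j * dl (cr_exp lam k) j x)" for k
 define h g where "h = 1-3*b/2" and "g = b/2"
 have zs: "z_exp b lam a c = z_exp b lam c a" for a c using sym_exps(2)[of b lam] by (simp add: sym_exp_def)
 have zv: "z_exp b lam q p2 = g" "z_exp b lam q q2 = -g" "z_exp b lam q p3 = g" "z_exp b lam q q3 = -g" "z_exp b lam p2 q2 = h"
  "z_exp b lam p2 p3 = -g" "z_exp b lam p2 q3 = g" "z_exp b lam q2 p3 = g" "z_exp b lam q2 q3 = -g" "z_exp b lam p3 q3 = h"
  using d by (simp_all add: rs z_exp_def eps_def h_def g_def)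
 note zv' = zv zs[of p2 q, unfolded zv] zs[of q2 q, unfolded zv] zs[of p3 q, unfolded zv] zs[of q3 q, unfolded zv] zs[of q2 p2, unfolded zv]
  zs[of p3 p2, unfolded zv] zs[of q3 p2, unfolded zv] zs[of p3 q2, unfolded zv] zs[of q3 q2, unfolded zv] zs[of q3 p3, unfolded zv]
 have dz: "dz = 2*((1-3*b/2)*A^2 + b/2*(C^2-B^2+E^2-D'^2)) - 2*((1-3*b/2)*(B*C+D'*E) + b/2*(A*B-A*C+A*D'-A*E-B*D'+B*E+C*D'-C*E))"
  unfolding dz_def v_def dr w(2) unfolding ev zv' z0 h_def[symmetric] g_def[symmetric] by (simp add: algebra_simps power2_eq_square)
 have dc: "dc k1 = 2*(B-C)*(D'-E)" "dc k3 = 2*(C^2-B^2) - 2*(A*B-A*C)" "dc k2 = 2*(E^2-D'^2) - 2*(A*D'-A*E)"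
  unfolding dc_def v_def dr K2 unfolding ev using d kd by (simp_all add: rs cr_exp_def eps_def algebra_simps add_divide_distrib diff_divide_distrib)
 have sq: "(\<Sum>j\<in>I6-{i}. (v j)^2) = A^2+B^2+C^2+D'^2+E^2" unfolding ev ..
 have ve: "2 / (x j - x i) = 2 * v j" "p / (x j - x i)^2 = p * (v j)^2" for j and p :: real
  by (simp_all add: v_def power_divide)
 have "(\<Sum>j\<in>I6-{i}. 2 / (x j - x i) * Zf1 b lam F j x - (3*b/2-1) / (x j - x i)^2 * (W * F c))
   = (\<Sum>j\<in>I6-{i}. W * (F c * (2 * v j * dl (z_exp b lam) j x) + (\<Sum>k\<in>UNIV. c$k * partial3 k F c * (2 * v j * dl (cr_exp lam k) j x)) - (3*b/2-1) * F c * (v j)^2))"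
  unfolding Zf1_def W_def[symmetric] c_def[symmetric] by (intro sum.cong refl) (simp add: ve sum_3 algebra_simps)
 also have "\<dots> = W * (F c * dz + (\<Sum>k\<in>UNIV. c$k * partial3 k F c * dc k) - (3*b/2-1) * F c * (A^2+B^2+C^2+D'^2+E^2))"
  unfolding sum_distrib_left[symmetric] sum_subtractf sum.distrib sq[symmetric] dz_def dc_def
  by (subst sum.swap) (simp only: sum_distrib_left[symmetric])
 also have "\<dots> = W * (F c * (dz - (3*b/2-1) * (A^2+B^2+C^2+D'^2+E^2)) + c$k3 * partial3 k3 F c * dc k3 + c$k2 * partial3 k2 F c * dc k2 + c$k1 * partial3 k1 F c * dc k1)"
  unfolding sum3 by (simp add: algebra_simps)
 finally have first: "(\<Sum>j\<in>I6-{i}. 2 / (x j - x i) * Zf1 b lam F j x - (3*b/2-1) / (x j - x i)^2 * (W * F c)) = \<dots>" .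
 \<comment> \<open>The cross-ratios in the coordinates v_j, in which x_i is sent to infinity; two of
   them reduce to simple ratios.\<close>
 have R: "c$k3 * (C-A) = B-A" "c$k2 * (E-A) = D'-A" "c$k1 * ((D'-B)*(E-C)) = (E-B)*(D'-C)"
 proof -
  have xs: "x j = x i + 1/v j" "v j ~= 0" if "j \<in> {q,p2,q2,p3,q3}" for j
   using n[of j i] that d by (auto simp: v_def)
  have xj: "x q = x i + 1/A" "x p2 = x i + 1/B" "x q2 = x i + 1/C" "x p3 = x i + 1/D'" "x q3 = x i + 1/E"
   using xs(1) by (simp_all add: A_def B_def C_def D'_def E_def)
  have nz: "A ~= 0" "B ~= 0" "C ~= 0" "D' ~= 0" "E ~= 0" using xs(2) by (auto simp: A_def B_def C_def D'_def E_def)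
  have nn: "C ~= A" "E ~= A" "D' ~= B" "E ~= C"
   using n[of q q2] n[of q q3] n[of p2 p3] n[of q2 q3] d by (auto simp: A_def B_def C_def D'_def E_def v_def)
  note c3 = Cv_value(1)[OF x r g, folded c_def k3_def] and c2 = Cv_value(1)[OF x roles_perm(2)[OF r] g, folded c_def k2_def]
   and c1 = Cv_value(1)[OF x roles_perm(1)[OF r] g, folded c_def k1_def]
  have core: "(- (1/t)) * (1/p - 1/s) / ((- (1/s)) * (1/p - 1/t)) * (t - p) = s - p" if "p ~= 0" "s ~= 0" "t ~= 0" "t ~= p" for p s t :: real
   using that by (simp add: divide_simps)
  show "c$k3 * (C-A) = B-A" unfolding c3 xj using core[of A B C] nz nn by simp
  show "c$k2 * (E-A) = D'-A" unfolding c2 xj using core[of A D' E] nz nn by simp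
  have "(1/s - 1/e) * (1/t - 1/y) / ((1/s - 1/y) * (1/t - 1/e)) * ((y-s)*(e-t)) = (e-s)*(y-t)"
   if "s ~= 0" "t ~= 0" "y ~= 0" "e ~= 0" "y ~= s" "e ~= t" for s t y e :: real
   using that by (simp add: divide_simps)
  from this[of B C D' E] show "c$k1 * ((D'-B)*(E-C)) = (E-B)*(D'-C)" unfolding c1 xj using nz nn by simp
 qed
 have co: "c \<in> open_cube" unfolding c_def by (rule Cv_open_cube[OF x r g])
 have sym: "partial3 k3 (partial3 k2 F) c = partial3 k2 (partial3 k3 F) c"
  by (rule lop_neighbor_function(2)[OF nc F G co]) (use kd in auto)
 note pde = neighbor_pde(1)[OF nc jkl(1) F G co] neighbor_pde(1)[OF nc jkl(2) F G co] neighbor_pde(2)[OF nc jkl(3) F G co]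
 have "2*((w^2 - dl2 (z_exp b lam) i x) * F c + 2*w*((B-C)*c$k3*partial3 k3 F c + (D'-E)*c$k2*partial3 k2 F c)
   + ((B-C)^2-(C^2-B^2))*c$k3*partial3 k3 F c + ((D'-E)^2-(E^2-D'^2))*c$k2*partial3 k2 F c
   + (B-C)*c$k3*((B-C)*c$k3*partial3 k3 (partial3 k3 F) c + (D'-E)*c$k2*partial3 k3 (partial3 k2 F) c)
   + (D'-E)*c$k2*((B-C)*c$k3*partial3 k3 (partial3 k2 F) c + (D'-E)*c$k2*partial3 k2 (partial3 k2 F) c))
  + b*(F c*(dz - (3*b/2-1)*(A^2+B^2+C^2+D'^2+E^2))
   + c$k3*partial3 k3 F c*dc k3 + c$k2*partial3 k2 F c*dc k2 + c$k1*partial3 k1 F c*dc k1) = 0"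
  unfolding dc dz w(2)[symmetric]
 proof (rule pde_core[OF R _ _ _ w refl refl])
  show "c$k3*(1-c$k3)*partial3 k3 (partial3 k3 F) c + (2*b-2*c$k3)*partial3 k3 F c - b*(1-b)*F c = (1-c$k2)*(1-c$k1)*G c"
   using pde(1) by (simp add: mult_ac)
  show "c$k2*(1-c$k2)*partial3 k2 (partial3 k2 F) c + (2*b-2*c$k2)*partial3 k2 F c - b*(1-b)*F c = (1-c$k3)*(1-c$k1)*G c"
   using pde(2) by (simp add: mult_ac)
  show "2*c$k3*c$k2*partial3 k3 (partial3 k2 F) c + b*c$k3*partial3 k3 F c + b*c$k2*partial3 k2 F c + b*c$k1*partial3 k1 F c + b^2*F c
   = (c$k1*(c$k3+c$k2) - (1+c$k3*c$k2))*G c" by (rule pde(3))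
 qed
 then have "2/b*((w^2 - dl2 (z_exp b lam) i x) * F c + 2*w*((B-C)*c$k3*partial3 k3 F c + (D'-E)*c$k2*partial3 k2 F c)
   + ((B-C)^2-(C^2-B^2))*c$k3*partial3 k3 F c + ((D'-E)^2-(E^2-D'^2))*c$k2*partial3 k2 F c
   + (B-C)*c$k3*((B-C)*c$k3*partial3 k3 (partial3 k3 F) c + (D'-E)*c$k2*partial3 k3 (partial3 k2 F) c)
   + (D'-E)*c$k2*((B-C)*c$k3*partial3 k3 (partial3 k2 F) c + (D'-E)*c$k2*partial3 k2 (partial3 k2 F) c))
  + (F c*(dz - (3*b/2-1)*(A^2+B^2+C^2+D'^2+E^2))
   + c$k3*partial3 k3 F c*dc k3 + c$k2*partial3 k2 F c*dc k2 + c$k1*partial3 k1 F c*dc k1) = 0"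
  (is "2/b*?P + ?Q = 0")
 proof -
  assume e: "2*?P + b*?Q = 0"
  have "b * (2/b*?P + ?Q) = 2*?P + b*?Q" using b by (simp add: distrib_left)
  then show ?thesis using e b by simp
 qed
 then have "W * (2/b*?P + ?Q) = 0" by simp
 then show ?thesis unfolding W_def[symmetric] first sum3 K K2 sym by (simp add: algebra_simps)
qed

section \<open>The two neighbor patterns\<close>

definition lam1 :: "nat => 3" where "lam1 i = (if i <= 2 then 1 else if i <= 4 then 2 else 3)"
definition lam2 :: "nat => 3" where "lam2 i = (if i = 1 \<or> i = 6 then 3 else if i <= 3 then 1 else 2)"

lemma I6_cases: "i \<in> I6 ==> i = 1 \<or> i = 2 \<or> i = 3 \<or> i = 4 \<or> i = 5 \<or> i = 6"
 unfolding atLeastAtMost_iff by presburger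

lemma I6_eq: "I6 = {1,2,3,4,5,6}"
 using I6_cases by auto

lemma roles_pattern: "roles lam1 1 2 3 4 5 6" "roles lam2 2 3 4 5 6 1"
 unfolding roles_def I6_eq lam1_def lam2_def by auto

lemma roles_ex:
 assumes lam: "lam = lam1 \<or> lam = lam2" and i: "i \<in> I6"
 shows "\<exists>q p2 q2 p3 q3. roles lam i q p2 q2 p3 q3"
proof -
 obtain a a' c c' e e' where r: "roles lam a a' c c' e e'" using lam roles_pattern by blast
 have swap: "roles lam p q p2 q2 p3 q3 ==> roles lam q p q2 p2 q3 p3" for p q p2 q2 p3 q3
  by (auto simp: roles_def)
 have "i = a \<or> i = a' \<or> i = c \<or> i = c' \<or> i = e \<or> i = e'" using i r unfolding roles_def by blast
 then show ?thesis
  using r swap[OF r] roles_perm(1)[OF r] swap[OF roles_perm(1)[OF r]] roles_perm(1)[OF roles_perm(1)[OF r]] swap[OF roles_perm(1)[OF roles_perm(1)[OF r]]]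
  by blast
qed

text \<open>A check of finitely many cases: each pattern has 12 choices of two links with endpoints
  matched by parity, and the order of the x_i gives the signs.\<close>

lemma sgood_pattern:
 assumes x: "x \<in> chamber 3" and lam: "lam = lam1 \<or> lam = lam2"
 shows "sgood lam x"
 unfolding sgood_def
proof (intro allI impI)
 fix p q p2 q2 p3 q3 assume r: "roles lam p q p2 q2 p3 q3"
 have I: "p \<in> I6" "q \<in> I6" "p2 \<in> I6" "q2 \<in> I6" using r unfolding roles_def by blast+
 have lt: "x i < x j" if "i < j" "i \<in> I6" "j \<in> I6" for i j using x that by (auto simp: chamber_def)
 have c: "x 1 < x 2" "x 1 < x 3" "x 1 < x 4" "x 1 < x 5" "x 1 < x 6" "x 2 < x 3" "x 2 < x 4" "x 2 < x 5" "x 2 < x 6"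
  "x 3 < x 4" "x 3 < x 5" "x 3 < x 6" "x 4 < x 5" "x 4 < x 6" "x 5 < x 6" by (rule lt; simp)+
 have e: "lam q = lam p" "lam q2 = lam p2" "lam p ~= lam p2" "q ~= p" "q2 ~= p2" "even p2 = even p" using r by (auto simp: roles_def)
 have "(p,q,p2,q2) \<in> {(1,2,3,4),(1,2,5,6),(2,1,4,3),(2,1,6,5),(3,4,1,2),(3,4,5,6),(4,3,2,1),(4,3,6,5),(5,6,1,2),(5,6,3,4),(6,5,2,1),(6,5,4,3),
  (1,6,3,2),(1,6,5,4),(3,2,1,6),(3,2,5,4),(5,4,1,6),(5,4,3,2),(6,1,2,3),(6,1,4,5),(2,3,6,1),(2,3,4,5),(4,5,6,1),(4,5,2,3)}"
  using lam
 proof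
  assume l: "lam = lam1"
  have P: "(i,j) \<in> {(1,2),(2,1),(3,4),(4,3),(5,6),(6,5)}" if "i \<in> I6" "j \<in> I6" "lam1 j = lam1 i" "j ~= i" for i j
   using I6_cases[OF that(1)] I6_cases[OF that(2)] that(3,4) by (elim disjE) (simp_all add: lam1_def)
  show ?thesis using P[OF I(1,2) e(1)[unfolded l] e(4)] P[OF I(3,4) e(2)[unfolded l] e(5)] e(3)[unfolded l] e(6)
   by (simp only: insert_iff empty_iff prod.inject simp_thms) (elim disjE conjE; simp add: lam1_def)
 next
  assume l: "lam = lam2"
  have P: "(i,j) \<in> {(1,6),(6,1),(2,3),(3,2),(4,5),(5,4)}" if "i \<in> I6" "j \<in> I6" "lam2 j = lam2 i" "j ~= i" for i j
   using I6_cases[OF that(1)] I6_cases[OF that(2)] that(3,4) by (elim disjE) (simp_all add: lam2_def)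
  show ?thesis using P[OF I(1,2) e(1)[unfolded l] e(4)] P[OF I(3,4) e(2)[unfolded l] e(5)] e(3)[unfolded l] e(6)
   by (simp only: insert_iff empty_iff prod.inject simp_thms) (elim disjE conjE; simp add: lam2_def)
 qed
 then show "0 < (x p - x q2) * (x q - x p2) / ((x p - x p2) * (x q - x q2)) & 0 < (x p - x q) * (x p2 - x q2) / ((x p - x p2) * (x q - x q2))"
  unfolding insert_iff empty_iff prod.inject by (elim disjE conjE)
   (simp_all only: zero_less_divide_iff zero_less_mult_iff mult_less_0_iff diff_gt_0_iff_gt diff_less_0_iff_less c simp_thms)
qed

lemma Cv_in_open_cube: "x \<in> chamber 3 ==> lam = lam1 \<or> lam = lam2 ==> Cv lam x \<in> open_cube"
 using roles_ex[of lam 1] Cv_open_cube sgood_pattern by fastforce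

lemma cross_ratio_sym:
 "cross_ratio q1 p1 p2 q2 = cross_ratio p1 q1 p2 q2" "cross_ratio p1 q1 q2 p2 = cross_ratio p1 q1 p2 q2"
 unfolding cross_ratio_def by (simp_all add: min.commute mult.commute)

text \<open>The signed cross-ratio V lies in (0,1), hence V < 1/V and the minimum selects V.\<close>

lemma cross_ratio_Cv:
 assumes x: "x \<in> chamber 3" and r: "roles lam p q p2 q2 p3 q3" and g: "sgood lam x"
 shows "cross_ratio (x p) (x q) (x p2) (x q2) = Cv lam x $ (lam p3)"
proof -
 define V where "V = Cv lam x $ (lam p3)"
 note v = Cv_value[OF x r g, folded V_def]
 have "\<bar>V\<bar> = \<bar>x p - x q2\<bar> * \<bar>x q - x p2\<bar> / (\<bar>x p - x p2\<bar> * \<bar>x q - x q2\<bar>)" unfolding v(1) by (simp add: abs_mult)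
 moreover have "1 / \<bar>V\<bar> = \<bar>x p - x p2\<bar> * \<bar>x q - x q2\<bar> / (\<bar>x p - x q2\<bar> * \<bar>x q - x p2\<bar>)" unfolding v(1) by (simp add: abs_mult)
 moreover have "V < 1 / V" using v(3,4) mult_strict_mono[of V 1 V 1] by (simp add: less_divide_eq)
 ultimately show ?thesis unfolding cross_ratio_def V_def[symmetric] using v(3) by (simp add: min_def)
qed

text \<open>Two points on different links occur in exactly one of the three cross-ratios, the one
  indexed by the remaining link.\<close>

lemma z_exp_split:
 "z_exp b lam a c = (if a ~= c & lam a = lam c then 1 - 3*b/2 else 0) + b/2 * (\<Sum>k\<in>UNIV. cr_exp lam k a c)"
proof -
 have "(\<Sum>k\<in>UNIV. cr_exp lam k a c) = eps a c" if "lam a ~= lam c"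
  using that exhaust_3[of "lam a"] exhaust_3[of "lam c"] unfolding sum_3 cr_exp_def by (elim disjE) simp_all
 then show ?thesis by (auto simp: z_exp_def cr_exp_def)
qed

lemma pw_z_exp:
 assumes r: "roles lam p q p2 q2 p3 q3"
 shows "pw (z_exp b lam) x = exp ((1 - 3*b/2) * (ln (x p - x q) + ln (x p2 - x q2) + ln (x p3 - x q3))) * (\<Prod>k\<in>UNIV. Cv lam x $ k) powr (b/2)"
proof -
 define L where "L s = (\<Sum>a\<in>I6. \<Sum>c\<in>I6. s a c / 2 * ln (x a - x c))" for s
 define s0 where "s0 a c = (if a ~= c & lam a = lam c then 1 - 3*b/2 else 0)" for a c
 have pwL: "pw s x = exp (L s)" for s by (simp add: pw_def L_def)
 have sw: "ln (x q - x p) = ln (x p - x q)" "ln (x q2 - x p2) = ln (x p2 - x q2)" "ln (x q3 - x p3) = ln (x p3 - x q3)"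
  using ln_minus[of "x p - x q"] ln_minus[of "x p2 - x q2"] ln_minus[of "x p3 - x q3"] by simp_all
 have "L s0 = (1 - 3*b/2) * (ln (x p - x q) + ln (x p2 - x q2) + ln (x p3 - x q3))"
 proof -
  have l: "lam q = lam p" "lam q2 = lam p2" "lam q3 = lam p3" "lam p ~= lam p2" "lam p ~= lam p3" "lam p2 ~= lam p3"
   "lam p2 ~= lam p" "lam p3 ~= lam p" "lam p3 ~= lam p2" and d: "distinct [p,q,p2,q2,p3,q3]"
   using r by (auto simp: roles_def)
  show ?thesis unfolding L_def roles_sum(2)[OF r] using d by (simp add: s0_def sw l) (simp add: algebra_simps add_divide_distrib)
 qed
 moreover have "L (z_exp b lam) = L s0 + b/2 * (\<Sum>k\<in>UNIV. L (cr_exp lam k))"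
  unfolding L_def z_exp_split s0_def[symmetric] sum_3
  by (simp add: add_divide_distrib distrib_right distrib_left sum.distrib sum_distrib_left mult.assoc)
 moreover have "(\<Prod>k\<in>UNIV. Cv lam x $ k) = exp (\<Sum>k\<in>UNIV. L (cr_exp lam k))"
  by (simp add: Cv_def pwL exp_sum)
 ultimately show ?thesis unfolding pwL by (simp add: exp_add powr_def)
qed

text \<open>The order of the endpoints within a link does not affect cross-ratios, and the numbering
  of the links permutes the arguments of F, which is symmetric.\<close>

lemma Z_neighbor_eq:
 assumes b: "b > 1/2" and k: "\<kappa> = 4/b" and nc: "neighbor_coefficients b A0 B0" and F: "continues_power_series A0 F"
  and lam: "lam = lam1 \<or> lam = lam2" and x: "x \<in> chamber 3"
  and ab: "I6 = {a 1, c 1, a 2, c 2, a 3, c 3}" "distinct [a 1, c 1, a 2, c 2, a 3, c 3]" "distinct [lam (a 1), lam (a 2), lam (a 3)]"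
   "!!j. j \<in> {1,2,3} ==> lam (c j) = lam (a j) & even (c j) = odd (a j)"
 shows "Z_neighbor b \<kappa> F a c x = c_alpha b * Zf b lam F x"
proof -
 \<comment> \<open>Reorder each link so that its odd endpoint comes first, as \<open>roles\<close>
   requires equal parities.\<close>
 define p q where "p j = (if odd (a j) then a j else c j)" and "q j = (if odd (a j) then c j else a j)" for j
 have r: "roles lam (p 1) (q 1) (p 2) (q 2) (p 3) (q 3)"
  unfolding roles_def ab(1) using ab(2,3) ab(4)[of 1] ab(4)[of 2] ab(4)[of 3] by (auto simp: p_def q_def)
 note g = sgood_pattern[OF x lam]
 have lp: "lam (p j) = lam (a j)" if "j \<in> {1,2,3}" for j using ab(4)[OF that] by (simp add: p_def)
 have cr: "cross_ratio (x (a i)) (x (c i)) (x (a j)) (x (c j)) = cross_ratio (x (p i)) (x (q i)) (x (p j)) (x (q j))" for i j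
  by (simp add: p_def q_def cross_ratio_sym)
 have C: "cross_ratio (x (a 1)) (x (c 1)) (x (a 2)) (x (c 2)) = Cv lam x $ lam (a 3)"
  "cross_ratio (x (a 2)) (x (c 2)) (x (a 3)) (x (c 3)) = Cv lam x $ lam (a 1)"
  "cross_ratio (x (a 3)) (x (c 3)) (x (a 1)) (x (c 1)) = Cv lam x $ lam (a 2)"
  unfolding cr using cross_ratio_Cv[OF x r g] cross_ratio_Cv[OF x roles_perm(1)[OF r] g]
   cross_ratio_Cv[OF x roles_perm(1)[OF roles_perm(1)[OF r]] g] by (simp_all add: lp)
 define \<pi> :: "3 => 3" where "\<pi> = (%k. if k = 1 then lam (a 3) else if k = 2 then lam (a 1) else lam (a 2))"
 have "inj \<pi>" using ab(3) by (auto simp: inj_def \<pi>_def split: if_splits) (metis exhaust_3)+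
 then have \<pi>: "bij \<pi>" by (simp add: bij_def finite_UNIV_inj_surj)
 have v: "vector [Cv lam x $ lam (a 3), Cv lam x $ lam (a 1), Cv lam x $ lam (a 2)] = vperm \<pi> (Cv lam x)"
  by (simp add: vec_eq_iff forall_3 \<pi>_def)
 note co = Cv_in_open_cube[OF x lam]
 have pr: "Cv lam x $ lam (a 3) * Cv lam x $ lam (a 1) * Cv lam x $ lam (a 2) = (\<Prod>k\<in>UNIV. Cv lam x $ k)"
 proof -
  have P3: "(\<Prod>k\<in>UNIV. f k) = f 1 * f 2 * f 3" for f :: "3 => real" unfolding UNIV_3 by (simp add: mult.assoc)
  have "Cv lam x $ \<pi> 1 * Cv lam x $ \<pi> 2 * Cv lam x $ \<pi> 3 = (\<Prod>k\<in>UNIV. Cv lam x $ k)"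
   using P3[of "%k. Cv lam x $ \<pi> k"] prod.reindex_bij_betw[OF \<pi>, of "%k. Cv lam x $ k"] by (rule trans[OF sym])
  moreover have "\<pi> 1 = lam (a 3)" "\<pi> 2 = lam (a 1)" "\<pi> 3 = lam (a 2)" by (simp_all add: \<pi>_def)
  ultimately show ?thesis by metis
 qed
 have n: "x (a j) ~= x (c j)" if "j \<in> {1,2,3}" for j
  by (rule chamber_neq[OF x]) (use ab(1,2) that in auto)
 have h: "-2 * h_exp \<kappa> = 1 - 3*b/2" "2/\<kappa> = b/2" using b by (simp_all add: h_exp_def k field_simps)
 have lpq: "ln (x (p j) - x (q j)) = ln (x (a j) - x (c j))" for j
  using ln_minus[of "x (a j) - x (c j)"] by (simp add: p_def q_def)
 have "\<bar>x (a j) - x (c j)\<bar> powr (1 - 3*b/2) = exp ((1 - 3*b/2) * ln (x (p j) - x (q j)))" if "j \<in> {1,2,3}" for j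
  using n[OF that] unfolding lpq by (simp add: powr_def ln_real_def)
 then have "(\<Prod>j\<in>{1..3}. \<bar>x (a j) - x (c j)\<bar> powr (1 - 3*b/2)) = exp ((1 - 3*b/2) * (ln (x (p 1) - x (q 1)) + ln (x (p 2) - x (q 2)) + ln (x (p 3) - x (q 3))))"
  by (simp add: numeral_3_eq_3 numeral_2_eq_2 prod.atLeast1_atMost_eq lessThan_Suc distrib_left exp_add mult_ac)
 then show ?thesis
  unfolding Z_neighbor_def Let_def H_fun_def h Zf_def pw_z_exp[OF r] C v
   neighbor_function_symmetric[OF b nc F \<pi> subsetD[OF open_cube_subset(1) co]]
  by (simp add: pr[symmetric] v[symmetric])
qed

section \<open>Moebius covariance\<close>

text \<open>If every ln |x_a - x_c| changes by (l_a + l_c)/2, the total change depends only on the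
  row sums of the exponents.\<close>

lemma pw_cov:
 assumes x: "x \<in> chamber 3" and s: "sym_exp s" "!!a. s a a = 0" "!!a. a \<in> I6 ==> (\<Sum>c\<in>I6. s a c) = \<rho>"
  and y: "!!a c. a \<in> I6 ==> c \<in> I6 ==> a ~= c ==> ln (y a - y c) = ln (x a - x c) + (l a + l c) / 2"
 shows "pw s y = pw s x * exp (\<rho>/2 * (\<Sum>a\<in>I6. l a))"
proof -
 have "(\<Sum>a\<in>I6. \<Sum>c\<in>I6. s a c / 2 * ln (y a - y c)) = (\<Sum>a\<in>I6. \<Sum>c\<in>I6. s a c / 2 * ln (x a - x c) + (s a c * l a / 4 + s a c * l c / 4))"
 proof (intro sum.cong refl)
  fix a c assume "a \<in> I6" "c \<in> I6"
  then show "s a c / 2 * ln (y a - y c) = s a c / 2 * ln (x a - x c) + (s a c * l a / 4 + s a c * l c / 4)"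
   using y[of a c] s(2) by (cases "a = c") (simp_all add: algebra_simps add_divide_distrib)
 qed
 moreover have "(\<Sum>a\<in>I6. \<Sum>c\<in>I6. s a c * l a / 4) = \<rho>/4 * (\<Sum>a\<in>I6. l a)"
  using s(3) by (simp add: sum_divide_distrib[symmetric] sum_distrib_right[symmetric] sum_distrib_left)
 moreover have "(\<Sum>a\<in>I6. \<Sum>c\<in>I6. s a c * l c / 4) = (\<Sum>a\<in>I6. \<Sum>c\<in>I6. s a c * l a / 4)"
  by (subst sum.swap) (use s(1) in \<open>simp add: sym_exp_def\<close>)
 ultimately show ?thesis by (simp add: pw_def sum.distrib exp_add[symmetric] algebra_simps)
qed

text \<open>A Moebius map multiplies |x - y| by the square root of the product of its derivatives at
  x and y. The row sums are 0 for the cross-ratios, which are therefore invariant, and 1 - 3b/2 =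
  -2h for the prefactor.\<close>

lemma Zf_cov:
 assumes x: "x \<in> chamber 3" and lam: "lam = lam1 \<or> lam = lam2"
  and D: "a*d - c*e > 0" "!!i. i \<in> I6 ==> c * x i + d ~= 0"
  and y: "!!i. i \<in> I6 ==> y i = moebius a e c d (x i)"
 shows "Zf b lam F x = (\<Prod>i\<in>I6. deriv (moebius a e c d) (x i) powr (3*b/4 - 1/2)) * Zf b lam F y"
proof -
 define \<Delta> where "\<Delta> = a*d - c*e"
 have \<Delta>: "\<Delta> > 0" using D by (simp add: \<Delta>_def)
 have dm: "deriv (moebius a e c d) (x i) = \<Delta> / (c * x i + d)^2" if "i \<in> I6" for i
 proof (rule DERIV_imp_deriv)
  show "(moebius a e c d has_real_derivative \<Delta> / (c * x i + d)^2) (at (x i))" unfolding moebius_def[abs_def]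
   by (rule derivative_eq_intros refl D(2)[OF that])+ (simp add: \<Delta>_def algebra_simps power2_eq_square)
 qed
 define l where "l i = ln (\<Delta> / (c * x i + d)^2)" for i
 have yl: "ln (y i - y j) = ln (x i - x j) + (l i + l j) / 2" if "i \<in> I6" "j \<in> I6" "i ~= j" for i j
 proof -
  note n = D(2)[OF that(1)] D(2)[OF that(2)] chamber_neq[OF x that]
  have "y i - y j = \<Delta> * (x i - x j) / ((c * x i + d) * (c * x j + d))"
   unfolding y[OF that(1)] y[OF that(2)] moebius_def \<Delta>_def using n by (simp add: diff_frac_eq algebra_simps)
  then show ?thesis using n \<Delta> by (simp add: l_def ln_div ln_mult power2_eq_square)
 qed
 have z0: "z_exp b lam j j = 0" "cr_exp lam k j j = 0" for j k by (simp_all add: z_exp_def cr_exp_def)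
 have row: "(\<Sum>j\<in>I6. z_exp b lam i j) = 1 - 3*b/2" "(\<Sum>j\<in>I6. cr_exp lam k i j) = 0" if i: "i \<in> I6" for i k
 proof -
  obtain q p2 q2 p3 q3 where r: "roles lam i q p2 q2 p3 q3" using roles_ex[OF lam i] by blast
  show "(\<Sum>j\<in>I6. z_exp b lam i j) = 1 - 3*b/2" "(\<Sum>j\<in>I6. cr_exp lam k i j) = 0"
   unfolding roles_sum(2)[OF r] using r by (auto simp: roles_def z_exp_def cr_exp_def eps_def)
 qed
 have "Cv lam y = Cv lam x"
  using pw_cov[OF x sym_exps(1) z0(2) row(2) yl] by (simp add: Cv_def)
 moreover have "pw (z_exp b lam) x = (\<Prod>i\<in>I6. exp ((3*b/4 - 1/2) * l i)) * pw (z_exp b lam) y"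
 proof -
  have e: "pw (z_exp b lam) y = pw (z_exp b lam) x * exp ((1 - 3*b/2)/2 * (\<Sum>i\<in>I6. l i))"
   by (rule pw_cov[OF x sym_exps(2) z0(1) row(1) yl])
  have "(\<Prod>i\<in>I6. exp ((3*b/4 - 1/2) * l i)) = exp ((3*b/4 - 1/2) * (\<Sum>i\<in>I6. l i))"
   by (simp add: exp_sum sum_distrib_left)
  moreover have "(3*b/4 - 1/2) * S + (1 - 3*b/2)/2 * S = 0" for S :: real by (simp add: algebra_simps add_divide_distrib diff_divide_distrib)
  ultimately show ?thesis unfolding e by (simp only: mult.left_commute[of "exp _" "pw _ x"] exp_add[symmetric]) simp
 qed
 moreover have "(\<Prod>i\<in>I6. deriv (moebius a e c d) (x i) powr (3*b/4 - 1/2)) = (\<Prod>i\<in>I6. exp ((3*b/4 - 1/2) * l i))"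
  using D(2) \<Delta> by (intro prod.cong refl) (simp add: dm l_def powr_def)
 ultimately show ?thesis by (simp add: Zf_def)
qed

section \<open>Link patterns and their labelings\<close>

definition links :: "(nat => 3) => nat set set" where
 "links lam = (%k. {i \<in> I6. lam i = k}) ` UNIV"

lemma link_eq: "roles lam p q p2 q2 p3 q3 ==> {i \<in> I6. lam i = lam p} = {p, q}"
proof -
 assume r: "roles lam p q p2 q2 p3 q3"
 have l: "lam q = lam p" "lam q2 ~= lam p" "lam q3 ~= lam p" "lam p2 ~= lam p" "lam p3 ~= lam p" and I: "I6 = {p,q,p2,q2,p3,q3}"
  using r by (simp_all add: roles_def) metis+
 show ?thesis unfolding I using l by blast
qed

lemma links_eq: assumes r: "roles lam p q p2 q2 p3 q3" shows "links lam = {{p,q},{p2,q2},{p3,q3}}"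
 unfolding links_def roles_exhaust[OF r]
 using link_eq[OF r] link_eq[OF roles_perm(1)[OF r]] link_eq[OF roles_perm(1)[OF roles_perm(1)[OF r]]] by simp

lemma neighbor_pattern_links: "\<alpha> \<in> neighbor_patterns ==> \<exists>lam. (lam = lam1 \<or> lam = lam2) & \<alpha> = links lam"
proof -
 assume a: "\<alpha> \<in> neighbor_patterns"
 have "{6, 1} = {1, 6 :: nat}" by auto
 then have "links lam2 = {{1, 6}, {2, 3}, {4, 5}}" unfolding links_eq[OF roles_pattern(2)] by blast
 then show ?thesis using a links_eq[OF roles_pattern(1)] unfolding neighbor_patterns_def by blast
qed

lemma link_iff:
 assumes lam: "lam = lam1 \<or> lam = lam2" and ac: "a \<in> I6" "c \<in> I6" "a ~= c"
 shows "{a, c} \<in> links lam \<longleftrightarrow> lam a = lam c"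
proof
 assume "{a, c} \<in> links lam"
 then obtain k where k: "{a, c} = {i \<in> I6. lam i = k}" unfolding links_def by blast
 have "a \<in> {i \<in> I6. lam i = k}" "c \<in> {i \<in> I6. lam i = k}" unfolding k[symmetric] by simp_all
 then show "lam a = lam c" by simp
next
 assume e: "lam a = lam c"
 obtain q p2 q2 p3 q3 where r: "roles lam a q p2 q2 p3 q3" using roles_ex[OF lam ac(1)] by blast
 have "c \<in> {a, q}" unfolding link_eq[OF r, symmetric] using e ac(2) by simp
 then have "c = q" using ac(3) by simp
 then show "{a, c} \<in> links lam" unfolding links_eq[OF r] by simp
qed

lemma labels:
 fixes a c :: "nat => nat"
 assumes lam: "lam = lam1 \<or> lam = lam2" and l: "links lam = {{a 1, c 1}, {a 2, c 2}, {a 3, c 3}}"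
 shows "I6 = {a 1, c 1, a 2, c 2, a 3, c 3}" "distinct [a 1, c 1, a 2, c 2, a 3, c 3]" "distinct [lam (a 1), lam (a 2), lam (a 3)]"
  "!!j. j \<in> {1,2,3} ==> lam (c j) = lam (a j) & even (c j) = odd (a j)"
proof -
 have D: "a j \<in> I6" "c j \<in> I6" "a j ~= c j" "lam (c j) = lam (a j)" "even (c j) = odd (a j)" if j: "j \<in> {1,2,3}" for j :: nat
 proof -
  have "{a j, c j} \<in> links lam" unfolding l using j by auto
  then obtain k where k: "{a j, c j} = {i \<in> I6. lam i = k}" unfolding links_def by blast
  have m: "a j \<in> {i \<in> I6. lam i = k}" "c j \<in> {i \<in> I6. lam i = k}" unfolding k[symmetric] by simp_all
  then show "a j \<in> I6" "c j \<in> I6" "lam (c j) = lam (a j)" by simp_all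
  obtain q p2 q2 p3 q3 where r: "roles lam (a j) q p2 q2 p3 q3" using roles_ex[OF lam \<open>a j \<in> I6\<close>] by blast
  have "{a j, c j} = {a j, q}" unfolding link_eq[OF r, symmetric] k using m by simp
  then have "c j = q" by (metis doubleton_eq_iff)
  then show "a j ~= c j" "even (c j) = odd (a j)" using r by (simp_all add: roles_def)
 qed
 have "UNIV = {lam (a 1), lam (a 2), lam (a 3)}"
 proof (intro equalityI subsetI)
  fix k
  have "{i \<in> I6. lam i = k} \<in> {{a 1, c 1}, {a 2, c 2}, {a 3, c 3}}" unfolding l[symmetric] links_def by blast
  moreover have "k = lam (a j)" if "{i \<in> I6. lam i = k} = {a j, c j}" for j
  proof -
   have "a j \<in> {i \<in> I6. lam i = k}" unfolding that by simp
   then show ?thesis by simp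
  qed
  ultimately show "k \<in> {lam (a 1), lam (a 2), lam (a 3)}" by (elim insertE emptyE) simp_all
 qed simp
 moreover have "card (UNIV::3 set) = 3" by simp
 ultimately have c3: "card {lam (a 1), lam (a 2), lam (a 3)} = 3" by (simp only:)
 then show d: "distinct [lam (a 1), lam (a 2), lam (a 3)]" by (auto simp: card_insert_if split: if_splits)
 show "lam (c j) = lam (a j) & even (c j) = odd (a j)" if "j \<in> {1,2,3}" for j using D(4,5)[OF that] by simp
 show "distinct [a 1, c 1, a 2, c 2, a 3, c 3]"
  using d D(3)[of 1] D(3)[of 2] D(3)[of 3] D(4)[of 1] D(4)[of 2] D(4)[of 3] by auto
 show "I6 = {a 1, c 1, a 2, c 2, a 3, c 3}"
 proof (intro equalityI subsetI)
  fix i assume i: "i \<in> I6"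
  have m: "{i' \<in> I6. lam i' = lam i} \<in> {{a 1, c 1}, {a 2, c 2}, {a 3, c 3}}" unfolding l[symmetric] links_def by blast
  obtain S where "S \<in> {{a 1, c 1}, {a 2, c 2}, {a 3, c 3}}" "i \<in> S" by (rule that[OF m]) (use i in simp)
  then show "i \<in> {a 1, c 1, a 2, c 2, a 3, c 3}" by auto
 next
  fix i assume "i \<in> {a 1, c 1, a 2, c 2, a 3, c 3}"
  then show "i \<in> I6" using D(1,2)[of 1] D(1,2)[of 2] D(1,2)[of 3] by (elim insertE emptyE) (simp_all only: insert_iff simp_thms)
 qed
qed

section \<open>Behavior when two neighboring points fuse\<close>

lemma tendsto_pw:
 assumes X: "!!a. a \<in> I6 ==> ((%z. X z a) \<longlongrightarrow> Y a) F"
  and s: "!!a c. a \<in> I6 ==> c \<in> I6 ==> Y a = Y c ==> s a c = 0 \<or> a = c"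
 shows "((%z. pw s (X z)) \<longlongrightarrow> pw s Y) F"
proof -
 have "((%z. s a c / 2 * ln (X z a - X z c)) \<longlongrightarrow> s a c / 2 * ln (Y a - Y c)) F" if "a \<in> I6" "c \<in> I6" for a c
 proof (cases "s a c = 0 \<or> a = c")
  case False
  then show ?thesis using s[OF that] by (intro tendsto_intros X that) auto
 qed auto
 then show ?thesis unfolding pw_def by (intro tendsto_exp tendsto_sum)
qed

text \<open>Isolates the only factor that degenerates when x_p and x_q come together; the other
  factors have a limit by \<open>tendsto_pw\<close>.\<close>

lemma pw_split_pair:
 assumes "p \<in> I6" "q \<in> I6" "p ~= q" "sym_exp s" "x p < x q"
 defines "s' \<equiv> %a c. if {a, c} = {p, q} then 0 else s a c"
 shows "pw s x = (x q - x p) powr (s p q) * pw s' x"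
proof -
 define d where "d a c = (if a = p then if c = q then s p q / 2 * ln (x q - x p) else 0 else 0) + (if a = q then if c = p then s p q / 2 * ln (x q - x p) else 0 else 0)" for a c
 have e: "s a c / 2 * ln (x a - x c) = s' a c / 2 * ln (x a - x c) + d a c" for a c
 proof -
  consider "a = p" "c = q" | "a = q" "c = p" | "\<not> (a = p & c = q)" "\<not> (a = q & c = p)" by blast
  then show ?thesis
  proof cases
   case 1
   then show ?thesis using assms(3) ln_minus[of "x q - x p"] by (simp add: s'_def d_def)
  next
   case 2
   then show ?thesis using assms(3,4) by (simp add: s'_def d_def sym_exp_def insert_commute)
  next
   case 3
   then have "{a, c} ~= {p, q}" by (metis doubleton_eq_iff)
   then show ?thesis using 3 by (auto simp: s'_def d_def)
  qed
 qed
 have t: "(\<Sum>a\<in>I6. \<Sum>c\<in>I6. d a c) = s p q * ln (x q - x p)"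
 proof -
  have "(\<Sum>a\<in>I6. \<Sum>c\<in>I6. if a = u then if c = v then t else 0 else 0) = t" if "u \<in> I6" "v \<in> I6" for u v and t :: real
  proof -
   have "(\<Sum>c\<in>I6. if a = u then if c = v then t else 0 else 0) = (if a = u then t else 0)" for a using that by auto
   then show ?thesis using that by simp
  qed
  then show ?thesis unfolding d_def sum.distrib using assms(1,2) by simp
 qed
 show ?thesis using assms(5) unfolding pw_def e sum.distrib t exp_add by (simp add: powr_def)
qed

lemma cross_ratio_exchange: "cross_ratio p2 q2 p1 q1 = cross_ratio p1 q1 p2 q2"
 unfolding cross_ratio_def by (simp add: abs_minus_commute mult.commute)

text \<open>Linked points p and q have opposite parity, so their exponents against every other point
  are opposite. When they coincide these factors cancel, and the cross-ratios involving their link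
  become 1.\<close>

lemma fused_values:
 assumes r: "roles lam p q p2 q2 p3 q3" and Y: "Y p = Y q"
  and n: "Y p2 ~= Y q2" "Y p3 ~= Y q3" "Y p2 ~= Y p3" "Y p2 ~= Y q3" "Y q2 ~= Y p3" "Y q2 ~= Y q3"
 defines "V \<equiv> Cv lam Y $ (lam p)"
 shows "V = \<bar>Y p2 - Y q3\<bar> * \<bar>Y q2 - Y p3\<bar> / (\<bar>Y p2 - Y p3\<bar> * \<bar>Y q2 - Y q3\<bar>)"
  and "k ~= lam p ==> Cv lam Y $ k = 1"
  and "pw (%a c. if {a, c} = {p, q} then 0 else z_exp b lam a c) Y = \<bar>Y p2 - Y q2\<bar> powr (1 - 3*b/2) * \<bar>Y p3 - Y q3\<bar> powr (1 - 3*b/2) * V powr (b/2)"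
proof -
 have l: "lam q = lam p" "lam q2 = lam p2" "lam q3 = lam p3" "lam p ~= lam p2" "lam p ~= lam p3" "lam p2 ~= lam p3"
  "lam p2 ~= lam p" "lam p3 ~= lam p" "lam p3 ~= lam p2" "even p2 = even p" "even p3 = even p" "even q = odd p" "even q2 = odd p" "even q3 = odd p"
  and d: "distinct [p,q,p2,q2,p3,q3]" using r by (auto simp: roles_def)
 have sw: "ln (Y q2 - Y p2) = ln (Y p2 - Y q2)" "ln (Y q3 - Y p3) = ln (Y p3 - Y q3)" "ln (Y p3 - Y p2) = ln (Y p2 - Y p3)"
  "ln (Y q3 - Y p2) = ln (Y p2 - Y q3)" "ln (Y p3 - Y q2) = ln (Y q2 - Y p3)" "ln (Y q3 - Y q2) = ln (Y q2 - Y q3)"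
  using ln_minus[of "Y p2 - Y q2"] ln_minus[of "Y p3 - Y q3"] ln_minus[of "Y p2 - Y p3"] ln_minus[of "Y p2 - Y q3"] ln_minus[of "Y q2 - Y p3"] ln_minus[of "Y q2 - Y q3"] by simp_all
 define W where "W = ln (Y p2 - Y q3) + ln (Y q2 - Y p3) - ln (Y p2 - Y p3) - ln (Y q2 - Y q3)"
 have V: "V = exp W"
  unfolding V_def Cv_def vec_lambda_beta pw_def roles_sum(2)[OF r] by (simp add: cr_exp_def l sw eps_def W_def)
 have L: "ln \<bar>t\<bar> = ln t" for t :: real by (simp add: abs_if ln_minus)
 show "V = \<bar>Y p2 - Y q3\<bar> * \<bar>Y q2 - Y p3\<bar> / (\<bar>Y p2 - Y p3\<bar> * \<bar>Y q2 - Y q3\<bar>)"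
 proof -
  have "\<bar>t\<bar> = exp (ln t)" if "t ~= 0" for t :: real using that exp_ln[of "\<bar>t\<bar>"] by (simp add: L)
  then show ?thesis unfolding V W_def exp_add exp_diff using n by (simp add: mult_ac)
 qed
 show "Cv lam Y $ k = 1" if "k ~= lam p"
 proof -
  have "k = lam p2 \<or> k = lam p3" using that roles_exhaust[OF r] by auto
  then show ?thesis unfolding Cv_def vec_lambda_beta pw_def roles_sum(2)[OF r] by (elim disjE) (simp_all add: cr_exp_def l eps_def Y)
 qed
 define s' where "s' a c = (if {a, c} = {p, q} then 0 else z_exp b lam a c)" for a c
 define h g where "h = 1 - 3*b/2" and "g = b/2"
 have s'e: "s' a c = (if a = c then 0 else if a = p & c = q \<or> a = q & c = p then 0 else if lam a = lam c then h else g * eps a c)" for a c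
  unfolding s'_def z_exp_def doubleton_eq_iff h_def g_def by simp
 have d': "distinct (rev [p,q,p2,q2,p3,q3])" using d by (simp only: distinct_rev)
 have sv: "s' p q = 0" "s' p p2 = -g" "s' p q2 = g" "s' p p3 = -g" "s' p q3 = g" "s' q p2 = g" "s' q q2 = -g" "s' q p3 = g" "s' q q3 = -g"
  "s' p2 q2 = h" "s' p2 p3 = -g" "s' p2 q3 = g" "s' q2 p3 = g" "s' q2 q3 = -g" "s' p3 q3 = h"
  "s' q p = 0" "s' p2 p = -g" "s' q2 p = g" "s' p3 p = -g" "s' q3 p = g" "s' p2 q = g" "s' q2 q = -g" "s' p3 q = g" "s' q3 q = -g"
  "s' q2 p2 = h" "s' p3 p2 = -g" "s' q3 p2 = g" "s' p3 q2 = g" "s' q3 q2 = -g" "s' q3 p3 = h" "s' a a = 0" for a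
  unfolding s'e using d d' by (simp_all add: l eps_def)
 have "(\<Sum>a\<in>I6. \<Sum>c\<in>I6. s' a c / 2 * ln (Y a - Y c)) = h * ln (Y p2 - Y q2) + h * ln (Y p3 - Y q3) + g * W"
  unfolding roles_sum(2)[OF r] sv sw W_def Y by (simp add: algebra_simps)
 then have "(\<Sum>a\<in>I6. \<Sum>c\<in>I6. (if {a, c} = {p, q} then 0 else z_exp b lam a c) / 2 * ln (Y a - Y c))
  = (1 - 3*b/2) * ln (Y p2 - Y q2) + (1 - 3*b/2) * ln (Y p3 - Y q3) + b/2 * W"
  unfolding s'_def h_def g_def .
 then show "pw (%a c. if {a, c} = {p, q} then 0 else z_exp b lam a c) Y = \<bar>Y p2 - Y q2\<bar> powr (1 - 3*b/2) * \<bar>Y p3 - Y q3\<bar> powr (1 - 3*b/2) * V powr (b/2)"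
  using n unfolding pw_def V by (simp add: exp_add powr_def L)
qed

text \<open>The ratio equals P (t-s)^E \<open>Fbar\<close>(cross-ratios) with P convergent and E the
  exponent of the pair minus -2h. For unlinked points E = 2b - 1 > 0. For linked points E = 0, and
  the boundary value c_F f(V) together with \<open>c_alpha\<close> yields the N = 2
  function.\<close>

lemma ASY3_neighbor:
 assumes b: "b > 1/2" and k: "\<kappa> = 4/b" and nc: "neighbor_coefficients b A0 B0" and F: "continues_power_series A0 F"
  and lam: "lam = lam1 \<or> lam = lam2" and Z: "!!x. x \<in> chamber 3 ==> Z x = c_alpha b * Zf b lam F x"
 shows "ASY3 \<kappa> (links lam) Z"
 unfolding ASY3_def Let_def
proof (intro ballI allI impI)
 fix j :: nat and \<xi> :: real and y :: "nat => real"
 assume j: "j \<in> {1..5}" and y: "y \<in> {1..6} \<rightarrow>\<^sub>E UNIV"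
  and o: "strict_mono_on ({1..6} - {j, j+1}) y & (\<forall>i\<in>{1..<j}. y i < \<xi>) & (\<forall>i\<in>{j+2..6}. \<xi> < y i)"
 define X where "X = (%(s, t). y(j := s, j+1 := t))"
 define S where "S = {st. X st \<in> chamber 3}"
 define ratio where "ratio = (%(s, t). Z (X (s, t)) / (t - s) powr (-2 * h_exp \<kappa>))"
 define Y where "Y = X (\<xi>, \<xi>)"
 define NF where "NF = at (\<xi>, \<xi>) within S"
 have jI: "j \<in> I6" "j+1 \<in> I6" "j ~= j+1" using j by auto
 have h: "-2 * h_exp \<kappa> = 1 - 3*b/2" "2/\<kappa> = b/2" "4/\<kappa> = b" using b by (simp_all add: h_exp_def k field_simps)
 have hh: "- (2 * h_exp \<kappa>) = 1 - 3*b/2" using h(1) by simp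
 have ev: "eventually (%z. z \<in> S) NF" unfolding NF_def by (simp add: eventually_at_filter)
 have Xj: "X z j = fst z" "X z (j+1) = snd z" "i ~= j ==> i ~= j+1 ==> X z i = y i" for z i
  by (cases z; simp add: X_def)+
 have Y: "Y j = \<xi>" "Y (j+1) = \<xi>" "i ~= j ==> i ~= j+1 ==> Y i = y i" for i unfolding Y_def Xj by simp_all
 have fs: "(fst \<longlongrightarrow> \<xi>) NF" "(snd \<longlongrightarrow> \<xi>) NF"
  using tendsto_fst[OF tendsto_ident_at, of "(\<xi>, \<xi>)" S] tendsto_snd[OF tendsto_ident_at, of "(\<xi>, \<xi>)" S] by (simp_all add: NF_def)
 have XY: "((%z. X z a) \<longlongrightarrow> Y a) NF" for a
 proof -
  consider "a = j" | "a = j+1" | "a ~= j" "a ~= j+1" by blast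
  then show ?thesis by cases (simp_all only: Xj Y fs tendsto_const not_False_eq_True)
 qed
 have Yn: "Y a ~= Y c" if ac: "a \<in> I6" "c \<in> I6" "a ~= c" "{a, c} ~= {j, j+1}" for a c
 proof -
  have lt: "Y a < Y c" if acl: "a \<in> I6" "c \<in> I6" "a < c" "{a, c} ~= {j, j+1}" for a c
  proof -
   have m: "y i < y i'" if "i \<in> I6" "i' \<in> I6" "i < i'" "i ~= j" "i ~= j+1" "i' ~= j" "i' ~= j+1" for i i'
    by (rule strict_mono_onD[OF conjunct1[OF o]]) (use that in auto)
   have l: "y i < \<xi>" if "i \<in> I6" "i < j" for i using o that by simp
   have u: "\<xi> < y i" if "i \<in> I6" "j+1 < i" for i using o that by simp
   consider "a < j" "c = j \<or> c = j+1" | "a = j \<or> a = j+1" "j+1 < c" | "a ~= j" "a ~= j+1" "c ~= j" "c ~= j+1"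
    using acl(3,4) unfolding doubleton_eq_iff by linarith
   then show ?thesis
   proof cases
    case 1 then show ?thesis using Y l[OF acl(1)] by auto
   next
    case 2 then show ?thesis using Y u[OF acl(2)] by auto
   next
    case 3 then show ?thesis using Y(3) m[OF acl(1-3)] by simp
   qed
  qed
  show ?thesis using lt[OF ac(1,2)] lt[OF ac(2,1)] ac(3,4) by (metis insert_commute less_irrefl linorder_neqE_nat)
 qed
 have st: "fst z < snd z" if "z \<in> S" for z
 proof -
  have "X z j < X z (j+1)" using that jI unfolding S_def chamber_def by simp
  then show ?thesis by (simp only: Xj)
 qed
 define s' where "s' = (%a c. if {a, c} = {j, j+1} then 0 else z_exp b lam a c)"
 define P where "P z = c_alpha b * pw s' (X z)" for z
 define E where "E = z_exp b lam j (j+1) - (1 - 3*b/2)"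
 have s'0: "s' a c = 0 \<or> a = c" if "a \<in> I6" "c \<in> I6" "Y a = Y c" for a c
 proof (cases "{a, c} = {j, j+1}")
  case True
  show ?thesis by (simp only: s'_def True if_True simp_thms)
 next
  case False
  then show ?thesis using Yn[OF that(1,2)] that(3) by blast
 qed
 have Plim: "(P \<longlongrightarrow> c_alpha b * pw s' Y) NF"
  unfolding P_def by (rule tendsto_mult[OF tendsto_const tendsto_pw[OF XY s'0]])
 have rt: "ratio z = P z * (snd z - fst z) powr E * Fbar b (Cv lam (X z))" if z: "z \<in> S" for z
 proof -
  have x: "X z \<in> chamber 3" using z by (simp add: S_def)
  have d: "0 < snd z - fst z" using st[OF z] by simp
  have "pw (z_exp b lam) (X z) = (snd z - fst z) powr z_exp b lam j (j+1) * pw s' (X z)"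
   using pw_split_pair[OF jI sym_exps(2)[of b lam], of "X z"] st[OF z] unfolding s'_def Xj by simp
  moreover have "F (Cv lam (X z)) = Fbar b (Cv lam (X z))"
   by (rule neighbor_function_eq_Fbar[OF b nc F subsetD[OF open_cube_subset(1) Cv_in_open_cube[OF x lam]]])
  ultimately have "ratio z = c_alpha b * ((snd z - fst z) powr z_exp b lam j (j+1) * pw s' (X z) * Fbar b (Cv lam (X z))) / (snd z - fst z) powr (1 - 3*b/2)"
   using Z[OF x] by (cases z) (simp add: ratio_def hh Zf_def)
  then show ?thesis by (simp add: P_def E_def powr_diff mult_ac)
 qed
 have Cc: "Cv lam (X z) \<in> closed_cube" if "z \<in> S" for z
  using Cv_in_open_cube[OF _ lam] that open_cube_subset by (auto simp: S_def)
 show "({j, j+1} \<notin> links lam \<longrightarrow> ((%(s, t). Z ((%(s, t). y(j := s, j+1 := t)) (s, t)) / (t - s) powr (-2 * h_exp \<kappa>)) \<longlongrightarrow> 0)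
   (at (\<xi>, \<xi>) within {st. (%(s, t). y(j := s, j+1 := t)) st \<in> chamber 3})) &
  ({j, j+1} \<in> links lam \<longrightarrow> (\<forall>a c. remove_link j (links lam) = {{a 1, c 1}, {a 2, c 2}} \<longrightarrow>
   ((%(s, t). Z ((%(s, t). y(j := s, j+1 := t)) (s, t)) / (t - s) powr (-2 * h_exp \<kappa>)) \<longlongrightarrow> ppf2 \<kappa> a c (remove_points j y))
   (at (\<xi>, \<xi>) within {st. (%(s, t). y(j := s, j+1 := t)) st \<in> chamber 3})))"
  unfolding X_def[symmetric] S_def[symmetric] NF_def[symmetric] ratio_def[symmetric] link_iff[OF lam jI]
 proof (intro conjI impI allI)
  assume u: "lam j ~= lam (j+1)"
  have "z_exp b lam j (j+1) = b/2" using u jI by (simp add: z_exp_def eps_def)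
  then have E: "0 < E" using b by (simp add: E_def)
  \<comment> \<open>The cross-ratios need not converge here; boundedness of \<open>Fbar\<close> on
    the compact cube is enough.\<close>
  obtain s where s: "!!r. r \<in> closed_cube ==> \<bar>Fbar b r\<bar> <= \<bar>Fbar b s\<bar>"
   using continuous_attains_sup[OF compact_closed_cube _ continuous_on_rabs[OF Fbar_continuous[OF b]]]
   by (cases "closed_cube = ({} :: (real^3) set)") auto
  show "(ratio \<longlongrightarrow> 0) NF"
  proof (rule Lim_null_comparison)
   show "eventually (%z. norm (ratio z) <= \<bar>P z\<bar> * (snd z - fst z) powr E * \<bar>Fbar b s\<bar>) NF"
    using ev by (rule eventually_mono) (simp add: rt abs_mult mult_left_mono s Cc)
   have "((%z. (snd z - fst z) powr E) \<longlongrightarrow> 0) NF"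
   proof (rule tendsto_zero_powrI[OF _ tendsto_const _ E])
    show "((%z. snd z - fst z) \<longlongrightarrow> 0) NF" using tendsto_diff[OF fs(2,1)] by simp
    show "eventually (%z. 0 <= snd z - fst z) NF" using ev by (rule eventually_mono) (use st in \<open>simp add: less_imp_le\<close>)
   qed
   then have "((%z. \<bar>P z\<bar> * (snd z - fst z) powr E * \<bar>Fbar b s\<bar>) \<longlongrightarrow> \<bar>c_alpha b * pw s' Y\<bar> * 0 * \<bar>Fbar b s\<bar>) NF"
    by (intro tendsto_intros Plim)
   then show "((%z. \<bar>P z\<bar> * (snd z - fst z) powr E * \<bar>Fbar b s\<bar>) \<longlongrightarrow> 0) NF" by simp
  qed
 next
  fix a c :: "nat => nat" assume e: "lam j = lam (j+1)" and rl: "remove_link j (links lam) = {{a 1, c 1}, {a 2, c 2}}"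
  obtain q p2 q2 p3 q3 where r0: "roles lam j q p2 q2 p3 q3" using roles_ex[OF lam jI(1)] by blast
  have "j+1 \<in> {j, q}" unfolding link_eq[OF r0, symmetric] using e jI by simp
  then have q: "q = j+1" by simp
  note r = r0[unfolded q]
  have I: "I6 = {j,j+1,p2,q2,p3,q3}" and d: "distinct [j,j+1,p2,q2,p3,q3]" using r by (simp_all add: roles_def)
  have i6: "p2 \<in> I6" "q2 \<in> I6" "p3 \<in> I6" "q3 \<in> I6" unfolding I by simp_all
  have dd: "p2 ~= j" "q2 ~= j" "p3 ~= j" "q3 ~= j" "p2 ~= j+1" "q2 ~= j+1" "p3 ~= j+1" "q3 ~= j+1" using d by auto
  have n: "y u ~= y w" if "u \<in> {p2,q2,p3,q3}" "w \<in> {p2,q2,p3,q3}" "u ~= w" for u w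
  proof -
   have uw: "u ~= j" "u ~= j+1" "w ~= j" "w ~= j+1" "u \<in> I6" "w \<in> I6" using that dd i6 by blast+
   then show ?thesis using Yn[of u w] that(3) by (simp add: Y doubleton_eq_iff)
  qed
  have n6: "y p2 ~= y q2" "y p3 ~= y q3" "y p2 ~= y p3" "y p2 ~= y q3" "y q2 ~= y p3" "y q2 ~= y q3" by (rule n; use d in auto)+
  note Y4 = Y(3)[OF dd(1,5)] Y(3)[OF dd(2,6)] Y(3)[OF dd(3,7)] Y(3)[OF dd(4,8)]
  define V where "V = Cv lam Y $ (lam j)"
  note fv = fused_values(1,2)[OF r trans[OF Y(1) Y(2)[symmetric]], unfolded Y4, OF n6, folded V_def]
  note fv3 = fused_values(3)[where b = b, OF r trans[OF Y(1) Y(2)[symmetric]], unfolded Y4, OF n6, folded V_def s'_def]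
  have Ylim: "((%z. Cv lam (X z)) \<longlongrightarrow> Cv lam Y) NF" unfolding Cv_def
  proof (intro tendsto_vec_lambda tendsto_pw XY)
   fix k u w assume uw: "u \<in> I6" "w \<in> I6" "Y u = Y w"
   show "cr_exp lam k u w = 0 \<or> u = w"
   proof (cases "u = w \<or> {u, w} ~= {j, j+1}")
    case False
    then have "u = j & w = j+1 \<or> u = j+1 & w = j" unfolding doubleton_eq_iff by blast
    then have "lam u = lam w" using e by metis
    then show ?thesis by (simp add: cr_exp_def)
   qed (use Yn[OF uw(1,2)] uw(3) in blast)
  qed
  show "(ratio \<longlongrightarrow> ppf2 \<kappa> a c (remove_points j y)) NF"
  \<comment> \<open>Closedness places the limit of the cross-ratios in the cube only along a
    nontrivial filter; for the trivial one every limit statement holds.\<close>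
  proof (cases "NF = bot")
   case False
   have YC: "Cv lam Y \<in> closed_cube"
    by (rule Lim_in_closed_set[OF compact_imp_closed[OF compact_closed_cube] _ False Ylim]) (use ev Cc in \<open>auto elim: eventually_mono\<close>)
   have V01: "0 < V" "V <= 1" using YC by (simp_all add: V_def closed_cube_def) (simp add: Cv_def pw_pos)
   have Fl: "((%z. Fbar b (Cv lam (X z))) \<longlongrightarrow> Fbar b (Cv lam Y)) NF"
    by (rule continuous_on_tendsto_compose[OF Fbar_continuous[OF b] Ylim YC]) (use ev Cc in \<open>auto elim: eventually_mono\<close>)
   have "((%z. P z * Fbar b (Cv lam (X z))) \<longlongrightarrow> c_alpha b * pw s' Y * Fbar b (Cv lam Y)) NF"
    by (intro tendsto_mult Plim Fl)
   moreover have "eventually (%z. P z * Fbar b (Cv lam (X z)) = ratio z) NF"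
    using ev
   proof (rule eventually_mono)
    fix z assume z: "z \<in> S"
    have "E = 0" using e by (simp add: E_def z_exp_def)
    then show "P z * Fbar b (Cv lam (X z)) = ratio z" using rt[OF z] st[OF z] by simp
   qed
   ultimately have lim: "(ratio \<longlongrightarrow> c_alpha b * pw s' Y * Fbar b (Cv lam Y)) NF"
    by (rule Lim_transform_eventually)
   have k2: "lam p2 ~= lam j" using r by (auto simp: roles_def)
   obtain k k' where kk: "{k, k', lam p2} = {1,2,3}" "Fbar b (Cv lam Y) = Beta b (3*b-1) / Beta b b * (hypint b (Cv lam Y $ k) * hypint b (Cv lam Y $ k'))"
    by (rule Fbar_one_face[OF b nc F YC fv(2)[OF k2]])
   have "Fbar b (Cv lam Y) = Beta b (3*b-1) / Beta b b * (hypint b 1 * hypint b V)"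
   proof -
    have "lam j \<in> {k, k', lam p2}" unfolding kk(1) using exhaust_3[of "lam j"] by blast
    moreover have "k ~= k'"
    proof
     assume "k = k'"
     then have "{k, lam p2} = UNIV" using kk(1) UNIV_3 by simp
     then have "card {k, lam p2} = card (UNIV::3 set)" by (simp only:)
     then show False by (simp add: card_insert_if split: if_splits)
    qed
    ultimately show ?thesis using kk(2) fv(2)[of k] fv(2)[of k'] k2 by (auto simp: V_def)
   qed
   then have "Fbar b (Cv lam Y) = c_F b * f_hyp b V" using V01 b by (simp add: c_F_eq[OF b] f_hyp_eq_hypint)
   then have cF: "c_alpha b * Fbar b (Cv lam Y) = f_hyp b V / f_hyp b 1"
    using c_F_pos[OF b] by (simp add: c_alpha_def divide_inverse)
   have "c_alpha b * pw s' Y * Fbar b (Cv lam Y) = pw s' Y * (c_alpha b * Fbar b (Cv lam Y))" by simp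
   then have val: "c_alpha b * pw s' Y * Fbar b (Cv lam Y) = \<bar>y p2 - y q2\<bar> powr (1 - 3*b/2) * \<bar>y p3 - y q3\<bar> powr (1 - 3*b/2) * (V powr (b/2) * f_hyp b V / f_hyp b 1)"
    unfolding cF fv3 by simp
   have cr: "cross_ratio (y p2) (y q2) (y p3) (y q3) = V"
   proof -
    have "1 / V = \<bar>y p2 - y p3\<bar> * \<bar>y q2 - y q3\<bar> / (\<bar>y p2 - y q3\<bar> * \<bar>y q2 - y p3\<bar>)" unfolding fv(1) by simp
    moreover have "V <= 1 / V" using V01 mult_mono[of V 1 V 1] by (simp add: le_divide_eq)
    ultimately show ?thesis unfolding cross_ratio_def using fv(1) by (simp add: min_def)
   qed
   \<comment> \<open>Relabeling after removal of j and j+1; it identifies the two remaining links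
     with the given labels up to order of links and endpoints, under which \<open>ppf2\<close> is
     symmetric.\<close>
   define rel where "rel i = (if i < j then i else i - 2)" for i
   have rp: "remove_points j y (rel i) = y i" if "i \<in> I6" "i ~= j" "i ~= j+1" for i
    using that j by (auto simp: remove_points_def rel_def intro!: arg_cong[of _ _ y])
   note rp4 = rp[OF i6(1) dd(1,5)] rp[OF i6(2) dd(2,6)] rp[OF i6(3) dd(3,7)] rp[OF i6(4) dd(4,8)]
   have "{p2, q2} ~= {j, j+1}" "{p3, q3} ~= {j, j+1}" using dd by (metis doubleton_eq_iff)+
   then have "links lam - {{j, j+1}} = {{p2,q2},{p3,q3}}" unfolding links_eq[OF r] by blast
   then have "{{a 1, c 1}, {a 2, c 2}} = {{rel p2, rel q2}, {rel p3, rel q3}}"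
    unfolding rl[symmetric] remove_link_def rel_def by simp
   then have "{a 1, c 1} = {rel p2, rel q2} & {a 2, c 2} = {rel p3, rel q3} \<or> {a 1, c 1} = {rel p3, rel q3} & {a 2, c 2} = {rel p2, rel q2}"
    by (simp only: doubleton_eq_iff[of "{_, _}"])
   moreover have P2: "(\<Prod>i\<in>{1..2}. g i) = g 1 * g 2" for g :: "nat => real"
   proof -
    have "{1..2} = {1, 2 :: nat}" by auto
    then show ?thesis by simp
   qed
   ultimately have "ppf2 \<kappa> a c (remove_points j y) = \<bar>y p2 - y q2\<bar> powr (1 - 3*b/2) * \<bar>y p3 - y q3\<bar> powr (1 - 3*b/2) * (V powr (b/2) * f_hyp b V / f_hyp b 1)"
    unfolding ppf2_def Let_def h P2 doubleton_eq_iff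
    by (elim disjE conjE) (simp_all only: rp4 cross_ratio_sym[of "y q2"] cross_ratio_sym(2)[of _ _ "y q3"] cross_ratio_sym[of "y q3"] cross_ratio_sym(2)[of _ _ "y q2"]
     cross_ratio_exchange[of "y p3"] cr abs_minus_commute[of "y q2"] abs_minus_commute[of "y q3"] mult.commute[of "\<bar>y p3 - y q3\<bar> powr _"])
   then show ?thesis using lim val by simp
  qed simp
 qed
qed

section \<open>Assembly of the theorem\<close>

text \<open>With \<kappa>/2 = 2/b and 2h = 3b/2 - 1, the equation at x_i is c times
  \<open>Zf_pde\<close>, for the roles in which i is the first point.\<close>

lemma PDE_neighbor:
 assumes b: "b > 1/2" and k: "\<kappa> = 4/b" and nc: "neighbor_coefficients b A0 B0" and F: "continues_power_series A0 F"
  and G: "continues_power_series B0 G" and lam: "lam = lam1 \<or> lam = lam2" and Z: "!!x. x \<in> chamber 3 ==> Z x = c * Zf b lam F x"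
 shows "PDE 3 \<kappa> Z"
proof -
 obtain D f where f: "continues_real f D F" by (rule continues_power_seriesE[OF F], blast)
 note co = Cv_in_open_cube[OF _ lam]
 have h: "\<kappa>/2 = 2/b" "2 * h_exp \<kappa> = 3*b/2 - 1" using b by (simp_all add: h_exp_def k field_simps)
 have alg: "cf_algebra lam (%x. c * (pw (z_exp b lam) x * F (Cv lam x)))"
  by (intro cf_algebra.mult cf_algebra.const cf_algebra.pw sym_exps cf_algebra.comp[OF f])
 have "smooth_on_chamber 3 Z"
  by (rule cf_algebra_smooth[OF co alg]) (use Z in \<open>simp_all add: Zf_def\<close>)
 moreover have p1: "partial j Z x = c * Zf1 b lam F j x" if "x \<in> chamber 3" "j \<in> I6" for j x
  by (rule partial_on_chamber(2)[OF Z that DERIV_cmult[OF Zf_deriv[OF that co[OF that(1)] f]]])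
 moreover have "\<kappa>/2 * partial i (partial i Z) x + (\<Sum>j\<in>I6-{i}. 2 / (x j - x i) * partial j Z x - 2 * h_exp \<kappa> / (x j - x i)\<^sup>2 * Z x) = 0"
  if i: "i \<in> I6" and x: "x \<in> chamber 3" for i x
 proof -
  obtain q p2 q2 p3 q3 where r: "roles lam i q p2 q2 p3 q3" using roles_ex[OF lam i] by blast
  define d where "d = pw (z_exp b lam) x *
   (((dl (z_exp b lam) i x)^2 - dl2 (z_exp b lam) i x) * F (Cv lam x)
    + 2*dl (z_exp b lam) i x*(\<Sum>k\<in>UNIV. dl (cr_exp lam k) i x * Cv lam x$k * partial3 k F (Cv lam x))
    + (\<Sum>k\<in>UNIV. ((dl (cr_exp lam k) i x)^2 - dl2 (cr_exp lam k) i x) * Cv lam x$k * partial3 k F (Cv lam x)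
     + dl (cr_exp lam k) i x * Cv lam x$k * (\<Sum>l\<in>UNIV. dl (cr_exp lam l) i x * Cv lam x$l * partial3 l (partial3 k F) (Cv lam x))))"
  have "((%t. Zf1 b lam F i (x(i := t))) has_real_derivative d) (at (x i))"
   unfolding d_def by (rule Zf1_deriv[OF x i co[OF x] f])
  then have p2: "partial i (partial i Z) x = c * d"
   by (intro partial_on_chamber(2)[where f = "%x. c * Zf1 b lam F i x"] p1 x i DERIV_cmult)
  have s: "(\<Sum>j\<in>I6-{i}. 2 / (x j - x i) * partial j Z x - 2 * h_exp \<kappa> / (x j - x i)\<^sup>2 * Z x)
    = c * (\<Sum>j\<in>I6-{i}. 2 / (x j - x i) * Zf1 b lam F j x - (3*b/2-1) / (x j - x i)\<^sup>2 * (pw (z_exp b lam) x * F (Cv lam x)))"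
   unfolding sum_distrib_left
  proof (rule sum.cong[OF refl])
   fix j assume "j \<in> I6-{i}"
   then have "partial j Z x = c * Zf1 b lam F j x" using p1[OF x] by blast
   then show "2 / (x j - x i) * partial j Z x - 2 * h_exp \<kappa> / (x j - x i)\<^sup>2 * Z x
    = c * (2 / (x j - x i) * Zf1 b lam F j x - (3*b/2-1) / (x j - x i)\<^sup>2 * (pw (z_exp b lam) x * F (Cv lam x)))"
    unfolding h Z[OF x] Zf_def by (simp add: right_diff_distrib mult.left_commute)
  qed
  have e: "u * (c * v) + c * w = c * (u * v + w)" for u v w :: real by (simp add: algebra_simps)
  have b0: "b > 0" using b by simp
  note Zf_pde[OF x r sgood_pattern[OF x lam] b0 nc F G f, folded d_def]
  then show ?thesis unfolding s p2 h(1) e by simp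
 qed
 ultimately show ?thesis unfolding PDE_def by blast
qed

lemma COV_neighbor:
 assumes b: "b > 1/2" and k: "\<kappa> = 4/b" and lam: "lam = lam1 \<or> lam = lam2"
  and Z: "!!x. x \<in> chamber 3 ==> Z x = C * Zf b lam F x"
 shows "COV 3 \<kappa> Z"
 unfolding COV_def Let_def
proof (intro ballI allI impI)
 fix x a e c d
 define y where "y = restrict (%i. moebius a e c d (x i)) I6"
 assume x: "x \<in> chamber 3" and A: "0 < a * d - e * c & (\<forall>i\<in>I6. c * x i + d ~= 0) & restrict (%i. moebius a e c d (x i)) I6 \<in> chamber 3"
 have D: "0 < a * d - c * e" using A by (simp add: mult.commute)
 have y: "y \<in> chamber 3" using A by (simp add: y_def)
 have h: "h_exp \<kappa> = 3*b/4 - 1/2" using b by (simp add: h_exp_def k field_simps)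
 have "Zf b lam F x = (\<Prod>i\<in>I6. deriv (moebius a e c d) (x i) powr (3*b/4 - 1/2)) * Zf b lam F y"
  by (rule Zf_cov[OF x lam D]) (use A in \<open>simp_all add: y_def\<close>)
 then show "Z x = (\<Prod>i\<in>I6. deriv (moebius a e c d) (x i) powr h_exp \<kappa>) * Z (restrict (%i. moebius a e c d (x i)) I6)"
  unfolding y_def[symmetric] h Z[OF x] Z[OF y] by simp
qed

lemma Fbar_edges:
 assumes b: "b > 1/2" and nc: "neighbor_coefficients b A B" and F: "continues_power_series A F" and r: "r \<in> {0<..<1}"
 shows "Fbar b (vector [r, 1, 1]) = c_F b * f_hyp b r" "Fbar b (vector [1, r, 1]) = c_F b * f_hyp b r"
  "Fbar b (vector [1, 1, r]) = c_F b * f_hyp b r"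
proof -
 have f: "f_hyp b r = hypint b r" using r by (intro f_hyp_eq_hypint[OF b]) auto
 have c: "vector [r, 1, 1] \<in> closed_cube" "vector [1, r, 1] \<in> closed_cube" "vector [1, 1, r] \<in> closed_cube"
  using r by (simp_all add: closed_cube_def forall_3)
 show 1: "Fbar b (vector [r, 1, 1]) = c_F b * f_hyp b r" "Fbar b (vector [1, r, 1]) = c_F b * f_hyp b r"
  using Fbar_face[OF b c(1)] Fbar_face[OF b c(2)] by (simp_all add: f c_F_eq[OF b])
 define \<pi> :: "3 => 3" where "\<pi> k = (if k = 1 then 3 else if k = 3 then 1 else k)" for k
 have "bij \<pi>" unfolding \<pi>_def by (rule bij_swap3)
 moreover have "vperm \<pi> (vector [1, 1, r]) = vector [r, 1, 1]" by (simp add: vec_eq_iff forall_3 \<pi>_def)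
 ultimately show "Fbar b (vector [1, 1, r]) = c_F b * f_hyp b r" using Fbar_symmetric[OF b nc F _ c(3)] 1(1) by metis
qed

lemma frontier_closed_cube: "r \<in> frontier closed_cube ==> r \<in> closed_cube & r \<notin> open_cube"
proof -
 assume r: "r \<in> frontier closed_cube"
 have "closure closed_cube = closed_cube" by (simp add: compact_imp_closed[OF compact_closed_cube])
 moreover have "open_cube \<subseteq> interior closed_cube"
  by (rule interior_maximal[OF _ open_open_cube]) (auto simp: open_cube_def closed_cube_def less_imp_le)
 ultimately show ?thesis using r by (auto simp: frontier_def)
qed

theorem corollary6p14:
  fixes \<beta> \<kappa> :: real and F G :: "real^3 \<Rightarrow> real"
  assumes \<beta>: "\<beta> > 1/2" and \<kappa>: "\<kappa> = 4 / \<beta>"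
    and FG: "neighbor_functions \<beta> F G"
  shows
    "(\<forall>r\<in>open_cube. \<forall>(j::3) k l. {j, k, l} = {1, 2, 3} \<longrightarrow>
        r$l * (1 - r$l) * partial3 l (partial3 l F) r + (2*\<beta> - 2 * r$l) * partial3 l F r
            - \<beta> * (1 - \<beta>) * F r
          = (1 - r$j) * (1 - r$k) * G r \<and>
        2 * r$j * r$k * partial3 j (partial3 k F) r + \<beta> * r$j * partial3 j F r
            + \<beta> * r$k * partial3 k F r + \<beta> * r$l * partial3 l F r + \<beta>\<^sup>2 * F r
          = (r$l * (r$j + r$k) - (1 + r$j * r$k)) * G r)
      \<and>
      (\<exists>Fbar. continuous_on closed_cube Fbar \<and> (\<forall>r\<in>half_open_cube. Fbar r = F r) \<and>
        (\<forall>r\<in>{0<..<1}.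
          Fbar (vector [r, 1, 1]) = c_F \<beta> * f_hyp \<beta> r \<and>
          Fbar (vector [1, r, 1]) = c_F \<beta> * f_hyp \<beta> r \<and>
          Fbar (vector [1, 1, r]) = c_F \<beta> * f_hyp \<beta> r) \<and>
        (\<forall>r\<in>frontier closed_cube. 0 < Fbar r))
      \<and>
      (c_alpha \<beta> = Gamma \<beta> * Gamma (4*\<beta> - 1) / (Gamma (2*\<beta>) * Gamma (3*\<beta> - 1)) *
        (Gamma \<beta> * Gamma (3*\<beta> - 1) / (Gamma (2*\<beta>) * Gamma (2*\<beta> - 1)))\<^sup>2)
      \<and>
      (\<forall>\<alpha>\<in>LP 3. \<alpha> \<in> neighbor_patterns \<longrightarrow>
        (\<forall>a b. \<alpha> = {{a 1, b 1}, {a 2, b 2}, {a 3, b 3}} \<longrightarrow>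
          (\<forall>x\<in>chamber 3. 0 < Z_neighbor \<beta> \<kappa> F a b x) \<and>
          PDE 3 \<kappa> (Z_neighbor \<beta> \<kappa> F a b) \<and>
          COV 3 \<kappa> (Z_neighbor \<beta> \<kappa> F a b) \<and>
          ASY3 \<kappa> \<alpha> (Z_neighbor \<beta> \<kappa> F a b) \<and>
          pure_partition_function3 \<kappa> \<alpha> (Z_neighbor \<beta> \<kappa> F a b)))"
proof -
 obtain A B where nc: "neighbor_coefficients \<beta> A B" and F: "continues_power_series A F" and G: "continues_power_series B G"
  using FG unfolding neighbor_functions_def by blast
 show ?thesis
 proof (intro conjI)
  show "\<forall>r\<in>open_cube. \<forall>(j::3) k l. {j, k, l} = {1, 2, 3} \<longrightarrow>
    r$l * (1 - r$l) * partial3 l (partial3 l F) r + (2*\<beta> - 2 * r$l) * partial3 l F r - \<beta> * (1 - \<beta>) * F r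
     = (1 - r$j) * (1 - r$k) * G r &
    2 * r$j * r$k * partial3 j (partial3 k F) r + \<beta> * r$j * partial3 j F r
      + \<beta> * r$k * partial3 k F r + \<beta> * r$l * partial3 l F r + \<beta>\<^sup>2 * F r
     = (r$l * (r$j + r$k) - (1 + r$j * r$k)) * G r"
   by (intro ballI allI impI conjI neighbor_pde[OF nc _ F G])
  show "\<exists>Fbar. continuous_on closed_cube Fbar & (\<forall>r\<in>half_open_cube. Fbar r = F r) &
    (\<forall>r\<in>{0<..<1}.
     Fbar (vector [r, 1, 1]) = c_F \<beta> * f_hyp \<beta> r &
     Fbar (vector [1, r, 1]) = c_F \<beta> * f_hyp \<beta> r &
     Fbar (vector [1, 1, r]) = c_F \<beta> * f_hyp \<beta> r) &
    (\<forall>r\<in>frontier closed_cube. 0 < Fbar r)"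
   by (intro exI[of _ "Fbar \<beta>"] conjI ballI Fbar_continuous[OF \<beta>] neighbor_function_eq_Fbar[OF \<beta> nc F, symmetric]
     Fbar_edges[OF \<beta> nc F] Fbar_pos_boundary[OF \<beta> nc F] conjunct1[OF frontier_closed_cube] conjunct2[OF frontier_closed_cube])
  show "c_alpha \<beta> = Gamma \<beta> * Gamma (4*\<beta> - 1) / (Gamma (2*\<beta>) * Gamma (3*\<beta> - 1)) *
    (Gamma \<beta> * Gamma (3*\<beta> - 1) / (Gamma (2*\<beta>) * Gamma (2*\<beta> - 1)))\<^sup>2"
   by (rule c_alpha_eq[OF \<beta>])
  show "\<forall>\<alpha>\<in>LP 3. \<alpha> \<in> neighbor_patterns \<longrightarrow>
    (\<forall>a b. \<alpha> = {{a 1, b 1}, {a 2, b 2}, {a 3, b 3}} \<longrightarrow>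
     (\<forall>x\<in>chamber 3. 0 < Z_neighbor \<beta> \<kappa> F a b x) &
     PDE 3 \<kappa> (Z_neighbor \<beta> \<kappa> F a b) &
     COV 3 \<kappa> (Z_neighbor \<beta> \<kappa> F a b) &
     ASY3 \<kappa> \<alpha> (Z_neighbor \<beta> \<kappa> F a b) &
     pure_partition_function3 \<kappa> \<alpha> (Z_neighbor \<beta> \<kappa> F a b))"
  proof (intro ballI impI allI)
   fix \<alpha> and a b :: "nat => nat"
   assume "\<alpha> \<in> neighbor_patterns" and ab: "\<alpha> = {{a 1, b 1}, {a 2, b 2}, {a 3, b 3}}"
   then obtain lam where lam: "lam = lam1 \<or> lam = lam2" and \<alpha>: "\<alpha> = links lam" using neighbor_pattern_links by blast
   have Z: "Z_neighbor \<beta> \<kappa> F a b x = c_alpha \<beta> * Zf \<beta> lam F x" if "x \<in> chamber 3" for x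
    by (rule Z_neighbor_eq[OF \<beta> \<kappa> nc F lam that labels[OF lam trans[OF \<alpha>[symmetric] ab]]])
   have "0 < c_alpha \<beta>" using c_F_pos[OF \<beta>] f_hyp_pos[OF \<beta>, of 1] by (simp add: c_alpha_def)
   then have "0 < Z_neighbor \<beta> \<kappa> F a b x" if x: "x \<in> chamber 3" for x
    unfolding Z[OF x] Zf_def
    by (intro mult_pos_pos pw_pos x neighbor_function_pos[OF \<beta> nc F G] Cv_in_open_cube[OF x lam])
   moreover have "PDE 3 \<kappa> (Z_neighbor \<beta> \<kappa> F a b)" by (rule PDE_neighbor[OF \<beta> \<kappa> nc F G lam Z])
   moreover have "COV 3 \<kappa> (Z_neighbor \<beta> \<kappa> F a b)" by (rule COV_neighbor[OF \<beta> \<kappa> lam Z])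
   moreover have "ASY3 \<kappa> \<alpha> (Z_neighbor \<beta> \<kappa> F a b)" unfolding \<alpha> by (rule ASY3_neighbor[OF \<beta> \<kappa> nc F lam Z])
   ultimately show "(\<forall>x\<in>chamber 3. 0 < Z_neighbor \<beta> \<kappa> F a b x) &
     PDE 3 \<kappa> (Z_neighbor \<beta> \<kappa> F a b) &
     COV 3 \<kappa> (Z_neighbor \<beta> \<kappa> F a b) &
     ASY3 \<kappa> \<alpha> (Z_neighbor \<beta> \<kappa> F a b) &
     pure_partition_function3 \<kappa> \<alpha> (Z_neighbor \<beta> \<kappa> F a b)"
    unfolding pure_partition_function3_def by (intro conjI ballI)
  qed
 qed
qed

end
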